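(* Let $A$ be a commutative monoid object in $(\mathbf C,\otimes,1)$, let $t\in \mathcal E(A)$, and let $I_t:A\longrightarrow A_t$ denote the localisation of $A$ with respect to $t$. Then the induced morphism $Spec(A_t)\longrightarrow Spec(A)$ is a Zariski open immersion.
   Context: Standing assumptions: $(\mathbf C,\otimes,1)$ is an abelian symmetric monoidal category with small limits and small colimits such that for every object $X$ the functor $-\otimes X$ preserves colimits. $Comm(\mathbf C)$ is the category of unital commutative monoid objects in $\mathbf C$ (all monoids are unital and commutative), and $A\text{-}Mod$ is the category of modules over $A\in Comm(\mathbf C)$. For every monoid $A$, filtered colimits commute with finite limits in $A\text{-}Mod$. Moreover: (C1) $Hom_{\mathbf C}(1,-)$ preserves filtered colimits, and for every monoid $A$ and every finite (not necessarily filtered) system of $A$-modules of the form $\{A^{r_i}\}_{i\in I}$, $r_i\ge 0$, the canonical map $colim_{i}\,Hom_{A-Mod}(A,A^{r_i})\to Hom_{A-Mod}(A,colim_i A^{r_i})$ is an isomorphism. (C2) For every monoid $A$, every object of $A\text{-}Mod$ is a directed colimit of finitely presented objects, where $M$ is finitely presented if $Hom_{A-Mod}(M,-)$ preserves directed colimits. $\mathcal E(A):=Hom_{A-Mod}(A,A)$, a commutative ring under composition; a morphism $g:A\to B$ in $Comm(\mathbf C)$ induces by base change a ring homomorphism $\mathcal E(g):\mathcal E(A)\to\mathcal E(B)$. Localisation: for $t\in\mathcal E(A)$, $A_t:=colim(A\overset{t}{\to}A\overset{t}{\to}A\overset{t}{\to}\cdots)$, which is a commutative monoid with canonical monoid morphism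 $I_t:A\to A_t$; it is a flat $A$-module, $\mathcal E(I_t)(t)$ is invertible, and $I_t$ is universal among monoid morphisms $g:A\to B$ with $\mathcal E(g)(t)$ invertible. $Aff_{\mathbf C}:=Comm(\mathbf C)^{op}$, with $Spec(A)$ the object corresponding to $A$. A morphism $Spec(B)\to Spec(A)$ given by $f:A\to B$ is a Zariski open immersion if $f$ is (1) flat: $-\otimes_AB:A\text{-}Mod\to B\text{-}Mod$ is exact (preserves finite limits); (2) an epimorphism in $Comm(\mathbf C)$; (3) of finite presentation: for every filtered system $\{A'_i\}$ in the category $A/Comm(\mathbf C)$ of monoids under $A$, the natural map $colim_i Hom_{A/Comm(\mathbf C)}(B,A'_i)\to Hom_{A/Comm(\mathbf C)}(B,colim_iA'_i)$ is an isomorphism. *)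

theory Defs
  imports "HOL-Algebra.Product_Groups" "HOL-Algebra.Ring" "HOL-Library.Countable_Set"
begin

section \<open>Categories, functors, limits and colimits\<close>

text \<open>
  Hom-sets need not be disjoint, so the same arrows can be reused in categories of
  structured objects (monoids, modules, ...).  For this reason the arrow part of a functor
  takes the domain and the codomain as arguments.
\<close>

record ('o, 'a) cat =
  Ob :: "'o set"
  Hom :: "'o \<Rightarrow> 'o \<Rightarrow> 'a set"
  Comp :: "'a \<Rightarrow> 'a \<Rightarrow> 'a"  (infixr "\<cdot>\<index>" 70)
  Id :: "'o \<Rightarrow> 'a"

locale category =
  fixes C (structure)
  assumes Id_in_Hom: "X \<in> Ob C \<Longrightarrow> Id C X \<in> Hom C X X"
    and Comp_in_Hom:
      "\<lbrakk>X \<in> Ob C; Y \<in> Ob C; Z \<in> Ob C; f \<in> Hom C X Y; g \<in> Hom C Y Z\<rbrakk>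
        \<Longrightarrow> g \<cdot> f \<in> Hom C X Z"
    and Comp_Id_right: "\<lbrakk>X \<in> Ob C; Y \<in> Ob C; f \<in> Hom C X Y\<rbrakk> \<Longrightarrow> f \<cdot> Id C X = f"
    and Comp_Id_left: "\<lbrakk>X \<in> Ob C; Y \<in> Ob C; f \<in> Hom C X Y\<rbrakk> \<Longrightarrow> Id C Y \<cdot> f = f"
    and Comp_assoc:
      "\<lbrakk>W \<in> Ob C; X \<in> Ob C; Y \<in> Ob C; Z \<in> Ob C;
        f \<in> Hom C W X; g \<in> Hom C X Y; h \<in> Hom C Y Z\<rbrakk>
        \<Longrightarrow> (h \<cdot> g) \<cdot> f = h \<cdot> (g \<cdot> f)"

definition op_cat :: "('o, 'a, 'm) cat_scheme \<Rightarrow> ('o, 'a) cat" where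
  "op_cat C = \<lparr>Ob = Ob C, Hom = (\<lambda>X Y. Hom C Y X), Comp = (\<lambda>g f. f \<cdot>\<^bsub>C\<^esub> g), Id = Id C\<rparr>"

definition prod_cat ::
  "('i, 'u, 'm) cat_scheme \<Rightarrow> ('k, 'v, 'n) cat_scheme \<Rightarrow> ('i \<times> 'k, 'u \<times> 'v) cat" where
  "prod_cat J K =
    \<lparr>Ob = Ob J \<times> Ob K,
     Hom = (\<lambda>x y. Hom J (fst x) (fst y) \<times> Hom K (snd x) (snd y)),
     Comp = (\<lambda>g f. (fst g \<cdot>\<^bsub>J\<^esub> fst f, snd g \<cdot>\<^bsub>K\<^esub> snd f)),
     Id = (\<lambda>x. (Id J (fst x), Id K (snd x)))\<rparr>"

definition discrete_cat :: "'i set \<Rightarrow> ('i, unit) cat" where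
  "discrete_cat S =
    \<lparr>Ob = S, Hom = (\<lambda>i j. if i = j then {()} else {}), Comp = (\<lambda>_ _. ()), Id = (\<lambda>_. ())\<rparr>"

text \<open>The ordered set of natural numbers as a category.\<close>

definition nat_chain :: "(nat, unit) cat" where
  "nat_chain =
    \<lparr>Ob = UNIV, Hom = (\<lambda>m n. if m \<le> n then {()} else {}), Comp = (\<lambda>_ _. ()), Id = (\<lambda>_. ())\<rparr>"

definition under_cat :: "('o, 'a, 'm) cat_scheme \<Rightarrow> 'o \<Rightarrow> ('o \<times> 'a, 'a) cat" where
  "under_cat C X =
    \<lparr>Ob = {(Y, g). Y \<in> Ob C \<and> g \<in> Hom C X Y},
     Hom = (\<lambda>(Y, g) (Z, h). {k \<in> Hom C Y Z. k \<cdot>\<^bsub>C\<^esub> g = h}),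
     Comp = Comp C,
     Id = (\<lambda>(Y, g). Id C Y)\<rparr>"

definition iso_arr :: "('o, 'a, 'm) cat_scheme \<Rightarrow> 'o \<Rightarrow> 'o \<Rightarrow> 'a \<Rightarrow> bool" where
  "iso_arr C X Y f \<longleftrightarrow> f \<in> Hom C X Y \<and>
    (\<exists>g \<in> Hom C Y X. g \<cdot>\<^bsub>C\<^esub> f = Id C X \<and> f \<cdot>\<^bsub>C\<^esub> g = Id C Y)"

definition mono_arr :: "('o, 'a, 'm) cat_scheme \<Rightarrow> 'o \<Rightarrow> 'o \<Rightarrow> 'a \<Rightarrow> bool" where
  "mono_arr C X Y f \<longleftrightarrow> f \<in> Hom C X Y \<and>
    (\<forall>W \<in> Ob C. \<forall>g \<in> Hom C W X. \<forall>h \<in> Hom C W X. f \<cdot>\<^bsub>C\<^esub> g = f \<cdot>\<^bsub>C\<^esub> h \<longrightarrow> g = h)"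

definition epi_arr :: "('o, 'a, 'm) cat_scheme \<Rightarrow> 'o \<Rightarrow> 'o \<Rightarrow> 'a \<Rightarrow> bool" where
  "epi_arr C X Y f \<longleftrightarrow> f \<in> Hom C X Y \<and>
    (\<forall>Z \<in> Ob C. \<forall>g \<in> Hom C Y Z. \<forall>h \<in> Hom C Y Z. g \<cdot>\<^bsub>C\<^esub> f = h \<cdot>\<^bsub>C\<^esub> f \<longrightarrow> g = h)"

definition coequalizer ::
  "('o, 'a, 'm) cat_scheme \<Rightarrow> 'o \<Rightarrow> 'o \<Rightarrow> 'a \<Rightarrow> 'a \<Rightarrow> 'o \<Rightarrow> 'a \<Rightarrow> bool" where
  "coequalizer C X Y f g Q q \<longleftrightarrow>
    Q \<in> Ob C \<and> q \<in> Hom C Y Q \<and> q \<cdot>\<^bsub>C\<^esub> f = q \<cdot>\<^bsub>C\<^esub> g \<and>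
    (\<forall>Z \<in> Ob C. \<forall>r \<in> Hom C Y Z. r \<cdot>\<^bsub>C\<^esub> f = r \<cdot>\<^bsub>C\<^esub> g \<longrightarrow>
      (\<exists>!h. h \<in> Hom C Q Z \<and> h \<cdot>\<^bsub>C\<^esub> q = r))"

record ('o, 'a, 'p, 'b) ftor =
  FOb :: "'o \<Rightarrow> 'p"
  FAr :: "'o \<Rightarrow> 'o \<Rightarrow> 'a \<Rightarrow> 'b"

definition is_functor ::
  "('o, 'a, 'm) cat_scheme \<Rightarrow> ('p, 'b, 'n) cat_scheme \<Rightarrow> ('o, 'a, 'p, 'b) ftor \<Rightarrow> bool" where
  "is_functor C D F \<longleftrightarrow>
    (\<forall>X \<in> Ob C. FOb F X \<in> Ob D) \<and>
    (\<forall>X \<in> Ob C. \<forall>Y \<in> Ob C. \<forall>f \<in> Hom C X Y. FAr F X Y f \<in> Hom D (FOb F X) (FOb F Y)) \<and>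
    (\<forall>X \<in> Ob C. FAr F X X (Id C X) = Id D (FOb F X)) \<and>
    (\<forall>X \<in> Ob C. \<forall>Y \<in> Ob C. \<forall>Z \<in> Ob C. \<forall>f \<in> Hom C X Y. \<forall>g \<in> Hom C Y Z.
      FAr F X Z (g \<cdot>\<^bsub>C\<^esub> f) = FAr F Y Z g \<cdot>\<^bsub>D\<^esub> FAr F X Y f)"

definition ftor_comp ::
  "('p, 'b, 'q, 'c) ftor \<Rightarrow> ('o, 'a, 'p, 'b) ftor \<Rightarrow> ('o, 'a, 'q, 'c) ftor" where
  "ftor_comp G F =
    \<lparr>FOb = (\<lambda>X. FOb G (FOb F X)),
     FAr = (\<lambda>X Y f. FAr G (FOb F X) (FOb F Y) (FAr F X Y f))\<rparr>"

text \<open>The partial functors \<open>F(j, -)\<close> and \<open>F(-, k)\<close> of a functor on \<open>prod_cat J K\<close>.\<close>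

definition slice_left ::
  "('i, 'u, 'm) cat_scheme \<Rightarrow> ('i \<times> 'k, 'u \<times> 'v, 'o, 'a) ftor \<Rightarrow> 'i \<Rightarrow> ('k, 'v, 'o, 'a) ftor" where
  "slice_left J F j =
    \<lparr>FOb = (\<lambda>k. FOb F (j, k)), FAr = (\<lambda>k l v. FAr F (j, k) (j, l) (Id J j, v))\<rparr>"

definition slice_right ::
  "('k, 'v, 'm) cat_scheme \<Rightarrow> ('i \<times> 'k, 'u \<times> 'v, 'o, 'a) ftor \<Rightarrow> 'k \<Rightarrow> ('i, 'u, 'o, 'a) ftor" where
  "slice_right K F k =
    \<lparr>FOb = (\<lambda>j. FOb F (j, k)), FAr = (\<lambda>i j u. FAr F (i, k) (j, k) (u, Id K k))\<rparr>"

definition cocone ::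
  "('i, 'u, 'm) cat_scheme \<Rightarrow> ('o, 'a, 'n) cat_scheme \<Rightarrow> ('i, 'u, 'o, 'a) ftor
    \<Rightarrow> 'o \<Rightarrow> ('i \<Rightarrow> 'a) \<Rightarrow> bool" where
  "cocone J C F L \<iota> \<longleftrightarrow> L \<in> Ob C \<and> (\<forall>i \<in> Ob J. \<iota> i \<in> Hom C (FOb F i) L) \<and>
    (\<forall>i \<in> Ob J. \<forall>j \<in> Ob J. \<forall>u \<in> Hom J i j. \<iota> j \<cdot>\<^bsub>C\<^esub> FAr F i j u = \<iota> i)"

definition is_colimit ::
  "('i, 'u, 'm) cat_scheme \<Rightarrow> ('o, 'a, 'n) cat_scheme \<Rightarrow> ('i, 'u, 'o, 'a) ftor
    \<Rightarrow> 'o \<Rightarrow> ('i \<Rightarrow> 'a) \<Rightarrow> bool" where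
  "is_colimit J C F L \<iota> \<longleftrightarrow> cocone J C F L \<iota> \<and>
    (\<forall>M \<kappa>. cocone J C F M \<kappa> \<longrightarrow>
      (\<exists>!h. h \<in> Hom C L M \<and> (\<forall>i \<in> Ob J. h \<cdot>\<^bsub>C\<^esub> \<iota> i = \<kappa> i)))"

definition cone ::
  "('i, 'u, 'm) cat_scheme \<Rightarrow> ('o, 'a, 'n) cat_scheme \<Rightarrow> ('i, 'u, 'o, 'a) ftor
    \<Rightarrow> 'o \<Rightarrow> ('i \<Rightarrow> 'a) \<Rightarrow> bool" where
  "cone J C F L \<pi> \<longleftrightarrow> L \<in> Ob C \<and> (\<forall>i \<in> Ob J. \<pi> i \<in> Hom C L (FOb F i)) \<and>
    (\<forall>i \<in> Ob J. \<forall>j \<in> Ob J. \<forall>u \<in> Hom J i j. FAr F i j u \<cdot>\<^bsub>C\<^esub> \<pi> i = \<pi> j)"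

definition is_limit ::
  "('i, 'u, 'm) cat_scheme \<Rightarrow> ('o, 'a, 'n) cat_scheme \<Rightarrow> ('i, 'u, 'o, 'a) ftor
    \<Rightarrow> 'o \<Rightarrow> ('i \<Rightarrow> 'a) \<Rightarrow> bool" where
  "is_limit J C F L \<pi> \<longleftrightarrow> cone J C F L \<pi> \<and>
    (\<forall>M \<kappa>. cone J C F M \<kappa> \<longrightarrow>
      (\<exists>!h. h \<in> Hom C M L \<and> (\<forall>i \<in> Ob J. \<pi> i \<cdot>\<^bsub>C\<^esub> h = \<kappa> i)))"

section \<open>Small, finite, filtered and directed index categories\<close>

text \<open>
  The type \<open>'i\<close> plays the role of the universe: a category is small if its objects and its
  arrows form subsets of \<open>'i\<close> of cardinality strictly less than that of \<open>'i\<close>.  For \<open>'i\<close> of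
  the cardinality of a Grothendieck universe this is the usual notion of smallness.
\<close>

definition small_cat :: "('i, 'i) cat \<Rightarrow> bool" where
  "small_cat J \<longleftrightarrow> category J \<and>
    Ob J \<prec> (UNIV :: 'i set) \<and> (\<Union>i \<in> Ob J. \<Union>j \<in> Ob J. Hom J i j) \<prec> (UNIV :: 'i set)"

text \<open>Every finite category is isomorphic to one whose objects and arrows are natural numbers.\<close>

definition finite_cat :: "(nat, nat) cat \<Rightarrow> bool" where
  "finite_cat J \<longleftrightarrow> category J \<and>
    finite (Ob J) \<and> (\<forall>i \<in> Ob J. \<forall>j \<in> Ob J. finite (Hom J i j))"

definition filtered_cat :: "('i, 'u, 'm) cat_scheme \<Rightarrow> bool" where
  "filtered_cat J \<longleftrightarrow> Ob J \<noteq> {} \<and>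
    (\<forall>i \<in> Ob J. \<forall>j \<in> Ob J. \<exists>k \<in> Ob J. Hom J i k \<noteq> {} \<and> Hom J j k \<noteq> {}) \<and>
    (\<forall>i \<in> Ob J. \<forall>j \<in> Ob J. \<forall>u \<in> Hom J i j. \<forall>v \<in> Hom J i j.
      \<exists>k \<in> Ob J. \<exists>w \<in> Hom J j k. w \<cdot>\<^bsub>J\<^esub> u = w \<cdot>\<^bsub>J\<^esub> v)"

text \<open>A directed (preordered) set, regarded as a category with at most one arrow \<open>i \<rightarrow> j\<close>.\<close>

definition directed_cat :: "('i, 'u, 'm) cat_scheme \<Rightarrow> bool" where
  "directed_cat J \<longleftrightarrow> Ob J \<noteq> {} \<and>
    (\<forall>i \<in> Ob J. \<forall>j \<in> Ob J. \<forall>u \<in> Hom J i j. \<forall>v \<in> Hom J i j. u = v) \<and>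
    (\<forall>i \<in> Ob J. \<forall>j \<in> Ob J. \<exists>k \<in> Ob J. Hom J i k \<noteq> {} \<and> Hom J j k \<noteq> {})"

definition has_small_limits :: "'i itself \<Rightarrow> ('o, 'a, 'm) cat_scheme \<Rightarrow> bool" where
  "has_small_limits _ C \<longleftrightarrow>
    (\<forall>(J :: ('i, 'i) cat) F. small_cat J \<and> is_functor J C F \<longrightarrow> (\<exists>L \<pi>. is_limit J C F L \<pi>))"

definition has_small_colimits :: "'i itself \<Rightarrow> ('o, 'a, 'm) cat_scheme \<Rightarrow> bool" where
  "has_small_colimits _ C \<longleftrightarrow>
    (\<forall>(J :: ('i, 'i) cat) F. small_cat J \<and> is_functor J C F \<longrightarrow> (\<exists>L \<iota>. is_colimit J C F L \<iota>))"

definition preserves_small_colimits ::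
  "'i itself \<Rightarrow> ('o, 'a, 'm) cat_scheme \<Rightarrow> ('p, 'b, 'n) cat_scheme
    \<Rightarrow> ('o, 'a, 'p, 'b) ftor \<Rightarrow> bool" where
  "preserves_small_colimits _ C D G \<longleftrightarrow>
    (\<forall>(J :: ('i, 'i) cat) F L \<iota>. small_cat J \<and> is_functor J C F \<and> is_colimit J C F L \<iota> \<longrightarrow>
      is_colimit J D (ftor_comp G F) (FOb G L) (\<lambda>i. FAr G (FOb F i) L (\<iota> i)))"

definition preserves_finite_limits ::
  "('o, 'a, 'm) cat_scheme \<Rightarrow> ('p, 'b, 'n) cat_scheme \<Rightarrow> ('o, 'a, 'p, 'b) ftor \<Rightarrow> bool" where
  "preserves_finite_limits C D G \<longleftrightarrow>
    (\<forall>(J :: (nat, nat) cat) F L \<pi>. finite_cat J \<and> is_functor J C F \<and> is_limit J C F L \<pi> \<longrightarrow>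
      is_limit J D (ftor_comp G F) (FOb G L) (\<lambda>i. FAr G L (FOb F i) (\<pi> i)))"

text \<open>
  Filtered colimits commute with finite limits: for \<open>F : J \<times> K \<rightarrow> C\<close>, let \<open>Lf j = lim\<^sub>k F(j, k)\<close>
  and \<open>Cf k = colim\<^sub>j F(j, k)\<close>, with the induced functor structures.  The arrow \<open>\<phi>\<close> below is
  then uniquely determined: it is the canonical map from \<open>X = colim\<^sub>j Lf j\<close> to \<open>Y = lim\<^sub>k Cf k\<close>.
\<close>

definition filtered_colimits_commute_with_finite_limits ::
  "'i itself \<Rightarrow> ('o, 'a, 'm) cat_scheme \<Rightarrow> bool" where
  "filtered_colimits_commute_with_finite_limits _ C \<longleftrightarrow>
    (\<forall>(J :: ('i, 'i) cat) (K :: (nat, nat) cat) F Lf \<pi> Cf \<iota> X q Y p.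
      small_cat J \<and> filtered_cat J \<and> finite_cat K \<and> is_functor (prod_cat J K) C F \<and>
      is_functor J C Lf \<and> (\<forall>j \<in> Ob J. is_limit K C (slice_left J F j) (FOb Lf j) (\<pi> j)) \<and>
      (\<forall>i \<in> Ob J. \<forall>j \<in> Ob J. \<forall>u \<in> Hom J i j. \<forall>k \<in> Ob K.
        \<pi> j k \<cdot>\<^bsub>C\<^esub> FAr Lf i j u = FAr F (i, k) (j, k) (u, Id K k) \<cdot>\<^bsub>C\<^esub> \<pi> i k) \<and>
      is_functor K C Cf \<and> (\<forall>k \<in> Ob K. is_colimit J C (slice_right K F k) (FOb Cf k) (\<iota> k)) \<and>
      (\<forall>k \<in> Ob K. \<forall>l \<in> Ob K. \<forall>v \<in> Hom K k l. \<forall>j \<in> Ob J.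
        FAr Cf k l v \<cdot>\<^bsub>C\<^esub> \<iota> k j = \<iota> l j \<cdot>\<^bsub>C\<^esub> FAr F (j, k) (j, l) (Id J j, v)) \<and>
      is_colimit J C Lf X q \<and> is_limit K C Cf Y p \<longrightarrow>
      (\<exists>\<phi>. iso_arr C X Y \<phi> \<and>
        (\<forall>j \<in> Ob J. \<forall>k \<in> Ob K. p k \<cdot>\<^bsub>C\<^esub> \<phi> \<cdot>\<^bsub>C\<^esub> q j = \<iota> k j \<cdot>\<^bsub>C\<^esub> \<pi> j k)))"

section \<open>Compatibility of representable functors with colimits\<close>

text \<open>
  The colimit of the sets \<open>Hom(X, F j)\<close> is their disjoint union modulo the equivalence
  relation generated by \<open>(i, g) \<sim> (j, F u \<cdot> g)\<close>.
\<close>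

definition hom_step ::
  "('i, 'u, 'm) cat_scheme \<Rightarrow> ('o, 'a, 'n) cat_scheme \<Rightarrow> 'o \<Rightarrow> ('i, 'u, 'o, 'a) ftor
    \<Rightarrow> (('i \<times> 'a) \<times> ('i \<times> 'a)) set" where
  "hom_step J C X F =
    {((i, g), (j, FAr F i j u \<cdot>\<^bsub>C\<^esub> g)) | i j u g.
      i \<in> Ob J \<and> j \<in> Ob J \<and> u \<in> Hom J i j \<and> g \<in> Hom C X (FOb F i)}"

definition hom_colim ::
  "('i, 'u, 'm) cat_scheme \<Rightarrow> ('o, 'a, 'n) cat_scheme \<Rightarrow> 'o \<Rightarrow> ('i, 'u, 'o, 'a) ftor
    \<Rightarrow> ('i \<times> 'a) set set" where
  "hom_colim J C X F =
    (SIGMA j : Ob J. Hom C X (FOb F j)) // (hom_step J C X F \<union> (hom_step J C X F)\<inverse>)\<^sup>*"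

definition hom_colim_map ::
  "('o, 'a, 'n) cat_scheme \<Rightarrow> ('i \<Rightarrow> 'a) \<Rightarrow> ('i \<times> 'a) set \<Rightarrow> 'a" where
  "hom_colim_map C \<iota> c = the_elem ((\<lambda>(j, g). \<iota> j \<cdot>\<^bsub>C\<^esub> g) ` c)"

definition hom_preserves_colimit ::
  "('i, 'u, 'm) cat_scheme \<Rightarrow> ('o, 'a, 'n) cat_scheme \<Rightarrow> 'o \<Rightarrow> ('i, 'u, 'o, 'a) ftor
    \<Rightarrow> 'o \<Rightarrow> ('i \<Rightarrow> 'a) \<Rightarrow> bool" where
  "hom_preserves_colimit J C X F L \<iota> \<longleftrightarrow>
    bij_betw (hom_colim_map C \<iota>) (hom_colim J C X F) (Hom C X L)"

definition hom_preserves_filtered_colimits ::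
  "'i itself \<Rightarrow> ('o, 'a, 'm) cat_scheme \<Rightarrow> 'o \<Rightarrow> bool" where
  "hom_preserves_filtered_colimits _ C X \<longleftrightarrow>
    (\<forall>(J :: ('i, 'i) cat) F L \<iota>.
      small_cat J \<and> filtered_cat J \<and> is_functor J C F \<and> is_colimit J C F L \<iota> \<longrightarrow>
      hom_preserves_colimit J C X F L \<iota>)"

definition finitely_presented_ob ::
  "'i itself \<Rightarrow> ('o, 'a, 'm) cat_scheme \<Rightarrow> 'o \<Rightarrow> bool" where
  "finitely_presented_ob _ C X \<longleftrightarrow> X \<in> Ob C \<and>
    (\<forall>(J :: ('i, 'i) cat) F L \<iota>.
      small_cat J \<and> directed_cat J \<and> is_functor J C F \<and> is_colimit J C F L \<iota> \<longrightarrow>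
      hom_preserves_colimit J C X F L \<iota>)"

section \<open>Abelian categories\<close>

record ('o, 'a) abcat = "('o, 'a) cat" +
  Add :: "'a \<Rightarrow> 'a \<Rightarrow> 'a"
  Zer :: "'o \<Rightarrow> 'o \<Rightarrow> 'a"

definition hom_group :: "('o, 'a, 'm) abcat_scheme \<Rightarrow> 'o \<Rightarrow> 'o \<Rightarrow> 'a monoid" where
  "hom_group C X Y = \<lparr>carrier = Hom C X Y, mult = Add C, one = Zer C X Y\<rparr>"

definition zero_ob :: "('o, 'a, 'm) cat_scheme \<Rightarrow> 'o \<Rightarrow> bool" where
  "zero_ob C Z \<longleftrightarrow> Z \<in> Ob C \<and>
    (\<forall>X \<in> Ob C. (\<exists>!f. f \<in> Hom C X Z) \<and> (\<exists>!f. f \<in> Hom C Z X))"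

definition biproduct ::
  "('o, 'a, 'm) abcat_scheme \<Rightarrow> 'o \<Rightarrow> 'o \<Rightarrow> 'o \<Rightarrow> 'a \<Rightarrow> 'a \<Rightarrow> 'a \<Rightarrow> 'a \<Rightarrow> bool" where
  "biproduct C X Y P i\<^sub>1 i\<^sub>2 p\<^sub>1 p\<^sub>2 \<longleftrightarrow> P \<in> Ob C \<and>
    i\<^sub>1 \<in> Hom C X P \<and> i\<^sub>2 \<in> Hom C Y P \<and> p\<^sub>1 \<in> Hom C P X \<and> p\<^sub>2 \<in> Hom C P Y \<and>
    p\<^sub>1 \<cdot>\<^bsub>C\<^esub> i\<^sub>1 = Id C X \<and> p\<^sub>2 \<cdot>\<^bsub>C\<^esub> i\<^sub>2 = Id C Y \<and>
    p\<^sub>2 \<cdot>\<^bsub>C\<^esub> i\<^sub>1 = Zer C X Y \<and> p\<^sub>1 \<cdot>\<^bsub>C\<^esub> i\<^sub>2 = Zer C Y X \<and>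
    Add C (i\<^sub>1 \<cdot>\<^bsub>C\<^esub> p\<^sub>1) (i\<^sub>2 \<cdot>\<^bsub>C\<^esub> p\<^sub>2) = Id C P"

definition is_kernel ::
  "('o, 'a, 'm) abcat_scheme \<Rightarrow> 'o \<Rightarrow> 'o \<Rightarrow> 'a \<Rightarrow> 'o \<Rightarrow> 'a \<Rightarrow> bool" where
  "is_kernel C X Y f K k \<longleftrightarrow> K \<in> Ob C \<and> k \<in> Hom C K X \<and> f \<cdot>\<^bsub>C\<^esub> k = Zer C K Y \<and>
    (\<forall>W \<in> Ob C. \<forall>w \<in> Hom C W X. f \<cdot>\<^bsub>C\<^esub> w = Zer C W Y \<longrightarrow>
      (\<exists>!h. h \<in> Hom C W K \<and> k \<cdot>\<^bsub>C\<^esub> h = w))"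

definition is_cokernel ::
  "('o, 'a, 'm) abcat_scheme \<Rightarrow> 'o \<Rightarrow> 'o \<Rightarrow> 'a \<Rightarrow> 'o \<Rightarrow> 'a \<Rightarrow> bool" where
  "is_cokernel C X Y f Q q \<longleftrightarrow> Q \<in> Ob C \<and> q \<in> Hom C Y Q \<and> q \<cdot>\<^bsub>C\<^esub> f = Zer C X Q \<and>
    (\<forall>Z \<in> Ob C. \<forall>z \<in> Hom C Y Z. z \<cdot>\<^bsub>C\<^esub> f = Zer C X Z \<longrightarrow>
      (\<exists>!h. h \<in> Hom C Q Z \<and> h \<cdot>\<^bsub>C\<^esub> q = z))"

locale abelian_category = category C
  for C :: "('o, 'a, 'm) abcat_scheme" (structure) +
  assumes comm_group_Hom: "\<lbrakk>X \<in> Ob C; Y \<in> Ob C\<rbrakk> \<Longrightarrow> comm_group (hom_group C X Y)"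
    and Comp_Add_right:
      "\<lbrakk>X \<in> Ob C; Y \<in> Ob C; Z \<in> Ob C; f \<in> Hom C X Y; f' \<in> Hom C X Y; g \<in> Hom C Y Z\<rbrakk>
        \<Longrightarrow> g \<cdot> Add C f f' = Add C (g \<cdot> f) (g \<cdot> f')"
    and Comp_Add_left:
      "\<lbrakk>X \<in> Ob C; Y \<in> Ob C; Z \<in> Ob C; f \<in> Hom C X Y; g \<in> Hom C Y Z; g' \<in> Hom C Y Z\<rbrakk>
        \<Longrightarrow> Add C g g' \<cdot> f = Add C (g \<cdot> f) (g' \<cdot> f)"
    and ex_zero_ob: "\<exists>Z. zero_ob C Z"
    and ex_biproduct:
      "\<lbrakk>X \<in> Ob C; Y \<in> Ob C\<rbrakk> \<Longrightarrow> \<exists>P i\<^sub>1 i\<^sub>2 p\<^sub>1 p\<^sub>2. biproduct C X Y P i\<^sub>1 i\<^sub>2 p\<^sub>1 p\<^sub>2"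
    and ex_kernel: "\<lbrakk>X \<in> Ob C; Y \<in> Ob C; f \<in> Hom C X Y\<rbrakk> \<Longrightarrow> \<exists>K k. is_kernel C X Y f K k"
    and ex_cokernel: "\<lbrakk>X \<in> Ob C; Y \<in> Ob C; f \<in> Hom C X Y\<rbrakk> \<Longrightarrow> \<exists>Q q. is_cokernel C X Y f Q q"
    and mono_is_kernel:
      "\<lbrakk>X \<in> Ob C; Y \<in> Ob C; mono_arr C X Y f\<rbrakk>
        \<Longrightarrow> \<exists>Z \<in> Ob C. \<exists>g \<in> Hom C Y Z. is_kernel C Y Z g X f"
    and epi_is_cokernel:
      "\<lbrakk>X \<in> Ob C; Y \<in> Ob C; epi_arr C X Y f\<rbrakk>
        \<Longrightarrow> \<exists>W \<in> Ob C. \<exists>g \<in> Hom C W X. is_cokernel C W X g Y f"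

text \<open>
  The colimit of the abelian groups \<open>Hom(X, F j)\<close>: their direct sum modulo the subgroup
  generated by the elements \<open>[g]\<^sub>i - [F u \<cdot> g]\<^sub>j\<close>.  It differs from the colimit of the underlying
  sets if the system is not filtered.  (For \<open>X = A\<close> in the category of \<open>A\<close>-modules these are
  modules over the endomorphism ring of \<open>A\<close>; the colimit of these modules has the same
  underlying group.)
\<close>

definition hom_sum_group ::
  "('i, 'u, 'm) cat_scheme \<Rightarrow> ('o, 'a, 'n) abcat_scheme \<Rightarrow> 'o \<Rightarrow> ('i, 'u, 'o, 'a) ftor
    \<Rightarrow> ('i \<Rightarrow> 'a) monoid" where
  "hom_sum_group J C X F = sum_group (Ob J) (\<lambda>j. hom_group C X (FOb F j))"

definition hom_sum_incl ::
  "('i, 'u, 'm) cat_scheme \<Rightarrow> ('o, 'a, 'n) abcat_scheme \<Rightarrow> 'o \<Rightarrow> ('i, 'u, 'o, 'a) ftor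
    \<Rightarrow> 'i \<Rightarrow> 'a \<Rightarrow> ('i \<Rightarrow> 'a)" where
  "hom_sum_incl J C X F i g = (\<lambda>j \<in> Ob J. if j = i then g else Zer C X (FOb F j))"

definition hom_sum_relations ::
  "('i, 'u, 'm) cat_scheme \<Rightarrow> ('o, 'a, 'n) abcat_scheme \<Rightarrow> 'o \<Rightarrow> ('i, 'u, 'o, 'a) ftor
    \<Rightarrow> ('i \<Rightarrow> 'a) set" where
  "hom_sum_relations J C X F =
    generate (hom_sum_group J C X F)
      {hom_sum_incl J C X F i g \<otimes>\<^bsub>hom_sum_group J C X F\<^esub>
        inv\<^bsub>hom_sum_group J C X F\<^esub> (hom_sum_incl J C X F j (FAr F i j u \<cdot>\<^bsub>C\<^esub> g)) | i j u g.
        i \<in> Ob J \<and> j \<in> Ob J \<and> u \<in> Hom J i j \<and> g \<in> Hom C X (FOb F i)}"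

definition hom_group_colim ::
  "('i, 'u, 'm) cat_scheme \<Rightarrow> ('o, 'a, 'n) abcat_scheme \<Rightarrow> 'o \<Rightarrow> ('i, 'u, 'o, 'a) ftor
    \<Rightarrow> ('i \<Rightarrow> 'a) set monoid" where
  "hom_group_colim J C X F = hom_sum_group J C X F Mod hom_sum_relations J C X F"

text \<open>The canonical map sends the class of \<open>s\<close> to the (finite) sum of the \<open>\<iota> j \<cdot> s j\<close>.\<close>

definition hom_group_colim_map ::
  "('i, 'u, 'm) cat_scheme \<Rightarrow> ('o, 'a, 'n) abcat_scheme \<Rightarrow> 'o \<Rightarrow> 'o \<Rightarrow> ('i \<Rightarrow> 'a)
    \<Rightarrow> ('i \<Rightarrow> 'a) set \<Rightarrow> 'a" where
  "hom_group_colim_map J C X L \<iota> c =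
    the_elem ((\<lambda>s. finprod (hom_group C X L) (\<lambda>j. \<iota> j \<cdot>\<^bsub>C\<^esub> s j) (Ob J)) ` c)"

definition hom_group_preserves_finite_colimit ::
  "('i, 'u, 'm) cat_scheme \<Rightarrow> ('o, 'a, 'n) abcat_scheme \<Rightarrow> 'o \<Rightarrow> ('i, 'u, 'o, 'a) ftor
    \<Rightarrow> 'o \<Rightarrow> ('i \<Rightarrow> 'a) \<Rightarrow> bool" where
  "hom_group_preserves_finite_colimit J C X F L \<iota> \<longleftrightarrow>
    hom_group_colim_map J C X L \<iota> \<in> iso (hom_group_colim J C X F) (hom_group C X L)"

text \<open>\<open>M\<close> is a direct sum of \<open>r\<close> copies of \<open>X\<close>.\<close>

definition is_power :: "('o, 'a, 'm) cat_scheme \<Rightarrow> 'o \<Rightarrow> nat \<Rightarrow> 'o \<Rightarrow> bool" where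
  "is_power C X r M \<longleftrightarrow>
    (\<exists>\<iota>. is_colimit (discrete_cat {..<r}) C \<lparr>FOb = (\<lambda>_. X), FAr = (\<lambda>_ _ _. Id C X)\<rparr> M \<iota>)"

section \<open>Symmetric monoidal categories\<close>

record ('o, 'a) smcat = "('o, 'a) abcat" +
  TenO :: "'o \<Rightarrow> 'o \<Rightarrow> 'o"  (infixr "\<odot>\<index>" 75)
  TenA :: "'a \<Rightarrow> 'a \<Rightarrow> 'a"  (infixr "\<star>\<index>" 75)
  Unit :: "'o"
  Assoc :: "'o \<Rightarrow> 'o \<Rightarrow> 'o \<Rightarrow> 'a"
  LUnit :: "'o \<Rightarrow> 'a"
  RUnit :: "'o \<Rightarrow> 'a"
  Braid :: "'o \<Rightarrow> 'o \<Rightarrow> 'a"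

locale symmetric_monoidal_category = category C
  for C :: "('o, 'a, 'm) smcat_scheme" (structure) +
  assumes TenO_in_Ob: "\<lbrakk>X \<in> Ob C; Y \<in> Ob C\<rbrakk> \<Longrightarrow> X \<odot> Y \<in> Ob C"
    and Unit_in_Ob: "Unit C \<in> Ob C"
    and TenA_in_Hom:
      "\<lbrakk>X \<in> Ob C; Y \<in> Ob C; X' \<in> Ob C; Y' \<in> Ob C; f \<in> Hom C X Y; f' \<in> Hom C X' Y'\<rbrakk>
        \<Longrightarrow> f \<star> f' \<in> Hom C (X \<odot> X') (Y \<odot> Y')"
    and TenA_Id: "\<lbrakk>X \<in> Ob C; Y \<in> Ob C\<rbrakk> \<Longrightarrow> Id C X \<star> Id C Y = Id C (X \<odot> Y)"
    and TenA_Comp: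
      "\<lbrakk>X \<in> Ob C; Y \<in> Ob C; Z \<in> Ob C; X' \<in> Ob C; Y' \<in> Ob C; Z' \<in> Ob C;
        f \<in> Hom C X Y; g \<in> Hom C Y Z; f' \<in> Hom C X' Y'; g' \<in> Hom C Y' Z'\<rbrakk>
        \<Longrightarrow> (g \<cdot> f) \<star> (g' \<cdot> f') = (g \<star> g') \<cdot> (f \<star> f')"
    and Assoc_iso:
      "\<lbrakk>X \<in> Ob C; Y \<in> Ob C; Z \<in> Ob C\<rbrakk>
        \<Longrightarrow> iso_arr C ((X \<odot> Y) \<odot> Z) (X \<odot> (Y \<odot> Z)) (Assoc C X Y Z)"
    and LUnit_iso: "X \<in> Ob C \<Longrightarrow> iso_arr C (Unit C \<odot> X) X (LUnit C X)"
    and RUnit_iso: "X \<in> Ob C \<Longrightarrow> iso_arr C (X \<odot> Unit C) X (RUnit C X)"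
    and Braid_in_Hom: "\<lbrakk>X \<in> Ob C; Y \<in> Ob C\<rbrakk> \<Longrightarrow> Braid C X Y \<in> Hom C (X \<odot> Y) (Y \<odot> X)"
    and Assoc_natural:
      "\<lbrakk>X \<in> Ob C; Y \<in> Ob C; Z \<in> Ob C; X' \<in> Ob C; Y' \<in> Ob C; Z' \<in> Ob C;
        f \<in> Hom C X X'; g \<in> Hom C Y Y'; h \<in> Hom C Z Z'\<rbrakk>
        \<Longrightarrow> Assoc C X' Y' Z' \<cdot> ((f \<star> g) \<star> h) = (f \<star> (g \<star> h)) \<cdot> Assoc C X Y Z"
    and LUnit_natural:
      "\<lbrakk>X \<in> Ob C; Y \<in> Ob C; f \<in> Hom C X Y\<rbrakk>
        \<Longrightarrow> LUnit C Y \<cdot> (Id C (Unit C) \<star> f) = f \<cdot> LUnit C X"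
    and RUnit_natural:
      "\<lbrakk>X \<in> Ob C; Y \<in> Ob C; f \<in> Hom C X Y\<rbrakk>
        \<Longrightarrow> RUnit C Y \<cdot> (f \<star> Id C (Unit C)) = f \<cdot> RUnit C X"
    and Braid_natural:
      "\<lbrakk>X \<in> Ob C; Y \<in> Ob C; X' \<in> Ob C; Y' \<in> Ob C; f \<in> Hom C X X'; g \<in> Hom C Y Y'\<rbrakk>
        \<Longrightarrow> Braid C X' Y' \<cdot> (f \<star> g) = (g \<star> f) \<cdot> Braid C X Y"
    and pentagon:
      "\<lbrakk>W \<in> Ob C; X \<in> Ob C; Y \<in> Ob C; Z \<in> Ob C\<rbrakk>
        \<Longrightarrow> (Id C W \<star> Assoc C X Y Z) \<cdot> Assoc C W (X \<odot> Y) Z \<cdot> (Assoc C W X Y \<star> Id C Z)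
            = Assoc C W X (Y \<odot> Z) \<cdot> Assoc C (W \<odot> X) Y Z"
    and triangle:
      "\<lbrakk>X \<in> Ob C; Y \<in> Ob C\<rbrakk>
        \<Longrightarrow> (Id C X \<star> LUnit C Y) \<cdot> Assoc C X (Unit C) Y = RUnit C X \<star> Id C Y"
    and hexagon:
      "\<lbrakk>X \<in> Ob C; Y \<in> Ob C; Z \<in> Ob C\<rbrakk>
        \<Longrightarrow> Assoc C Y Z X \<cdot> Braid C X (Y \<odot> Z) \<cdot> Assoc C X Y Z
            = (Id C Y \<star> Braid C X Z) \<cdot> Assoc C Y X Z \<cdot> (Braid C X Y \<star> Id C Z)"
    and symmetry:
      "\<lbrakk>X \<in> Ob C; Y \<in> Ob C\<rbrakk> \<Longrightarrow> Braid C Y X \<cdot> Braid C X Y = Id C (X \<odot> Y)"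

definition tensor_right :: "('o, 'a, 'm) smcat_scheme \<Rightarrow> 'o \<Rightarrow> ('o, 'a, 'o, 'a) ftor" where
  "tensor_right C X =
    \<lparr>FOb = (\<lambda>Y. Y \<odot>\<^bsub>C\<^esub> X), FAr = (\<lambda>_ _ f. f \<star>\<^bsub>C\<^esub> Id C X)\<rparr>"

section \<open>Commutative monoids and their modules\<close>

record ('o, 'a) cmon =
  Car :: "'o"
  Mul :: "'a"
  Uni :: "'a"

definition comm_monoid_ob :: "('o, 'a, 'm) smcat_scheme \<Rightarrow> ('o, 'a) cmon \<Rightarrow> bool" where
  "comm_monoid_ob C A \<longleftrightarrow>
    Car A \<in> Ob C \<and>
    Mul A \<in> Hom C (Car A \<odot>\<^bsub>C\<^esub> Car A) (Car A) \<and>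
    Uni A \<in> Hom C (Unit C) (Car A) \<and>
    Mul A \<cdot>\<^bsub>C\<^esub> (Mul A \<star>\<^bsub>C\<^esub> Id C (Car A))
      = Mul A \<cdot>\<^bsub>C\<^esub> (Id C (Car A) \<star>\<^bsub>C\<^esub> Mul A) \<cdot>\<^bsub>C\<^esub> Assoc C (Car A) (Car A) (Car A) \<and>
    Mul A \<cdot>\<^bsub>C\<^esub> (Uni A \<star>\<^bsub>C\<^esub> Id C (Car A)) = LUnit C (Car A) \<and>
    Mul A \<cdot>\<^bsub>C\<^esub> (Id C (Car A) \<star>\<^bsub>C\<^esub> Uni A) = RUnit C (Car A) \<and>
    Mul A \<cdot>\<^bsub>C\<^esub> Braid C (Car A) (Car A) = Mul A"

definition Comm :: "('o, 'a, 'm) smcat_scheme \<Rightarrow> (('o, 'a) cmon, 'a) cat" where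
  "Comm C =
    \<lparr>Ob = {A. comm_monoid_ob C A},
     Hom = (\<lambda>A B. {f \<in> Hom C (Car A) (Car B).
       f \<cdot>\<^bsub>C\<^esub> Mul A = Mul B \<cdot>\<^bsub>C\<^esub> (f \<star>\<^bsub>C\<^esub> f) \<and> f \<cdot>\<^bsub>C\<^esub> Uni A = Uni B}),
     Comp = Comp C,
     Id = (\<lambda>A. Id C (Car A))\<rparr>"

text \<open>
  Modules are right modules \<open>M \<odot> A \<rightarrow> M\<close>; by commutativity of \<open>A\<close> and the symmetry of \<open>C\<close>
  these are the same as left modules.
\<close>

record ('o, 'a) amod =
  MCar :: "'o"
  Act :: "'a"

definition module_ob ::
  "('o, 'a, 'm) smcat_scheme \<Rightarrow> ('o, 'a) cmon \<Rightarrow> ('o, 'a) amod \<Rightarrow> bool" where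
  "module_ob C A M \<longleftrightarrow>
    MCar M \<in> Ob C \<and>
    Act M \<in> Hom C (MCar M \<odot>\<^bsub>C\<^esub> Car A) (MCar M) \<and>
    Act M \<cdot>\<^bsub>C\<^esub> (Act M \<star>\<^bsub>C\<^esub> Id C (Car A))
      = Act M \<cdot>\<^bsub>C\<^esub> (Id C (MCar M) \<star>\<^bsub>C\<^esub> Mul A) \<cdot>\<^bsub>C\<^esub> Assoc C (MCar M) (Car A) (Car A) \<and>
    Act M \<cdot>\<^bsub>C\<^esub> (Id C (MCar M) \<star>\<^bsub>C\<^esub> Uni A) = RUnit C (MCar M)"

definition Modules ::
  "('o, 'a, 'm) smcat_scheme \<Rightarrow> ('o, 'a) cmon \<Rightarrow> (('o, 'a) amod, 'a) abcat" where
  "Modules C A =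
    \<lparr>Ob = {M. module_ob C A M},
     Hom = (\<lambda>M N. {f \<in> Hom C (MCar M) (MCar N).
       f \<cdot>\<^bsub>C\<^esub> Act M = Act N \<cdot>\<^bsub>C\<^esub> (f \<star>\<^bsub>C\<^esub> Id C (Car A))}),
     Comp = Comp C,
     Id = (\<lambda>M. Id C (MCar M)),
     Add = Add C,
     Zer = (\<lambda>M N. Zer C (MCar M) (MCar N))\<rparr>"

definition self_module :: "('o, 'a) cmon \<Rightarrow> ('o, 'a) amod" where
  "self_module A = \<lparr>MCar = Car A, Act = Mul A\<rparr>"

text \<open>\<open>B\<close> as an \<open>A\<close>-module along a monoid morphism \<open>f : A \<rightarrow> B\<close>.\<close>

definition monoid_as_module ::
  "('o, 'a, 'm) smcat_scheme \<Rightarrow> ('o, 'a) cmon \<Rightarrow> 'a \<Rightarrow> ('o, 'a) amod" where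
  "monoid_as_module C B f =
    \<lparr>MCar = Car B, Act = Mul B \<cdot>\<^bsub>C\<^esub> (Id C (Car B) \<star>\<^bsub>C\<^esub> f)\<rparr>"

definition endo_ring :: "('o, 'a, 'm) smcat_scheme \<Rightarrow> ('o, 'a) cmon \<Rightarrow> 'a ring" where
  "endo_ring C A =
    \<lparr>carrier = Hom (Modules C A) (self_module A) (self_module A),
     mult = Comp C, one = Id C (Car A), zero = Zer C (Car A) (Car A), add = Add C\<rparr>"

text \<open>
  \<open>N = M \<otimes>\<^sub>A B\<close> is the coequalizer of the two arrows \<open>(M \<odot> A) \<odot> B \<rightarrow> M \<odot> B\<close> given by the action
  of \<open>A\<close> on \<open>M\<close> and on \<open>B\<close>, with the action of \<open>B\<close> induced by multiplication on the factor \<open>B\<close>.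
\<close>

definition is_base_change ::
  "('o, 'a, 'm) smcat_scheme \<Rightarrow> ('o, 'a) cmon \<Rightarrow> ('o, 'a) cmon \<Rightarrow> 'a \<Rightarrow> ('o, 'a) amod
    \<Rightarrow> ('o, 'a) amod \<Rightarrow> 'a \<Rightarrow> bool" where
  "is_base_change C A B f M N q \<longleftrightarrow>
    N \<in> Ob (Modules C B) \<and>
    coequalizer C ((MCar M \<odot>\<^bsub>C\<^esub> Car A) \<odot>\<^bsub>C\<^esub> Car B) (MCar M \<odot>\<^bsub>C\<^esub> Car B)
      (Act M \<star>\<^bsub>C\<^esub> Id C (Car B))
      ((Id C (MCar M) \<star>\<^bsub>C\<^esub> (Mul B \<cdot>\<^bsub>C\<^esub> (f \<star>\<^bsub>C\<^esub> Id C (Car B))))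
        \<cdot>\<^bsub>C\<^esub> Assoc C (MCar M) (Car A) (Car B))
      (MCar N) q \<and>
    Act N \<cdot>\<^bsub>C\<^esub> (q \<star>\<^bsub>C\<^esub> Id C (Car B))
      = q \<cdot>\<^bsub>C\<^esub> (Id C (MCar M) \<star>\<^bsub>C\<^esub> Mul B) \<cdot>\<^bsub>C\<^esub> Assoc C (MCar M) (Car B) (Car B)"

definition base_change_choice ::
  "('o, 'a, 'm) smcat_scheme \<Rightarrow> ('o, 'a) cmon \<Rightarrow> ('o, 'a) cmon \<Rightarrow> 'a \<Rightarrow> ('o, 'a) amod
    \<Rightarrow> ('o, 'a) amod \<times> 'a" where
  "base_change_choice C A B f M = (SOME (N, q). is_base_change C A B f M N q)"

definition base_change ::
  "('o, 'a, 'm) smcat_scheme \<Rightarrow> ('o, 'a) cmon \<Rightarrow> ('o, 'a) cmon \<Rightarrow> 'a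
    \<Rightarrow> (('o, 'a) amod, 'a, ('o, 'a) amod, 'a) ftor" where
  "base_change C A B f =
    \<lparr>FOb = (\<lambda>M. fst (base_change_choice C A B f M)),
     FAr = (\<lambda>M M' h.
       THE k. k \<in> Hom (Modules C B) (fst (base_change_choice C A B f M))
                                    (fst (base_change_choice C A B f M')) \<and>
         k \<cdot>\<^bsub>C\<^esub> snd (base_change_choice C A B f M)
           = snd (base_change_choice C A B f M') \<cdot>\<^bsub>C\<^esub> (h \<star>\<^bsub>C\<^esub> Id C (Car B)))\<rparr>"

section \<open>The standing assumptions\<close>

locale algebraic_context =
  abelian_category C + symmetric_monoidal_category C
  for C :: "('o, 'a, 'm) smcat_scheme" (structure) +
  fixes U :: "'i itself"
  assumes universe_uncountable: "uncountable  (UNIV :: 'i set)"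
    and small_limits: "has_small_limits U C"
    and small_colimits: "has_small_colimits U C"
    and tensor_preserves_colimits:
      "X \<in> Ob C \<Longrightarrow> preserves_small_colimits U C C (tensor_right C X)"
    and filtered_colimits_finite_limits:
      "A \<in> Ob (Comm C) \<Longrightarrow> filtered_colimits_commute_with_finite_limits U (Modules C A)"
    and C1_filtered: "hom_preserves_filtered_colimits U C (Unit C)"
    and C1_finite:
      "\<lbrakk>A \<in> Ob (Comm C); finite_cat J; is_functor J (Modules C A) F;
        \<And>j. j \<in> Ob J \<Longrightarrow> \<exists>r. is_power (Modules C A) (self_module A) r (FOb F j);
        is_colimit J (Modules C A) F L \<iota>\<rbrakk>
        \<Longrightarrow> hom_group_preserves_finite_colimit J (Modules C A) (self_module A) F L \<iota>"
    and C2: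
      "\<lbrakk>A \<in> Ob (Comm C); M \<in> Ob (Modules C A)\<rbrakk>
        \<Longrightarrow> \<exists>(J :: ('i, 'i) cat) F \<iota>. small_cat J \<and> directed_cat J \<and>
              is_functor J (Modules C A) F \<and>
              (\<forall>j \<in> Ob J. finitely_presented_ob U (Modules C A) (FOb F j)) \<and>
              is_colimit J (Modules C A) F M \<iota>"

section \<open>Localisation and Zariski open immersions\<close>

definition mult_chain ::
  "('o, 'a, 'm) smcat_scheme \<Rightarrow> ('o, 'a) cmon \<Rightarrow> 'a \<Rightarrow> (nat, unit, ('o, 'a) amod, 'a) ftor" where
  "mult_chain C A t =
    \<lparr>FOb = (\<lambda>_. self_module A), FAr = (\<lambda>m n _. t [^]\<^bsub>endo_ring C A\<^esub> (n - m))\<rparr>"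

text \<open>
  The monoid \<open>A\<^sub>t\<close> with \<open>I\<^sub>t : A \<rightarrow> A\<^sub>t\<close> is a localisation of \<open>A\<close> at \<open>t\<close> if, as an \<open>A\<close>-module, it is
  the colimit of \<open>A \<rightarrow> A \<rightarrow> A \<rightarrow> \<dots>\<close> (all maps being \<open>t\<close>) and \<open>I\<^sub>t\<close> is the structure map of the
  first copy of \<open>A\<close>.  This determines the multiplication of \<open>A\<^sub>t\<close>: it is \<open>A\<close>-bilinear, so its
  restriction to the \<open>m\<close>-th and \<open>n\<close>-th copies of \<open>A\<close> is the multiplication of \<open>A\<close> followed by
  the structure map of the \<open>(m + n)\<close>-th copy.
\<close>

definition is_localisation ::
  "('o, 'a, 'm) smcat_scheme \<Rightarrow> ('o, 'a) cmon \<Rightarrow> 'a \<Rightarrow> ('o, 'a) cmon \<Rightarrow> 'a \<Rightarrow> bool" where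
  "is_localisation C A t A\<^sub>t I\<^sub>t \<longleftrightarrow>
    A\<^sub>t \<in> Ob (Comm C) \<and> I\<^sub>t \<in> Hom (Comm C) A A\<^sub>t \<and>
    (\<exists>\<iota>. is_colimit nat_chain (Modules C A) (mult_chain C A t) (monoid_as_module C A\<^sub>t I\<^sub>t) \<iota> \<and>
      \<iota> 0 = I\<^sub>t)"

definition Aff :: "('o, 'a, 'm) smcat_scheme \<Rightarrow> (('o, 'a) cmon, 'a) cat" where
  "Aff C = op_cat (Comm C)"

text \<open>The object of \<open>Aff\<close> corresponding to a monoid.\<close>

definition Spec :: "('o, 'a) cmon \<Rightarrow> ('o, 'a) cmon" where
  "Spec A = A"

definition flat_mor ::
  "('o, 'a, 'm) smcat_scheme \<Rightarrow> ('o, 'a) cmon \<Rightarrow> ('o, 'a) cmon \<Rightarrow> 'a \<Rightarrow> bool" where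
  "flat_mor C A B f \<longleftrightarrow> preserves_finite_limits (Modules C A) (Modules C B) (base_change C A B f)"

definition finitely_presented_mor ::
  "'i itself \<Rightarrow> ('o, 'a, 'm) smcat_scheme \<Rightarrow> ('o, 'a) cmon \<Rightarrow> ('o, 'a) cmon \<Rightarrow> 'a \<Rightarrow> bool" where
  "finitely_presented_mor U C A B f \<longleftrightarrow>
    hom_preserves_filtered_colimits U (under_cat (Comm C) A) (B, f)"

definition zariski_open_immersion ::
  "'i itself \<Rightarrow> ('o, 'a, 'm) smcat_scheme \<Rightarrow> ('o, 'a) cmon \<Rightarrow> ('o, 'a) cmon \<Rightarrow> 'a \<Rightarrow> bool" where
  "zariski_open_immersion U C Y X f \<longleftrightarrow>
    (\<exists>A B. X = Spec A \<and> Y = Spec B \<and> f \<in> Hom (Aff C) (Spec B) (Spec A) \<and>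
      flat_mor C A B f \<and> epi_arr (Comm C) A B f \<and> finitely_presented_mor U C A B f)"

end

theory Submission
  imports Defs
begin

text \<open>
  Let \<open>B = A\<^sub>t\<close> be the colimit of \<open>A \<rightarrow> A \<rightarrow> \<dots>\<close> with structure maps \<open>\<iota> n\<close>.  The element \<open>r = \<iota> 1 (1)\<close> of
  \<open>B\<close> is inverse to the image of \<open>t\<close>, and \<open>\<iota> n\<close> is \<open>\<iota> 0\<close> followed by multiplication by \<open>r\<^sup>n\<close>; hence
  \<open>\<iota> m (a) \<iota> n (b) = \<iota> (m + n) (a b)\<close>.  Since inverses are unique, a morphism out of \<open>B\<close> is determined by
  its restriction to \<open>A\<close>, and it exists as soon as the image of \<open>t\<close> is invertible.

  Because \<open>\<otimes>\<close> preserves colimits, \<open>M \<otimes>\<^sub>A B\<close> is the colimit of \<open>M \<rightarrow> M \<rightarrow> \<dots>\<close> along the action of \<open>t\<close>.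
  This is a filtered colimit of \<open>A\<close>-modules, so it commutes with finite limits; the forgetful functor
  from \<open>B\<close>-modules reflects them, as the limits of \<open>A\<close>-modules are those of \<open>C\<close>.

  A filtered colimit of monoids is computed in \<open>C\<close>.  If \<open>t\<close> becomes invertible in such a colimit, then
  by (C1) an inverse \<open>1 \<rightarrow> colim\<close> and the equation expressing that it is one already exist at some stage,
  so \<open>B\<close> maps to that stage.
\<close>

section \<open>Index categories\<close>

text \<open>The hypotheses live in different categories. The localisation is a colimit of A-modules,
  tensoring preserves colimits of C, filtered colimits commute with finite limits among modules,
  (C1) speaks of arrows out of the unit object of C, and finite presentation concerns monoids under
  A. Two devices connect them. An A-linear endomorphism of A is multiplication by a global element,
  its value at the unit; invertibility of t thereby becomes an equation between arrows out of the
  unit object, which is what (C1) can bring down to a stage. And linearity or multiplicativity is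
  tested in C on jointly epic families, which stay jointly epic after tensoring. Since the
  localisation is an epimorphism, an arrow out of it under A is unique; injectivity in the
  definition of finite presentation then follows from filteredness alone, and only the existence of
  an arrow to some stage is at stake. Base change is fixed by an arbitrary choice of a coequaliser,
  so its description as a chain colimit is proved for one explicit model and transported to all
  others.\<close>

text \<open>
  Small categories have their objects and arrows in the type \<open>'i\<close>; the natural numbers and the finite
  index categories are moved there along injections.
\<close>

definition relabel_cat :: "('x \<Rightarrow> 'i) \<Rightarrow> ('u \<Rightarrow> 'i) \<Rightarrow> ('x, 'u) cat \<Rightarrow> ('i, 'i) cat" where
  "relabel_cat e a J =
    \<lparr>Ob = e ` Ob J, Hom = (\<lambda>i j. a ` Hom J (inv_into UNIV e i) (inv_into UNIV e j)),
     Comp = (\<lambda>g f. a (inv_into UNIV a g \<cdot>\<^bsub>J\<^esub> inv_into UNIV a f)), Id = (\<lambda>i. a (Id J (inv_into UNIV e i)))\<rparr>"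

definition relabel_ftor ::
  "('x \<Rightarrow> 'i) \<Rightarrow> ('u \<Rightarrow> 'i) \<Rightarrow> ('x, 'u, 'o, 'a) ftor \<Rightarrow> ('i, 'i, 'o, 'a) ftor" where
  "relabel_ftor e a F =
    \<lparr>FOb = (\<lambda>i. FOb F (inv_into UNIV e i)), FAr = (\<lambda>i j u. FAr F (inv_into UNIV e i) (inv_into UNIV e j) (inv_into UNIV a u))\<rparr>"

lemma ftor_comp_relabel: "ftor_comp G (relabel_ftor e a F) = relabel_ftor e a (ftor_comp G F)"
  by (simp add: ftor_comp_def relabel_ftor_def)

lemma ex_inj_nat:
  assumes "uncountable (UNIV :: 'i set)"
  obtains e where "inj (e :: nat \<Rightarrow> 'i)"
proof -
  have "infinite (UNIV :: 'i set)" using assms countable_finite by auto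
  from infinite_countable_subset[OF this] show ?thesis
    by (elim exE conjE) (rule that)
qed

text \<open>Smallness asks for a cardinality strictly below that of the universe; its uncountability
  is what makes infinite countable index categories, such as the chain of natural numbers,
  small.\<close>

lemma countable_lesspoll_uncountable:
  assumes "countable A" "uncountable B" shows "A \<prec> B"
proof -
  have "infinite B" using assms(2) countable_finite by auto
  from infinite_countable_subset[OF this]
  obtain e :: "nat \<Rightarrow> _" where e: "inj e" "range e \<subseteq> B" by (elim exE conjE)
  have "inj_on (e \<circ> to_nat_on A) A"
    using assms(1) e(1) by (intro comp_inj_on) (auto intro: inj_on_subset)
  moreover have "(e \<circ> to_nat_on A) ` A \<subseteq> B" using e(2) by auto
  ultimately have "A \<lesssim> B" unfolding lepoll_def by (intro exI[where x = "e \<circ> to_nat_on A"] conjI)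
  moreover have "\<not> B \<lesssim> A"
    using assms countable_lepoll by auto
  ultimately show ?thesis using eqpoll_imp_lepoll eqpoll_sym unfolding lesspoll_def by auto
qed

context
  fixes e :: "'x \<Rightarrow> 'i" and a :: "'u \<Rightarrow> 'i" and J :: "('x, 'u) cat"
  assumes inj_e: "inj e" and inj_a: "inj a"
begin

lemma inv_relabel [simp]: "inv_into UNIV e (e i) = i" "inv_into UNIV a (a u) = u"
  using inj_e inj_a by simp_all

lemma category_relabel: "category J \<Longrightarrow> category (relabel_cat e a J)"
proof -
  assume "category J"
  then interpret category J .
  show ?thesis
    by unfold_locales
      (auto simp: relabel_cat_def Id_in_Hom Comp_in_Hom Comp_Id_right Comp_Id_left Comp_assoc)
qed

lemma small_relabel:
  assumes "category J" "uncountable (UNIV :: 'i set)" "countable (Ob J)"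
    "\<And>i j. countable (Hom J i j)"
  shows "small_cat (relabel_cat e a J)"
proof -
  have "countable (\<Union>i \<in> e ` Ob J. \<Union>j \<in> e ` Ob J. a ` Hom J (inv_into UNIV e i) (inv_into UNIV e j))"
    by (intro countable_UN countable_image assms)
  moreover have "countable (e ` Ob J)"
    by (intro countable_image assms)
  ultimately show ?thesis
    unfolding small_cat_def
    by (intro conjI category_relabel assms(1))
      (simp_all only: relabel_cat_def cat.simps countable_lesspoll_uncountable[OF _ assms(2)])
qed

lemma filtered_relabel: "filtered_cat J \<Longrightarrow> filtered_cat (relabel_cat e a J)"
  by (simp add: filtered_cat_def relabel_cat_def inj_eq[OF inj_a])

lemma is_functor_relabel: "is_functor J C F \<Longrightarrow> is_functor (relabel_cat e a J) C (relabel_ftor e a F)"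
  by (auto simp: is_functor_def relabel_cat_def relabel_ftor_def)

lemma cocone_relabel:
  "cocone (relabel_cat e a J) C (relabel_ftor e a F) L \<kappa> \<longleftrightarrow> cocone J C F L (\<kappa> \<circ> e)"
  by (auto simp: cocone_def relabel_cat_def relabel_ftor_def)

lemma cone_relabel:
  "cone (relabel_cat e a J) C (relabel_ftor e a F) L \<kappa> \<longleftrightarrow> cone J C F L (\<kappa> \<circ> e)"
  by (auto simp: cone_def relabel_cat_def relabel_ftor_def)

text \<open>A left inverse of \<open>e\<close> writes every family indexed by the old objects as
  \<open>\<mu> \<circ> e\<close>, so a universal property is tested against the same cocones or
  cones before and after relabelling.\<close>

lemma all_relabel: "(\<forall>\<mu>. P (\<mu> \<circ> e)) \<longleftrightarrow> (\<forall>\<mu>. P \<mu>)"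
proof -
  have "\<mu> \<circ> inv_into UNIV e \<circ> e = \<mu>" for \<mu> :: "'x \<Rightarrow> 'y"
    by (simp add: fun_eq_iff)
  then show ?thesis by metis
qed

lemma is_colimit_relabel:
  "is_colimit (relabel_cat e a J) C (relabel_ftor e a F) L \<kappa> \<longleftrightarrow> is_colimit J C F L (\<kappa> \<circ> e)"
proof -
  note * = all_relabel[where P = "\<lambda>\<mu>. cocone J C F M \<mu> \<longrightarrow>
    (\<exists>!h. h \<in> Hom C L M \<and> (\<forall>i \<in> Ob J. h \<cdot>\<^bsub>C\<^esub> (\<kappa> \<circ> e) i = \<mu> i))" for M]
  show ?thesis
    unfolding is_colimit_def cocone_relabel *[symmetric]
    by (simp add: relabel_cat_def)
qed

lemma is_limit_relabel:
  "is_limit (relabel_cat e a J) C (relabel_ftor e a F) L \<kappa> \<longleftrightarrow> is_limit J C F L (\<kappa> \<circ> e)"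
proof -
  note * = all_relabel[where P = "\<lambda>\<mu>. cone J C F M \<mu> \<longrightarrow>
    (\<exists>!h. h \<in> Hom C M L \<and> (\<forall>i \<in> Ob J. (\<kappa> \<circ> e) i \<cdot>\<^bsub>C\<^esub> h = \<mu> i))" for M]
  show ?thesis
    unfolding is_limit_def cone_relabel *[symmetric]
    by (simp add: relabel_cat_def)
qed

end

subsection \<open>Chains given by iterating an endomorphism\<close>

text \<open>The new factor goes on the right, as in the power operation of \<open>endo_ring\<close>
  by which \<open>mult_chain\<close> is given, so that the two chains can be identified by a plain
  induction.\<close>

primrec epow :: "('o, 'a, 'm) cat_scheme \<Rightarrow> 'o \<Rightarrow> 'a \<Rightarrow> nat \<Rightarrow> 'a" where
  "epow D X s 0 = Id D X"
| "epow D X s (Suc n) = epow D X s n \<cdot>\<^bsub>D\<^esub> s"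

definition endo_chain :: "('o, 'a, 'm) cat_scheme \<Rightarrow> 'o \<Rightarrow> 'a \<Rightarrow> (nat, unit, 'o, 'a) ftor" where
  "endo_chain D X s = \<lparr>FOb = (\<lambda>_. X), FAr = (\<lambda>m n _. epow D X s (n - m))\<rparr>"

text \<open>Only the successor maps are tested; \<open>cocone_endo_chain\<close> recovers
  compatibility with all \<open>m \<le> n\<close>.\<close>

definition chain_cocone ::
  "('o, 'a, 'm) cat_scheme \<Rightarrow> 'o \<Rightarrow> 'a \<Rightarrow> 'o \<Rightarrow> (nat \<Rightarrow> 'a) \<Rightarrow> bool" where
  "chain_cocone D X s L \<kappa> \<longleftrightarrow>
    L \<in> Ob D \<and> (\<forall>n. \<kappa> n \<in> Hom D X L) \<and> (\<forall>n. \<kappa> (Suc n) \<cdot>\<^bsub>D\<^esub> s = \<kappa> n)"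

lemma category_nat_chain: "category nat_chain"
  by unfold_locales (auto simp: nat_chain_def split: if_splits)

lemma filtered_nat_chain: "filtered_cat nat_chain"
proof -
  have "\<exists>k. (if i \<le> k then {()} else {}) \<noteq> {} \<and> (if j \<le> k then {()} else {}) \<noteq> {}" for i j :: nat
    by (rule exI[of _ "max i j"]) auto
  then show ?thesis by (auto simp: filtered_cat_def nat_chain_def)
qed

context category
begin

lemma epow_in_Hom: "\<lbrakk>X \<in> Ob C; s \<in> Hom C X X\<rbrakk> \<Longrightarrow> epow C X s n \<in> Hom C X X"
  by (induction n) (auto intro: Id_in_Hom Comp_in_Hom)

lemma epow_add:
  assumes "X \<in> Ob C" "s \<in> Hom C X X"
  shows "epow C X s (m + n) = epow C X s m \<cdot> epow C X s n"
proof (induction n)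
  case 0
  show ?case using assms by (simp add: Comp_Id_right[OF _ _ epow_in_Hom])
next
  case (Suc n)
  then show ?case
    using assms by (simp add: Comp_assoc[OF _ _ _ _ assms(2) epow_in_Hom epow_in_Hom])
qed

lemma is_functor_endo_chain:
  assumes "X \<in> Ob C" "s \<in> Hom C X X"
  shows "is_functor nat_chain C (endo_chain C X s)"
proof -
  have *: "epow C X s (k - m) = epow C X s (k - n) \<cdot> epow C X s (n - m)" if "m \<le> n" "n \<le> k" for k m n
  proof -
    have "k - m = (k - n) + (n - m)" using that by simp
    then show ?thesis by (simp only: epow_add[OF assms])
  qed
  have "m \<le> n \<and> n \<le> k" if "u \<in> Hom nat_chain m n" "v \<in> Hom nat_chain n k" for u v m n k
    using that by (simp add: nat_chain_def split: if_splits)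
  then show ?thesis
    unfolding is_functor_def
    using assms(1) by (auto simp: endo_chain_def nat_chain_def epow_in_Hom[OF assms] intro!: *)
qed

lemma chain_cocone_epow:
  assumes "X \<in> Ob C" "s \<in> Hom C X X" "chain_cocone C X s L \<kappa>"
  shows "\<kappa> (m + n) \<cdot> epow C X s n = \<kappa> m"
proof (induction n)
  case 0
  show ?case using assms by (simp add: chain_cocone_def Comp_Id_right[of X L])
next
  case (Suc n)
  have k: "L \<in> Ob C" "\<kappa> i \<in> Hom C X L" "\<kappa> (Suc i) \<cdot> s = \<kappa> i" for i
    using assms(3) by (auto simp: chain_cocone_def)
  have "epow C X s (Suc n) = s \<cdot> epow C X s n"
    using epow_add[OF assms(1,2), of 1 n] assms(1,2) by (simp add: Comp_Id_left)
  then have "\<kappa> (m + Suc n) \<cdot> epow C X s (Suc n) = (\<kappa> (Suc (m + n)) \<cdot> s) \<cdot> epow C X s n"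
    using Comp_assoc[OF assms(1) assms(1) assms(1) k(1) epow_in_Hom[OF assms(1,2)] assms(2) k(2)]
    by simp
  then show ?case using Suc k by simp
qed

lemma cocone_endo_chain:
  assumes "X \<in> Ob C" "s \<in> Hom C X X"
  shows "cocone nat_chain C (endo_chain C X s) L \<kappa> \<longleftrightarrow> chain_cocone C X s L \<kappa>"
proof
  assume "cocone nat_chain C (endo_chain C X s) L \<kappa>"
  then have *: "L \<in> Ob C" "\<kappa> n \<in> Hom C X L" "m \<le> n \<Longrightarrow> \<kappa> n \<cdot> epow C X s (n - m) = \<kappa> m" for m n
    by (auto simp: cocone_def nat_chain_def endo_chain_def)
  show "chain_cocone C X s L \<kappa>"
    using *(1,2) *(3)[of n "Suc n" for n] assms
    by (auto simp: chain_cocone_def Comp_Id_left)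
next
  assume a: "chain_cocone C X s L \<kappa>"
  have "\<kappa> n \<cdot> epow C X s (n - m) = \<kappa> m" if "m \<le> n" for m n
    using chain_cocone_epow[OF assms a, of m "n - m"] that by simp
  then show "cocone nat_chain C (endo_chain C X s) L \<kappa>"
    using a by (auto simp: cocone_def nat_chain_def endo_chain_def chain_cocone_def split: if_splits)
qed

lemma is_colimit_endo_chain:
  assumes "X \<in> Ob C" "s \<in> Hom C X X"
  shows "is_colimit nat_chain C (endo_chain C X s) L \<kappa> \<longleftrightarrow>
    chain_cocone C X s L \<kappa> \<and>
    (\<forall>M \<mu>. chain_cocone C X s M \<mu> \<longrightarrow> (\<exists>!h. h \<in> Hom C L M \<and> (\<forall>n. h \<cdot> \<kappa> n = \<mu> n)))"
  unfolding is_colimit_def cocone_endo_chain[OF assms] by (simp add: nat_chain_def)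

end

subsection \<open>Colimits of sets of arrows\<close>

text \<open>Induction along the zigzag that joins the two elements. Filteredness enters when the
  last step goes forward; a backward step merely lengthens the arrow \<open>v\<close>.\<close>

lemma hom_colim_filtered:
  assumes "category J" "category C" "is_functor J C F" "filtered_cat J" "X \<in> Ob C"
    and "((i, g), (j, h)) \<in> (hom_step J C X F \<union> (hom_step J C X F)\<inverse>)\<^sup>*"
    and "i \<in> Ob J" "g \<in> Hom C X (FOb F i)"
  shows "j \<in> Ob J \<and> h \<in> Hom C X (FOb F j) \<and>
    (\<exists>k \<in> Ob J. \<exists>u \<in> Hom J i k. \<exists>v \<in> Hom J j k. FAr F i k u \<cdot>\<^bsub>C\<^esub> g = FAr F j k v \<cdot>\<^bsub>C\<^esub> h)"
proof -
  interpret J: category J by fact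
  interpret C: category C by fact
  note F = \<open>is_functor J C F\<close>[unfolded is_functor_def]
  show ?thesis using assms(6)
  proof (induction rule: rtrancl_induct2)
    case refl
    show ?case using assms(7,8) J.Id_in_Hom by blast
  next
    case (step j h j' h')
    then obtain k u v where k: "k \<in> Ob J" "u \<in> Hom J i k" "v \<in> Hom J j k"
      and eq: "FAr F i k u \<cdot>\<^bsub>C\<^esub> g = FAr F j k v \<cdot>\<^bsub>C\<^esub> h" and j: "j \<in> Ob J" "h \<in> Hom C X (FOb F j)"
      by blast
    from step(2) consider
      (fwd) w where "j' \<in> Ob J" "w \<in> Hom J j j'" "h' = FAr F j j' w \<cdot>\<^bsub>C\<^esub> h"
    | (bwd) w where "j' \<in> Ob J" "w \<in> Hom J j' j" "h = FAr F j' j w \<cdot>\<^bsub>C\<^esub> h'" "h' \<in> Hom C X (FOb F j')"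
      by (auto simp: hom_step_def)
    then show ?case
    proof cases
      \<comment> \<open>Both \<open>k\<close> and \<open>j'\<close> are reached from
        \<open>j\<close>. An upper bound \<open>l\<close> need not make the two paths from
        \<open>j\<close> agree, so a further arrow \<open>c\<close> to \<open>p\<close> coequalises
        them.\<close>
      case fwd
      obtain l a b where l: "l \<in> Ob J" "a \<in> Hom J k l" "b \<in> Hom J j' l"
        using assms(4) k(1) fwd(1) unfolding filtered_cat_def by blast
      obtain p c where p: "p \<in> Ob J" "c \<in> Hom J l p" "c \<cdot>\<^bsub>J\<^esub> (a \<cdot>\<^bsub>J\<^esub> v) = c \<cdot>\<^bsub>J\<^esub> (b \<cdot>\<^bsub>J\<^esub> w)"
        using assms(4) j(1) l(1) J.Comp_in_Hom[OF j(1) k(1) l(1) k(3) l(2)]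
          J.Comp_in_Hom[OF j(1) fwd(1) l(1) fwd(2) l(3)]
        unfolding filtered_cat_def by metis
      define ca cb where "ca = c \<cdot>\<^bsub>J\<^esub> a" and "cb = c \<cdot>\<^bsub>J\<^esub> b"
      have ca: "ca \<in> Hom J k p" "cb \<in> Hom J j' p" "ca \<cdot>\<^bsub>J\<^esub> v = cb \<cdot>\<^bsub>J\<^esub> w"
        unfolding ca_def cb_def
        using J.Comp_in_Hom[OF k(1) l(1) p(1) l(2) p(2)] J.Comp_in_Hom[OF fwd(1) l(1) p(1) l(3) p(2)]
          J.Comp_assoc[OF j(1) k(1) l(1) p(1) k(3) l(2) p(2)]
          J.Comp_assoc[OF j(1) fwd(1) l(1) p(1) fwd(2) l(3) p(2)] p(3) by simp_all
      have "FAr F i p (ca \<cdot>\<^bsub>J\<^esub> u) \<cdot>\<^bsub>C\<^esub> g = FAr F k p ca \<cdot>\<^bsub>C\<^esub> (FAr F i k u \<cdot>\<^bsub>C\<^esub> g)"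
        using F C.Comp_assoc[of X "FOb F i" "FOb F k" "FOb F p" g "FAr F i k u" "FAr F k p ca"]
          assms(5,7,8) k p ca by simp
      also have "\<dots> = FAr F j p (ca \<cdot>\<^bsub>J\<^esub> v) \<cdot>\<^bsub>C\<^esub> h"
        using F C.Comp_assoc[of X "FOb F j" "FOb F k" "FOb F p" h "FAr F j k v" "FAr F k p ca"]
          assms(5) j k p ca(1) eq by simp
      also have "\<dots> = FAr F j' p cb \<cdot>\<^bsub>C\<^esub> h'"
        using F C.Comp_assoc[of X "FOb F j" "FOb F j'" "FOb F p" h "FAr F j j' w" "FAr F j' p cb"]
          assms(5) j fwd p ca(2,3) by simp
      finally have "FAr F i p (ca \<cdot>\<^bsub>J\<^esub> u) \<cdot>\<^bsub>C\<^esub> g = FAr F j' p cb \<cdot>\<^bsub>C\<^esub> h'" .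
      moreover have "h' \<in> Hom C X (FOb F j')"
        using F C.Comp_in_Hom[of X "FOb F j" "FOb F j'" h "FAr F j j' w"] assms(5) j fwd by simp
      moreover have "ca \<cdot>\<^bsub>J\<^esub> u \<in> Hom J i p"
        using J.Comp_in_Hom[OF assms(7) k(1) p(1) k(2) ca(1)] .
      ultimately show ?thesis using fwd(1) p(1) ca(2) by blast
    next
      case bwd
      have "FAr F i k u \<cdot>\<^bsub>C\<^esub> g = FAr F j' k (v \<cdot>\<^bsub>J\<^esub> w) \<cdot>\<^bsub>C\<^esub> h'"
        using F C.Comp_assoc[of X "FOb F j'" "FOb F j" "FOb F k" h' "FAr F j' j w" "FAr F j k v"]
          assms(5) j k bwd eq by simp
      moreover have "v \<cdot>\<^bsub>J\<^esub> w \<in> Hom J j' k"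
        using J.Comp_in_Hom[OF bwd(1) j(1) k(1) bwd(2) k(3)] .
      ultimately show ?thesis using bwd k by blast
    qed
  qed
qed

section \<open>Arrows with source and target\<close>

text \<open>
  Hom-sets need not be disjoint.  With source and target recorded in the arrow, all typing conditions
  can be discharged by rewriting.
\<close>

datatype ('o, 'a) tarrow = Arr (src: 'o) (raw: 'a) (tgt: 'o)

context symmetric_monoidal_category
begin

definition arr :: "('o, 'a) tarrow \<Rightarrow> bool" where
  "arr f \<longleftrightarrow> src f \<in> Ob C \<and> tgt f \<in> Ob C \<and> raw f \<in> Hom C (src f) (tgt f)"

definition tcomp :: "('o, 'a) tarrow \<Rightarrow> ('o, 'a) tarrow \<Rightarrow> ('o, 'a) tarrow"  (infixr "\<bullet>" 70) where
  "g \<bullet> f = Arr (src f) (raw g \<cdot> raw f) (tgt g)"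

definition ten :: "('o, 'a) tarrow \<Rightarrow> ('o, 'a) tarrow \<Rightarrow> ('o, 'a) tarrow"  (infixr "\<boxtimes>" 75) where
  "f \<boxtimes> g = Arr (src f \<odot> src g) (raw f \<star> raw g) (tgt f \<odot> tgt g)"

definition idn :: "'o \<Rightarrow> ('o, 'a) tarrow" where
  "idn X = Arr X (Id C X) X"

definition asc :: "'o \<Rightarrow> 'o \<Rightarrow> 'o \<Rightarrow> ('o, 'a) tarrow" where
  "asc X Y Z = Arr ((X \<odot> Y) \<odot> Z) (Assoc C X Y Z) (X \<odot> (Y \<odot> Z))"

definition lun :: "'o \<Rightarrow> ('o, 'a) tarrow" where
  "lun X = Arr (Unit C \<odot> X) (LUnit C X) X"

definition run :: "'o \<Rightarrow> ('o, 'a) tarrow" where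
  "run X = Arr (X \<odot> Unit C) (RUnit C X) X"

definition brd :: "'o \<Rightarrow> 'o \<Rightarrow> ('o, 'a) tarrow" where
  "brd X Y = Arr (X \<odot> Y) (Braid C X Y) (Y \<odot> X)"

text \<open>A chosen inverse, meaningful only for invertible arrows. It names the inverses of the
  constraint isomorphisms, which the locale asserts to exist without naming them.\<close>

definition iarr :: "('o, 'a) tarrow \<Rightarrow> ('o, 'a) tarrow" where
  "iarr f = Arr (tgt f) (SOME g. g \<in> Hom C (tgt f) (src f) \<and>
     g \<cdot> raw f = Id C (src f) \<and> raw f \<cdot> g = Id C (tgt f)) (src f)"

definition thom :: "'o \<Rightarrow> 'o \<Rightarrow> ('o, 'a) tarrow set" where
  "thom X Y = {f. arr f \<and> src f = X \<and> tgt f = Y}"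

lemma mem_thom [simp]: "f \<in> thom X Y \<longleftrightarrow> arr f \<and> src f = X \<and> tgt f = Y"
  by (simp add: thom_def)

lemma src_tgt [simp]:
  "src (g \<bullet> f) = src f" "tgt (g \<bullet> f) = tgt g"
  "src (f \<boxtimes> g) = src f \<odot> src g" "tgt (f \<boxtimes> g) = tgt f \<odot> tgt g"
  "src (idn X) = X" "tgt (idn X) = X"
  "src (asc X Y Z) = (X \<odot> Y) \<odot> Z" "tgt (asc X Y Z) = X \<odot> (Y \<odot> Z)"
  "src (lun X) = Unit C \<odot> X" "tgt (lun X) = X"
  "src (run X) = X \<odot> Unit C" "tgt (run X) = X"
  "src (brd X Y) = X \<odot> Y" "tgt (brd X Y) = Y \<odot> X"
  "src (iarr f) = tgt f" "tgt (iarr f) = src f"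
  by (simp_all add: tcomp_def ten_def idn_def asc_def lun_def run_def brd_def iarr_def)

lemma raw_simps:
  "raw (g \<bullet> f) = raw g \<cdot> raw f" "raw (f \<boxtimes> g) = raw f \<star> raw g" "raw (idn X) = Id C X"
  "raw (asc X Y Z) = Assoc C X Y Z" "raw (lun X) = LUnit C X" "raw (run X) = RUnit C X"
  "raw (brd X Y) = Braid C X Y"
  by (simp_all add: tcomp_def ten_def idn_def asc_def lun_def run_def brd_def)

lemma arr_Arr: "arr (Arr X f Y) \<longleftrightarrow> X \<in> Ob C \<and> Y \<in> Ob C \<and> f \<in> Hom C X Y"
  by (simp add: arr_def)

lemma thom_iff: "f \<in> thom X Y \<longleftrightarrow> (\<exists>r. f = Arr X r Y \<and> X \<in> Ob C \<and> Y \<in> Ob C \<and> r \<in> Hom C X Y)"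
  by (cases f) (auto simp: arr_def)

lemma tarrow_eq: "f = g \<longleftrightarrow> src f = src g \<and> tgt f = tgt g \<and> raw f = raw g"
  by (cases f; cases g) auto

declare TenO_in_Ob [simp] Unit_in_Ob [simp]

lemma arr_Ob: "arr f \<Longrightarrow> src f \<in> Ob C" "arr f \<Longrightarrow> tgt f \<in> Ob C"
  by (simp_all add: arr_def)

lemma arr_comp [simp]: "\<lbrakk>arr f; arr g; tgt f = src g\<rbrakk> \<Longrightarrow> arr (g \<bullet> f)"
  using Comp_in_Hom[of "src f" "tgt f" "tgt g" "raw f" "raw g"] by (simp add: arr_def tcomp_def)

lemma arr_ten [simp]: "\<lbrakk>arr f; arr g\<rbrakk> \<Longrightarrow> arr (f \<boxtimes> g)"
  by (simp add: arr_def ten_def TenA_in_Hom)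

lemma arr_idn [simp]: "X \<in> Ob C \<Longrightarrow> arr (idn X)"
  by (simp add: arr_def idn_def Id_in_Hom)

lemma arr_coherence [simp]:
  "\<lbrakk>X \<in> Ob C; Y \<in> Ob C; Z \<in> Ob C\<rbrakk> \<Longrightarrow> arr (asc X Y Z)"
  "X \<in> Ob C \<Longrightarrow> arr (lun X)" "X \<in> Ob C \<Longrightarrow> arr (run X)"
  "\<lbrakk>X \<in> Ob C; Y \<in> Ob C\<rbrakk> \<Longrightarrow> arr (brd X Y)"
  using Assoc_iso LUnit_iso RUnit_iso Braid_in_Hom
  by (simp_all add: arr_def asc_def lun_def run_def brd_def iso_arr_def)

declare arr_Ob [simp]

lemma comp_assoc [simp]:
  "\<lbrakk>arr f; arr g; arr h; tgt f = src g; tgt g = src h\<rbrakk> \<Longrightarrow> (h \<bullet> g) \<bullet> f = h \<bullet> (g \<bullet> f)"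
  using Comp_assoc[of "src f" "tgt f" "tgt g" "tgt h" "raw f" "raw g" "raw h"]
  unfolding arr_def tcomp_def by simp

lemma comp_idn [simp]:
  "\<lbrakk>arr f; src f = X\<rbrakk> \<Longrightarrow> f \<bullet> idn X = f" "\<lbrakk>arr f; tgt f = X\<rbrakk> \<Longrightarrow> idn X \<bullet> f = f"
  using Comp_Id_right[of "src f" "tgt f" "raw f"] Comp_Id_left[of "src f" "tgt f" "raw f"]
  unfolding arr_def tcomp_def idn_def tarrow_eq by auto

lemma ten_idn [simp]: "\<lbrakk>X \<in> Ob C; Y \<in> Ob C\<rbrakk> \<Longrightarrow> idn X \<boxtimes> idn Y = idn (X \<odot> Y)"
  by (simp add: ten_def idn_def TenA_Id)

lemma ten_comp:
  "\<lbrakk>arr f; arr g; arr f'; arr g'; tgt f = src g; tgt f' = src g'\<rbrakk>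
    \<Longrightarrow> (g \<boxtimes> g') \<bullet> (f \<boxtimes> f') = (g \<bullet> f) \<boxtimes> (g' \<bullet> f')"
  unfolding arr_def tcomp_def ten_def
  using TenA_Comp[of "src f" "tgt f" "tgt g" "src f'" "tgt f'" "tgt g'" "raw f" "raw g" "raw f'" "raw g'"]
  by simp

text \<open>The interchange law in the shape that it takes inside a right-nested composite.\<close>

lemma ten_comp2:
  "\<lbrakk>arr f; arr g; arr f'; arr g'; arr h; tgt f = src g; tgt f' = src g'; tgt h = src f \<odot> src f'\<rbrakk>
    \<Longrightarrow> (g \<boxtimes> g') \<bullet> ((f \<boxtimes> f') \<bullet> h) = ((g \<bullet> f) \<boxtimes> (g' \<bullet> f')) \<bullet> h"
  using comp_assoc[of h "f \<boxtimes> f'" "g \<boxtimes> g'"] by (simp add: ten_comp del: comp_assoc)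

text \<open>Composites are simplified into right-nested form, in which an equation for
  \<open>g \<bullet> f\<close> no longer matches once another arrow \<open>h\<close> precedes it. In
  this form it can still be applied.\<close>

lemma reassoc:
  "\<lbrakk>g \<bullet> f = k; arr f; arr g; tgt f = src g; arr h; tgt h = src f\<rbrakk> \<Longrightarrow> g \<bullet> (f \<bullet> h) = k \<bullet> h"
  using comp_assoc[of h f g] by (simp del: comp_assoc)

lemma asc_nat:
  "\<lbrakk>arr f; arr g; arr h; tgt f = X; tgt g = Y; tgt h = Z\<rbrakk>
    \<Longrightarrow> asc X Y Z \<bullet> ((f \<boxtimes> g) \<boxtimes> h) = (f \<boxtimes> (g \<boxtimes> h)) \<bullet> asc (src f) (src g) (src h)"
  unfolding arr_def tcomp_def ten_def asc_def
  using Assoc_natural[of "src f" "src g" "src h" "tgt f" "tgt g" "tgt h" "raw f" "raw g" "raw h"]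
  by simp

lemma run_nat: "\<lbrakk>arr f; tgt f = Y\<rbrakk> \<Longrightarrow> run Y \<bullet> (f \<boxtimes> idn (Unit C)) = f \<bullet> run (src f)"
  unfolding arr_def tcomp_def ten_def run_def idn_def
  using RUnit_natural[of "src f" "tgt f" "raw f"] by auto

lemma lun_nat: "\<lbrakk>arr f; tgt f = Y\<rbrakk> \<Longrightarrow> lun Y \<bullet> (idn (Unit C) \<boxtimes> f) = f \<bullet> lun (src f)"
  unfolding arr_def tcomp_def ten_def lun_def idn_def
  using LUnit_natural[of "src f" "tgt f" "raw f"] by auto

lemma brd_nat:
  "\<lbrakk>arr f; arr g; tgt f = X; tgt g = Y\<rbrakk>
    \<Longrightarrow> brd X Y \<bullet> (f \<boxtimes> g) = (g \<boxtimes> f) \<bullet> brd (src f) (src g)"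
  unfolding arr_def tcomp_def ten_def brd_def
  using Braid_natural[of "src f" "src g" "tgt f" "tgt g" "raw f" "raw g"] by auto

lemma brd_brd [simp]: "\<lbrakk>X \<in> Ob C; Y \<in> Ob C\<rbrakk> \<Longrightarrow> brd Y X \<bullet> brd X Y = idn (X \<odot> Y)"
  by (simp add: tcomp_def brd_def idn_def symmetry)

definition inv_pair :: "('o, 'a) tarrow \<Rightarrow> ('o, 'a) tarrow \<Rightarrow> bool" where
  "inv_pair f g \<longleftrightarrow> arr f \<and> arr g \<and> src g = tgt f \<and> tgt g = src f \<and>
    g \<bullet> f = idn (src f) \<and> f \<bullet> g = idn (tgt f)"

lemma inv_pair_iarr:
  assumes "iso_arr C (src f) (tgt f) (raw f)" "src f \<in> Ob C" "tgt f \<in> Ob C"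
  shows "inv_pair f (iarr f)"
proof -
  have "\<exists>g. g \<in> Hom C (tgt f) (src f) \<and> g \<cdot> raw f = Id C (src f) \<and> raw f \<cdot> g = Id C (tgt f)"
    using assms(1) by (auto simp: iso_arr_def)
  from someI_ex[OF this] show ?thesis
    using assms Id_in_Hom unfolding inv_pair_def iarr_def arr_def tcomp_def idn_def iso_arr_def by simp
qed

lemma inv_pair_coherence:
  "\<lbrakk>X \<in> Ob C; Y \<in> Ob C; Z \<in> Ob C\<rbrakk> \<Longrightarrow> inv_pair (asc X Y Z) (iarr (asc X Y Z))"
  "X \<in> Ob C \<Longrightarrow> inv_pair (lun X) (iarr (lun X))"
  "X \<in> Ob C \<Longrightarrow> inv_pair (run X) (iarr (run X))"
  by (simp_all add: inv_pair_iarr raw_simps Assoc_iso LUnit_iso RUnit_iso)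

lemma iarr_coherence [simp]:
  "\<lbrakk>X \<in> Ob C; Y \<in> Ob C; Z \<in> Ob C\<rbrakk> \<Longrightarrow> arr (iarr (asc X Y Z))"
  "X \<in> Ob C \<Longrightarrow> arr (iarr (lun X))"
  "X \<in> Ob C \<Longrightarrow> arr (iarr (run X))"
  "\<lbrakk>X \<in> Ob C; Y \<in> Ob C; Z \<in> Ob C\<rbrakk> \<Longrightarrow> asc X Y Z \<bullet> iarr (asc X Y Z) = idn (X \<odot> (Y \<odot> Z))"
  "X \<in> Ob C \<Longrightarrow> lun X \<bullet> iarr (lun X) = idn X"
  "X \<in> Ob C \<Longrightarrow> run X \<bullet> iarr (run X) = idn X"
  "\<lbrakk>X \<in> Ob C; Y \<in> Ob C; Z \<in> Ob C\<rbrakk> \<Longrightarrow> iarr (asc X Y Z) \<bullet> asc X Y Z = idn ((X \<odot> Y) \<odot> Z)"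
  "X \<in> Ob C \<Longrightarrow> iarr (lun X) \<bullet> lun X = idn (Unit C \<odot> X)"
  "X \<in> Ob C \<Longrightarrow> iarr (run X) \<bullet> run X = idn (X \<odot> Unit C)"
  using inv_pair_coherence(1)[of X Y Z] inv_pair_coherence(2,3)[of X]
  by (simp_all add: inv_pair_def)

lemma inv_pair_cancel:
  assumes "inv_pair f g" "arr x" "arr y"
  shows "tgt x = src f \<Longrightarrow> tgt y = src f \<Longrightarrow> f \<bullet> x = f \<bullet> y \<longleftrightarrow> x = y"
    and "src x = tgt f \<Longrightarrow> src y = tgt f \<Longrightarrow> x \<bullet> f = y \<bullet> f \<longleftrightarrow> x = y"
proof -
  have f: "arr f" "arr g" "src g = tgt f" "tgt g = src f" "g \<bullet> f = idn (src f)" "f \<bullet> g = idn (tgt f)"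
    using assms(1) by (auto simp: inv_pair_def)
  show "f \<bullet> x = f \<bullet> y \<longleftrightarrow> x = y" if "tgt x = src f" "tgt y = src f"
  proof
    assume "f \<bullet> x = f \<bullet> y"
    then have "g \<bullet> (f \<bullet> x) = g \<bullet> (f \<bullet> y)" by simp
    then show "x = y" using f assms that by (simp add: reassoc[OF f(5)])
  qed simp
  show "x \<bullet> f = y \<bullet> f \<longleftrightarrow> x = y" if "src x = tgt f" "src y = tgt f"
  proof
    assume "x \<bullet> f = y \<bullet> f"
    then have "(x \<bullet> f) \<bullet> g = (y \<bullet> f) \<bullet> g" by simp
    then show "x = y" using f assms that by simp
  qed simp
qed

lemma iarr_run_nat: "\<lbrakk>arr f; src f = X\<rbrakk> \<Longrightarrow> (f \<boxtimes> idn (Unit C)) \<bullet> iarr (run X) = iarr (run (tgt f)) \<bullet> f"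
proof -
  assume f: "arr f" "src f = X"
  then have "X \<in> Ob C" by auto
  then have "run (tgt f) \<bullet> ((f \<boxtimes> idn (Unit C)) \<bullet> iarr (run X)) = run (tgt f) \<bullet> (iarr (run (tgt f)) \<bullet> f)"
    using f by (simp add: reassoc[OF run_nat] reassoc[OF iarr_coherence(6)])
  then show ?thesis
    using f \<open>X \<in> Ob C\<close> inv_pair_cancel(1)[OF inv_pair_coherence(3)] by simp
qed

section \<open>Coherence of the right unit constraint\<close>

lemma pentagon_arr:
  "\<lbrakk>W \<in> Ob C; X \<in> Ob C; Y \<in> Ob C; Z \<in> Ob C\<rbrakk>
    \<Longrightarrow> (idn W \<boxtimes> asc X Y Z) \<bullet> (asc W (X \<odot> Y) Z \<bullet> (asc W X Y \<boxtimes> idn Z))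
      = asc W X (Y \<odot> Z) \<bullet> asc (W \<odot> X) Y Z"
  using pentagon by (simp add: tarrow_eq raw_simps)

lemma triangle_arr:
  "\<lbrakk>X \<in> Ob C; Y \<in> Ob C\<rbrakk> \<Longrightarrow> (idn X \<boxtimes> lun Y) \<bullet> asc X (Unit C) Y = run X \<boxtimes> idn Y"
  using triangle by (simp add: tarrow_eq raw_simps)

text \<open>By naturality of the unit constraint, \<open>f\<close> and
  \<open>f \<boxtimes> idn (Unit C)\<close> determine each other up to composition with
  isomorphisms.\<close>

lemma ten_unit_faithful:
  assumes "arr f" "arr g" "src f = src g" "tgt f = tgt g"
    and "f \<boxtimes> idn (Unit C) = g \<boxtimes> idn (Unit C)"
  shows "f = g"
proof -
  have "f \<bullet> run (src f) = g \<bullet> run (src f)"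
    using assms run_nat[of f "tgt f"] run_nat[of g "tgt f"] by simp
  then show ?thesis
    using assms inv_pair_cancel(2)[OF inv_pair_coherence(3)] by simp
qed

text \<open>Kelly's argument: it suffices to compare both sides after tensoring with the unit object.\<close>

lemma run_ten:
  assumes [simp]: "X \<in> Ob C" "Y \<in> Ob C"
  shows "(idn X \<boxtimes> run Y) \<bullet> asc X Y (Unit C) = run (X \<odot> Y)"
proof (rule ten_unit_faithful)
  let ?I = "Unit C"
  have "asc X Y ?I \<bullet> (run (X \<odot> Y) \<boxtimes> idn ?I)
      = asc X Y ?I \<bullet> (((idn X \<boxtimes> idn Y) \<boxtimes> lun ?I) \<bullet> asc (X \<odot> Y) ?I ?I)"
    by (simp add: triangle_arr)
  also have "\<dots> = (idn X \<boxtimes> (idn Y \<boxtimes> lun ?I)) \<bullet> (asc X Y (?I \<odot> ?I) \<bullet> asc (X \<odot> Y) ?I ?I)"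
    using reassoc[OF asc_nat[of "idn X" "idn Y" "lun ?I" X Y ?I], of "asc (X \<odot> Y) ?I ?I"] by simp
  \<comment> \<open>The pentagon for \<open>X\<close>, \<open>Y\<close> and two unit objects, then
    the triangle identity for \<open>Y\<close> inside the second factor.\<close>
  also have "\<dots> = (idn X \<boxtimes> (run Y \<boxtimes> idn ?I)) \<bullet> (asc X (Y \<odot> ?I) ?I \<bullet> (asc X Y ?I \<boxtimes> idn ?I))"
    by (simp add: pentagon_arr[symmetric] ten_comp2 triangle_arr)
  also have "\<dots> = asc X Y ?I \<bullet> (((idn X \<boxtimes> run Y) \<bullet> asc X Y ?I) \<boxtimes> idn ?I)"
    using reassoc[OF asc_nat[of "idn X" "run Y" "idn ?I" X Y ?I], of "asc X Y ?I \<boxtimes> idn ?I"]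
    by (simp add: ten_comp)
  finally show "((idn X \<boxtimes> run Y) \<bullet> asc X Y ?I) \<boxtimes> idn ?I = run (X \<odot> Y) \<boxtimes> idn ?I"
    using inv_pair_cancel(1)[OF inv_pair_coherence(1)[of X Y ?I]] by simp
qed simp_all

text \<open>The inverse form of \<open>run_ten\<close>: a unit inserted behind a product may be
  inserted behind its second factor instead.\<close>

lemma asc_iarr_run:
  assumes [simp]: "X \<in> Ob C" "Y \<in> Ob C"
  shows "asc X Y (Unit C) \<bullet> iarr (run (X \<odot> Y)) = idn X \<boxtimes> iarr (run Y)"
proof -
  have "inv_pair (idn X \<boxtimes> run Y) (idn X \<boxtimes> iarr (run Y))"
    by (simp add: inv_pair_def ten_comp)
  moreover have "(idn X \<boxtimes> run Y) \<bullet> (asc X Y (Unit C) \<bullet> iarr (run (X \<odot> Y))) = (idn X \<boxtimes> run Y) \<bullet> (idn X \<boxtimes> iarr (run Y))"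
    by (simp add: reassoc[OF run_ten] ten_comp)
  ultimately show ?thesis
    using inv_pair_cancel(1) by fastforce
qed

section \<open>Colimits of quivers of arrows\<close>

text \<open>
  The relation \<open>R\<close> need not be closed under composition, so a chain is given by its successor maps.
\<close>

definition qcol ::
  "'x set \<Rightarrow> ('x \<Rightarrow> 'o) \<Rightarrow> ('x \<times> 'x \<times> ('o, 'a) tarrow) set \<Rightarrow> 'o \<Rightarrow> ('x \<Rightarrow> ('o, 'a) tarrow) \<Rightarrow> bool"
where
  "qcol I D R L \<kappa> \<longleftrightarrow> L \<in> Ob C \<and> (\<forall>i \<in> I. D i \<in> Ob C \<and> \<kappa> i \<in> thom (D i) L) \<and>
    (\<forall>(i, j, x) \<in> R. i \<in> I \<and> j \<in> I \<and> x \<in> thom (D i) (D j) \<and> \<kappa> j \<bullet> x = \<kappa> i) \<and>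
    (\<forall>Z \<mu>. Z \<in> Ob C \<longrightarrow> (\<forall>i \<in> I. \<mu> i \<in> thom (D i) Z) \<longrightarrow>
      (\<forall>(i, j, x) \<in> R. \<mu> j \<bullet> x = \<mu> i) \<longrightarrow> (\<exists>!h. h \<in> thom L Z \<and> (\<forall>i \<in> I. h \<bullet> \<kappa> i = \<mu> i)))"

lemma qcolD:
  assumes "qcol I D R L \<kappa>"
  shows "L \<in> Ob C"
    and "i \<in> I \<Longrightarrow> D i \<in> Ob C" "i \<in> I \<Longrightarrow> \<kappa> i \<in> thom (D i) L"
    and "(i, j, x) \<in> R \<Longrightarrow> i \<in> I" "(i, j, x) \<in> R \<Longrightarrow> j \<in> I"
    and "(i, j, x) \<in> R \<Longrightarrow> x \<in> thom (D i) (D j)" "(i, j, x) \<in> R \<Longrightarrow> \<kappa> j \<bullet> x = \<kappa> i"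
  using assms unfolding qcol_def by blast+

lemma qcol_ex1:
  assumes "qcol I D R L \<kappa>" "Z \<in> Ob C" "\<And>i. i \<in> I \<Longrightarrow> \<mu> i \<in> thom (D i) Z"
    "\<And>i j x. (i, j, x) \<in> R \<Longrightarrow> \<mu> j \<bullet> x = \<mu> i"
  shows "\<exists>!h. h \<in> thom L Z \<and> (\<forall>i \<in> I. h \<bullet> \<kappa> i = \<mu> i)"
proof -
  have "\<forall>Z \<mu>. Z \<in> Ob C \<longrightarrow> (\<forall>i \<in> I. \<mu> i \<in> thom (D i) Z) \<longrightarrow>
      (\<forall>(i, j, x) \<in> R. \<mu> j \<bullet> x = \<mu> i) \<longrightarrow> (\<exists>!h. h \<in> thom L Z \<and> (\<forall>i \<in> I. h \<bullet> \<kappa> i = \<mu> i))"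
    using assms(1) unfolding qcol_def by (elim conjE)
  moreover have "\<forall>i \<in> I. \<mu> i \<in> thom (D i) Z" "\<forall>(i, j, x) \<in> R. \<mu> j \<bullet> x = \<mu> i"
    using assms(3,4) by auto
  ultimately show ?thesis using assms(2) by (elim allE[of _ Z] allE[of _ \<mu>] impE)
qed

lemma qcol_factor:
  assumes "qcol I D R L \<kappa>" "Z \<in> Ob C" "\<And>i. i \<in> I \<Longrightarrow> \<mu> i \<in> thom (D i) Z"
    "\<And>i j x. (i, j, x) \<in> R \<Longrightarrow> \<mu> j \<bullet> x = \<mu> i"
  obtains h where "h \<in> thom L Z" "\<And>i. i \<in> I \<Longrightarrow> h \<bullet> \<kappa> i = \<mu> i"
proof -
  have "\<exists>!h. h \<in> thom L Z \<and> (\<forall>i \<in> I. h \<bullet> \<kappa> i = \<mu> i)"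
    by (rule qcol_ex1[OF assms(1,2)]) (use assms(3,4) in auto)
  then obtain h where "h \<in> thom L Z \<and> (\<forall>i \<in> I. h \<bullet> \<kappa> i = \<mu> i)" by (elim ex1E)
  then show ?thesis by (intro that[of h]) auto
qed

lemma qcol_unique:
  assumes c: "qcol I D R L \<kappa>" and "x \<in> thom L Z" "y \<in> thom L Z" "\<And>i. i \<in> I \<Longrightarrow> x \<bullet> \<kappa> i = y \<bullet> \<kappa> i"
  shows "x = y"
proof -
  note D = qcolD[OF c]
  have "(x \<bullet> \<kappa> j) \<bullet> r = x \<bullet> \<kappa> i" if "(i, j, r) \<in> R" for i j r
    using D(1) D(3)[of j] D(4-7)[OF that] assms(2) by simp
  moreover have "Z \<in> Ob C" using assms(2) by auto
  moreover have "x \<bullet> \<kappa> i \<in> thom (D i) Z" if "i \<in> I" for i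
    using D(3)[OF that] assms(2) by simp
  ultimately have "\<exists>!h. h \<in> thom L Z \<and> (\<forall>i \<in> I. h \<bullet> \<kappa> i = x \<bullet> \<kappa> i)"
    by (intro qcol_ex1[OF c])
  then obtain k where "\<forall>h. h \<in> thom L Z \<and> (\<forall>i \<in> I. h \<bullet> \<kappa> i = x \<bullet> \<kappa> i) \<longrightarrow> h = k"
    by (elim ex1E)
  then have "x = k" "y = k" using assms(2-4) by simp_all
  then show ?thesis by simp
qed

lemma qcol_iso:
  assumes c: "qcol I D R L \<kappa>" and h: "inv_pair h g" "src h = L"
  shows "qcol I D R (tgt h) (\<lambda>i. h \<bullet> \<kappa> i)"
proof -
  note D = qcolD[OF c]
  have hg: "arr h" "arr g" "src g = tgt h" "tgt g = L" "g \<bullet> h = idn L" "h \<bullet> g = idn (tgt h)"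
    using h by (auto simp: inv_pair_def)
  have "\<exists>!k. k \<in> thom (tgt h) Z \<and> (\<forall>i \<in> I. k \<bullet> (h \<bullet> \<kappa> i) = \<mu> i)"
    if Z: "Z \<in> Ob C" and m: "\<forall>i \<in> I. \<mu> i \<in> thom (D i) Z" "\<forall>(i, j, x) \<in> R. \<mu> j \<bullet> x = \<mu> i" for Z \<mu>
  proof -
    obtain k where k: "k \<in> thom L Z" "\<And>i. i \<in> I \<Longrightarrow> k \<bullet> \<kappa> i = \<mu> i"
      by (rule qcol_factor[OF c Z, of \<mu>]) (use m in auto)
    show ?thesis
    proof (intro ex1I[of _ "k \<bullet> g"] conjI ballI)
      show "k \<bullet> g \<in> thom (tgt h) Z" using k(1) hg by simp
      show "(k \<bullet> g) \<bullet> (h \<bullet> \<kappa> i) = \<mu> i" if "i \<in> I" for i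
        using k hg h(2) that D(3)[OF that] by (simp add: reassoc[OF hg(5)])
      fix k' assume k': "k' \<in> thom (tgt h) Z \<and> (\<forall>i \<in> I. k' \<bullet> (h \<bullet> \<kappa> i) = \<mu> i)"
      have "k' \<bullet> h = k"
      proof (rule qcol_unique[OF c, of _ Z])
        show "(k' \<bullet> h) \<bullet> \<kappa> i = k \<bullet> \<kappa> i" if "i \<in> I" for i
          using k(2)[OF that] k' hg h(2) D(3)[OF that] that by simp
      qed (use k k' hg h(2) in simp_all)
      then have "(k' \<bullet> h) \<bullet> g = k \<bullet> g" by simp
      then show "k' = k \<bullet> g" using k' hg h(2) by simp
    qed
  qed
  moreover have "\<forall>(i, j, x) \<in> R. i \<in> I \<and> j \<in> I \<and> x \<in> thom (D i) (D j) \<and> (h \<bullet> \<kappa> j) \<bullet> x = h \<bullet> \<kappa> i"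
  proof clarify
    fix i j x assume r: "(i, j, x) \<in> R"
    show "i \<in> I \<and> j \<in> I \<and> x \<in> thom (D i) (D j) \<and> (h \<bullet> \<kappa> j) \<bullet> x = h \<bullet> \<kappa> i"
      using D(4-7)[OF r] D(3)[of j] hg h(2) by simp
  qed
  ultimately show ?thesis
    using D(1-3) hg h(2) unfolding qcol_def by simp
qed

definition rten :: "('x \<times> 'x \<times> ('o, 'a) tarrow) set \<Rightarrow> 'o \<Rightarrow> ('x \<times> 'x \<times> ('o, 'a) tarrow) set" where
  "rten R Y = (\<lambda>(i, j, x). (i, j, x \<boxtimes> idn Y)) ` R"

definition lten :: "('x \<times> 'x \<times> ('o, 'a) tarrow) set \<Rightarrow> 'o \<Rightarrow> ('x \<times> 'x \<times> ('o, 'a) tarrow) set" where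
  "lten R Y = (\<lambda>(i, j, x). (i, j, idn Y \<boxtimes> x)) ` R"

text \<open>Preservation of colimits is assumed for tensoring on the right; the braiding transfers
  it to the left.\<close>

lemma qcol_lten:
  assumes c: "qcol I D R L \<kappa>" and Y [simp]: "Y \<in> Ob C"
    and r: "qcol I (\<lambda>i. D i \<odot> Y) (rten R Y) (L \<odot> Y) (\<lambda>i. \<kappa> i \<boxtimes> idn Y)"
  shows "qcol I (\<lambda>i. Y \<odot> D i) (lten R Y) (Y \<odot> L) (\<lambda>i. idn Y \<boxtimes> \<kappa> i)"
proof -
  note D = qcolD[OF c]
  note [simp] = D(1) D(2)
  have "\<exists>!h. h \<in> thom (Y \<odot> L) Z \<and> (\<forall>i \<in> I. h \<bullet> (idn Y \<boxtimes> \<kappa> i) = \<mu> i)"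
    if Z: "Z \<in> Ob C" and m: "\<forall>i \<in> I. \<mu> i \<in> thom (Y \<odot> D i) Z"
      and mR: "\<forall>(i, j, x) \<in> lten R Y. \<mu> j \<bullet> x = \<mu> i" for Z \<mu>
  proof -
    have "\<exists>!k. k \<in> thom (L \<odot> Y) Z \<and> (\<forall>i \<in> I. k \<bullet> (\<kappa> i \<boxtimes> idn Y) = \<mu> i \<bullet> brd (D i) Y)"
    proof -
      have m1: "\<forall>i \<in> I. \<mu> i \<bullet> brd (D i) Y \<in> thom (D i \<odot> Y) Z" using m by simp
      have m2: "(\<mu> j \<bullet> brd (D j) Y) \<bullet> (x \<boxtimes> idn Y) = \<mu> i \<bullet> brd (D i) Y" if "(i, j, x) \<in> R" for i j x
      proof -
        have "\<mu> j \<bullet> (idn Y \<boxtimes> x) = \<mu> i" using mR that by (force simp: lten_def)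
        then show ?thesis
          using m D(4-6)[OF that] by (simp add: brd_nat reassoc)
      qed
      show ?thesis
        by (rule qcol_ex1[OF r Z]) (use m1 m2 in \<open>auto simp: rten_def\<close>)
    qed
    then obtain k where "k \<in> thom (L \<odot> Y) Z \<and> (\<forall>i \<in> I. k \<bullet> (\<kappa> i \<boxtimes> idn Y) = \<mu> i \<bullet> brd (D i) Y)"
      by (elim ex1E)
    then have k: "k \<in> thom (L \<odot> Y) Z" "\<And>i. i \<in> I \<Longrightarrow> k \<bullet> (\<kappa> i \<boxtimes> idn Y) = \<mu> i \<bullet> brd (D i) Y"
      by auto
    show ?thesis
    proof (intro ex1I[of _ "k \<bullet> brd Y L"] conjI ballI)
      show "k \<bullet> brd Y L \<in> thom (Y \<odot> L) Z" using k(1) by simp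
      show "(k \<bullet> brd Y L) \<bullet> (idn Y \<boxtimes> \<kappa> i) = \<mu> i" if i: "i \<in> I" for i
      proof -
        have "(k \<bullet> brd Y L) \<bullet> (idn Y \<boxtimes> \<kappa> i) = k \<bullet> ((\<kappa> i \<boxtimes> idn Y) \<bullet> brd Y (D i))"
          using k(1) D(3)[OF i] by (simp add: brd_nat)
        also have "\<dots> = (\<mu> i \<bullet> brd (D i) Y) \<bullet> brd Y (D i)"
          using k(1) D(3)[OF i] i by (intro reassoc k(2)) simp_all
        finally show ?thesis using m i by simp
      qed
      fix k' assume k': "k' \<in> thom (Y \<odot> L) Z \<and> (\<forall>i \<in> I. k' \<bullet> (idn Y \<boxtimes> \<kappa> i) = \<mu> i)"
      have "k' \<bullet> brd L Y = k"
      proof (rule qcol_unique[OF r, of _ Z])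
        show "(k' \<bullet> brd L Y) \<bullet> (\<kappa> i \<boxtimes> idn Y) = k \<bullet> (\<kappa> i \<boxtimes> idn Y)" if i: "i \<in> I" for i
        proof -
          have "(k' \<bullet> brd L Y) \<bullet> (\<kappa> i \<boxtimes> idn Y) = k' \<bullet> ((idn Y \<boxtimes> \<kappa> i) \<bullet> brd (D i) Y)"
            using k' D(3)[OF i] by (simp add: brd_nat)
          also have "\<dots> = \<mu> i \<bullet> brd (D i) Y"
            using k' D(3)[OF i] i by (intro reassoc) simp_all
          finally show ?thesis using k(2)[OF i] by simp
        qed
      qed (use k(1) k' in simp_all)
      then show "k' = k \<bullet> brd Y L" using k' by auto
    qed
  qed
  moreover have "\<forall>(i, j, x) \<in> lten R Y. i \<in> I \<and> j \<in> I \<and> x \<in> thom (Y \<odot> D i) (Y \<odot> D j) \<and>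
    (idn Y \<boxtimes> \<kappa> j) \<bullet> x = idn Y \<boxtimes> \<kappa> i"
    using D by (auto simp: lten_def ten_comp)
  ultimately show ?thesis
    using D(3) unfolding qcol_def by simp
qed

definition jrel ::
  "('i, 'u, 'n) cat_scheme \<Rightarrow> ('i, 'u, 'o, 'a) ftor \<Rightarrow> ('i \<times> 'i \<times> ('o, 'a) tarrow) set" where
  "jrel J F = {(i, j, Arr (FOb F i) (FAr F i j u) (FOb F j)) | i j u.
     i \<in> Ob J \<and> j \<in> Ob J \<and> u \<in> Hom J i j}"

lemma qcolI:
  fixes \<kappa> :: "'x \<Rightarrow> 'a"
  assumes D: "\<And>i. i \<in> I \<Longrightarrow> D i \<in> Ob C" and L: "L \<in> Ob C"
    and \<kappa>: "\<And>i. i \<in> I \<Longrightarrow> \<kappa> i \<in> Hom C (D i) L"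
    and R: "\<And>i j x. (i, j, x) \<in> R \<Longrightarrow> i \<in> I \<and> j \<in> I \<and> x \<in> thom (D i) (D j) \<and> \<kappa> j \<cdot> raw x = \<kappa> i"
    and u: "\<And>M \<mu>. \<lbrakk>M \<in> Ob C; \<And>i. i \<in> I \<Longrightarrow> \<mu> i \<in> Hom C (D i) M;
      \<And>i j x. (i, j, x) \<in> R \<Longrightarrow> \<mu> j \<cdot> raw x = \<mu> i\<rbrakk>
      \<Longrightarrow> \<exists>!h. h \<in> Hom C L M \<and> (\<forall>i \<in> I. h \<cdot> \<kappa> i = \<mu> i)"
  shows "qcol I D R L (\<lambda>i. Arr (D i) (\<kappa> i) L)"
proof -
  have "\<exists>!h. h \<in> thom L M \<and> (\<forall>i \<in> I. h \<bullet> Arr (D i) (\<kappa> i) L = \<mu> i)"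
    if M: "M \<in> Ob C" and m: "\<forall>i \<in> I. \<mu> i \<in> thom (D i) M" "\<forall>(i, j, x) \<in> R. \<mu> j \<bullet> x = \<mu> i" for M \<mu>
  proof -
    have e: "\<mu> i = Arr (D i) (raw (\<mu> i)) M" if "i \<in> I" for i
      using m(1) that by (cases "\<mu> i") auto
    have 1: "raw (\<mu> i) \<in> Hom C (D i) M" if "i \<in> I" for i
      using m(1) that by (auto simp: arr_def simp del: arr_Ob)
    have 2: "raw (\<mu> j) \<cdot> raw x = raw (\<mu> i)" if "(i, j, x) \<in> R" for i j x
    proof -
      have "\<mu> j \<bullet> x = \<mu> i" using m(2) that by blast
      then show ?thesis using raw_simps(1)[of "\<mu> j" x] by simp
    qed
    have "\<exists>!h. h \<in> Hom C L M \<and> (\<forall>i \<in> I. h \<cdot> \<kappa> i = raw (\<mu> i))"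
      by (rule u[OF M]) (use 1 2 in auto)
    then obtain h where h: "h \<in> Hom C L M \<and> (\<forall>i \<in> I. h \<cdot> \<kappa> i = raw (\<mu> i))"
      and un: "\<forall>h'. h' \<in> Hom C L M \<and> (\<forall>i \<in> I. h' \<cdot> \<kappa> i = raw (\<mu> i)) \<longrightarrow> h' = h"
      by (elim ex1E)
    show ?thesis
    proof (intro ex1I[of _ "Arr L h M"] conjI ballI)
      show "Arr L h M \<in> thom L M" using h L M by (simp add: arr_Arr)
      show "Arr L h M \<bullet> Arr (D i) (\<kappa> i) L = \<mu> i" if "i \<in> I" for i
        using h e[OF that] that by (simp add: tcomp_def)
      fix k assume k: "k \<in> thom L M \<and> (\<forall>i \<in> I. k \<bullet> Arr (D i) (\<kappa> i) L = \<mu> i)"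
      have "raw k \<cdot> \<kappa> i = raw (\<mu> i)" if "i \<in> I" for i
        using k that raw_simps(1)[of k "Arr (D i) (\<kappa> i) L"] by simp
      moreover have "raw k \<in> Hom C L M" using k by (auto simp: arr_def simp del: arr_Ob)
      ultimately have "raw k = h" using un by simp
      then show "k = Arr L h M" using k by (cases k) auto
    qed
  qed
  moreover have "\<forall>(i, j, x) \<in> R. i \<in> I \<and> j \<in> I \<and> x \<in> thom (D i) (D j) \<and>
      Arr (D j) (\<kappa> j) L \<bullet> x = Arr (D i) (\<kappa> i) L"
    using R by (fastforce simp: tcomp_def)
  ultimately show ?thesis
    using D L \<kappa> unfolding qcol_def by (simp add: arr_Arr)
qed

lemma qcol_is_colimit:
  assumes F: "is_functor J C F" and c: "is_colimit J C F L \<kappa>"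
  shows "qcol (Ob J) (FOb F) (jrel J F) L (\<lambda>i. Arr (FOb F i) (\<kappa> i) L)"
proof (rule qcolI)
  fix M \<mu>
  assume *: "M \<in> Ob C" "\<And>i. i \<in> Ob J \<Longrightarrow> \<mu> i \<in> Hom C (FOb F i) M"
    "\<And>i j x. (i, j, x) \<in> jrel J F \<Longrightarrow> \<mu> j \<cdot> raw x = \<mu> i"
  have "\<mu> j \<cdot> FAr F i j u = \<mu> i" if "i \<in> Ob J" "j \<in> Ob J" "u \<in> Hom J i j" for i j u
    using *(3)[of i j "Arr (FOb F i) (FAr F i j u) (FOb F j)"] that by (auto simp: jrel_def)
  then have "cocone J C F M \<mu>" using * by (simp add: cocone_def)
  then show "\<exists>!h. h \<in> Hom C L M \<and> (\<forall>i \<in> Ob J. h \<cdot> \<kappa> i = \<mu> i)"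
    using c by (simp add: is_colimit_def)
qed (use F c in \<open>auto simp: is_functor_def is_colimit_def cocone_def jrel_def arr_Arr\<close>)

definition crel :: "('o, 'a) tarrow \<Rightarrow> (nat \<times> nat \<times> ('o, 'a) tarrow) set" where
  "crel s = {(n, Suc n, s) | n. True}"

abbreviation scol :: "('o, 'a) tarrow \<Rightarrow> 'o \<Rightarrow> (nat \<Rightarrow> ('o, 'a) tarrow) \<Rightarrow> bool" where
  "scol s L \<kappa> \<equiv> qcol UNIV (\<lambda>_. src s) (crel s) L \<kappa>"

lemma scolD:
  assumes "scol s L \<kappa>"
  shows "arr s" "tgt s = src s" "L \<in> Ob C" "\<kappa> n \<in> thom (src s) L" "\<kappa> (Suc n) \<bullet> s = \<kappa> n"
  using qcolD(1)[OF assms] qcolD(3)[OF assms, of n] qcolD(6,7)[OF assms, of n "Suc n" s]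
  by (auto simp: crel_def)

lemma scol_factor:
  assumes "scol s L \<kappa>" "Z \<in> Ob C" "\<And>n. \<mu> n \<in> thom (src s) Z" "\<And>n. \<mu> (Suc n) \<bullet> s = \<mu> n"
  obtains h where "h \<in> thom L Z" "\<And>n. h \<bullet> \<kappa> n = \<mu> n"
  by (rule qcol_factor[OF assms(1,2), of \<mu>]) (use assms(3,4) in \<open>auto simp: crel_def\<close>)

lemma scol_unique:
  assumes "scol s L \<kappa>" "x \<in> thom L Z" "y \<in> thom L Z" "\<And>n. x \<bullet> \<kappa> n = y \<bullet> \<kappa> n"
  shows "x = y"
  by (rule qcol_unique[OF assms(1-3)]) (rule assms(4))

lemma scol_is_colimit:
  assumes X: "X \<in> Ob C" "s \<in> Hom C X X" and c: "is_colimit nat_chain C (endo_chain C X s) L \<kappa>"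
  shows "scol (Arr X s X) L (\<lambda>n. Arr X (\<kappa> n) L)"
proof -
  note * = c[unfolded is_colimit_endo_chain[OF X]]
  have "qcol UNIV (\<lambda>_. X) (crel (Arr X s X)) L (\<lambda>n. Arr X (\<kappa> n) L)"
  proof (rule qcolI)
    fix M \<mu>
    assume m: "M \<in> Ob C" "\<And>i. i \<in> UNIV \<Longrightarrow> \<mu> i \<in> Hom C X M"
      "\<And>i j x. (i, j, x) \<in> crel (Arr X s X) \<Longrightarrow> \<mu> j \<cdot> raw x = \<mu> i"
    have "\<mu> (Suc n) \<cdot> s = \<mu> n" for n
      using m(3)[of n "Suc n" "Arr X s X"] by (simp add: crel_def)
    then have "chain_cocone C X s M \<mu>"
      using m by (simp add: chain_cocone_def)
    then show "\<exists>!h. h \<in> Hom C L M \<and> (\<forall>i \<in> UNIV. h \<cdot> \<kappa> i = \<mu> i)"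
      using * by simp
  qed (use X * in \<open>auto simp: chain_cocone_def crel_def arr_Arr\<close>)
  then show ?thesis by simp
qed

lemma qcol_compare:
  assumes c: "qcol I D R L \<kappa>" and c': "qcol I D R L' \<kappa>'"
  obtains h g where "inv_pair h g" "src h = L" "tgt h = L'" "\<And>i. i \<in> I \<Longrightarrow> h \<bullet> \<kappa> i = \<kappa>' i"
proof -
  obtain h where h: "h \<in> thom L L'" "\<And>i. i \<in> I \<Longrightarrow> h \<bullet> \<kappa> i = \<kappa>' i"
    by (rule qcol_factor[OF c qcolD(1)[OF c'], of \<kappa>']) (use qcolD[OF c'] in auto)
  obtain g where g: "g \<in> thom L' L" "\<And>i. i \<in> I \<Longrightarrow> g \<bullet> \<kappa>' i = \<kappa> i"
    by (rule qcol_factor[OF c' qcolD(1)[OF c], of \<kappa>]) (use qcolD[OF c] in auto)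
  have "g \<bullet> h = idn L"
    by (rule qcol_unique[OF c, of _ L]) (use g h qcolD[OF c] in simp_all)
  moreover have "h \<bullet> g = idn L'"
    by (rule qcol_unique[OF c', of _ L']) (use g h qcolD[OF c'] in simp_all)
  ultimately show ?thesis using that[of h g] g h by (simp add: inv_pair_def)
qed

lemma inv_pair_ten: "\<lbrakk>inv_pair h g; Y \<in> Ob C\<rbrakk> \<Longrightarrow> inv_pair (h \<boxtimes> idn Y) (g \<boxtimes> idn Y)"
  by (simp add: inv_pair_def ten_comp)

end

section \<open>Sequential colimits in \<open>C\<close> and their tensor products\<close>

context algebraic_context
begin

lemma tensor_functor:
  assumes J: "small_cat (J :: ('i, 'i) cat)" and F: "is_functor J C F" and Y: "Y \<in> Ob C"
  shows "is_functor J C (ftor_comp (tensor_right C Y) F)"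
proof -
  interpret J: category J using J by (simp add: small_cat_def)
  have *: "(g \<cdot> f) \<star> Id C Y = (g \<star> Id C Y) \<cdot> (f \<star> Id C Y)"
    if "X \<in> Ob C" "X' \<in> Ob C" "Z \<in> Ob C" "f \<in> Hom C X X'" "g \<in> Hom C X' Z" for X X' Z f g
    using TenA_Comp[of X X' Z Y Y Y f g "Id C Y" "Id C Y"] that Y
    by (simp add: Id_in_Hom Comp_Id_left[OF Y Y Id_in_Hom[OF Y]])
  have "(FAr F j k v \<cdot> FAr F i j u) \<star> Id C Y = (FAr F j k v \<star> Id C Y) \<cdot> (FAr F i j u \<star> Id C Y)"
    if "i \<in> Ob J" "j \<in> Ob J" "k \<in> Ob J" "u \<in> Hom J i j" "v \<in> Hom J j k" for i j k u v
    using that F *[of "FOb F i" "FOb F j" "FOb F k"] by (simp add: is_functor_def)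
  with F Y show ?thesis
    unfolding is_functor_def ftor_comp_def tensor_right_def
    by (simp add: TenA_in_Hom Id_in_Hom TenA_Id)
qed

lemma tensor_colimit:
  assumes "small_cat (J :: ('i, 'i) cat)" "is_functor J C F" "is_colimit J C F L \<kappa>" "Y \<in> Ob C"
  shows "is_colimit J C (ftor_comp (tensor_right C Y) F) (L \<odot> Y) (\<lambda>i. \<kappa> i \<star> Id C Y)"
  using tensor_preserves_colimits[OF assms(4)] assms(1-3)
  by (auto simp: preserves_small_colimits_def tensor_right_def)

lemma qcol_rten:
  assumes J: "small_cat (J :: ('i, 'i) cat)" and F: "is_functor J C F" and c: "is_colimit J C F L \<kappa>"
    and Y: "Y \<in> Ob C"
  shows "qcol (Ob J) (\<lambda>i. FOb F i \<odot> Y) (rten (jrel J F) Y) (L \<odot> Y)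
    (\<lambda>i. Arr (FOb F i) (\<kappa> i) L \<boxtimes> idn Y)"
proof -
  let ?F = "ftor_comp (tensor_right C Y) F"
  have "qcol (Ob J) (FOb ?F) (jrel J ?F) (L \<odot> Y) (\<lambda>i. Arr (FOb ?F i) (\<kappa> i \<star> Id C Y) (L \<odot> Y))"
    by (rule qcol_is_colimit[OF tensor_functor[OF J F Y] tensor_colimit[OF J F c Y]])
  moreover have "jrel J ?F = rten (jrel J F) Y"
    by (force simp: jrel_def rten_def ftor_comp_def tensor_right_def ten_def idn_def image_iff)
  ultimately show ?thesis
    by (simp add: ftor_comp_def tensor_right_def ten_def idn_def)
qed

text \<open>Any function on \<open>unit\<close> is injective, so all arrows may carry the single
  name \<open>undefined\<close>; only the objects need an injection into the universe.\<close>

lemma nat_chain_relabel: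
  obtains e :: "nat \<Rightarrow> 'i" where "inj e" "small_cat (relabel_cat e (\<lambda>_. undefined) nat_chain)"
proof -
  obtain e :: "nat \<Rightarrow> 'i" where e: "inj e" using ex_inj_nat[OF universe_uncountable] .
  moreover have "small_cat (relabel_cat e (\<lambda>_. undefined :: 'i) nat_chain)"
    by (rule small_relabel) (simp_all add: e category_nat_chain universe_uncountable, simp add: inj_on_def)
  ultimately show ?thesis by (rule that)
qed

text \<open>Colimits are assumed only over categories inside the universe, so the chain is
  relabelled and the result is read back on the natural numbers. Tensoring commutes with the powers
  of \<open>s\<close>, hence the tensored chain is again the chain of an endomorphism.\<close>

lemma scol_exists:
  assumes s: "arr s" "tgt s = src s"
  obtains L \<kappa> where "scol s L \<kappa>" "\<And>Y. Y \<in> Ob C \<Longrightarrow> scol (s \<boxtimes> idn Y) (L \<odot> Y) (\<lambda>n. \<kappa> n \<boxtimes> idn Y)"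
proof -
  obtain e :: "nat \<Rightarrow> 'i" where e: "inj e" and J: "small_cat (relabel_cat e (\<lambda>_. undefined) nat_chain)"
    (is "small_cat ?J") by (rule nat_chain_relabel)
  let ?X = "src s" and ?s = "raw s"
  have X: "?X \<in> Ob C" "?s \<in> Hom C ?X ?X" and s_eq: "Arr ?X ?s ?X = s"
    using s by (auto simp: arr_def tarrow_eq simp del: arr_Ob)
  let ?F = "endo_chain C ?X ?s"
  let ?rF = "relabel_ftor e (\<lambda>_. undefined) ?F"
  have u: "inj (\<lambda>_ :: unit. undefined :: 'i)" by (simp add: inj_on_def)
  have rF: "is_functor ?J C ?rF"
    using is_functor_relabel[OF e u is_functor_endo_chain[OF X]] .
  obtain L \<nu> where \<nu>: "is_colimit ?J C ?rF L \<nu>"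
    using small_colimits J rF unfolding has_small_colimits_def by blast
  then have c: "is_colimit nat_chain C ?F L (\<nu> \<circ> e)"
    by (simp add: is_colimit_relabel[OF e u])
  have "scol (s \<boxtimes> idn Y) (L \<odot> Y) (\<lambda>n. Arr ?X ((\<nu> \<circ> e) n) L \<boxtimes> idn Y)" if Y: "Y \<in> Ob C" for Y
  proof -
    have XY: "?X \<odot> Y \<in> Ob C" "?s \<star> Id C Y \<in> Hom C (?X \<odot> Y) (?X \<odot> Y)"
      using X Y by (simp_all add: TenA_in_Hom Id_in_Hom)
    have "is_colimit ?J C (ftor_comp (tensor_right C Y) ?rF) (L \<odot> Y) (\<lambda>i. \<nu> i \<star> Id C Y)"
      by (rule tensor_colimit[OF J rF \<nu> Y])
    then have "is_colimit nat_chain C (ftor_comp (tensor_right C Y) ?F) (L \<odot> Y) ((\<lambda>i. \<nu> i \<star> Id C Y) \<circ> e)"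
      by (simp add: is_colimit_relabel[OF e u] ftor_comp_relabel)
    moreover have "epow C ?X ?s n \<star> Id C Y = epow C (?X \<odot> Y) (?s \<star> Id C Y) n" for n
    proof (induction n)
      case (Suc n)
      have "(epow C ?X ?s n \<cdot> ?s) \<star> (Id C Y \<cdot> Id C Y) = (epow C ?X ?s n \<star> Id C Y) \<cdot> (?s \<star> Id C Y)"
        by (rule TenA_Comp[OF X(1) X(1) X(1) Y Y Y X(2) epow_in_Hom[OF X] Id_in_Hom[OF Y] Id_in_Hom[OF Y]])
      then show ?case using Suc Comp_Id_left[OF Y Y Id_in_Hom[OF Y]] by simp
    qed (use X Y in \<open>simp add: TenA_Id\<close>)
    then have "ftor_comp (tensor_right C Y) ?F = endo_chain C (?X \<odot> Y) (?s \<star> Id C Y)"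
      by (simp add: ftor_comp_def tensor_right_def endo_chain_def)
    ultimately have "is_colimit nat_chain C (endo_chain C (?X \<odot> Y) (?s \<star> Id C Y)) (L \<odot> Y) ((\<lambda>i. \<nu> i \<star> Id C Y) \<circ> e)"
      by simp
    from scol_is_colimit[OF XY this] show ?thesis
      by (simp add: ten_def idn_def s)
  qed
  moreover have "scol s L (\<lambda>n. Arr ?X ((\<nu> \<circ> e) n) L)"
    using scol_is_colimit[OF X c] by (simp add: s_eq)
  ultimately show ?thesis using that by blast
qed

text \<open>\<open>scol_exists\<close> gives this for one particular colimit of the chain; any other
  is reached by the comparison isomorphism, which remains invertible after tensoring.\<close>

lemma scol_rten:
  assumes c: "scol s L \<kappa>" and Y: "Y \<in> Ob C"
  shows "scol (s \<boxtimes> idn Y) (L \<odot> Y) (\<lambda>n. \<kappa> n \<boxtimes> idn Y)"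
proof -
  obtain L' \<nu> where c': "scol s L' \<nu>" and t: "scol (s \<boxtimes> idn Y) (L' \<odot> Y) (\<lambda>n. \<nu> n \<boxtimes> idn Y)"
    by (rule scol_exists[OF scolD(1,2)[OF c]]) (rule that, assumption, simp add: Y)
  obtain h g where h: "inv_pair h g" "src h = L'" "tgt h = L" "\<And>n. h \<bullet> \<nu> n = \<kappa> n"
    by (rule qcol_compare[OF c' c]) (rule that, auto)
  have "(h \<boxtimes> idn Y) \<bullet> (\<nu> n \<boxtimes> idn Y) = \<kappa> n \<boxtimes> idn Y" for n
    using h Y scolD(4)[OF c', of n] by (simp add: inv_pair_def ten_comp)
  then show ?thesis
    using qcol_iso[OF t inv_pair_ten[OF h(1) Y]] h(2,3) by simp
qed

lemma scol_lten:
  assumes c: "scol s L \<kappa>" and Y: "Y \<in> Ob C"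
  shows "scol (idn Y \<boxtimes> s) (Y \<odot> L) (\<lambda>n. idn Y \<boxtimes> \<kappa> n)"
proof -
  have "rten (crel s) Y = crel (s \<boxtimes> idn Y)" "lten (crel s) Y = crel (idn Y \<boxtimes> s)"
    by (auto simp: rten_def lten_def crel_def image_def)
  then show ?thesis
    using qcol_lten[OF c Y] scol_rten[OF c Y] by simp
qed

end

section \<open>Monoids and modules\<close>

context symmetric_monoidal_category
begin

definition mulT :: "('o, 'a) cmon \<Rightarrow> ('o, 'a) tarrow" where
  "mulT A = Arr (Car A \<odot> Car A) (Mul A) (Car A)"

definition uniT :: "('o, 'a) cmon \<Rightarrow> ('o, 'a) tarrow" where
  "uniT A = Arr (Unit C) (Uni A) (Car A)"

definition actT :: "('o, 'a) cmon \<Rightarrow> ('o, 'a) amod \<Rightarrow> ('o, 'a) tarrow" where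
  "actT A M = Arr (MCar M \<odot> Car A) (Act M) (MCar M)"

lemma src_tgt_structure [simp]:
  "src (mulT A) = Car A \<odot> Car A" "tgt (mulT A) = Car A"
  "src (uniT A) = Unit C" "tgt (uniT A) = Car A"
  "src (actT A M) = MCar M \<odot> Car A" "tgt (actT A M) = MCar M"
  by (simp_all add: mulT_def uniT_def actT_def)

lemma comm_monoid_ob_iff:
  "comm_monoid_ob C A \<longleftrightarrow> Car A \<in> Ob C \<and> arr (mulT A) \<and> arr (uniT A) \<and>
    mulT A \<bullet> (mulT A \<boxtimes> idn (Car A)) = mulT A \<bullet> ((idn (Car A) \<boxtimes> mulT A) \<bullet> asc (Car A) (Car A) (Car A)) \<and>
    mulT A \<bullet> (uniT A \<boxtimes> idn (Car A)) = lun (Car A) \<and>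
    mulT A \<bullet> (idn (Car A) \<boxtimes> uniT A) = run (Car A) \<and>
    mulT A \<bullet> brd (Car A) (Car A) = mulT A"
  by (auto simp: comm_monoid_ob_def mulT_def uniT_def arr_Arr tcomp_def ten_def idn_def asc_def
      lun_def run_def brd_def)

lemma module_ob_iff:
  assumes "Car A \<in> Ob C"
  shows "module_ob C A M \<longleftrightarrow> MCar M \<in> Ob C \<and> arr (actT A M) \<and>
    actT A M \<bullet> (actT A M \<boxtimes> idn (Car A))
      = actT A M \<bullet> ((idn (MCar M) \<boxtimes> mulT A) \<bullet> asc (MCar M) (Car A) (Car A)) \<and>
    actT A M \<bullet> (idn (MCar M) \<boxtimes> uniT A) = run (MCar M)"
  using assms by (auto simp: module_ob_def mulT_def uniT_def actT_def arr_Arr tcomp_def ten_def idn_def asc_def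
      lun_def run_def)

lemma Comm_simps [simp]:
  "A \<in> Ob (Comm C) \<longleftrightarrow> comm_monoid_ob C A" "Comp (Comm C) = Comp C" "Id (Comm C) A = Id C (Car A)"
  by (simp_all add: Comm_def)

lemma Modules_simps [simp]:
  "M \<in> Ob (Modules C A) \<longleftrightarrow> module_ob C A M" "Comp (Modules C A) = Comp C"
  "Id (Modules C A) M = Id C (MCar M)"
  by (simp_all add: Modules_def)

lemma Hom_Comm:
  assumes "Car A \<in> Ob C" "Car B \<in> Ob C"
  shows "f \<in> Hom (Comm C) A B \<longleftrightarrow> arr (Arr (Car A) f (Car B)) \<and>
    Arr (Car A) f (Car B) \<bullet> mulT A = mulT B \<bullet> (Arr (Car A) f (Car B) \<boxtimes> Arr (Car A) f (Car B)) \<and>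
    Arr (Car A) f (Car B) \<bullet> uniT A = uniT B"
  using assms by (auto simp: Comm_def mulT_def uniT_def arr_Arr tcomp_def ten_def)

lemma Hom_Modules:
  assumes "MCar M \<in> Ob C" "MCar N \<in> Ob C"
  shows "h \<in> Hom (Modules C A) M N \<longleftrightarrow> arr (Arr (MCar M) h (MCar N)) \<and>
    Arr (MCar M) h (MCar N) \<bullet> actT A M = actT A N \<bullet> (Arr (MCar M) h (MCar N) \<boxtimes> idn (Car A))"
  using assms by (auto simp: Modules_def actT_def arr_Arr tcomp_def ten_def idn_def)

lemma monoidD:
  assumes "comm_monoid_ob C A"
  shows "Car A \<in> Ob C" "arr (mulT A)" "arr (uniT A)"
    "mulT A \<bullet> (mulT A \<boxtimes> idn (Car A)) = mulT A \<bullet> ((idn (Car A) \<boxtimes> mulT A) \<bullet> asc (Car A) (Car A) (Car A))"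
    "mulT A \<bullet> (uniT A \<boxtimes> idn (Car A)) = lun (Car A)"
    "mulT A \<bullet> (idn (Car A) \<boxtimes> uniT A) = run (Car A)"
    "mulT A \<bullet> brd (Car A) (Car A) = mulT A"
  using assms unfolding comm_monoid_ob_iff by auto

lemma moduleD:
  assumes "module_ob C A M" "Car A \<in> Ob C"
  shows "MCar M \<in> Ob C" "arr (actT A M)"
    "actT A M \<bullet> (actT A M \<boxtimes> idn (Car A))
      = actT A M \<bullet> ((idn (MCar M) \<boxtimes> mulT A) \<bullet> asc (MCar M) (Car A) (Car A))"
    "actT A M \<bullet> (idn (MCar M) \<boxtimes> uniT A) = run (MCar M)"
  using assms unfolding module_ob_iff[OF assms(2)] by auto

lemma self_module_simps [simp]: "MCar (self_module A) = Car A" "actT A (self_module A) = mulT A"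
  by (simp_all add: self_module_def actT_def mulT_def)

lemma module_self: "comm_monoid_ob C A \<Longrightarrow> module_ob C A (self_module A)"
  using monoidD[of A] by (simp add: module_ob_iff)

lemma mul_swap:
  assumes A: "comm_monoid_ob C A" and "arr f" "arr g" "tgt f = Car A" "tgt g = Car A"
  shows "mulT A \<bullet> (g \<boxtimes> f) \<bullet> brd (src f) (src g) = mulT A \<bullet> (f \<boxtimes> g)"
proof -
  note [simp] = monoidD(1-3)[OF A]
  have "mulT A \<bullet> (g \<boxtimes> f) \<bullet> brd (src f) (src g) = mulT A \<bullet> brd (Car A) (Car A) \<bullet> (f \<boxtimes> g)"
    using assms by (simp add: brd_nat)
  also have "\<dots> = mulT A \<bullet> (f \<boxtimes> g)"
    using assms by (intro reassoc monoidD(7)[OF A]) simp_all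
  finally show ?thesis .
qed

text \<open>The unit splits the action. Every action is therefore a split epimorphism and can be
  cancelled, also after tensoring (\<open>act_cancel\<close>,
  \<open>act_ten_cancel\<close>).\<close>

lemma act_section:
  assumes A: "comm_monoid_ob C A" and M: "module_ob C A M"
  shows "actT A M \<bullet> (idn (MCar M) \<boxtimes> uniT A) \<bullet> iarr (run (MCar M)) = idn (MCar M)"
proof -
  note [simp] = monoidD(1-3)[OF A] moduleD(1,2)[OF M monoidD(1)[OF A]]
  show ?thesis
    by (simp add: reassoc[OF moduleD(4)[OF M monoidD(1)[OF A]]])
qed

lemma split_epi_cancel:
  assumes "g \<bullet> s = idn (tgt g)" "arr g" "arr s" "tgt s = src g"
    and "arr x" "arr y" "src x = tgt g" "src y = tgt g" and eq: "x \<bullet> g = y \<bullet> g"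
  shows "x = y"
proof -
  have "x = x \<bullet> (g \<bullet> s)" using assms(1-8) by simp
  also have "\<dots> = (x \<bullet> g) \<bullet> s" using assms(2-8) by simp
  also have "\<dots> = y \<bullet> (g \<bullet> s)" unfolding eq using assms(2-8) by simp
  also have "\<dots> = y" using assms(1-8) by simp
  finally show ?thesis .
qed

lemma act_cancel:
  assumes A: "comm_monoid_ob C A" and M: "module_ob C A M"
    and "arr x" "arr y" "src x = MCar M" "src y = MCar M" "x \<bullet> actT A M = y \<bullet> actT A M"
  shows "x = y"
proof (rule split_epi_cancel)
  show "actT A M \<bullet> ((idn (MCar M) \<boxtimes> uniT A) \<bullet> iarr (run (MCar M))) = idn (tgt (actT A M))"
    using act_section[OF A M] by simp
qed (use assms monoidD(1-3)[OF A] moduleD(1,2)[OF M monoidD(1)[OF A]] in simp_all)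

lemma act_ten_cancel:
  assumes A: "comm_monoid_ob C A" and M: "module_ob C A M" and Y: "Y \<in> Ob C"
    and "arr x" "arr y" "src x = MCar M \<odot> Y" "src y = MCar M \<odot> Y"
    "x \<bullet> (actT A M \<boxtimes> idn Y) = y \<bullet> (actT A M \<boxtimes> idn Y)"
  shows "x = y"
proof (rule split_epi_cancel)
  note [simp] = monoidD(1-3)[OF A] moduleD(1,2)[OF M monoidD(1)[OF A]]
  show "(actT A M \<boxtimes> idn Y) \<bullet> (((idn (MCar M) \<boxtimes> uniT A) \<bullet> iarr (run (MCar M))) \<boxtimes> idn Y)
      = idn (tgt (actT A M \<boxtimes> idn Y))"
    using act_section[OF A M] Y by (simp add: ten_comp)
qed (use assms monoidD(1-3)[OF A] moduleD(1,2)[OF M monoidD(1)[OF A]] in simp_all)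

subsection \<open>Multiplication by a global element\<close>

text \<open>Multiplication \<open>m \<mapsto> m z\<close> by a global element of \<open>A\<close>.
  On \<open>self_module A\<close> every linear endomorphism has this form, with \<open>z\<close> its
  value at the unit; see \<open>linear_eq_emul\<close>.\<close>

definition emul :: "('o, 'a) cmon \<Rightarrow> ('o, 'a) amod \<Rightarrow> ('o, 'a) tarrow \<Rightarrow> ('o, 'a) tarrow" where
  "emul A M z = actT A M \<bullet> (idn (MCar M) \<boxtimes> z) \<bullet> iarr (run (MCar M))"

lemma emul_src_tgt [simp]: "src (emul A M z) = MCar M" "tgt (emul A M z) = MCar M"
  by (simp_all add: emul_def)

lemma arr_emul:
  assumes A: "comm_monoid_ob C A" and M: "module_ob C A M" and z: "z \<in> thom (Unit C) (Car A)"
  shows "arr (emul A M z)"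
  using z moduleD(1,2)[OF M monoidD(1)[OF A]] by (simp add: emul_def)

text \<open>In elements, (x a) z = x (a z). The unit inserted behind x a has to be moved behind a,
  which is \<open>asc_iarr_run\<close>.\<close>

lemma emul_act:
  assumes A: "comm_monoid_ob C A" and M: "module_ob C A M" and z: "z \<in> thom (Unit C) (Car A)"
  shows "emul A M z \<bullet> actT A M = actT A M \<bullet> (idn (MCar M) \<boxtimes> emul A (self_module A) z)"
proof -
  let ?a = "actT A M" and ?X = "MCar M" and ?A = "Car A"
  note [simp] = monoidD(1-3)[OF A] moduleD(1,2)[OF M monoidD(1)[OF A]] z[simplified]
  have "emul A M z \<bullet> ?a = ?a \<bullet> ((idn ?X \<boxtimes> z) \<bullet> (iarr (run ?X) \<bullet> ?a))"
    by (simp add: emul_def)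
  also have "iarr (run ?X) \<bullet> ?a = (?a \<boxtimes> idn (Unit C)) \<bullet> iarr (run (?X \<odot> ?A))"
    using iarr_run_nat[of ?a "?X \<odot> ?A"] by simp
  also have "?a \<bullet> ((idn ?X \<boxtimes> z) \<bullet> \<dots>)
      = ?a \<bullet> ((?a \<boxtimes> idn ?A) \<bullet> ((idn (?X \<odot> ?A) \<boxtimes> z) \<bullet> iarr (run (?X \<odot> ?A))))"
    by (simp add: ten_comp2)
  also have "\<dots> = ?a \<bullet> ((idn ?X \<boxtimes> mulT A) \<bullet> (asc ?X ?A ?A \<bullet>
      (((idn ?X \<boxtimes> idn ?A) \<boxtimes> z) \<bullet> iarr (run (?X \<odot> ?A)))))"
    using reassoc[OF moduleD(3)[OF M monoidD(1)[OF A]], of "(idn (?X \<odot> ?A) \<boxtimes> z) \<bullet> iarr (run (?X \<odot> ?A))"]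
    by simp
  also have "asc ?X ?A ?A \<bullet> (((idn ?X \<boxtimes> idn ?A) \<boxtimes> z) \<bullet> iarr (run (?X \<odot> ?A)))
      = (idn ?X \<boxtimes> (idn ?A \<boxtimes> z)) \<bullet> (asc ?X ?A (Unit C) \<bullet> iarr (run (?X \<odot> ?A)))"
    using reassoc[OF asc_nat[of "idn ?X" "idn ?A" z ?X ?A ?A], of "iarr (run (?X \<odot> ?A))"] by simp
  finally show ?thesis
    by (simp add: asc_iarr_run ten_comp emul_def)
qed

text \<open>In elements, (x z) a = x (z a). The inserted unit sits between x and a, and the triangle
  identity (\<open>tri\<close>) turns it from a right unit of x into a left unit of a.\<close>

lemma act_emul:
  assumes A: "comm_monoid_ob C A" and M: "module_ob C A M" and z: "z \<in> thom (Unit C) (Car A)"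
  shows "actT A M \<bullet> (emul A M z \<boxtimes> idn (Car A))
    = actT A M \<bullet> (idn (MCar M) \<boxtimes> (mulT A \<bullet> (z \<boxtimes> idn (Car A)) \<bullet> iarr (lun (Car A))))"
proof -
  let ?a = "actT A M" and ?X = "MCar M" and ?A = "Car A"
  note [simp] = monoidD(1-3)[OF A] moduleD(1,2)[OF M monoidD(1)[OF A]] z[simplified]
  have tri: "asc ?X (Unit C) ?A \<bullet> (iarr (run ?X) \<boxtimes> idn ?A) = idn ?X \<boxtimes> iarr (lun ?A)"
  proof -
    have "(idn ?X \<boxtimes> lun ?A) \<bullet> (asc ?X (Unit C) ?A \<bullet> (iarr (run ?X) \<boxtimes> idn ?A))
        = (idn ?X \<boxtimes> lun ?A) \<bullet> (idn ?X \<boxtimes> iarr (lun ?A))"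
      by (simp add: reassoc[OF triangle_arr] ten_comp)
    moreover have "inv_pair (idn ?X \<boxtimes> lun ?A) (idn ?X \<boxtimes> iarr (lun ?A))"
      by (simp add: inv_pair_def ten_comp)
    ultimately show ?thesis by (simp add: inv_pair_cancel(1))
  qed
  have "?a \<bullet> (emul A M z \<boxtimes> idn ?A)
      = ?a \<bullet> ((?a \<boxtimes> idn ?A) \<bullet> (((idn ?X \<boxtimes> z) \<boxtimes> idn ?A) \<bullet> (iarr (run ?X) \<boxtimes> idn ?A)))"
    by (simp add: emul_def ten_comp)
  also have "\<dots> = ?a \<bullet> ((idn ?X \<boxtimes> mulT A) \<bullet> (asc ?X ?A ?A \<bullet>
      (((idn ?X \<boxtimes> z) \<boxtimes> idn ?A) \<bullet> (iarr (run ?X) \<boxtimes> idn ?A))))"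
    using reassoc[OF moduleD(3)[OF M monoidD(1)[OF A]],
        of "((idn ?X \<boxtimes> z) \<boxtimes> idn ?A) \<bullet> (iarr (run ?X) \<boxtimes> idn ?A)"]
    by simp
  also have "asc ?X ?A ?A \<bullet> (((idn ?X \<boxtimes> z) \<boxtimes> idn ?A) \<bullet> (iarr (run ?X) \<boxtimes> idn ?A))
      = (idn ?X \<boxtimes> (z \<boxtimes> idn ?A)) \<bullet> (asc ?X (Unit C) ?A \<bullet> (iarr (run ?X) \<boxtimes> idn ?A))"
    using reassoc[OF asc_nat[of "idn ?X" z "idn ?A" ?X ?A ?A], of "iarr (run ?X) \<boxtimes> idn ?A"] by simp
  finally show ?thesis
    by (simp add: tri ten_comp)
qed

lemma emul_linear:
  assumes A: "comm_monoid_ob C A" and M: "module_ob C A M" and N: "module_ob C A N"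
    and h: "h \<in> thom (MCar M) (MCar N)" "h \<bullet> actT A M = actT A N \<bullet> (h \<boxtimes> idn (Car A))"
    and z: "z \<in> thom (Unit C) (Car A)"
  shows "h \<bullet> emul A M z = emul A N z \<bullet> h"
proof -
  note [simp] = monoidD(1-3)[OF A] moduleD(1,2)[OF M monoidD(1)[OF A]]
    moduleD(1,2)[OF N monoidD(1)[OF A]] z[simplified] h(1)[simplified]
  have "h \<bullet> emul A M z = actT A N \<bullet> ((h \<boxtimes> idn (Car A)) \<bullet> ((idn (MCar M) \<boxtimes> z) \<bullet> iarr (run (MCar M))))"
    using reassoc[OF h(2), of "(idn (MCar M) \<boxtimes> z) \<bullet> iarr (run (MCar M))"] by (simp add: emul_def)
  also have "\<dots> = actT A N \<bullet> ((idn (MCar N) \<boxtimes> z) \<bullet> ((h \<boxtimes> idn (Unit C)) \<bullet> iarr (run (MCar M))))"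
    by (simp add: ten_comp2)
  finally show ?thesis by (simp add: iarr_run_nat emul_def)
qed

text \<open>Commutativity: precomposing with the braiding turns linearity in one factor into
  linearity in the other.\<close>

lemma linear_swap:
  assumes A: "comm_monoid_ob C A" and e: "e \<in> thom (Car A) (Car A)"
  shows "e \<bullet> mulT A = mulT A \<bullet> (e \<boxtimes> idn (Car A)) \<longleftrightarrow> e \<bullet> mulT A = mulT A \<bullet> (idn (Car A) \<boxtimes> e)"
proof -
  note [simp] = monoidD(1-3)[OF A] e[simplified]
  have *: "e \<bullet> mulT A = (e \<bullet> mulT A) \<bullet> brd (Car A) (Car A)"
    using monoidD(7)[OF A] by simp
  have 1: "(mulT A \<bullet> (e \<boxtimes> idn (Car A))) \<bullet> brd (Car A) (Car A) = mulT A \<bullet> (idn (Car A) \<boxtimes> e)"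
    using mul_swap[OF A, of "idn (Car A)" e] by simp
  have 2: "(mulT A \<bullet> (idn (Car A) \<boxtimes> e)) \<bullet> brd (Car A) (Car A) = mulT A \<bullet> (e \<boxtimes> idn (Car A))"
    using mul_swap[OF A, of e "idn (Car A)"] by simp
  show ?thesis
    using * 1 2 by metis
qed

lemma emul_self_linear:
  assumes A: "comm_monoid_ob C A" and z: "z \<in> thom (Unit C) (Car A)"
  shows "emul A (self_module A) z \<bullet> mulT A = mulT A \<bullet> (idn (Car A) \<boxtimes> emul A (self_module A) z)"
    and "emul A (self_module A) z \<bullet> mulT A = mulT A \<bullet> (emul A (self_module A) z \<boxtimes> idn (Car A))"
proof -
  show 1: "emul A (self_module A) z \<bullet> mulT A = mulT A \<bullet> (idn (Car A) \<boxtimes> emul A (self_module A) z)"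
    using emul_act[OF A module_self[OF A] z] by simp
  then show "emul A (self_module A) z \<bullet> mulT A = mulT A \<bullet> (emul A (self_module A) z \<boxtimes> idn (Car A))"
    using linear_swap[OF A, of "emul A (self_module A) z"] arr_emul[OF A module_self[OF A] z] by simp
qed

text \<open>Both composites send a product a b to e(a) e'(b), the first factor absorbing
  \<open>e\<close> and the second \<open>e'\<close>. The multiplication, a split epimorphism, is
  then cancelled.\<close>

lemma linear_endo_commute:
  assumes A: "comm_monoid_ob C A" and e: "e \<in> thom (Car A) (Car A)" "e \<bullet> mulT A = mulT A \<bullet> (idn (Car A) \<boxtimes> e)"
    and e': "e' \<in> thom (Car A) (Car A)" "e' \<bullet> mulT A = mulT A \<bullet> (idn (Car A) \<boxtimes> e')"
  shows "e \<bullet> e' = e' \<bullet> e"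
proof -
  note [simp] = monoidD(1-3)[OF A] e(1)[simplified] e'(1)[simplified]
  have el: "e \<bullet> mulT A = mulT A \<bullet> (e \<boxtimes> idn (Car A))"
    using linear_swap[OF A e(1)] e(2) by simp
  have "e \<bullet> e' \<bullet> mulT A = (mulT A \<bullet> (e \<boxtimes> idn (Car A))) \<bullet> (idn (Car A) \<boxtimes> e')"
    using reassoc[OF el, of "idn (Car A) \<boxtimes> e'"] e'(2) by simp
  also have "\<dots> = (mulT A \<bullet> (idn (Car A) \<boxtimes> e')) \<bullet> (e \<boxtimes> idn (Car A))"
    by (simp add: ten_comp)
  also have "\<dots> = e' \<bullet> e \<bullet> mulT A"
    using reassoc[OF e'(2), of "e \<boxtimes> idn (Car A)"] el by simp
  finally have "(e \<bullet> e') \<bullet> actT A (self_module A) = (e' \<bullet> e) \<bullet> actT A (self_module A)"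
    by simp
  then show ?thesis by (rule act_cancel[OF A module_self[OF A], rotated -1]) simp_all
qed

text \<open>The hypothesis reads g(a b) = g(a) l(b). By commutativity g(a b) = l(a) g(b), and b = 1
  gives g(a) = l(a) g(1). With \<open>l\<close> the identity this describes linear endomorphisms,
  with \<open>l\<close> a monoid morphism the A-linear maps into \<open>Z\<close>.\<close>

lemma linear_eq_emul:
  assumes A: "comm_monoid_ob C A" and Z: "comm_monoid_ob C Z"
    and l: "l \<in> thom (Car A) (Car Z)" and g: "g \<in> thom (Car A) (Car Z)" "g \<bullet> mulT A = mulT Z \<bullet> (g \<boxtimes> l)"
  shows "g = emul Z (self_module Z) (g \<bullet> uniT A) \<bullet> l"
proof -
  note [simp] = monoidD(1-3)[OF A] monoidD(1-3)[OF Z] g(1)[simplified] l[simplified]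
  have "g \<bullet> mulT A = (g \<bullet> mulT A) \<bullet> brd (Car A) (Car A)"
    using monoidD(7)[OF A] by simp
  then have gl: "g \<bullet> mulT A = mulT Z \<bullet> (l \<boxtimes> g)"
    using mul_swap[OF Z, of l g] g(2) by simp
  have "g = g \<bullet> (mulT A \<bullet> ((idn (Car A) \<boxtimes> uniT A) \<bullet> iarr (run (Car A))))"
    using act_section[OF A module_self[OF A]] by simp
  also have "\<dots> = mulT Z \<bullet> ((l \<boxtimes> g) \<bullet> ((idn (Car A) \<boxtimes> uniT A) \<bullet> iarr (run (Car A))))"
    using reassoc[OF gl, of "(idn (Car A) \<boxtimes> uniT A) \<bullet> iarr (run (Car A))"] by simp
  also have "\<dots> = mulT Z \<bullet> ((idn (Car Z) \<boxtimes> (g \<bullet> uniT A)) \<bullet> ((l \<boxtimes> idn (Unit C)) \<bullet> iarr (run (Car A))))"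
    by (simp add: ten_comp2)
  also have "\<dots> = emul Z (self_module Z) (g \<bullet> uniT A) \<bullet> l"
    by (simp add: iarr_run_nat emul_def)
  finally show ?thesis .
qed

lemma Hom_Modules_Hom: "h \<in> Hom (Modules C A) M N \<Longrightarrow> h \<in> Hom C (MCar M) (MCar N)"
  by (simp add: Modules_def)

lemma linear_comp:
  assumes "Car A \<in> Ob C" "arr (actT A M)" "arr (actT A N)" "arr (actT A P)"
    and h: "h \<in> thom (MCar M) (MCar N)" "h \<bullet> actT A M = actT A N \<bullet> (h \<boxtimes> idn (Car A))"
    and k: "k \<in> thom (MCar N) (MCar P)" "k \<bullet> actT A N = actT A P \<bullet> (k \<boxtimes> idn (Car A))"
  shows "(k \<bullet> h) \<bullet> actT A M = actT A P \<bullet> ((k \<bullet> h) \<boxtimes> idn (Car A))"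
proof -
  note [simp] = assms(1-4) h(1)[simplified] k(1)[simplified]
  have "(k \<bullet> h) \<bullet> actT A M = (k \<bullet> actT A N) \<bullet> (h \<boxtimes> idn (Car A))"
    using h(2) by simp
  then show ?thesis
    unfolding k(2) by (simp add: ten_comp)
qed

lemma category_Modules:
  assumes A: "comm_monoid_ob C A"
  shows "category (Modules C A)"
proof -
  note A_Ob = monoidD(1)[OF A]
  note mD = moduleD(1,2)[OF _ A_Ob]
  have comp: "g \<cdot> f \<in> Hom (Modules C A) M P"
    if m: "module_ob C A M" "module_ob C A N" "module_ob C A P"
      and f: "f \<in> Hom (Modules C A) M N" and g: "g \<in> Hom (Modules C A) N P" for M N P f g
  proof -
    note m' = mD[OF m(1)] mD[OF m(2)] mD[OF m(3)]
    note f' = f[unfolded Hom_Modules[OF m'(1,3)]] and g' = g[unfolded Hom_Modules[OF m'(3,5)]]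
    have "Arr (MCar N) g (MCar P) \<bullet> Arr (MCar M) f (MCar N) = Arr (MCar M) (g \<cdot> f) (MCar P)"
      by (simp add: tcomp_def)
    then show ?thesis
      using linear_comp[OF A_Ob m'(2,4,6), of "Arr (MCar M) f (MCar N)" "Arr (MCar N) g (MCar P)"]
        f' g' arr_comp[of "Arr (MCar M) f (MCar N)" "Arr (MCar N) g (MCar P)"]
      by (simp add: Hom_Modules[OF m'(1,5)])
  qed
  have idn: "Id C (MCar M) \<in> Hom (Modules C A) M M" if "module_ob C A M" for M
    using mD[OF that] A_Ob by (simp add: Hom_Modules flip: idn_def)
  have H: "f \<in> Hom C (MCar M) (MCar N)" if "f \<in> Hom (Modules C A) M N" for f M N
    using that by (rule Hom_Modules_Hom)
  show ?thesis
  proof unfold_locales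
    fix M N f assume "M \<in> Ob (Modules C A)" "N \<in> Ob (Modules C A)" "f \<in> Hom (Modules C A) M N"
    then show "f \<cdot>\<^bsub>Modules C A\<^esub> Id (Modules C A) M = f"
      "Id (Modules C A) N \<cdot>\<^bsub>Modules C A\<^esub> f = f"
      using Comp_Id_right[OF _ _ H[of f M N]] Comp_Id_left[OF _ _ H[of f M N]] mD by simp_all
  next
    fix M N P Q f g h
    assume "M \<in> Ob (Modules C A)" "N \<in> Ob (Modules C A)" "P \<in> Ob (Modules C A)" "Q \<in> Ob (Modules C A)"
      "f \<in> Hom (Modules C A) M N" "g \<in> Hom (Modules C A) N P" "h \<in> Hom (Modules C A) P Q"
    then show "(h \<cdot>\<^bsub>Modules C A\<^esub> g) \<cdot>\<^bsub>Modules C A\<^esub> f = h \<cdot>\<^bsub>Modules C A\<^esub> (g \<cdot>\<^bsub>Modules C A\<^esub> f)"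
      using Comp_assoc[OF _ _ _ _ H[of f M N] H[of g N P] H[of h P Q]] mD by simp
  qed (use comp idn in simp_all)
qed

end

section \<open>Chain colimits of modules compared with those of \<open>C\<close>\<close>

context algebraic_context
begin

text \<open>The localisation is a colimit of modules, while arguments with tensor products need a
  colimit in \<open>C\<close>. The colimit \<open>X\<close> of the chain in \<open>C\<close> carries
  an action because tensoring with \<open>A\<close> preserves it. The two universal properties then
  give arrows both ways between \<open>X\<close> and the given \<open>N\<close>, and these are
  inverse to each other.\<close>

lemma scol_Modules:
  assumes A: "comm_monoid_ob C A" and M: "module_ob C A M" and s: "s \<in> Hom (Modules C A) M M"
    and c: "is_colimit nat_chain (Modules C A) (endo_chain (Modules C A) M s) N \<kappa>"
  shows "scol (Arr (MCar M) s (MCar M)) (MCar N) (\<lambda>n. Arr (MCar M) (\<kappa> n) (MCar N))"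
proof -
  interpret Mod: category "Modules C A" by (rule category_Modules[OF A])
  note A_Ob = monoidD(1)[OF A]
  let ?A = "Car A" and ?M = "MCar M" and ?a = "actT A M" and ?m = "mulT A" and ?u = "uniT A"
  define S where "S = Arr ?M s ?M"
  define K where "K n = Arr ?M (\<kappa> n) (MCar N)" for n
  note [simp] = monoidD(1-3)[OF A] moduleD(1,2)[OF M A_Ob]
  have S_st [simp]: "src S = ?M" "tgt S = ?M" by (simp_all add: S_def)
  have [simp]: "arr S" and Sl: "S \<bullet> ?a = ?a \<bullet> (S \<boxtimes> idn ?A)"
    using s by (simp_all add: Hom_Modules S_def)
  have cc: "chain_cocone (Modules C A) M s N \<kappa>"
    and univ: "\<And>P \<mu>. chain_cocone (Modules C A) M s P \<mu> \<Longrightarrow>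
      \<exists>!h. h \<in> Hom (Modules C A) N P \<and> (\<forall>n. h \<cdot> \<kappa> n = \<mu> n)"
    using c M s by (simp_all add: Mod.is_colimit_endo_chain)
  have N: "module_ob C A N" using cc by (simp add: chain_cocone_def)
  note [simp] = moduleD(1,2)[OF N A_Ob]
  have K [simp]: "arr (K n)" "src (K n) = ?M" "tgt (K n) = MCar N"
    and Kl: "K n \<bullet> ?a = actT A N \<bullet> (K n \<boxtimes> idn ?A)" and KS: "K (Suc n) \<bullet> S = K n" for n
    using cc by (simp_all add: chain_cocone_def Hom_Modules K_def S_def) (simp add: tcomp_def)
  obtain X \<chi> where X: "scol S X \<chi>" by (rule scol_exists[where s = S]) (simp, simp, rule that)
  have [simp]: "X \<in> Ob C" "arr (\<chi> n)" "src (\<chi> n) = ?M" "tgt (\<chi> n) = X" and \<chi>S: "\<chi> (Suc n) \<bullet> S = \<chi> n" for n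
    using scolD(3)[OF X] scolD(4,5)[OF X, of n] by simp_all
  note XA = scol_rten[OF X A_Ob]
  obtain b where b [simp]: "arr b" "src b = X \<odot> ?A" "tgt b = X" and b\<chi>: "\<And>n. b \<bullet> (\<chi> n \<boxtimes> idn ?A) = \<chi> n \<bullet> ?a"
  proof (rule scol_factor[OF XA, of X "\<lambda>n. \<chi> n \<bullet> ?a"])
    show "(\<chi> (Suc n) \<bullet> ?a) \<bullet> (S \<boxtimes> idn ?A) = \<chi> n \<bullet> ?a" for n
      using reassoc[OF \<chi>S[of n], of ?a] by (simp add: Sl)
  qed auto
  define P where "P = \<lparr>MCar = X, Act = raw b\<rparr>"
  have P_simps [simp]: "MCar P = X" "actT A P = b"
    using b by (simp_all add: P_def actT_def tarrow_eq)
  have P: "module_ob C A P"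
    unfolding module_ob_iff[OF A_Ob] P_simps
  proof (intro conjI)
    show "b \<bullet> (b \<boxtimes> idn ?A) = b \<bullet> ((idn X \<boxtimes> ?m) \<bullet> asc X ?A ?A)"
    proof (rule scol_unique[OF scol_rten[OF XA A_Ob], of _ X])
      fix n
      have "(b \<bullet> (b \<boxtimes> idn ?A)) \<bullet> ((\<chi> n \<boxtimes> idn ?A) \<boxtimes> idn ?A) = b \<bullet> ((\<chi> n \<boxtimes> idn ?A) \<bullet> (?a \<boxtimes> idn ?A))"
        by (simp add: ten_comp b\<chi>)
      also have "\<dots> = \<chi> n \<bullet> ?a \<bullet> (?a \<boxtimes> idn ?A)"
        using reassoc[OF b\<chi>[of n], of "?a \<boxtimes> idn ?A"] by simp
      also have "\<dots> = \<chi> n \<bullet> ?a \<bullet> (idn ?M \<boxtimes> ?m) \<bullet> asc ?M ?A ?A"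
        by (simp add: moduleD(3)[OF M A_Ob])
      also have "\<dots> = b \<bullet> ((\<chi> n \<boxtimes> idn ?A) \<bullet> ((idn ?M \<boxtimes> ?m) \<bullet> asc ?M ?A ?A))"
        using reassoc[OF b\<chi>[of n], of "(idn ?M \<boxtimes> ?m) \<bullet> asc ?M ?A ?A"] by simp
      also have "\<dots> = b \<bullet> ((idn X \<boxtimes> ?m) \<bullet> ((\<chi> n \<boxtimes> (idn ?A \<boxtimes> idn ?A)) \<bullet> asc ?M ?A ?A))"
        by (simp add: ten_comp2)
      also have "\<dots> = (b \<bullet> ((idn X \<boxtimes> ?m) \<bullet> asc X ?A ?A)) \<bullet> ((\<chi> n \<boxtimes> idn ?A) \<boxtimes> idn ?A)"
        using asc_nat[of "\<chi> n" "idn ?A" "idn ?A" X ?A ?A] by simp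
      finally show "(b \<bullet> (b \<boxtimes> idn ?A)) \<bullet> ((\<chi> n \<boxtimes> idn ?A) \<boxtimes> idn ?A) =
        (b \<bullet> ((idn X \<boxtimes> ?m) \<bullet> asc X ?A ?A)) \<bullet> ((\<chi> n \<boxtimes> idn ?A) \<boxtimes> idn ?A)" .
    qed simp_all
    show "b \<bullet> (idn X \<boxtimes> ?u) = run X"
    proof (rule scol_unique[OF scol_rten[OF X Unit_in_Ob], of _ X])
      fix n
      have "(b \<bullet> (idn X \<boxtimes> ?u)) \<bullet> (\<chi> n \<boxtimes> idn (Unit C)) = b \<bullet> ((\<chi> n \<boxtimes> idn ?A) \<bullet> (idn ?M \<boxtimes> ?u))"
        by (simp add: ten_comp)
      also have "\<dots> = \<chi> n \<bullet> run ?M"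
        using reassoc[OF b\<chi>[of n], of "idn ?M \<boxtimes> ?u"] by (simp add: moduleD(4)[OF M A_Ob])
      finally show "(b \<bullet> (idn X \<boxtimes> ?u)) \<bullet> (\<chi> n \<boxtimes> idn (Unit C)) = run X \<bullet> (\<chi> n \<boxtimes> idn (Unit C))"
        by (simp add: run_nat)
    qed simp_all
  qed simp_all
  have raw_Arr: "Arr (src f) (raw f) (tgt f) = f" for f :: "('o, 'a) tarrow"
    by (cases f) simp
  have "chain_cocone (Modules C A) M s P (\<lambda>n. raw (\<chi> n))"
    unfolding chain_cocone_def
  proof (intro conjI allI)
    show "raw (\<chi> n) \<in> Hom (Modules C A) M P" for n
      using raw_Arr[of "\<chi> n"] b\<chi> by (simp add: Hom_Modules)
    show "raw (\<chi> (Suc n)) \<cdot>\<^bsub>Modules C A\<^esub> s = raw (\<chi> n)" for n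
      using arg_cong[OF \<chi>S[of n], of raw] by (simp add: raw_simps S_def)
  qed (simp add: P)
  from univ[OF this] obtain h where h: "h \<in> Hom (Modules C A) N P \<and> (\<forall>n. h \<cdot> \<kappa> n = raw (\<chi> n))"
    by (elim ex1E)
  define H where "H = Arr (MCar N) h X"
  have H [simp]: "arr H" "src H = MCar N" "tgt H = X" and Hl: "H \<bullet> actT A N = b \<bullet> (H \<boxtimes> idn ?A)"
    using h by (simp_all add: H_def Hom_Modules)
  have HK: "H \<bullet> K n = \<chi> n" for n
    using h by (simp add: tarrow_eq raw_simps) (simp add: H_def K_def)
  obtain G where G [simp]: "arr G" "src G = X" "tgt G = MCar N" and G\<chi>: "\<And>n. G \<bullet> \<chi> n = K n"
    by (rule scol_factor[OF X, of "MCar N" K]) (auto simp: KS)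
  \<comment> \<open>Uniqueness for \<open>N\<close> holds among module maps, so \<open>G\<close>,
    which comes from the universal property in \<open>C\<close>, has to be shown linear before
    \<open>G \<bullet> H\<close> can be compared with the identity.\<close>
  have Gl: "G \<bullet> b = actT A N \<bullet> (G \<boxtimes> idn ?A)"
  proof (rule scol_unique[OF XA, of _ "MCar N"])
    fix n
    have "(G \<bullet> b) \<bullet> (\<chi> n \<boxtimes> idn ?A) = K n \<bullet> ?a"
      using reassoc[OF G\<chi>[of n], of ?a] by (simp add: b\<chi>)
    then show "(G \<bullet> b) \<bullet> (\<chi> n \<boxtimes> idn ?A) = (actT A N \<bullet> (G \<boxtimes> idn ?A)) \<bullet> (\<chi> n \<boxtimes> idn ?A)"
      by (simp add: ten_comp G\<chi> Kl)
  qed simp_all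
  have "H \<bullet> G = idn X"
    by (rule scol_unique[OF X, of _ X]) (simp_all add: G\<chi> HK)
  moreover have "G \<bullet> H = idn (MCar N)"
  proof -
    have GH: "G \<bullet> H \<in> thom (MCar N) (MCar N)" "(G \<bullet> H) \<bullet> actT A N = actT A N \<bullet> ((G \<bullet> H) \<boxtimes> idn ?A)"
      using linear_comp[OF A_Ob, of N P N H G] by (simp_all add: Hl Gl)
    obtain k where k: "\<forall>h. h \<in> Hom (Modules C A) N N \<and> (\<forall>n. h \<cdot> \<kappa> n = \<kappa> n) \<longrightarrow> h = k"
      using univ[OF cc] by (elim ex1E)
    have "(G \<bullet> H) \<bullet> K n = K n" for n
      by (simp add: HK G\<chi>)
    then have "raw (G \<bullet> H) \<cdot> raw (K n) = raw (K n)" for n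
      unfolding raw_simps(1)[symmetric] by simp
    then have "raw (G \<bullet> H) = k"
      using k GH raw_Arr[of "G \<bullet> H"] by (simp add: Hom_Modules K_def)
    moreover have "Id C (MCar N) \<cdot> \<kappa> n = \<kappa> n" for n
      using cc by (intro Comp_Id_left[of ?M]) (simp_all add: chain_cocone_def Hom_Modules_Hom[of _ A])
    then have "Id C (MCar N) = k"
      using k Mod.Id_in_Hom[of N] N by simp
    ultimately show ?thesis by (simp add: tarrow_eq raw_simps)
  qed
  ultimately have "inv_pair G H" by (simp add: inv_pair_def)
  from qcol_iso[OF X this] show ?thesis
    by (simp add: G\<chi> S_def K_def)
qed

text \<open>The converse passage: an arrow out of the colimit in \<open>C\<close> that restricts to
  linear maps on the stages is linear, since the stages remain jointly epic after tensoring with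
  \<open>A\<close>.\<close>

lemma is_colimit_Modules:
  assumes A: "comm_monoid_ob C A" and M: "module_ob C A M" and N: "module_ob C A N"
    and s: "s \<in> Hom (Modules C A) M M" and \<kappa>: "\<And>n. \<kappa> n \<in> Hom (Modules C A) M N"
    and c: "scol (Arr (MCar M) s (MCar M)) (MCar N) (\<lambda>n. Arr (MCar M) (\<kappa> n) (MCar N))"
  shows "is_colimit nat_chain (Modules C A) (endo_chain (Modules C A) M s) N \<kappa>"
proof -
  interpret Mod: category "Modules C A" by (rule category_Modules[OF A])
  note A_Ob = monoidD(1)[OF A]
  let ?A = "Car A"
  define K where "K n = Arr (MCar M) (\<kappa> n) (MCar N)" for n
  note [simp] = monoidD(1-3)[OF A] moduleD(1,2)[OF M A_Ob] moduleD(1,2)[OF N A_Ob]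
  note c' = c[folded K_def]
  have K [simp]: "arr (K n)" "src (K n) = MCar M" "tgt (K n) = MCar N"
    and Kl: "K n \<bullet> actT A M = actT A N \<bullet> (K n \<boxtimes> idn ?A)" for n
    using \<kappa>[of n] by (simp_all add: Hom_Modules K_def)
  have "\<kappa> (Suc n) \<cdot> s = \<kappa> n" for n
    using arg_cong[OF scolD(5)[OF c, of n], of raw] by (simp add: raw_simps)
  then have "chain_cocone (Modules C A) M s N \<kappa>"
    using \<kappa> N by (simp add: chain_cocone_def)
  moreover have "\<exists>!h. h \<in> Hom (Modules C A) N P \<and> (\<forall>n. h \<cdot>\<^bsub>Modules C A\<^esub> \<kappa> n = \<mu> n)"
    if m: "chain_cocone (Modules C A) M s P \<mu>" for P \<mu>
  proof -
    have P: "module_ob C A P" using m by (simp add: chain_cocone_def)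
    note [simp] = moduleD(1,2)[OF P A_Ob]
    define D where "D n = Arr (MCar M) (\<mu> n) (MCar P)" for n
    have D [simp]: "arr (D n)" "src (D n) = MCar M" "tgt (D n) = MCar P"
      and Dl: "D n \<bullet> actT A M = actT A P \<bullet> (D n \<boxtimes> idn ?A)"
      and DS: "D (Suc n) \<bullet> Arr (MCar M) s (MCar M) = D n" for n
      using m by (simp_all add: chain_cocone_def Hom_Modules D_def) (simp add: tcomp_def)
    obtain G where G [simp]: "arr G" "src G = MCar N" "tgt G = MCar P" and GK: "\<And>n. G \<bullet> K n = D n"
      by (rule scol_factor[OF c', of "MCar P" D]) (auto simp: DS)
    have Gl: "G \<bullet> actT A N = actT A P \<bullet> (G \<boxtimes> idn ?A)"
    proof (rule scol_unique[OF scol_rten[OF c' A_Ob], of _ "MCar P"])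
      fix n
      have "(G \<bullet> actT A N) \<bullet> (K n \<boxtimes> idn ?A) = D n \<bullet> actT A M"
        using reassoc[OF GK[of n], of "actT A M"] by (simp flip: Kl)
      then show "(G \<bullet> actT A N) \<bullet> (K n \<boxtimes> idn ?A) = (actT A P \<bullet> (G \<boxtimes> idn ?A)) \<bullet> (K n \<boxtimes> idn ?A)"
        by (simp add: ten_comp GK Dl)
    qed simp_all
    have G_Arr: "Arr (MCar N) (raw G) (MCar P) = G" by (simp add: tarrow_eq)
    show ?thesis
    proof (intro ex1I[of _ "raw G"] conjI allI)
      show "raw G \<in> Hom (Modules C A) N P"
        by (simp add: Hom_Modules G_Arr Gl)
      show "raw G \<cdot>\<^bsub>Modules C A\<^esub> \<kappa> n = \<mu> n" for n
        using arg_cong[OF GK[of n], of raw] by (simp add: raw_simps) (simp add: K_def D_def)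
      fix k assume k: "k \<in> Hom (Modules C A) N P \<and> (\<forall>n. k \<cdot>\<^bsub>Modules C A\<^esub> \<kappa> n = \<mu> n)"
      have "Arr (MCar N) k (MCar P) = G"
      proof (rule scol_unique[OF c', of _ "MCar P"])
        fix n show "Arr (MCar N) k (MCar P) \<bullet> K n = G \<bullet> K n"
          using k unfolding GK by (simp add: K_def D_def tcomp_def)
      qed (use k in \<open>simp_all add: Hom_Modules\<close>)
      then show "k = raw G" by auto
    qed
  qed
  ultimately show ?thesis
    using M s by (simp add: Mod.is_colimit_endo_chain)
qed

end

section \<open>The localisation\<close>

text \<open>Tensoring preserves the chain colimits in each variable separately. This is how
  identities between bilinear maps are reduced to pairs of stages.\<close>

lemma (in algebraic_context) scol_ten_unique:
  assumes c: "scol s L \<kappa>" and c': "scol s' L' \<kappa>'"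
    and x: "x \<in> thom (L \<odot> L') Z" and y: "y \<in> thom (L \<odot> L') Z"
    and eq: "\<And>m n. x \<bullet> (\<kappa> m \<boxtimes> \<kappa>' n) = y \<bullet> (\<kappa> m \<boxtimes> \<kappa>' n)"
  shows "x = y"
proof (rule scol_unique[OF scol_rten[OF c scolD(3)[OF c']] x y])
  note [simp] = x[simplified] y[simplified] scolD(1-3)[OF c] scolD(1-3)[OF c']
    scolD(4)[OF c, simplified] scolD(4)[OF c', simplified]
  fix m
  show "x \<bullet> (\<kappa> m \<boxtimes> idn L') = y \<bullet> (\<kappa> m \<boxtimes> idn L')"
  proof (rule scol_unique[OF scol_lten[OF c', of "src s"], of _ Z])
    fix n
    show "(x \<bullet> (\<kappa> m \<boxtimes> idn L')) \<bullet> (idn (src s) \<boxtimes> \<kappa>' n) = (y \<bullet> (\<kappa> m \<boxtimes> idn L')) \<bullet> (idn (src s) \<boxtimes> \<kappa>' n)"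
      using eq[of m n] by (simp add: ten_comp)
  qed simp_all
qed

text \<open>\<open>T\<close> and \<open>F\<close> are t and its localisation morphism as typed
  arrows. \<open>\<iota>_linear\<close> is A-linearity for the action of \<open>A\<close> on
  \<open>B\<close> through \<open>F\<close>, and \<open>\<iota>_col\<close> is a colimit in
  \<open>C\<close> rather than one of modules.\<close>

locale localisation = algebraic_context C U
  for C :: "('o, 'a, 'm) smcat_scheme" (structure) and U :: "'i itself" +
  fixes A B :: "('o, 'a) cmon" and T F :: "('o, 'a) tarrow" and \<iota> :: "nat \<Rightarrow> ('o, 'a) tarrow"
  assumes monoid_A: "comm_monoid_ob C A" and monoid_B: "comm_monoid_ob C B"
    and T_thom: "T \<in> thom (Car A) (Car A)" and T_linear: "T \<bullet> mulT A = mulT A \<bullet> (T \<boxtimes> idn (Car A))"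
    and F_thom: "F \<in> thom (Car A) (Car B)" and F_mul: "F \<bullet> mulT A = mulT B \<bullet> (F \<boxtimes> F)"
    and F_uni: "F \<bullet> uniT A = uniT B"
    and \<iota>_linear: "\<And>n. \<iota> n \<bullet> mulT A = mulT B \<bullet> (\<iota> n \<boxtimes> F)" and \<iota>_0: "\<iota> 0 = F"
    and \<iota>_col: "scol T (Car B) \<iota>"
begin

lemmas A_simps [simp] = monoidD(1-3)[OF monoid_A]
lemmas B_simps [simp] = monoidD(1-3)[OF monoid_B]
lemmas T_simps [simp] = T_thom[simplified]
lemmas F_simps [simp] = F_thom[simplified]

lemma \<iota>_simps [simp]: "arr (\<iota> n)" "src (\<iota> n) = Car A" "tgt (\<iota> n) = Car B"
  using scolD(4)[OF \<iota>_col, of n] by simp_all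

lemma \<iota>_T: "\<iota> (Suc n) \<bullet> T = \<iota> n"
  using scolD(5)[OF \<iota>_col] .

text \<open>
  As \<open>\<iota> 1 \<bullet> T = \<iota> 0 = F\<close>, the unit of the copy of \<open>A\<close> with index 1 is inverse to the image of \<open>T\<close>.
\<close>

definition inv_T :: "('o, 'a) tarrow" where
  "inv_T = emul B (self_module B) (\<iota> 1 \<bullet> uniT A)"

lemma inv_T_simps [simp]: "arr inv_T" "src inv_T = Car B" "tgt inv_T = Car B"
  using arr_emul[OF monoid_B module_self[OF monoid_B]] by (simp_all add: inv_T_def)

lemma inv_T_linear:
  "inv_T \<bullet> mulT B = mulT B \<bullet> (idn (Car B) \<boxtimes> inv_T)"
  "inv_T \<bullet> mulT B = mulT B \<bullet> (inv_T \<boxtimes> idn (Car B))"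
  using emul_self_linear[OF monoid_B, of "\<iota> 1 \<bullet> uniT A"] by (simp_all add: inv_T_def)

lemma \<iota>_emul: "\<iota> n = emul B (self_module B) (\<iota> n \<bullet> uniT A) \<bullet> F"
  using linear_eq_emul[OF monoid_A monoid_B F_thom _ \<iota>_linear] by simp

lemma inv_T_F: "inv_T \<bullet> F \<bullet> T = F"
proof -
  have "inv_T \<bullet> F = \<iota> 1"
    unfolding inv_T_def by (rule \<iota>_emul[symmetric])
  from reassoc[OF this, of T] show ?thesis using \<iota>_T[of 0] by (simp add: \<iota>_0)
qed

text \<open>Write \<open>\<iota> n\<close> as \<open>\<iota> (Suc n) \<bullet> T\<close>, and
  \<open>\<iota> (Suc n)\<close> as a multiplication \<open>?e\<close> after \<open>F\<close>.
  Multiplications commute, so \<open>inv_T\<close> moves past \<open>?e\<close> and cancels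
  \<open>T\<close> by \<open>inv_T_F\<close>.\<close>

lemma \<iota>_Suc: "\<iota> (Suc n) = inv_T \<bullet> \<iota> n"
proof -
  let ?e = "emul B (self_module B) (\<iota> (Suc n) \<bullet> uniT A)"
  have e [simp]: "arr ?e"
    using arr_emul[OF monoid_B module_self[OF monoid_B]] by simp
  have "inv_T \<bullet> \<iota> n = inv_T \<bullet> ?e \<bullet> F \<bullet> T"
    using \<iota>_emul[of "Suc n"] \<iota>_T[of n] by (metis F_simps T_simps comp_assoc e emul_src_tgt self_module_simps(1))
  also have "inv_T \<bullet> ?e = ?e \<bullet> inv_T"
    by (rule linear_endo_commute[OF monoid_B])
      (simp_all add: inv_T_linear(1)[symmetric] emul_self_linear(1)[OF monoid_B, symmetric])
  then have "inv_T \<bullet> ?e \<bullet> F \<bullet> T = ?e \<bullet> inv_T \<bullet> F \<bullet> T"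
    using reassoc[of inv_T ?e "?e \<bullet> inv_T" "F \<bullet> T"] by simp
  also have "\<dots> = \<iota> (Suc n)"
    using \<iota>_emul[of "Suc n"] by (simp add: inv_T_F)
  finally show ?thesis by simp
qed

lemma mul_\<iota>: "mulT B \<bullet> (\<iota> m \<boxtimes> \<iota> n) = \<iota> (m + n) \<bullet> mulT A"
proof (induction m)
  case 0
  show ?case
  proof (induction n)
    case 0
    show ?case by (simp add: \<iota>_0 F_mul)
  next
    case (Suc n)
    have "mulT B \<bullet> (\<iota> 0 \<boxtimes> \<iota> (Suc n)) = (mulT B \<bullet> (idn (Car B) \<boxtimes> inv_T)) \<bullet> (\<iota> 0 \<boxtimes> \<iota> n)"
      by (simp add: \<iota>_Suc ten_comp)
    also have "\<dots> = inv_T \<bullet> (mulT B \<bullet> (\<iota> 0 \<boxtimes> \<iota> n))"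
      unfolding inv_T_linear(1)[symmetric] by simp
    finally show ?case using Suc by (simp add: \<iota>_Suc)
  qed
next
  case (Suc m)
  have "mulT B \<bullet> (\<iota> (Suc m) \<boxtimes> \<iota> n) = (mulT B \<bullet> (inv_T \<boxtimes> idn (Car B))) \<bullet> (\<iota> m \<boxtimes> \<iota> n)"
    by (simp add: \<iota>_Suc ten_comp)
  also have "\<dots> = inv_T \<bullet> (mulT B \<bullet> (\<iota> m \<boxtimes> \<iota> n))"
    unfolding inv_T_linear(2)[symmetric] by simp
  finally show ?case using Suc by (simp add: \<iota>_Suc)
qed

text \<open>On the stages, \<open>G\<close> and \<open>H\<close> are multiplications by elements of
  \<open>Z\<close> after their common restriction \<open>G \<bullet> F\<close>. The induction passes
  from one stage to the next by cancelling \<open>T\<close>, whose image in \<open>Z\<close> is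
  invertible.\<close>

lemma epi:
  assumes Z: "comm_monoid_ob C Z"
    and G: "G \<in> thom (Car B) (Car Z)" "G \<bullet> mulT B = mulT Z \<bullet> (G \<boxtimes> G)"
    and H: "H \<in> thom (Car B) (Car Z)" "H \<bullet> mulT B = mulT Z \<bullet> (H \<boxtimes> H)"
    and eq: "G \<bullet> F = H \<bullet> F"
  shows "G = H"
proof -
  note [simp] = monoidD(1-3)[OF Z] G(1)[simplified] H(1)[simplified]
  have lin: "(G \<bullet> \<iota> n) \<bullet> mulT A = mulT Z \<bullet> ((G \<bullet> \<iota> n) \<boxtimes> (G \<bullet> F))"
    if [simp]: "arr G" "src G = Car B" "tgt G = Car Z" and G2: "G \<bullet> mulT B = mulT Z \<bullet> (G \<boxtimes> G)" for G n
    using reassoc[OF G2, of "\<iota> n \<boxtimes> F"] by (simp add: \<iota>_linear ten_comp)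
  have comm: "emul Z (self_module Z) x \<bullet> emul Z (self_module Z) y = emul Z (self_module Z) y \<bullet> emul Z (self_module Z) x"
    if "x \<in> thom (Unit C) (Car Z)" "y \<in> thom (Unit C) (Car Z)" for x y
    using that by (intro linear_endo_commute[OF Z])
      (simp_all add: emul_self_linear(1)[OF Z, symmetric] arr_emul[OF Z module_self[OF Z]])
  let ?R = "\<lambda>x. emul Z (self_module Z) (x \<bullet> uniT A)"
  have R [simp]: "arr (?R x)" if "x \<in> thom (Car A) (Car Z)" for x
    using that by (intro arr_emul[OF Z module_self[OF Z]]) simp
  have GR: "G \<bullet> \<iota> n = ?R (G \<bullet> \<iota> n) \<bullet> G \<bullet> F" and HR: "H \<bullet> \<iota> n = ?R (H \<bullet> \<iota> n) \<bullet> G \<bullet> F" for n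
  proof -
    have G': "(G \<bullet> \<iota> n) \<bullet> mulT A = mulT Z \<bullet> ((G \<bullet> \<iota> n) \<boxtimes> (G \<bullet> F))"
      by (rule lin[OF _ _ _ G(2)]) simp_all
    show "G \<bullet> \<iota> n = ?R (G \<bullet> \<iota> n) \<bullet> G \<bullet> F"
      by (rule linear_eq_emul[OF monoid_A Z _ _ G']) simp_all
    have H': "(H \<bullet> \<iota> n) \<bullet> mulT A = mulT Z \<bullet> ((H \<bullet> \<iota> n) \<boxtimes> (G \<bullet> F))"
      unfolding eq by (rule lin[OF _ _ _ H(2)]) simp_all
    show "H \<bullet> \<iota> n = ?R (H \<bullet> \<iota> n) \<bullet> G \<bullet> F"
      by (rule linear_eq_emul[OF monoid_A Z _ _ H']) simp_all
  qed
  have step: "G \<bullet> \<iota> (Suc n) = H \<bullet> \<iota> (Suc n)" if IH: "G \<bullet> \<iota> n = H \<bullet> \<iota> n" for n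
  proof -
    \<comment> \<open>\<open>e\<close> is multiplication by the image under \<open>G\<close> of the
      unit at stage 1, that is, by the inverse of t in \<open>Z\<close>. It commutes with
      \<open>x\<close> and \<open>y\<close> and cancels \<open>T\<close>
      (\<open>elT\<close>).\<close>
    define e x y where "e = ?R (G \<bullet> \<iota> 1)" and "x = ?R (G \<bullet> \<iota> (Suc n))" and "y = ?R (H \<bullet> \<iota> (Suc n))"
    have [simp]: "arr e" "arr x" "arr y"
      unfolding e_def x_def y_def by (rule R; simp)+
    have [simp]: "src e = Car Z" "tgt e = Car Z" "src x = Car Z" "tgt x = Car Z"
      "src y = Car Z" "tgt y = Car Z"
      by (simp_all add: e_def x_def y_def)
    have ex: "x \<bullet> e = e \<bullet> x" and ey: "y \<bullet> e = e \<bullet> y"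
      unfolding e_def x_def y_def by (rule comm; simp)+
    have xl: "x \<bullet> G \<bullet> F = G \<bullet> \<iota> (Suc n)" and yl: "y \<bullet> G \<bullet> F = H \<bullet> \<iota> (Suc n)"
      and el: "e \<bullet> G \<bullet> F = G \<bullet> \<iota> 1"
      unfolding e_def x_def y_def by (rule GR[symmetric] HR[symmetric])+
    have elT: "e \<bullet> G \<bullet> F \<bullet> T = G \<bullet> F"
      using reassoc[OF el, of T] \<iota>_T[of 0] by (simp add: \<iota>_0)
    have xy: "x \<bullet> G \<bullet> F \<bullet> T = y \<bullet> G \<bullet> F \<bullet> T"
      using reassoc[OF xl, of T] reassoc[OF yl, of T] IH by (simp add: \<iota>_T)
    have "x \<bullet> G \<bullet> F = x \<bullet> e \<bullet> G \<bullet> F \<bullet> T" by (simp add: elT)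
    also have "\<dots> = e \<bullet> x \<bullet> G \<bullet> F \<bullet> T" using reassoc[OF ex, of "G \<bullet> F \<bullet> T"] by simp
    also have "\<dots> = e \<bullet> y \<bullet> G \<bullet> F \<bullet> T" by (simp add: xy)
    also have "\<dots> = y \<bullet> e \<bullet> G \<bullet> F \<bullet> T" using reassoc[OF ey, of "G \<bullet> F \<bullet> T"] by simp
    also have "\<dots> = y \<bullet> G \<bullet> F" by (simp add: elT)
    finally show ?thesis by (simp only: xl yl)
  qed
  have "G \<bullet> \<iota> n = H \<bullet> \<iota> n" for n
    by (induction n) (use eq step in \<open>simp_all add: \<iota>_0\<close>)
  then show ?thesis
    by (intro scol_unique[OF \<iota>_col, of G "Car Z" H]) simp_all
qed

text \<open>The last hypothesis on \<open>e\<close> says that it inverts the image of t in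
  \<open>Z\<close>. The iterates of \<open>e\<close> applied to \<open>l\<close> form a cocone on
  the chain, and they obey the same product rule as the maps \<open>\<iota> n\<close>
  (\<open>mul_\<iota>\<close>), so the induced arrow is multiplicative.\<close>

lemma extension:
  assumes Z: "comm_monoid_ob C Z"
    and l: "l \<in> thom (Car A) (Car Z)" "l \<bullet> mulT A = mulT Z \<bullet> (l \<boxtimes> l)" "l \<bullet> uniT A = uniT Z"
    and e: "e \<in> thom (Car Z) (Car Z)" "e \<bullet> mulT Z = mulT Z \<bullet> (e \<boxtimes> idn (Car Z))" "e \<bullet> l \<bullet> T = l"
  obtains G where "G \<in> thom (Car B) (Car Z)" "G \<bullet> mulT B = mulT Z \<bullet> (G \<boxtimes> G)"
    "G \<bullet> uniT B = uniT Z" "G \<bullet> F = l"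
proof -
  note [simp] = monoidD(1-3)[OF Z] l(1)[simplified] e(1)[simplified]
  have e': "e \<bullet> mulT Z = mulT Z \<bullet> (idn (Car Z) \<boxtimes> e)"
    using linear_swap[OF Z e(1)] e(2) by simp
  define \<mu> where "\<mu> n = ((\<bullet>) e ^^ n) l" for n :: nat
  have \<mu>_0: "\<mu> 0 = l" and \<mu>_Suc: "\<mu> (Suc n) = e \<bullet> \<mu> n" for n
    by (simp_all add: \<mu>_def)
  have \<mu> [simp]: "arr (\<mu> n)" "src (\<mu> n) = Car A" "tgt (\<mu> n) = Car Z" for n
  proof -
    have "arr (\<mu> n) \<and> src (\<mu> n) = Car A \<and> tgt (\<mu> n) = Car Z"
      by (induction n) (simp_all add: \<mu>_0 \<mu>_Suc)
    then show "arr (\<mu> n)" "src (\<mu> n) = Car A" "tgt (\<mu> n) = Car Z" by auto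
  qed
  have \<mu>_T: "\<mu> (Suc n) \<bullet> T = \<mu> n" for n
  proof (induction n)
    case 0
    show ?case using e(3) by (simp add: \<mu>_0 \<mu>_Suc)
  next
    case (Suc n)
    have "\<mu> (Suc (Suc n)) \<bullet> T = e \<bullet> (\<mu> (Suc n) \<bullet> T)"
      by (subst \<mu>_Suc) simp
    then show ?case using Suc by (simp add: \<mu>_Suc)
  qed
  have mul_\<mu>: "mulT Z \<bullet> (\<mu> m \<boxtimes> \<mu> n) = \<mu> (m + n) \<bullet> mulT A" for m n
  proof (induction m)
    case 0
    show ?case
    proof (induction n)
      case 0
      show ?case by (simp add: \<mu>_0 l(2))
    next
      case (Suc n)
      have "mulT Z \<bullet> (\<mu> 0 \<boxtimes> \<mu> (Suc n)) = (mulT Z \<bullet> (idn (Car Z) \<boxtimes> e)) \<bullet> (\<mu> 0 \<boxtimes> \<mu> n)"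
        by (simp add: \<mu>_Suc ten_comp)
      also have "\<dots> = e \<bullet> (mulT Z \<bullet> (\<mu> 0 \<boxtimes> \<mu> n))"
        unfolding e'[symmetric] by simp
      finally show ?case using Suc by (simp add: \<mu>_Suc)
    qed
  next
    case (Suc m)
    have "mulT Z \<bullet> (\<mu> (Suc m) \<boxtimes> \<mu> n) = (mulT Z \<bullet> (e \<boxtimes> idn (Car Z))) \<bullet> (\<mu> m \<boxtimes> \<mu> n)"
      by (simp add: \<mu>_Suc ten_comp)
    also have "\<dots> = e \<bullet> (mulT Z \<bullet> (\<mu> m \<boxtimes> \<mu> n))"
      unfolding e(2)[symmetric] by simp
    finally show ?case using Suc by (simp add: \<mu>_Suc)
  qed
  obtain G where G [simp]: "arr G" "src G = Car B" "tgt G = Car Z" and G\<iota>: "\<And>n. G \<bullet> \<iota> n = \<mu> n"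
    by (rule scol_factor[OF \<iota>_col, of "Car Z" \<mu>]) (auto simp: \<mu>_T)
  have GF: "G \<bullet> F = l" using G\<iota>[of 0] by (simp add: \<iota>_0 \<mu>_0)
  moreover have "G \<bullet> uniT B = uniT Z"
    using reassoc[OF GF, of "uniT A"] by (simp add: F_uni l(3))
  moreover have "G \<bullet> mulT B = mulT Z \<bullet> (G \<boxtimes> G)"
  proof (rule scol_ten_unique[OF \<iota>_col \<iota>_col, of _ "Car Z"])
    fix m n
    have "(G \<bullet> mulT B) \<bullet> (\<iota> m \<boxtimes> \<iota> n) = \<mu> (m + n) \<bullet> mulT A"
      using reassoc[OF G\<iota>[of "m + n"], of "mulT A"] by (simp add: mul_\<iota>)
    then show "(G \<bullet> mulT B) \<bullet> (\<iota> m \<boxtimes> \<iota> n) = (mulT Z \<bullet> (G \<boxtimes> G)) \<bullet> (\<iota> m \<boxtimes> \<iota> n)"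
      by (simp add: ten_comp G\<iota> mul_\<mu>)
  qed simp_all
  ultimately show ?thesis using that[of G] by simp
qed

section \<open>Base change along the localisation\<close>

text \<open>The action of t on a module: \<open>T \<bullet> uniT A\<close> is the element of
  \<open>A\<close> belonging to t, and on \<open>A\<close> itself the formula gives back
  \<open>T\<close> (\<open>emul_T\<close>).\<close>

definition T_on :: "('o, 'a) amod \<Rightarrow> ('o, 'a) tarrow" where
  "T_on M = emul A M (T \<bullet> uniT A)"

lemma T_swap: "T \<bullet> mulT A = mulT A \<bullet> (idn (Car A) \<boxtimes> T)"
  using linear_swap[OF monoid_A T_thom] T_linear by simp

lemma emul_T: "emul A (self_module A) (T \<bullet> uniT A) = T"
proof -
  have "mulT A \<bullet> (idn (Car A) \<boxtimes> (T \<bullet> uniT A)) \<bullet> iarr (run (Car A))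
      = mulT A \<bullet> (idn (Car A) \<boxtimes> T) \<bullet> (idn (Car A) \<boxtimes> uniT A) \<bullet> iarr (run (Car A))"
    by (simp add: ten_comp2)
  also have "\<dots> = T \<bullet> mulT A \<bullet> (idn (Car A) \<boxtimes> uniT A) \<bullet> iarr (run (Car A))"
    using reassoc[OF T_swap[symmetric], of "(idn (Car A) \<boxtimes> uniT A) \<bullet> iarr (run (Car A))"] by simp
  finally show ?thesis
    using act_section[OF monoid_A module_self[OF monoid_A]] by (simp add: emul_def)
qed

text \<open>\<open>act_emul\<close> produces t in the form of a left multiplication, which has to be
  recognised as \<open>T\<close>.\<close>

lemma emul_T_left: "mulT A \<bullet> ((T \<bullet> uniT A) \<boxtimes> idn (Car A)) \<bullet> iarr (lun (Car A)) = T"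
proof -
  have "mulT A \<bullet> ((T \<bullet> uniT A) \<boxtimes> idn (Car A)) \<bullet> iarr (lun (Car A))
      = mulT A \<bullet> (T \<boxtimes> idn (Car A)) \<bullet> (uniT A \<boxtimes> idn (Car A)) \<bullet> iarr (lun (Car A))"
    by (simp add: ten_comp2)
  also have "\<dots> = T \<bullet> mulT A \<bullet> (uniT A \<boxtimes> idn (Car A)) \<bullet> iarr (lun (Car A))"
    using reassoc[OF T_linear[symmetric], of "(uniT A \<boxtimes> idn (Car A)) \<bullet> iarr (lun (Car A))"] by simp
  also have "\<dots> = T"
    using reassoc[OF monoidD(5)[OF monoid_A], of "iarr (lun (Car A))"] by simp
  finally show ?thesis .
qed

lemma T_on_simps [simp]: "src (T_on M) = MCar M" "tgt (T_on M) = MCar M"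
  by (simp_all add: T_on_def)

lemma arr_T_on [simp]: "module_ob C A M \<Longrightarrow> arr (T_on M)"
  using arr_emul[OF monoid_A] by (simp add: T_on_def)

text \<open>In elements, (m a) t = m (a t) and (m t) a = (m a) t. A step in the chain of
  \<open>M\<close> can thus be traded for a step in the chain of \<open>A\<close>.\<close>

lemma T_on_act:
  assumes "module_ob C A M"
  shows "T_on M \<bullet> actT A M = actT A M \<bullet> (idn (MCar M) \<boxtimes> T)"
    and "actT A M \<bullet> (T_on M \<boxtimes> idn (Car A)) = T_on M \<bullet> actT A M"
  using emul_act[OF monoid_A assms, of "T \<bullet> uniT A"] act_emul[OF monoid_A assms, of "T \<bullet> uniT A"]
  by (simp_all add: T_on_def emul_T emul_T_left)

lemma T_on_linear:
  assumes "module_ob C A M" "module_ob C A N"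
    and "h \<in> thom (MCar M) (MCar N)" "h \<bullet> actT A M = actT A N \<bullet> (h \<boxtimes> idn (Car A))"
  shows "h \<bullet> T_on M = T_on N \<bullet> h"
  unfolding T_on_def by (rule emul_linear[OF monoid_A assms]) simp

text \<open>\<open>is_base_change\<close> in terms of typed arrows
  (\<open>is_base_change_iff\<close>). The typing of \<open>R\<close> already makes \<open>Z\<close>
  an object.\<close>

definition bchange :: "('o, 'a) amod \<Rightarrow> ('o, 'a) amod \<Rightarrow> ('o, 'a) tarrow \<Rightarrow> bool" where
  "bchange M N Q \<longleftrightarrow> module_ob C B N \<and> Q \<in> thom (MCar M \<odot> Car B) (MCar N) \<and>
    Q \<bullet> (actT A M \<boxtimes> idn (Car B))
      = Q \<bullet> (idn (MCar M) \<boxtimes> (mulT B \<bullet> (F \<boxtimes> idn (Car B)))) \<bullet> asc (MCar M) (Car A) (Car B) \<and>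
    (\<forall>Z R. R \<in> thom (MCar M \<odot> Car B) Z \<longrightarrow>
      R \<bullet> (actT A M \<boxtimes> idn (Car B))
        = R \<bullet> (idn (MCar M) \<boxtimes> (mulT B \<bullet> (F \<boxtimes> idn (Car B)))) \<bullet> asc (MCar M) (Car A) (Car B) \<longrightarrow>
      (\<exists>!h. h \<in> thom (MCar N) Z \<and> h \<bullet> Q = R)) \<and>
    actT B N \<bullet> (Q \<boxtimes> idn (Car B))
      = Q \<bullet> (idn (MCar M) \<boxtimes> mulT B) \<bullet> asc (MCar M) (Car B) (Car B)"

lemma bchange_univ:
  assumes "bchange M N Q" "R \<in> thom (MCar M \<odot> Car B) Z"
    "R \<bullet> (actT A M \<boxtimes> idn (Car B))
      = R \<bullet> (idn (MCar M) \<boxtimes> (mulT B \<bullet> (F \<boxtimes> idn (Car B)))) \<bullet> asc (MCar M) (Car A) (Car B)"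
  shows "\<exists>!h. h \<in> thom (MCar N) Z \<and> h \<bullet> Q = R"
proof -
  have "\<forall>Z R. R \<in> thom (MCar M \<odot> Car B) Z \<longrightarrow>
      R \<bullet> (actT A M \<boxtimes> idn (Car B))
        = R \<bullet> (idn (MCar M) \<boxtimes> (mulT B \<bullet> (F \<boxtimes> idn (Car B)))) \<bullet> asc (MCar M) (Car A) (Car B) \<longrightarrow>
      (\<exists>!h. h \<in> thom (MCar N) Z \<and> h \<bullet> Q = R)"
    using assms(1) unfolding bchange_def by (elim conjE)
  then show ?thesis using assms(2,3) by (elim allE[of _ Z] allE[of _ R] impE)
qed

text \<open>
  Here \<open>N\<close> is \<open>M \<otimes>\<^sub>A A\<^sub>t\<close> with quotient map \<open>Q\<close>, and \<open>j n\<close> is to be thought of as \<open>m \<mapsto> m \<otimes> \<iota> n 1\<close>.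
\<close>

definition colim_data ::
  "('o, 'a) amod \<Rightarrow> ('o, 'a) amod \<Rightarrow> ('o, 'a) tarrow \<Rightarrow> (nat \<Rightarrow> ('o, 'a) tarrow) \<Rightarrow> bool" where
  "colim_data M N Q j \<longleftrightarrow> scol (T_on M) (MCar N) j \<and>
    (\<forall>m n. actT B N \<bullet> (j m \<boxtimes> \<iota> n) = j (m + n) \<bullet> actT A M) \<and>
    (\<forall>n. Q \<bullet> (idn (MCar M) \<boxtimes> \<iota> n) = j n \<bullet> actT A M)"

text \<open>In elements, m \<otimes> \<iota> n (a) = m a \<otimes> \<iota> n (1), so every pure
  tensor is represented at some stage by an element of \<open>M\<close>. This makes the colimit
  \<open>X\<close> of \<open>M\<close> along the action of t the candidate, m at stage n standing
  for m \<otimes> \<iota> n (1). \<open>B\<close> acts by adding indices: x at stage m times \<iota>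
  n (a) is x a at stage m + n.\<close>

lemma bchange_construct:
  assumes M: "module_ob C A M"
  obtains N Q j where "bchange M N Q" "colim_data M N Q j"
proof -
  let ?a = "actT A M" and ?M = "MCar M" and ?A = "Car A" and ?B = "Car B" and ?T = "T_on M"
  note [simp] = moduleD(1,2)[OF M A_simps(1)] arr_T_on[OF M]
  obtain X \<chi> where X: "scol ?T X \<chi>"
    by (rule scol_exists[where s = ?T]) (simp, simp, rule that)
  have [simp]: "X \<in> Ob C" "arr (\<chi> n)" "src (\<chi> n) = ?M" "tgt (\<chi> n) = X" and \<chi>T: "\<chi> (Suc n) \<bullet> ?T = \<chi> n" for n
    using scolD(3)[OF X] scolD(4,5)[OF X, of n] by simp_all
  have MB: "scol (idn ?M \<boxtimes> T) (?M \<odot> ?B) (\<lambda>n. idn ?M \<boxtimes> \<iota> n)"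
    by (rule scol_lten[OF \<iota>_col]) simp
  \<comment> \<open>\<open>q m\<close> is the action of \<open>B\<close> on the copy of
    \<open>M\<close> at stage m, glued over the stages of \<open>B\<close>. By \<open>qT\<close>
    these can in turn be glued over m, which gives the action \<open>b\<close>.\<close>
  have "\<exists>q. q \<in> thom (?M \<odot> ?B) X \<and> (\<forall>n. q \<bullet> (idn ?M \<boxtimes> \<iota> n) = \<chi> (m + n) \<bullet> ?a)" for m
  proof (rule scol_factor[OF MB, of X "\<lambda>n. \<chi> (m + n) \<bullet> ?a"])
    show "(\<chi> (m + Suc n) \<bullet> ?a) \<bullet> (idn ?M \<boxtimes> T) = \<chi> (m + n) \<bullet> ?a" for n
      using reassoc[OF \<chi>T[of "m + n"], of ?a] T_on_act(1)[OF M] by simp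
    fix h assume "h \<in> thom (?M \<odot> ?B) X" "\<And>n. h \<bullet> (idn ?M \<boxtimes> \<iota> n) = \<chi> (m + n) \<bullet> ?a"
    then show "\<exists>q. q \<in> thom (?M \<odot> ?B) X \<and> (\<forall>n. q \<bullet> (idn ?M \<boxtimes> \<iota> n) = \<chi> (m + n) \<bullet> ?a)"
      by (intro exI[of _ h]) simp
  qed simp_all
  then have "\<forall>m. \<exists>q. q \<in> thom (?M \<odot> ?B) X \<and> (\<forall>n. q \<bullet> (idn ?M \<boxtimes> \<iota> n) = \<chi> (m + n) \<bullet> ?a)"
    by (rule allI)
  from choice[OF this] obtain q where
    "\<forall>m. q m \<in> thom (?M \<odot> ?B) X \<and> (\<forall>n. q m \<bullet> (idn ?M \<boxtimes> \<iota> n) = \<chi> (m + n) \<bullet> ?a)"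
    by (elim exE)
  then have q [simp]: "arr (q m)" "src (q m) = ?M \<odot> ?B" "tgt (q m) = X"
    and q\<iota>: "q m \<bullet> (idn ?M \<boxtimes> \<iota> n) = \<chi> (m + n) \<bullet> ?a" for m n
    by auto
  have qT: "q (Suc m) \<bullet> (?T \<boxtimes> idn ?B) = q m" for m
  proof (rule scol_unique[OF MB, of _ X])
    fix n
    have "(q (Suc m) \<bullet> (?T \<boxtimes> idn ?B)) \<bullet> (idn ?M \<boxtimes> \<iota> n) = q (Suc m) \<bullet> ((idn ?M \<boxtimes> \<iota> n) \<bullet> (?T \<boxtimes> idn ?A))"
      by (simp add: ten_comp)
    also have "\<dots> = \<chi> (Suc (m + n)) \<bullet> ?T \<bullet> ?a"
      using reassoc[OF q\<iota>[of "Suc m" n], of "?T \<boxtimes> idn ?A"] T_on_act(2)[OF M] by simp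
    finally show "(q (Suc m) \<bullet> (?T \<boxtimes> idn ?B)) \<bullet> (idn ?M \<boxtimes> \<iota> n) = q m \<bullet> (idn ?M \<boxtimes> \<iota> n)"
      using reassoc[OF \<chi>T[of "m + n"], of ?a] by (simp add: q\<iota>)
  qed simp_all
  have XB: "scol (?T \<boxtimes> idn ?B) (X \<odot> ?B) (\<lambda>n. \<chi> n \<boxtimes> idn ?B)"
    by (rule scol_rten[OF X]) simp
  obtain b where b [simp]: "arr b" "src b = X \<odot> ?B" "tgt b = X" and b\<chi>: "\<And>n. b \<bullet> (\<chi> n \<boxtimes> idn ?B) = q n"
    by (rule scol_factor[OF XB, of X q]) (auto simp: qT)
  have b\<chi>\<iota>: "b \<bullet> (\<chi> m \<boxtimes> \<iota> n) = \<chi> (m + n) \<bullet> ?a" for m n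
  proof -
    have "b \<bullet> (\<chi> m \<boxtimes> \<iota> n) = b \<bullet> ((\<chi> m \<boxtimes> idn ?B) \<bullet> (idn ?M \<boxtimes> \<iota> n))"
      by (simp add: ten_comp)
    then show ?thesis
      using reassoc[OF b\<chi>[of m], of "idn ?M \<boxtimes> \<iota> n"] by (simp add: q\<iota>)
  qed
  define N where "N = \<lparr>MCar = X, Act = raw b\<rparr>"
  have N_simps [simp]: "MCar N = X" "actT B N = b"
    using b by (simp_all add: N_def actT_def tarrow_eq)
  have act_assoc: "b \<bullet> ((\<chi> m \<bullet> ?a) \<boxtimes> \<iota> k) = \<chi> (m + k) \<bullet> ?a \<bullet> (idn ?M \<boxtimes> mulT A) \<bullet> asc ?M ?A ?A" for m k
  proof -
    have "b \<bullet> ((\<chi> m \<bullet> ?a) \<boxtimes> \<iota> k) = b \<bullet> ((\<chi> m \<boxtimes> \<iota> k) \<bullet> (?a \<boxtimes> idn ?A))"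
      by (simp add: ten_comp)
    also have "\<dots> = \<chi> (m + k) \<bullet> ?a \<bullet> (?a \<boxtimes> idn ?A)"
      using reassoc[OF b\<chi>\<iota>[of m k], of "?a \<boxtimes> idn ?A"] by simp
    finally show ?thesis by (simp add: moduleD(3)[OF M A_simps(1)])
  qed
  have N: "module_ob C B N"
    unfolding module_ob_iff[OF B_simps(1)] N_simps
  proof (intro conjI)
    show "b \<bullet> (b \<boxtimes> idn ?B) = b \<bullet> ((idn X \<boxtimes> mulT B) \<bullet> asc X ?B ?B)"
    proof (rule scol_unique[OF scol_rten[OF XB B_simps(1)], of _ X])
      fix m
      have "(b \<bullet> (b \<boxtimes> idn ?B)) \<bullet> ((\<chi> m \<boxtimes> idn ?B) \<boxtimes> idn ?B) = b \<bullet> (q m \<boxtimes> idn ?B)"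
        by (simp add: ten_comp b\<chi>)
      also have "\<dots> = b \<bullet> (\<chi> m \<boxtimes> mulT B) \<bullet> asc ?M ?B ?B"
      proof (rule scol_ten_unique[OF MB \<iota>_col, of _ X])
        fix n k
        have "(b \<bullet> (q m \<boxtimes> idn ?B)) \<bullet> ((idn ?M \<boxtimes> \<iota> n) \<boxtimes> \<iota> k) = b \<bullet> ((\<chi> (m + n) \<bullet> ?a) \<boxtimes> \<iota> k)"
          by (simp add: ten_comp q\<iota>)
        also have "\<dots> = \<chi> (m + n + k) \<bullet> ?a \<bullet> (idn ?M \<boxtimes> mulT A) \<bullet> asc ?M ?A ?A"
          by (rule act_assoc)
        also have "\<dots> = b \<bullet> ((\<chi> m \<boxtimes> \<iota> (n + k)) \<bullet> ((idn ?M \<boxtimes> mulT A) \<bullet> asc ?M ?A ?A))"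
          using reassoc[OF b\<chi>\<iota>[of m "n + k"], of "(idn ?M \<boxtimes> mulT A) \<bullet> asc ?M ?A ?A"] by (simp add: add.assoc)
        also have "\<dots> = b \<bullet> ((\<chi> m \<boxtimes> mulT B) \<bullet> ((idn ?M \<boxtimes> (\<iota> n \<boxtimes> \<iota> k)) \<bullet> asc ?M ?A ?A))"
          by (simp add: ten_comp2 mul_\<iota>)
        also have "\<dots> = (b \<bullet> (\<chi> m \<boxtimes> mulT B) \<bullet> asc ?M ?B ?B) \<bullet> ((idn ?M \<boxtimes> \<iota> n) \<boxtimes> \<iota> k)"
          using asc_nat[of "idn ?M" "\<iota> n" "\<iota> k" ?M ?B ?B] by simp
        finally show "(b \<bullet> (q m \<boxtimes> idn ?B)) \<bullet> ((idn ?M \<boxtimes> \<iota> n) \<boxtimes> \<iota> k)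
          = (b \<bullet> (\<chi> m \<boxtimes> mulT B) \<bullet> asc ?M ?B ?B) \<bullet> ((idn ?M \<boxtimes> \<iota> n) \<boxtimes> \<iota> k)" .
      qed simp_all
      also have "\<dots> = b \<bullet> ((idn X \<boxtimes> mulT B) \<bullet> ((\<chi> m \<boxtimes> (idn ?B \<boxtimes> idn ?B)) \<bullet> asc ?M ?B ?B))"
        by (simp add: ten_comp2)
      also have "\<dots> = (b \<bullet> ((idn X \<boxtimes> mulT B) \<bullet> asc X ?B ?B)) \<bullet> ((\<chi> m \<boxtimes> idn ?B) \<boxtimes> idn ?B)"
        using asc_nat[of "\<chi> m" "idn ?B" "idn ?B" X ?B ?B] by simp
      finally show "(b \<bullet> (b \<boxtimes> idn ?B)) \<bullet> ((\<chi> m \<boxtimes> idn ?B) \<boxtimes> idn ?B) =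
        (b \<bullet> ((idn X \<boxtimes> mulT B) \<bullet> asc X ?B ?B)) \<bullet> ((\<chi> m \<boxtimes> idn ?B) \<boxtimes> idn ?B)" .
    qed simp_all
    show "b \<bullet> (idn X \<boxtimes> uniT B) = run X"
    proof (rule scol_unique[OF scol_rten[OF X Unit_in_Ob], of _ X])
      fix n
      have "(b \<bullet> (idn X \<boxtimes> uniT B)) \<bullet> (\<chi> n \<boxtimes> idn (Unit C)) = b \<bullet> ((\<chi> n \<boxtimes> \<iota> 0) \<bullet> (idn ?M \<boxtimes> uniT A))"
        by (simp add: ten_comp F_uni \<iota>_0)
      also have "\<dots> = \<chi> n \<bullet> run ?M"
        using reassoc[OF b\<chi>\<iota>[of n 0], of "idn ?M \<boxtimes> uniT A"] by (simp add: moduleD(4)[OF M A_simps(1)])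
      finally show "(b \<bullet> (idn X \<boxtimes> uniT B)) \<bullet> (\<chi> n \<boxtimes> idn (Unit C)) = run X \<bullet> (\<chi> n \<boxtimes> idn (Unit C))"
        by (simp add: run_nat)
    qed simp_all
  qed simp_all
  \<comment> \<open>The quotient map lets \<open>B\<close> act on the copy of \<open>M\<close> at
    stage 0.\<close>
  define Q where "Q = q 0"
  have Q [simp]: "arr Q" "src Q = ?M \<odot> ?B" "tgt Q = X" and Q\<iota>: "Q \<bullet> (idn ?M \<boxtimes> \<iota> n) = \<chi> n \<bullet> ?a" for n
    using q\<iota>[of 0] by (simp_all add: Q_def)
  let ?F = "(idn ?M \<boxtimes> (mulT B \<bullet> (F \<boxtimes> idn ?B))) \<bullet> asc ?M ?A ?B"
  \<comment> \<open>As \<open>F\<close> is \<open>\<iota> 0\<close>, multiplication by it does not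
    change the stage: \<open>mul_\<iota>\<close> gives the index \<open>0 + n\<close>.\<close>
  have F\<iota>: "?F \<bullet> (idn (?M \<odot> ?A) \<boxtimes> \<iota> n) = (idn ?M \<boxtimes> \<iota> n) \<bullet> (idn ?M \<boxtimes> mulT A) \<bullet> asc ?M ?A ?A" for n
  proof -
    have "?F \<bullet> ((idn ?M \<boxtimes> idn ?A) \<boxtimes> \<iota> n)
        = (idn ?M \<boxtimes> (mulT B \<bullet> (F \<boxtimes> idn ?B))) \<bullet> (idn ?M \<boxtimes> (idn ?A \<boxtimes> \<iota> n)) \<bullet> asc ?M ?A ?A"
      using asc_nat[of "idn ?M" "idn ?A" "\<iota> n" ?M ?A ?B] by simp
    also have "\<dots> = (idn ?M \<boxtimes> (mulT B \<bullet> (\<iota> 0 \<boxtimes> \<iota> n))) \<bullet> asc ?M ?A ?A"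
      by (simp add: ten_comp2 ten_comp \<iota>_0)
    finally show ?thesis by (simp add: mul_\<iota> ten_comp2)
  qed
  have Qcoeq: "Q \<bullet> (?a \<boxtimes> idn ?B) = Q \<bullet> ?F"
  proof (rule scol_unique[OF scol_lten[OF \<iota>_col, of "?M \<odot> ?A"], of _ X])
    fix n
    have "(Q \<bullet> (?a \<boxtimes> idn ?B)) \<bullet> (idn (?M \<odot> ?A) \<boxtimes> \<iota> n) = Q \<bullet> ((idn ?M \<boxtimes> \<iota> n) \<bullet> (?a \<boxtimes> idn ?A))"
      by (simp add: ten_comp)
    also have "\<dots> = \<chi> n \<bullet> ?a \<bullet> (?a \<boxtimes> idn ?A)"
      using reassoc[OF Q\<iota>[of n], of "?a \<boxtimes> idn ?A"] by simp
    also have "\<dots> = Q \<bullet> ((idn ?M \<boxtimes> \<iota> n) \<bullet> ((idn ?M \<boxtimes> mulT A) \<bullet> asc ?M ?A ?A))"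
      using reassoc[OF Q\<iota>[of n], of "(idn ?M \<boxtimes> mulT A) \<bullet> asc ?M ?A ?A"]
      by (simp add: moduleD(3)[OF M A_simps(1)])
    finally show "(Q \<bullet> (?a \<boxtimes> idn ?B)) \<bullet> (idn (?M \<odot> ?A) \<boxtimes> \<iota> n) = (Q \<bullet> ?F) \<bullet> (idn (?M \<odot> ?A) \<boxtimes> \<iota> n)"
      using F\<iota>[of n] by simp
  qed simp_all
  have Quniv: "\<exists>!h. h \<in> thom X Z \<and> h \<bullet> Q = R"
    if R: "R \<in> thom (?M \<odot> ?B) Z" and RF: "R \<bullet> (?a \<boxtimes> idn ?B) = R \<bullet> ?F" for Z R
  proof -
    note [simp] = R[simplified]
    have [simp]: "Z \<in> Ob C" using R arr_Ob(2)[of R] by simp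
    let ?s = "(idn ?M \<boxtimes> uniT A) \<bullet> iarr (run ?M)"
    \<comment> \<open>\<open>?s\<close> is m \<mapsto> m \<otimes> 1. In elements, R(m a \<otimes>
      \<iota> n (1)) = R(m \<otimes> \<iota> n (a)): a balanced \<open>R\<close> is determined by
      its values on m \<otimes> \<iota> n (1), and these define \<open>h\<close> at stage n.\<close>
    have R\<iota>: "(R \<bullet> (idn ?M \<boxtimes> \<iota> n) \<bullet> ?s) \<bullet> ?a = R \<bullet> (idn ?M \<boxtimes> \<iota> n)" for n
    proof -
      have "(R \<bullet> (idn ?M \<boxtimes> \<iota> n) \<bullet> ?s) \<bullet> ?a
          = R \<bullet> (idn ?M \<boxtimes> \<iota> n) \<bullet> (idn ?M \<boxtimes> uniT A) \<bullet> (?a \<boxtimes> idn (Unit C)) \<bullet> iarr (run (?M \<odot> ?A))"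
        using iarr_run_nat[of ?a "?M \<odot> ?A"] by simp
      also have "\<dots> = R \<bullet> (?a \<boxtimes> idn ?B) \<bullet> (idn (?M \<odot> ?A) \<boxtimes> \<iota> n) \<bullet> ((idn ?M \<boxtimes> idn ?A) \<boxtimes> uniT A) \<bullet> iarr (run (?M \<odot> ?A))"
        by (simp add: ten_comp2)
      also have "\<dots> = R \<bullet> ((?F \<bullet> (idn (?M \<odot> ?A) \<boxtimes> \<iota> n)) \<bullet> ((idn ?M \<boxtimes> idn ?A) \<boxtimes> uniT A) \<bullet> iarr (run (?M \<odot> ?A)))"
        using reassoc[OF RF, of "(idn (?M \<odot> ?A) \<boxtimes> \<iota> n) \<bullet> ((idn ?M \<boxtimes> idn ?A) \<boxtimes> uniT A) \<bullet> iarr (run (?M \<odot> ?A))"]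
        by simp
      also have "\<dots> = R \<bullet> (idn ?M \<boxtimes> \<iota> n) \<bullet> (idn ?M \<boxtimes> mulT A) \<bullet>
          (asc ?M ?A ?A \<bullet> ((idn ?M \<boxtimes> idn ?A) \<boxtimes> uniT A)) \<bullet> iarr (run (?M \<odot> ?A))"
        unfolding F\<iota> by simp
      also have "\<dots> = R \<bullet> (idn ?M \<boxtimes> \<iota> n) \<bullet> (idn ?M \<boxtimes> mulT A) \<bullet> (idn ?M \<boxtimes> (idn ?A \<boxtimes> uniT A)) \<bullet>
          (asc ?M ?A (Unit C) \<bullet> iarr (run (?M \<odot> ?A)))"
        using asc_nat[of "idn ?M" "idn ?A" "uniT A" ?M ?A ?A] by simp
      also have "\<dots> = R \<bullet> (idn ?M \<boxtimes> \<iota> n) \<bullet> (idn ?M \<boxtimes> (mulT A \<bullet> (idn ?A \<boxtimes> uniT A) \<bullet> iarr (run ?A)))"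
        by (simp add: asc_iarr_run ten_comp)
      finally show ?thesis
        using act_section[OF monoid_A module_self[OF monoid_A]] by simp
    qed
    obtain h where h [simp]: "arr h" "src h = X" "tgt h = Z" and h\<chi>: "\<And>n. h \<bullet> \<chi> n = R \<bullet> (idn ?M \<boxtimes> \<iota> n) \<bullet> ?s"
    proof (rule scol_factor[OF X, of Z "\<lambda>n. R \<bullet> (idn ?M \<boxtimes> \<iota> n) \<bullet> ?s"])
      fix n
      show "(R \<bullet> (idn ?M \<boxtimes> \<iota> (Suc n)) \<bullet> ?s) \<bullet> ?T = R \<bullet> (idn ?M \<boxtimes> \<iota> n) \<bullet> ?s"
      proof (rule act_cancel[OF monoid_A M])
        have "((R \<bullet> (idn ?M \<boxtimes> \<iota> (Suc n)) \<bullet> ?s) \<bullet> ?T) \<bullet> ?a = ((R \<bullet> (idn ?M \<boxtimes> \<iota> (Suc n)) \<bullet> ?s) \<bullet> ?a) \<bullet> (idn ?M \<boxtimes> T)"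
          by (simp add: T_on_act(1)[OF M])
        also have "\<dots> = R \<bullet> (idn ?M \<boxtimes> \<iota> n)"
          unfolding R\<iota> by (simp add: ten_comp \<iota>_T)
        finally show "((R \<bullet> (idn ?M \<boxtimes> \<iota> (Suc n)) \<bullet> ?s) \<bullet> ?T) \<bullet> ?a = (R \<bullet> (idn ?M \<boxtimes> \<iota> n) \<bullet> ?s) \<bullet> ?a"
          unfolding R\<iota> .
      qed simp_all
    qed auto
    have hQ: "h \<bullet> Q = R"
    proof (rule scol_unique[OF MB, of _ Z])
      show "(h \<bullet> Q) \<bullet> (idn ?M \<boxtimes> \<iota> n) = R \<bullet> (idn ?M \<boxtimes> \<iota> n)" for n
        using reassoc[OF h\<chi>[of n], of ?a] R\<iota>[of n] by (simp add: Q\<iota>)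
    qed simp_all
    show ?thesis
    proof (intro ex1I[of _ h] conjI)
      fix k assume k: "k \<in> thom X Z \<and> k \<bullet> Q = R"
      show "k = h"
      proof (rule scol_unique[OF X, of _ Z])
        fix n
        show "k \<bullet> \<chi> n = h \<bullet> \<chi> n"
        proof (rule act_cancel[OF monoid_A M])
          show "(k \<bullet> \<chi> n) \<bullet> ?a = (h \<bullet> \<chi> n) \<bullet> ?a"
            using k reassoc[of k Q R "idn ?M \<boxtimes> \<iota> n"] reassoc[OF hQ, of "idn ?M \<boxtimes> \<iota> n"]
            by (simp add: Q\<iota>)
        qed (use k in simp_all)
      qed (use k in simp_all)
    qed (simp_all add: hQ)
  qed
  have Qact: "b \<bullet> (Q \<boxtimes> idn ?B) = Q \<bullet> (idn ?M \<boxtimes> mulT B) \<bullet> asc ?M ?B ?B"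
  proof (rule scol_ten_unique[OF MB \<iota>_col, of _ X])
    fix n k
    have "(b \<bullet> (Q \<boxtimes> idn ?B)) \<bullet> ((idn ?M \<boxtimes> \<iota> n) \<boxtimes> \<iota> k) = \<chi> (n + k) \<bullet> ?a \<bullet> (idn ?M \<boxtimes> mulT A) \<bullet> asc ?M ?A ?A"
      by (simp add: ten_comp Q\<iota> act_assoc)
    also have "\<dots> = Q \<bullet> ((idn ?M \<boxtimes> \<iota> (n + k)) \<bullet> ((idn ?M \<boxtimes> mulT A) \<bullet> asc ?M ?A ?A))"
      using reassoc[OF Q\<iota>[of "n + k"], of "(idn ?M \<boxtimes> mulT A) \<bullet> asc ?M ?A ?A"] by simp
    also have "\<dots> = Q \<bullet> ((idn ?M \<boxtimes> mulT B) \<bullet> ((idn ?M \<boxtimes> (\<iota> n \<boxtimes> \<iota> k)) \<bullet> asc ?M ?A ?A))"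
      by (simp add: ten_comp2 mul_\<iota>)
    also have "\<dots> = (Q \<bullet> (idn ?M \<boxtimes> mulT B) \<bullet> asc ?M ?B ?B) \<bullet> ((idn ?M \<boxtimes> \<iota> n) \<boxtimes> \<iota> k)"
      using asc_nat[of "idn ?M" "\<iota> n" "\<iota> k" ?M ?B ?B] by simp
    finally show "(b \<bullet> (Q \<boxtimes> idn ?B)) \<bullet> ((idn ?M \<boxtimes> \<iota> n) \<boxtimes> \<iota> k)
      = (Q \<bullet> (idn ?M \<boxtimes> mulT B) \<bullet> asc ?M ?B ?B) \<bullet> ((idn ?M \<boxtimes> \<iota> n) \<boxtimes> \<iota> k)" .
  qed simp_all
  have "bchange M N Q"
    unfolding bchange_def using N Qcoeq Quniv Qact by simp
  moreover have "colim_data M N Q \<chi>"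
    using X by (simp add: colim_data_def b\<chi>\<iota> Q\<iota>)
  ultimately show ?thesis by (rule that)
qed

text \<open>The stage maps \<open>j n\<close>, preceded by the split epimorphism
  \<open>actT A M\<close>, factor through \<open>Q\<close>; they are jointly epic after tensoring
  with \<open>Y\<close>, and so \<open>Q\<close> stays epic.\<close>

lemma bchange_quotient_epi:
  assumes "colim_data M N Q j" and M: "module_ob C A M" and Y: "Y \<in> Ob C"
    and Q: "arr Q" "src Q = MCar M \<odot> Car B" "tgt Q = MCar N"
    and x: "x \<in> thom (MCar N \<odot> Y) Z" and y: "y \<in> thom (MCar N \<odot> Y) Z"
    and eq: "x \<bullet> (Q \<boxtimes> idn Y) = y \<bullet> (Q \<boxtimes> idn Y)"
  shows "x = y"
proof -
  note [simp] = moduleD(1,2)[OF M A_simps(1)] Q Y x[simplified] y[simplified]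
  have c: "scol (T_on M) (MCar N) j" and Q\<iota>: "Q \<bullet> (idn (MCar M) \<boxtimes> \<iota> n) = j n \<bullet> actT A M" for n
    using assms(1) by (simp_all add: colim_data_def)
  have [simp]: "arr (j n)" "src (j n) = MCar M" "tgt (j n) = MCar N" "MCar N \<in> Ob C" for n
    using scolD(3)[OF c] scolD(4)[OF c, of n] by simp_all
  show ?thesis
  proof (rule scol_unique[OF scol_rten[OF c Y] x y])
    fix n
    show "x \<bullet> (j n \<boxtimes> idn Y) = y \<bullet> (j n \<boxtimes> idn Y)"
    proof (rule act_ten_cancel[OF monoid_A M Y])
      have *: "(w \<bullet> (j n \<boxtimes> idn Y)) \<bullet> (actT A M \<boxtimes> idn Y)
          = (w \<bullet> (Q \<boxtimes> idn Y)) \<bullet> ((idn (MCar M) \<boxtimes> \<iota> n) \<boxtimes> idn Y)"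
        if "w \<in> thom (MCar N \<odot> Y) Z" for w
        using that by (simp add: ten_comp Q\<iota>)
      show "(x \<bullet> (j n \<boxtimes> idn Y)) \<bullet> (actT A M \<boxtimes> idn Y) = (y \<bullet> (j n \<boxtimes> idn Y)) \<bullet> (actT A M \<boxtimes> idn Y)"
        unfolding *[OF x] *[OF y] eq ..
    qed simp_all
  qed
qed

text \<open>The functor \<open>base_change\<close> takes its values from \<open>SOME\<close>, so the
  description as a chain colimit is needed for every base change. It is carried over from the
  constructed one by the isomorphism \<open>h\<close> between two coequalisers of the same
  pair.\<close>

lemma bchange_colim:
  assumes M: "module_ob C A M" and c: "bchange M N Q"
  obtains j where "colim_data M N Q j"
proof -
  let ?a = "actT A M" and ?M = "MCar M" and ?A = "Car A" and ?B = "Car B"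
  obtain N' Q' j' where c': "bchange M N' Q'" and d: "colim_data M N' Q' j'"
    by (rule bchange_construct[OF M])
  note cu = bchange_univ[OF c] and cu' = bchange_univ[OF c']
  note c = c[unfolded bchange_def] and c' = c'[unfolded bchange_def]
  note [simp] = moduleD(1,2)[OF M A_simps(1)]
  have N: "module_ob C B N" and N': "module_ob C B N'" using c c' by simp_all
  note [simp] = moduleD(1,2)[OF N B_simps(1)] moduleD(1,2)[OF N' B_simps(1)]
  have [simp]: "arr Q" "src Q = ?M \<odot> ?B" "tgt Q = MCar N" "arr Q'" "src Q' = ?M \<odot> ?B" "tgt Q' = MCar N'"
    using c c' by simp_all
  have s: "scol (T_on M) (MCar N') j'" and act': "\<And>m n. actT B N' \<bullet> (j' m \<boxtimes> \<iota> n) = j' (m + n) \<bullet> ?a"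
    and Q\<iota>': "\<And>n. Q' \<bullet> (idn ?M \<boxtimes> \<iota> n) = j' n \<bullet> ?a"
    using d by (simp_all add: colim_data_def)
  have [simp]: "arr (j' n)" "src (j' n) = ?M" "tgt (j' n) = MCar N'" for n
    using scolD(4)[OF s, of n] by simp_all
  have u: "\<exists>!h. h \<in> thom (MCar N') (MCar N) \<and> h \<bullet> Q' = Q" "\<exists>!h. h \<in> thom (MCar N) (MCar N') \<and> h \<bullet> Q = Q'"
    "\<exists>!h. h \<in> thom (MCar N') (MCar N') \<and> h \<bullet> Q' = Q'" "\<exists>!h. h \<in> thom (MCar N) (MCar N) \<and> h \<bullet> Q = Q"
    by (rule cu cu'; use c c' in simp)+
  from u(1) obtain h where "h \<in> thom (MCar N') (MCar N) \<and> h \<bullet> Q' = Q" by (elim ex1E)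
  then have h [simp]: "arr h" "src h = MCar N'" "tgt h = MCar N" and hQ: "h \<bullet> Q' = Q" by auto
  from u(2) obtain g where "g \<in> thom (MCar N) (MCar N') \<and> g \<bullet> Q = Q'" by (elim ex1E)
  then have g [simp]: "arr g" "src g = MCar N" "tgt g = MCar N'" and gQ: "g \<bullet> Q = Q'" by auto
  from u(3) obtain k where k: "\<forall>h. h \<in> thom (MCar N') (MCar N') \<and> h \<bullet> Q' = Q' \<longrightarrow> h = k" by (elim ex1E)
  have "g \<bullet> h = idn (MCar N')"
    using k[rule_format, of "g \<bullet> h"] k[rule_format, of "idn (MCar N')"] by (simp add: hQ gQ)
  moreover from u(4) obtain k' where k': "\<forall>h. h \<in> thom (MCar N) (MCar N) \<and> h \<bullet> Q = Q \<longrightarrow> h = k'" by (elim ex1E)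
  have "h \<bullet> g = idn (MCar N)"
    using k'[rule_format, of "h \<bullet> g"] k'[rule_format, of "idn (MCar N)"] by (simp add: hQ gQ)
  ultimately have "inv_pair h g" by (simp add: inv_pair_def)
  from qcol_iso[OF s this] have s2: "scol (T_on M) (MCar N) (\<lambda>n. h \<bullet> j' n)" by simp
  \<comment> \<open>\<open>h\<close> is known only by its composite with \<open>Q'\<close>, so its
    linearity is tested in front of the epimorphism
    \<open>Q' \<boxtimes> idn (Car B)\<close>.\<close>
  have hact: "h \<bullet> actT B N' = actT B N \<bullet> (h \<boxtimes> idn ?B)"
  proof (rule bchange_quotient_epi[OF d M B_simps(1), of _ "MCar N"])
    have "(h \<bullet> actT B N') \<bullet> (Q' \<boxtimes> idn ?B) = h \<bullet> Q' \<bullet> (idn ?M \<boxtimes> mulT B) \<bullet> asc ?M ?B ?B"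
      using c' by simp
    also have "\<dots> = Q \<bullet> (idn ?M \<boxtimes> mulT B) \<bullet> asc ?M ?B ?B"
      using reassoc[OF hQ, of "(idn ?M \<boxtimes> mulT B) \<bullet> asc ?M ?B ?B"] by simp
    also have "\<dots> = (actT B N \<bullet> (h \<boxtimes> idn ?B)) \<bullet> (Q' \<boxtimes> idn ?B)"
      using c by (simp add: ten_comp hQ)
    finally show "(h \<bullet> actT B N') \<bullet> (Q' \<boxtimes> idn ?B) = (actT B N \<bullet> (h \<boxtimes> idn ?B)) \<bullet> (Q' \<boxtimes> idn ?B)" .
  qed simp_all
  have "actT B N \<bullet> ((h \<bullet> j' m) \<boxtimes> \<iota> n) = (h \<bullet> j' (m + n)) \<bullet> ?a" for m n
  proof -
    have "actT B N \<bullet> ((h \<bullet> j' m) \<boxtimes> \<iota> n) = actT B N \<bullet> ((h \<boxtimes> idn ?B) \<bullet> (j' m \<boxtimes> \<iota> n))"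
      by (simp add: ten_comp)
    also have "\<dots> = h \<bullet> actT B N' \<bullet> (j' m \<boxtimes> \<iota> n)"
      using reassoc[OF hact[symmetric], of "j' m \<boxtimes> \<iota> n"] by simp
    finally show ?thesis by (simp add: act')
  qed
  moreover have "Q \<bullet> (idn ?M \<boxtimes> \<iota> n) = (h \<bullet> j' n) \<bullet> ?a" for n
    using reassoc[OF hQ, of "idn ?M \<boxtimes> \<iota> n"] by (simp add: Q\<iota>')
  ultimately have "colim_data M N Q (\<lambda>n. h \<bullet> j' n)"
    using s2 by (simp add: colim_data_def)
  then show ?thesis by (rule that)
qed

text \<open>The arrow is glued from \<open>h\<close> on the stages. The last conclusion is the
  uniqueness that makes the \<open>THE\<close> in \<open>base_change\<close> meaningful; the
  equation with \<open>j\<close> and \<open>j'\<close> is how the functor is computed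
  afterwards.\<close>

lemma bchange_map:
  assumes M: "module_ob C A M" and M': "module_ob C A M'"
    and b: "bchange M N Q" "colim_data M N Q j" and b': "bchange M' N' Q'" "colim_data M' N' Q' j'"
    and h: "h \<in> thom (MCar M) (MCar M')" and hl: "h \<bullet> actT A M = actT A M' \<bullet> (h \<boxtimes> idn (Car A))"
  obtains k where "k \<in> thom (MCar N) (MCar N')" "k \<bullet> actT B N = actT B N' \<bullet> (k \<boxtimes> idn (Car B))"
    "k \<bullet> Q = Q' \<bullet> (h \<boxtimes> idn (Car B))" "\<And>n. k \<bullet> j n = j' n \<bullet> h"
    "\<And>k'. k' \<in> thom (MCar N) (MCar N') \<Longrightarrow> k' \<bullet> Q = Q' \<bullet> (h \<boxtimes> idn (Car B)) \<Longrightarrow> k' = k"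
proof -
  let ?a = "actT A M" and ?A = "Car A" and ?B = "Car B"
  note [simp] = moduleD(1,2)[OF M A_simps(1)] moduleD(1,2)[OF M' A_simps(1)] h[simplified]
  have N: "module_ob C B N" and N': "module_ob C B N'" using b(1) b'(1) by (simp_all add: bchange_def)
  note [simp] = moduleD(1,2)[OF N B_simps(1)] moduleD(1,2)[OF N' B_simps(1)]
  have Q [simp]: "arr Q" "src Q = MCar M \<odot> ?B" "tgt Q = MCar N" "arr Q'" "src Q' = MCar M' \<odot> ?B" "tgt Q' = MCar N'"
    using b(1) b'(1) by (simp_all add: bchange_def)
  have s: "scol (T_on M) (MCar N) j" and act: "\<And>m n. actT B N \<bullet> (j m \<boxtimes> \<iota> n) = j (m + n) \<bullet> ?a"
    and Q\<iota>: "\<And>n. Q \<bullet> (idn (MCar M) \<boxtimes> \<iota> n) = j n \<bullet> ?a"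
    using b(2) by (simp_all add: colim_data_def)
  have s': "scol (T_on M') (MCar N') j'" and act': "\<And>m n. actT B N' \<bullet> (j' m \<boxtimes> \<iota> n) = j' (m + n) \<bullet> actT A M'"
    and Q\<iota>': "\<And>n. Q' \<bullet> (idn (MCar M') \<boxtimes> \<iota> n) = j' n \<bullet> actT A M'"
    using b'(2) by (simp_all add: colim_data_def)
  have [simp]: "arr (j n)" "src (j n) = MCar M" "tgt (j n) = MCar N" for n
    using scolD(4)[OF s, of n] by simp_all
  have [simp]: "arr (j' n)" "src (j' n) = MCar M'" "tgt (j' n) = MCar N'" for n
    using scolD(4)[OF s', of n] by simp_all
  note [simp] = arr_T_on[OF M] arr_T_on[OF M']
  obtain k where k [simp]: "arr k" "src k = MCar N" "tgt k = MCar N'" and kj: "\<And>n. k \<bullet> j n = j' n \<bullet> h"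
  proof (rule scol_factor[OF s, of "MCar N'" "\<lambda>n. j' n \<bullet> h"])
    show "(j' (Suc n) \<bullet> h) \<bullet> T_on M = j' n \<bullet> h" for n
      using reassoc[OF scolD(5)[OF s', of n], of h] by (simp add: T_on_linear[OF M M' h hl])
  qed auto
  have kl: "k \<bullet> actT B N = actT B N' \<bullet> (k \<boxtimes> idn ?B)"
  proof (rule scol_ten_unique[OF s \<iota>_col, of _ "MCar N'"])
    fix m n
    have "(k \<bullet> actT B N) \<bullet> (j m \<boxtimes> \<iota> n) = j' (m + n) \<bullet> h \<bullet> ?a"
      using reassoc[OF kj[of "m + n"], of ?a] by (simp add: act)
    also have "\<dots> = actT B N' \<bullet> ((j' m \<boxtimes> \<iota> n) \<bullet> (h \<boxtimes> idn ?A))"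
      using reassoc[OF act'[of m n], of "h \<boxtimes> idn ?A"] by (simp add: hl)
    also have "\<dots> = (actT B N' \<bullet> (k \<boxtimes> idn ?B)) \<bullet> (j m \<boxtimes> \<iota> n)"
      by (simp add: ten_comp kj)
    finally show "(k \<bullet> actT B N) \<bullet> (j m \<boxtimes> \<iota> n) = (actT B N' \<bullet> (k \<boxtimes> idn ?B)) \<bullet> (j m \<boxtimes> \<iota> n)" .
  qed simp_all
  have kQ: "k \<bullet> Q = Q' \<bullet> (h \<boxtimes> idn ?B)"
  proof (rule scol_unique[OF scol_lten[OF \<iota>_col, of "MCar M"], of _ "MCar N'"])
    fix n
    have "(k \<bullet> Q) \<bullet> (idn (MCar M) \<boxtimes> \<iota> n) = j' n \<bullet> h \<bullet> ?a"
      using reassoc[OF kj[of n], of ?a] by (simp add: Q\<iota>)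
    also have "\<dots> = Q' \<bullet> ((idn (MCar M') \<boxtimes> \<iota> n) \<bullet> (h \<boxtimes> idn ?A))"
      using reassoc[OF Q\<iota>'[of n], of "h \<boxtimes> idn ?A"] by (simp add: hl)
    finally show "(k \<bullet> Q) \<bullet> (idn (MCar M) \<boxtimes> \<iota> n) = (Q' \<bullet> (h \<boxtimes> idn ?B)) \<bullet> (idn (MCar M) \<boxtimes> \<iota> n)"
      by (simp add: ten_comp)
  qed simp_all
  have "k' = k" if k': "k' \<in> thom (MCar N) (MCar N')" "k' \<bullet> Q = Q' \<bullet> (h \<boxtimes> idn ?B)" for k'
  proof (rule scol_unique[OF s, of _ "MCar N'"])
    note [simp] = k'(1)[simplified]
    fix n
    show "k' \<bullet> j n = k \<bullet> j n"
    proof (rule act_cancel[OF monoid_A M])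
      show "(k' \<bullet> j n) \<bullet> ?a = (k \<bullet> j n) \<bullet> ?a"
        using reassoc[OF k'(2), of "idn (MCar M) \<boxtimes> \<iota> n"] reassoc[OF kQ, of "idn (MCar M) \<boxtimes> \<iota> n"]
        by (simp add: Q\<iota>)
    qed simp_all
  qed (use k' in simp_all)
  with k kl kQ kj show ?thesis by (intro that[of k]) simp_all
qed

subsection \<open>The base change functor\<close>

abbreviation BC :: "(('o, 'a) amod, 'a, ('o, 'a) amod, 'a) ftor" where
  "BC \<equiv> base_change C A B (raw F)"

definition Qbc :: "('o, 'a) amod \<Rightarrow> ('o, 'a) tarrow" where
  "Qbc M = Arr (MCar M \<odot> Car B) (snd (base_change_choice C A B (raw F) M)) (MCar (FOb BC M))"

definition jbc :: "('o, 'a) amod \<Rightarrow> nat \<Rightarrow> ('o, 'a) tarrow" where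
  "jbc M = (SOME j. colim_data M (FOb BC M) (Qbc M) j)"

lemma F_Arr: "Arr (Car A) (raw F) (Car B) = F"
  by (simp add: tarrow_eq)

lemma is_base_change_iff:
  assumes M: "module_ob C A M"
  shows "is_base_change C A B (raw F) M N q \<longleftrightarrow> bchange M N (Arr (MCar M \<odot> Car B) q (MCar N))"
proof -
  let ?Q = "Arr (MCar M \<odot> Car B) q (MCar N)"
  let ?f = "(idn (MCar M) \<boxtimes> (mulT B \<bullet> (F \<boxtimes> idn (Car B)))) \<bullet> asc (MCar M) (Car A) (Car B)"
  let ?rf = "(Id C (MCar M) \<star> (Mul B \<cdot> (raw F \<star> Id C (Car B)))) \<cdot> Assoc C (MCar M) (Car A) (Car B)"
  note [simp] = moduleD(1,2)[OF M A_simps(1)]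
  have raws: "raw (actT A M) = Act M" "raw (mulT B) = Mul B" "raw (actT B N) = Act N"
    by (simp_all add: actT_def mulT_def)
  have ex: "(\<exists>!h. h \<in> Hom C (MCar N) Z \<and> h \<cdot> q = r) \<longleftrightarrow>
      (\<exists>!h. h \<in> thom (MCar N) Z \<and> h \<bullet> ?Q = Arr (MCar M \<odot> Car B) r Z)"
    if "MCar N \<in> Ob C" "Z \<in> Ob C" for r Z
  proof
    assume "\<exists>!h. h \<in> Hom C (MCar N) Z \<and> h \<cdot> q = r"
    then obtain h where h: "h \<in> Hom C (MCar N) Z \<and> h \<cdot> q = r"
      and u: "\<forall>h'. h' \<in> Hom C (MCar N) Z \<and> h' \<cdot> q = r \<longrightarrow> h' = h" by (elim ex1E)
    show "\<exists>!h. h \<in> thom (MCar N) Z \<and> h \<bullet> ?Q = Arr (MCar M \<odot> Car B) r Z"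
    proof (rule ex1I[of _ "Arr (MCar N) h Z"])
      show "Arr (MCar N) h Z \<in> thom (MCar N) Z \<and> Arr (MCar N) h Z \<bullet> ?Q = Arr (MCar M \<odot> Car B) r Z"
        using h that by (simp add: arr_Arr tcomp_def)
      fix k assume "k \<in> thom (MCar N) Z \<and> k \<bullet> ?Q = Arr (MCar M \<odot> Car B) r Z"
      then show "k = Arr (MCar N) h Z"
        using u[rule_format, of "raw k"] by (cases k) (simp add: arr_Arr tcomp_def)
    qed
  next
    assume "\<exists>!h. h \<in> thom (MCar N) Z \<and> h \<bullet> ?Q = Arr (MCar M \<odot> Car B) r Z"
    then obtain h where h: "h \<in> thom (MCar N) Z \<and> h \<bullet> ?Q = Arr (MCar M \<odot> Car B) r Z"
      and u: "\<forall>h'. h' \<in> thom (MCar N) Z \<and> h' \<bullet> ?Q = Arr (MCar M \<odot> Car B) r Z \<longrightarrow> h' = h" by (elim ex1E)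
    show "\<exists>!h. h \<in> Hom C (MCar N) Z \<and> h \<cdot> q = r"
    proof (rule ex1I[of _ "raw h"])
      show "raw h \<in> Hom C (MCar N) Z \<and> raw h \<cdot> q = r"
        using h by (cases h) (simp add: arr_Arr tcomp_def)
      fix k assume "k \<in> Hom C (MCar N) Z \<and> k \<cdot> q = r"
      then have "Arr (MCar N) k Z = h"
        using that by (intro u[rule_format]) (simp add: arr_Arr tcomp_def)
      then show "k = raw h" by auto
    qed
  qed
  have univ: "(\<forall>Z \<in> Ob C. \<forall>r \<in> Hom C (MCar M \<odot> Car B) Z. r \<cdot> (Act M \<star> Id C (Car B)) = r \<cdot> ?rf \<longrightarrow>
        (\<exists>!h. h \<in> Hom C (MCar N) Z \<and> h \<cdot> q = r)) \<longleftrightarrow>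
      (\<forall>Z R. R \<in> thom (MCar M \<odot> Car B) Z \<longrightarrow> R \<bullet> (actT A M \<boxtimes> idn (Car B)) = R \<bullet> ?f \<longrightarrow>
        (\<exists>!h. h \<in> thom (MCar N) Z \<and> h \<bullet> ?Q = R))" (is "?l \<longleftrightarrow> ?r") if N: "MCar N \<in> Ob C"
  proof
    assume l: ?l
    show ?r
    proof (intro allI impI)
      fix Z R assume R: "R \<in> thom (MCar M \<odot> Car B) Z" and e: "R \<bullet> (actT A M \<boxtimes> idn (Car B)) = R \<bullet> ?f"
      obtain r where R': "R = Arr (MCar M \<odot> Car B) r Z" "Z \<in> Ob C" "r \<in> Hom C (MCar M \<odot> Car B) Z"
        using R[unfolded thom_iff] by auto
      have "r \<cdot> (Act M \<star> Id C (Car B)) = r \<cdot> ?rf"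
        using arg_cong[OF e, of raw] by (simp add: raw_simps raws R'(1))
      then show "\<exists>!h. h \<in> thom (MCar N) Z \<and> h \<bullet> ?Q = R"
        unfolding R'(1) ex[OF N R'(2), symmetric]
        by (intro l[THEN bspec, THEN bspec, THEN mp] R'(2,3))
    qed
  next
    assume r: ?r
    show ?l
    proof (intro ballI impI)
      fix Z r assume Z: "Z \<in> Ob C" "r \<in> Hom C (MCar M \<odot> Car B) Z" and e: "r \<cdot> (Act M \<star> Id C (Car B)) = r \<cdot> ?rf"
      have "Arr (MCar M \<odot> Car B) r Z \<bullet> (actT A M \<boxtimes> idn (Car B)) = Arr (MCar M \<odot> Car B) r Z \<bullet> ?f"
        using e by (simp add: tarrow_eq raw_simps raws)
      then show "\<exists>!h. h \<in> Hom C (MCar N) Z \<and> h \<cdot> q = r"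
        using r[rule_format, of "Arr (MCar M \<odot> Car B) r Z" Z] Z ex[OF N Z(1)] by (simp add: arr_Arr)
    qed
  qed
  show ?thesis
  proof (cases "module_ob C B N")
    case True
    note N = moduleD(1,2)[OF True B_simps(1)]
    show ?thesis
      unfolding is_base_change_def bchange_def coequalizer_def univ[OF N(1)]
      using True N by (auto simp: arr_Arr tarrow_eq raw_simps raws)
  qed (simp add: is_base_change_def bchange_def)
qed

text \<open>A base change exists by \<open>bchange_construct\<close>, so the \<open>SOME\<close> in
  \<open>base_change_choice\<close> selects one, and \<open>bchange_colim\<close> applies to
  whatever is selected.\<close>

lemma BC_Ob:
  assumes M: "module_ob C A M"
  shows "bchange M (FOb BC M) (Qbc M)" "colim_data M (FOb BC M) (Qbc M) (jbc M)"
proof -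
  obtain N Q j where b: "bchange M N Q" "colim_data M N Q j" by (rule bchange_construct[OF M])
  then have "Q \<in> thom (MCar M \<odot> Car B) (MCar N)" unfolding bchange_def by (elim conjE)
  then have Q: "Arr (MCar M \<odot> Car B) (raw Q) (MCar N) = Q" by (simp add: tarrow_eq)
  have "is_base_change C A B (raw F) M N (raw Q)"
    unfolding is_base_change_iff[OF M] Q by (rule b(1))
  then have "(\<lambda>(N, q). is_base_change C A B (raw F) M N q) (N, raw Q)" by simp
  then have "(\<lambda>(N, q). is_base_change C A B (raw F) M N q) (base_change_choice C A B (raw F) M)"
    unfolding base_change_choice_def by (rule someI)
  then have "is_base_change C A B (raw F) M (fst (base_change_choice C A B (raw F) M))
      (snd (base_change_choice C A B (raw F) M))"
    by (simp only: case_prod_beta)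
  then show bc: "bchange M (FOb BC M) (Qbc M)"
    unfolding is_base_change_iff[OF M] by (simp add: base_change_def Qbc_def)
  obtain j where "colim_data M (FOb BC M) (Qbc M) j" by (rule bchange_colim[OF M bc])
  then show "colim_data M (FOb BC M) (Qbc M) (jbc M)"
    unfolding jbc_def by (rule someI[of "colim_data M (FOb BC M) (Qbc M)"])
qed

lemma BC_module: "module_ob C A M \<Longrightarrow> module_ob C B (FOb BC M)"
  using BC_Ob(1) by (simp add: bchange_def)

lemma BC_col: "module_ob C A M \<Longrightarrow> scol (T_on M) (MCar (FOb BC M)) (jbc M)"
  using BC_Ob(2) by (simp add: colim_data_def)

lemma BC_Ar:
  assumes M: "module_ob C A M" and M': "module_ob C A M'" and h: "h \<in> Hom (Modules C A) M M'"
  shows "FAr BC M M' h \<in> Hom (Modules C B) (FOb BC M) (FOb BC M')"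
    and "Arr (MCar (FOb BC M)) (FAr BC M M' h) (MCar (FOb BC M')) \<bullet> jbc M n
      = jbc M' n \<bullet> Arr (MCar M) h (MCar M')"
proof -
  let ?N = "FOb BC M" and ?N' = "FOb BC M'" and ?H = "Arr (MCar M) h (MCar M')"
  note mM = moduleD(1,2)[OF M A_simps(1)] and mM' = moduleD(1,2)[OF M' A_simps(1)]
  note mN = moduleD(1,2)[OF BC_module[OF M] B_simps(1)] and mN' = moduleD(1,2)[OF BC_module[OF M'] B_simps(1)]
  have H: "?H \<in> thom (MCar M) (MCar M')" "?H \<bullet> actT A M = actT A M' \<bullet> (?H \<boxtimes> idn (Car A))"
    using h mM mM' by (simp_all add: Hom_Modules)
  obtain k where k: "k \<in> thom (MCar ?N) (MCar ?N')" "k \<bullet> actT B ?N = actT B ?N' \<bullet> (k \<boxtimes> idn (Car B))"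
    "k \<bullet> Qbc M = Qbc M' \<bullet> (?H \<boxtimes> idn (Car B))" "\<And>n. k \<bullet> jbc M n = jbc M' n \<bullet> ?H"
    and u: "\<And>k'. k' \<in> thom (MCar ?N) (MCar ?N') \<Longrightarrow> k' \<bullet> Qbc M = Qbc M' \<bullet> (?H \<boxtimes> idn (Car B)) \<Longrightarrow> k' = k"
    by (rule bchange_map[OF M M' BC_Ob[OF M] BC_Ob[OF M'] H]) (rule that)
  have k_Arr: "Arr (MCar ?N) (raw k) (MCar ?N') = k" using k(1) by (simp add: tarrow_eq)
  have "FAr BC M M' h = (THE r. r \<in> Hom (Modules C B) ?N ?N' \<and>
      r \<cdot> raw (Qbc M) = raw (Qbc M') \<cdot> (h \<star> Id C (Car B)))"
    by (simp add: base_change_def Qbc_def)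
  also have "\<dots> = raw k"
  proof (rule the_equality)
    show "raw k \<in> Hom (Modules C B) ?N ?N' \<and> raw k \<cdot> raw (Qbc M) = raw (Qbc M') \<cdot> (h \<star> Id C (Car B))"
      using k(1,2) mN mN' arg_cong[OF k(3), of raw] by (simp add: Hom_Modules k_Arr raw_simps)
    fix r assume r: "r \<in> Hom (Modules C B) ?N ?N' \<and> r \<cdot> raw (Qbc M) = raw (Qbc M') \<cdot> (h \<star> Id C (Car B))"
    then have "Arr (MCar ?N) r (MCar ?N') = k"
      using mN mN' by (intro u) (simp_all add: Hom_Modules, simp add: tarrow_eq raw_simps Qbc_def)
    then show "r = raw k" by auto
  qed
  finally have e: "FAr BC M M' h = raw k" .
  show "FAr BC M M' h \<in> Hom (Modules C B) ?N ?N'"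
    using k(1,2) mN mN' by (simp add: e Hom_Modules k_Arr)
  show "Arr (MCar ?N) (FAr BC M M' h) (MCar ?N') \<bullet> jbc M n = jbc M' n \<bullet> ?H"
    using k(4) by (simp add: e k_Arr)
qed

end

section \<open>Flatness\<close>

lemma is_limit_cong:
  assumes "\<And>i. i \<in> Ob J \<Longrightarrow> FOb F i = FOb G i"
    and "\<And>i j u. \<lbrakk>i \<in> Ob J; j \<in> Ob J; u \<in> Hom J i j\<rbrakk> \<Longrightarrow> FAr F i j u = FAr G i j u"
  shows "is_limit J C F L \<pi> \<longleftrightarrow> is_limit J C G L \<pi>"
proof -
  have "cone J C F M \<mu> \<longleftrightarrow> cone J C G M \<mu>" for M \<mu>
    using assms by (simp add: cone_def)
  then show ?thesis by (simp add: is_limit_def)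
qed

lemma is_colimit_cong:
  assumes "\<And>i. i \<in> Ob J \<Longrightarrow> FOb F i = FOb G i"
    and "\<And>i j u. \<lbrakk>i \<in> Ob J; j \<in> Ob J; u \<in> Hom J i j\<rbrakk> \<Longrightarrow> FAr F i j u = FAr G i j u"
  shows "is_colimit J C F L \<pi> \<longleftrightarrow> is_colimit J C G L \<pi>"
proof -
  have "cocone J C F M \<mu> \<longleftrightarrow> cocone J C G M \<mu>" for M \<mu>
    using assms by (simp add: cocone_def)
  then show ?thesis by (simp add: is_colimit_def)
qed

context category
begin

lemma epow_natural:
  assumes X: "X \<in> Ob C" "s \<in> Hom C X X" and Y: "Y \<in> Ob C" "s' \<in> Hom C Y Y"
    and h: "h \<in> Hom C X Y" "h \<cdot> s = s' \<cdot> h"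
  shows "h \<cdot> epow C X s n = epow C Y s' n \<cdot> h"
proof (induction n)
  case 0
  show ?case using Comp_Id_right[OF X(1) Y(1) h(1)] Comp_Id_left[OF X(1) Y(1) h(1)] by simp
next
  case (Suc n)
  note e = epow_in_Hom[OF X, of n] and e' = epow_in_Hom[OF Y, of n]
  have "h \<cdot> (epow C X s n \<cdot> s) = (epow C Y s' n \<cdot> h) \<cdot> s"
    using Comp_assoc[OF X(1) X(1) X(1) Y(1) X(2) e h(1)] Suc by simp
  also have "\<dots> = epow C Y s' n \<cdot> (s' \<cdot> h)"
    using Comp_assoc[OF X(1) X(1) Y(1) Y(1) X(2) h(1) e'] h(2) by simp
  also have "\<dots> = (epow C Y s' n \<cdot> s') \<cdot> h"
    using Comp_assoc[OF X(1) Y(1) Y(1) Y(1) h(1) Y(2) e'] by simp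
  finally show ?case by simp
qed

text \<open>A diagram on the product of the chain with \<open>K\<close>: at every stage the objects
  are those of \<open>G\<close>, and the maps along the chain are powers of the endomorphisms
  \<open>s\<close>. The function \<open>d\<close> reads the natural number off an object of the
  relabelled chain.\<close>

definition chain_prod ::
  "('k, 'v, 'a, 'b) ftor \<Rightarrow> ('k \<Rightarrow> 'b) \<Rightarrow> ('j \<Rightarrow> nat) \<Rightarrow> ('j \<times> 'k, 'u \<times> 'v, 'a, 'b) ftor" where
  "chain_prod G s d =
    \<lparr>FOb = (\<lambda>x. FOb G (snd x)),
     FAr = (\<lambda>x y w. epow C (FOb G (snd y)) (s (snd y)) (d (fst y) - d (fst x))
       \<cdot> FAr G (snd x) (snd y) (snd w))\<rparr>"

lemma is_functor_chain_prod:
  assumes G: "is_functor K C G"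
    and s: "\<And>k. k \<in> Ob K \<Longrightarrow> s k \<in> Hom C (FOb G k) (FOb G k)"
    and nat: "\<And>k l v. \<lbrakk>k \<in> Ob K; l \<in> Ob K; v \<in> Hom K k l\<rbrakk> \<Longrightarrow> FAr G k l v \<cdot> s k = s l \<cdot> FAr G k l v"
    and d: "\<And>i j u. \<lbrakk>i \<in> Ob J; j \<in> Ob J; u \<in> Hom J i j\<rbrakk> \<Longrightarrow> d i \<le> d j"
  shows "is_functor (prod_cat J K) C (chain_prod G s d)"
proof -
  let ?e = "\<lambda>k n. epow C (FOb G k) (s k) n"
  have G_Ob: "FOb G k \<in> Ob C" if "k \<in> Ob K" for k
    using G that by (simp add: is_functor_def)
  have G_Hom: "FAr G k l v \<in> Hom C (FOb G k) (FOb G l)" if "k \<in> Ob K" "l \<in> Ob K" "v \<in> Hom K k l" for k l v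
    using G that by (simp add: is_functor_def)
  have e: "?e k n \<in> Hom C (FOb G k) (FOb G k)" if "k \<in> Ob K" for k n
    using that by (intro epow_in_Hom G_Ob s)
  have comp: "?e m (p - r) \<cdot> FAr G k m (v' \<cdot>\<^bsub>K\<^esub> v) = (?e m (p - q) \<cdot> FAr G l m v') \<cdot> (?e l (q - r) \<cdot> FAr G k l v)"
    if k: "k \<in> Ob K" "l \<in> Ob K" "m \<in> Ob K" and v: "v \<in> Hom K k l" "v' \<in> Hom K l m" and le: "r \<le> q" "q \<le> p"
    for k l m v v' p q r
  proof -
    note O = G_Ob[OF k(1)] G_Ob[OF k(2)] G_Ob[OF k(3)]
    note v1 = G_Hom[OF k(1,2) v(1)] and v2 = G_Hom[OF k(2,3) v(2)]
    note e1 = e[OF k(2), of "q - r"] and e2 = e[OF k(3), of "p - q"] and e3 = e[OF k(3), of "q - r"]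
    have "(?e m (p - q) \<cdot> FAr G l m v') \<cdot> (?e l (q - r) \<cdot> FAr G k l v)
        = ?e m (p - q) \<cdot> (FAr G l m v' \<cdot> (?e l (q - r) \<cdot> FAr G k l v))"
      by (rule Comp_assoc[OF O(1) O(2) O(3) O(3) Comp_in_Hom[OF O(1) O(2) O(2) v1 e1] v2 e2])
    also have "FAr G l m v' \<cdot> (?e l (q - r) \<cdot> FAr G k l v) = (FAr G l m v' \<cdot> ?e l (q - r)) \<cdot> FAr G k l v"
      by (rule Comp_assoc[OF O(1) O(2) O(2) O(3) v1 e1 v2, symmetric])
    also have "FAr G l m v' \<cdot> ?e l (q - r) = ?e m (q - r) \<cdot> FAr G l m v'"
      by (rule epow_natural[OF O(2) s[OF k(2)] O(3) s[OF k(3)] v2 nat[OF k(2,3) v(2)]])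
    also have "(?e m (q - r) \<cdot> FAr G l m v') \<cdot> FAr G k l v = ?e m (q - r) \<cdot> (FAr G l m v' \<cdot> FAr G k l v)"
      by (rule Comp_assoc[OF O(1) O(2) O(3) O(3) v1 v2 e3])
    also have "?e m (p - q) \<cdot> (?e m (q - r) \<cdot> (FAr G l m v' \<cdot> FAr G k l v))
        = (?e m (p - q) \<cdot> ?e m (q - r)) \<cdot> (FAr G l m v' \<cdot> FAr G k l v)"
      by (rule Comp_assoc[OF O(1) O(3) O(3) O(3) Comp_in_Hom[OF O(1) O(2) O(3) v1 v2] e3 e2, symmetric])
    also have "?e m (p - q) \<cdot> ?e m (q - r) = ?e m (p - r)"
    proof -
      have "p - r = (p - q) + (q - r)" using le by simp
      then show ?thesis by (simp only: epow_add[OF O(3) s[OF k(3)]])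
    qed
    also have "FAr G l m v' \<cdot> FAr G k l v = FAr G k m (v' \<cdot>\<^bsub>K\<^esub> v)"
      using G k v by (simp add: is_functor_def)
    finally show ?thesis ..
  qed
  show ?thesis
    unfolding is_functor_def
  proof (intro conjI ballI)
    fix x assume x: "x \<in> Ob (prod_cat J K)"
    then have "snd x \<in> Ob K" by (auto simp: prod_cat_def)
    note x' = this G_Ob[OF this]
    show "FOb (chain_prod G s d) x \<in> Ob C" using x' by (simp add: chain_prod_def)
    have "FAr G (snd x) (snd x) (Id K (snd x)) = Id C (FOb G (snd x))"
      using G x' by (simp add: is_functor_def)
    then show "FAr (chain_prod G s d) x x (Id (prod_cat J K) x) = Id C (FOb (chain_prod G s d) x)"
      using Comp_Id_left[OF x'(2) x'(2) Id_in_Hom[OF x'(2)]] by (simp add: chain_prod_def prod_cat_def)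
  next
    fix x y w assume "x \<in> Ob (prod_cat J K)" "y \<in> Ob (prod_cat J K)" "w \<in> Hom (prod_cat J K) x y"
    then have w: "snd x \<in> Ob K" "snd y \<in> Ob K" "snd w \<in> Hom K (snd x) (snd y)"
      by (auto simp: prod_cat_def)
    show "FAr (chain_prod G s d) x y w \<in> Hom C (FOb (chain_prod G s d) x) (FOb (chain_prod G s d) y)"
      using Comp_in_Hom[OF G_Ob[OF w(1)] G_Ob[OF w(2)] G_Ob[OF w(2)] G_Hom[OF w] e[OF w(2)]]
      by (simp add: chain_prod_def)
  next
    fix x y z f g
    assume "x \<in> Ob (prod_cat J K)" "y \<in> Ob (prod_cat J K)" "z \<in> Ob (prod_cat J K)"
      "f \<in> Hom (prod_cat J K) x y" "g \<in> Hom (prod_cat J K) y z"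
    then have w: "snd x \<in> Ob K" "snd y \<in> Ob K" "snd z \<in> Ob K" "snd f \<in> Hom K (snd x) (snd y)"
        "snd g \<in> Hom K (snd y) (snd z)" "d (fst x) \<le> d (fst y)" "d (fst y) \<le> d (fst z)"
      using d by (auto simp: prod_cat_def)
    show "FAr (chain_prod G s d) x z (g \<cdot>\<^bsub>prod_cat J K\<^esub> f)
        = FAr (chain_prod G s d) y z g \<cdot> FAr (chain_prod G s d) x y f"
      using comp[OF w] by (simp add: chain_prod_def prod_cat_def)
  qed
qed

end

section \<open>Finite limits of modules\<close>

context algebraic_context
begin

text \<open>The limit in \<open>C\<close> inherits an action, so limits of modules are computed in
  \<open>C\<close>. The second conclusion keeps joint monicity for arbitrary arrows of
  \<open>C\<close>, because linearity is later tested on arrows out of a tensor product, which are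
  not given as module maps.\<close>

lemma Modules_limit:
  assumes A: "comm_monoid_ob C A" and K: "finite_cat K" and G: "is_functor K (Modules C A) G"
  obtains Y p where "is_limit K (Modules C A) G Y p"
    and "\<forall>Z. \<forall>x \<in> thom Z (MCar Y). \<forall>y \<in> thom Z (MCar Y).
      (\<forall>k \<in> Ob K. Arr (MCar Y) (p k) (MCar (FOb G k)) \<bullet> x = Arr (MCar Y) (p k) (MCar (FOb G k)) \<bullet> y)
      \<longrightarrow> x = y"
proof -
  note A_Ob = monoidD(1)[OF A]
  let ?A = "Car A" and ?m = "mulT A"
  note [simp] = monoidD(1-3)[OF A]
  interpret K: category K using K by (simp add: finite_cat_def)
  let ?X = "\<lambda>k. MCar (FOb G k)"
  let ?G = "\<lambda>k l v. Arr (?X k) (FAr G k l v) (?X l)"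
  have M: "module_ob C A (FOb G k)" if "k \<in> Ob K" for k
    using G that by (simp add: is_functor_def)
  note mM = moduleD(1,2)[OF M A_Ob]
  have Gv: "FAr G k l v \<in> Hom (Modules C A) (FOb G k) (FOb G l)" if "k \<in> Ob K" "l \<in> Ob K" "v \<in> Hom K k l" for k l v
    using G that by (simp add: is_functor_def)
  have GA: "arr (?G k l v)" "?G k l v \<bullet> actT A (FOb G k) = actT A (FOb G l) \<bullet> (?G k l v \<boxtimes> idn ?A)"
    if "k \<in> Ob K" "l \<in> Ob K" "v \<in> Hom K k l" for k l v
    using Gv[OF that] mM[OF that(1)] mM[OF that(2)] by (simp_all add: Hom_Modules)
  define G0 where "G0 = \<lparr>FOb = ?X, FAr = FAr G\<rparr>"
  have G0: "is_functor K C G0"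
    using G mM(1) Hom_Modules_Hom[OF Gv] by (simp add: is_functor_def G0_def)
  obtain e :: "nat \<Rightarrow> 'i" where e: "inj e" using ex_inj_nat[OF universe_uncountable] .
  \<comment> \<open>Limits are assumed over categories inside the universe. Objects and arrows of
    \<open>K\<close> are both natural numbers, so one injection serves for both.\<close>
  have J: "small_cat (relabel_cat e e K)"
    by (rule small_relabel[OF e e]) (simp_all add: K.category_axioms universe_uncountable)
  obtain Y0 \<pi> where "is_limit (relabel_cat e e K) C (relabel_ftor e e G0) Y0 \<pi>"
    using small_limits J is_functor_relabel[OF e e G0] unfolding has_small_limits_def by blast
  then have lim: "is_limit K C G0 Y0 (\<pi> \<circ> e)"
    by (simp add: is_limit_relabel[OF e e])
  define p where "p = \<pi> \<circ> e"
  define P where "P k = Arr Y0 (p k) (?X k)" for k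
  have Y0 [simp]: "Y0 \<in> Ob C" using lim by (simp add: is_limit_def cone_def)
  have P [simp]: "src (P k) = Y0" "tgt (P k) = ?X k" for k by (simp_all add: P_def)
  have P_arr: "arr (P k)" if "k \<in> Ob K" for k
    using lim mM(1)[OF that] that by (simp add: is_limit_def cone_def P_def arr_Arr p_def G0_def)
  have GP: "?G k l v \<bullet> P k = P l" if "k \<in> Ob K" "l \<in> Ob K" "v \<in> Hom K k l" for k l v
    using lim that by (simp add: is_limit_def cone_def P_def tcomp_def p_def G0_def)
  have ex: "\<exists>!h. h \<in> Hom C Z Y0 \<and> (\<forall>k \<in> Ob K. p k \<cdot> h = \<mu> k)" if "cone K C G0 Z \<mu>" for Z \<mu>
    using lim that by (simp add: is_limit_def p_def)
  have factor: "\<exists>h. h \<in> thom Z Y0 \<and> (\<forall>k \<in> Ob K. P k \<bullet> h = \<mu> k)"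
    if Z: "Z \<in> Ob C" and m: "\<And>k. k \<in> Ob K \<Longrightarrow> \<mu> k \<in> thom Z (?X k)"
      and v: "\<And>k l v. \<lbrakk>k \<in> Ob K; l \<in> Ob K; v \<in> Hom K k l\<rbrakk> \<Longrightarrow> ?G k l v \<bullet> \<mu> k = \<mu> l" for Z \<mu>
  proof -
    have "raw (\<mu> k) \<in> Hom C Z (?X k)" if "k \<in> Ob K" for k
      using m[OF that] by (auto simp: arr_def simp del: arr_Ob)
    moreover have "FAr G k l v \<cdot> raw (\<mu> k) = raw (\<mu> l)" if "k \<in> Ob K" "l \<in> Ob K" "v \<in> Hom K k l" for k l v
      using arg_cong[OF v[OF that], of raw] by (simp add: raw_simps)
    ultimately have "cone K C G0 Z (\<lambda>k. raw (\<mu> k))"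
      using Z by (simp add: cone_def G0_def)
    from ex[OF this] obtain h where h: "h \<in> Hom C Z Y0 \<and> (\<forall>k \<in> Ob K. p k \<cdot> h = raw (\<mu> k))" by (elim ex1E)
    show ?thesis
    proof (intro exI[of _ "Arr Z h Y0"] conjI ballI)
      show "Arr Z h Y0 \<in> thom Z Y0" using h Z by (simp add: arr_Arr)
      show "P k \<bullet> Arr Z h Y0 = \<mu> k" if "k \<in> Ob K" for k
        using h that m[OF that] by (simp add: tarrow_eq raw_simps) (simp add: P_def)
    qed
  qed
  have jm: "x = y" if x: "x \<in> thom Z Y0" and y: "y \<in> thom Z Y0"
    and eq: "\<And>k. k \<in> Ob K \<Longrightarrow> P k \<bullet> x = P k \<bullet> y" for x y Z
  proof -
    have Z: "Z \<in> Ob C" using x arr_Ob(1)[of x] by simp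
    have xy: "raw x \<in> Hom C Z Y0" "raw y \<in> Hom C Z Y0"
      using x y by (auto simp: arr_def simp del: arr_Ob)
    have "FAr G k l v \<cdot> (p k \<cdot> raw x) = p l \<cdot> raw x" if "k \<in> Ob K" "l \<in> Ob K" "v \<in> Hom K k l" for k l v
    proof -
      have "?G k l v \<bullet> P k \<bullet> x = P l \<bullet> x"
        using reassoc[OF GP[OF that], of x] GA(1)[OF that] P_arr[OF that(1)] x by simp
      from arg_cong[OF this, of raw] show ?thesis by (simp add: raw_simps P_def)
    qed
    moreover have "p k \<cdot> raw x \<in> Hom C Z (?X k)" if "k \<in> Ob K" for k
      using Comp_in_Hom[OF Z Y0 mM(1)[OF that] xy(1)] P_arr[OF that] by (simp add: P_def arr_Arr)
    ultimately have "cone K C G0 Z (\<lambda>k. p k \<cdot> raw x)"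
      using Z by (simp add: cone_def G0_def)
    from ex[OF this] obtain h where h: "\<forall>h'. h' \<in> Hom C Z Y0 \<and> (\<forall>k \<in> Ob K. p k \<cdot> h' = p k \<cdot> raw x) \<longrightarrow> h' = h"
      by (elim ex1E)
    have "p k \<cdot> raw y = p k \<cdot> raw x" if "k \<in> Ob K" for k
      using arg_cong[OF eq[OF that], of raw] by (simp add: raw_simps P_def)
    then have "raw x = h" "raw y = h" using h xy by simp_all
    then show ?thesis using x y by (simp add: tarrow_eq)
  qed
  obtain b where b: "b \<in> thom (Y0 \<odot> ?A) Y0 \<and> (\<forall>k \<in> Ob K. P k \<bullet> b = actT A (FOb G k) \<bullet> (P k \<boxtimes> idn ?A))"
  proof -
    have "\<exists>h. h \<in> thom (Y0 \<odot> ?A) Y0 \<and> (\<forall>k \<in> Ob K. P k \<bullet> h = actT A (FOb G k) \<bullet> (P k \<boxtimes> idn ?A))"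
    proof (rule factor)
      fix k l v assume kl: "k \<in> Ob K" "l \<in> Ob K" "v \<in> Hom K k l"
      note [simp] = P_arr[OF kl(1)] P_arr[OF kl(2)] mM[OF kl(1)] mM[OF kl(2)] GA(1)[OF kl]
      show "?G k l v \<bullet> actT A (FOb G k) \<bullet> (P k \<boxtimes> idn ?A) = actT A (FOb G l) \<bullet> (P l \<boxtimes> idn ?A)"
        using reassoc[OF GA(2)[OF kl], of "P k \<boxtimes> idn ?A"] by (simp add: ten_comp GP[OF kl])
    qed (use P_arr mM in simp_all)
    then show ?thesis by (elim exE) (rule that)
  qed
  then have b [simp]: "arr b" "src b = Y0 \<odot> ?A" "tgt b = Y0"
    and Pb: "\<And>k. k \<in> Ob K \<Longrightarrow> P k \<bullet> b = actT A (FOb G k) \<bullet> (P k \<boxtimes> idn ?A)" by auto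
  define Y where "Y = \<lparr>MCar = Y0, Act = raw b\<rparr>"
  have Y_simps [simp]: "MCar Y = Y0" "actT A Y = b"
    using b by (simp_all add: Y_def actT_def tarrow_eq)
  have Y: "module_ob C A Y"
    unfolding module_ob_iff[OF A_Ob] Y_simps
  proof (intro conjI)
    show "b \<bullet> (b \<boxtimes> idn ?A) = b \<bullet> ((idn Y0 \<boxtimes> ?m) \<bullet> asc Y0 ?A ?A)"
    proof (rule jm)
      fix k assume k: "k \<in> Ob K"
      let ?a = "actT A (FOb G k)"
      note [simp] = P_arr[OF k] mM[OF k]
      have "P k \<bullet> b \<bullet> (b \<boxtimes> idn ?A) = ?a \<bullet> (?a \<boxtimes> idn ?A) \<bullet> ((P k \<boxtimes> idn ?A) \<boxtimes> idn ?A)"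
        using reassoc[OF Pb[OF k], of "b \<boxtimes> idn ?A"] by (simp add: ten_comp Pb[OF k])
      also have "\<dots> = ?a \<bullet> (idn (?X k) \<boxtimes> ?m) \<bullet> asc (?X k) ?A ?A \<bullet> ((P k \<boxtimes> idn ?A) \<boxtimes> idn ?A)"
        using reassoc[OF moduleD(3)[OF M[OF k] A_Ob], of "(P k \<boxtimes> idn ?A) \<boxtimes> idn ?A"] by simp
      also have "\<dots> = ?a \<bullet> (P k \<boxtimes> idn ?A) \<bullet> (idn Y0 \<boxtimes> ?m) \<bullet> asc Y0 ?A ?A"
        using asc_nat[of "P k" "idn ?A" "idn ?A" "?X k" ?A ?A] by (simp add: ten_comp2)
      also have "\<dots> = P k \<bullet> b \<bullet> (idn Y0 \<boxtimes> ?m) \<bullet> asc Y0 ?A ?A"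
        using reassoc[OF Pb[OF k], of "(idn Y0 \<boxtimes> ?m) \<bullet> asc Y0 ?A ?A"] by simp
      finally show "P k \<bullet> b \<bullet> (b \<boxtimes> idn ?A) = P k \<bullet> b \<bullet> (idn Y0 \<boxtimes> ?m) \<bullet> asc Y0 ?A ?A" .
    qed simp_all
    show "b \<bullet> (idn Y0 \<boxtimes> uniT A) = run Y0"
    proof (rule jm)
      fix k assume k: "k \<in> Ob K"
      let ?a = "actT A (FOb G k)"
      note [simp] = P_arr[OF k] mM[OF k]
      have "P k \<bullet> b \<bullet> (idn Y0 \<boxtimes> uniT A) = ?a \<bullet> (idn (?X k) \<boxtimes> uniT A) \<bullet> (P k \<boxtimes> idn (Unit C))"
        using reassoc[OF Pb[OF k], of "idn Y0 \<boxtimes> uniT A"] by (simp add: ten_comp)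
      also have "\<dots> = run (?X k) \<bullet> (P k \<boxtimes> idn (Unit C))"
        using reassoc[OF moduleD(4)[OF M[OF k] A_Ob], of "P k \<boxtimes> idn (Unit C)"] by simp
      finally show "P k \<bullet> b \<bullet> (idn Y0 \<boxtimes> uniT A) = P k \<bullet> run Y0"
        by (simp add: run_nat)
    qed simp_all
  qed simp_all
  have p_Hom: "p k \<in> Hom (Modules C A) Y (FOb G k)" if "k \<in> Ob K" for k
    using Pb[OF that] P_arr[OF that] mM[OF that] by (simp add: Hom_Modules flip: P_def)
  have "is_limit K (Modules C A) G Y p"
    unfolding is_limit_def
  proof (intro conjI allI impI)
    have "FAr G k l v \<cdot> p k = p l" if "k \<in> Ob K" "l \<in> Ob K" "v \<in> Hom K k l" for k l v
      using arg_cong[OF GP[OF that], of raw] by (simp add: raw_simps) (simp add: P_def)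
    then show "cone K (Modules C A) G Y p"
      using Y p_Hom by (simp add: cone_def)
    fix W \<mu> assume W: "cone K (Modules C A) G W \<mu>"
    have W_mod: "module_ob C A W" using W by (simp add: cone_def)
    note mW [simp] = moduleD(1,2)[OF W_mod A_Ob]
    define D where "D k = Arr (MCar W) (\<mu> k) (?X k)" for k
    have D [simp]: "src (D k) = MCar W" "tgt (D k) = ?X k" for k by (simp_all add: D_def)
    have Dk: "arr (D k)" "D k \<bullet> actT A W = actT A (FOb G k) \<bullet> (D k \<boxtimes> idn ?A)" if "k \<in> Ob K" for k
    proof -
      have "\<mu> k \<in> Hom (Modules C A) W (FOb G k)" using W that by (simp add: cone_def)
      then show "arr (D k)" "D k \<bullet> actT A W = actT A (FOb G k) \<bullet> (D k \<boxtimes> idn ?A)"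
        using mM[OF that] by (simp_all add: Hom_Modules D_def)
    qed
    have GD: "?G k l v \<bullet> D k = D l" if "k \<in> Ob K" "l \<in> Ob K" "v \<in> Hom K k l" for k l v
      using W that by (simp add: cone_def D_def tcomp_def)
    obtain h where h: "h \<in> thom (MCar W) Y0 \<and> (\<forall>k \<in> Ob K. P k \<bullet> h = D k)"
    proof -
      have "\<exists>h. h \<in> thom (MCar W) Y0 \<and> (\<forall>k \<in> Ob K. P k \<bullet> h = D k)"
        by (rule factor) (use Dk GD in simp_all)
      then show ?thesis by (elim exE) (rule that)
    qed
    then have h [simp]: "arr h" "src h = MCar W" "tgt h = Y0" and Ph: "\<And>k. k \<in> Ob K \<Longrightarrow> P k \<bullet> h = D k" by auto
    have hl: "h \<bullet> actT A W = b \<bullet> (h \<boxtimes> idn ?A)"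
    proof (rule jm)
      fix k assume k: "k \<in> Ob K"
      note [simp] = P_arr[OF k] mM[OF k]
      have "P k \<bullet> h \<bullet> actT A W = D k \<bullet> actT A W"
        using reassoc[OF Ph[OF k], of "actT A W"] by simp
      also have "\<dots> = P k \<bullet> b \<bullet> (h \<boxtimes> idn ?A)"
        using reassoc[OF Pb[OF k], of "h \<boxtimes> idn ?A"] by (simp add: ten_comp Ph[OF k] Dk(2)[OF k])
      finally show "P k \<bullet> h \<bullet> actT A W = P k \<bullet> b \<bullet> (h \<boxtimes> idn ?A)" .
    qed simp_all
    have h_Arr: "Arr (MCar W) (raw h) Y0 = h" by (simp add: tarrow_eq)
    show "\<exists>!h. h \<in> Hom (Modules C A) W Y \<and> (\<forall>i \<in> Ob K. p i \<cdot>\<^bsub>Modules C A\<^esub> h = \<mu> i)"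
    proof (intro ex1I[of _ "raw h"] conjI ballI)
      show "raw h \<in> Hom (Modules C A) W Y" by (simp add: Hom_Modules h_Arr hl)
      show "p k \<cdot>\<^bsub>Modules C A\<^esub> raw h = \<mu> k" if "k \<in> Ob K" for k
        using arg_cong[OF Ph[OF that], of raw] by (simp add: raw_simps) (simp add: P_def D_def)
      fix r assume r: "r \<in> Hom (Modules C A) W Y \<and> (\<forall>i \<in> Ob K. p i \<cdot>\<^bsub>Modules C A\<^esub> r = \<mu> i)"
      have "Arr (MCar W) r Y0 = h"
      proof (rule jm)
        fix k assume k: "k \<in> Ob K"
        show "P k \<bullet> Arr (MCar W) r Y0 = P k \<bullet> h"
          unfolding Ph[OF k] using r k by (simp add: P_def D_def tcomp_def)
      qed (use r in \<open>simp_all add: Hom_Modules\<close>)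
      then show "r = raw h" by auto
    qed
  qed
  then show ?thesis
  proof (rule that, intro allI ballI impI)
    fix Z x y assume "x \<in> thom Z (MCar Y)" "y \<in> thom Z (MCar Y)"
      "\<forall>k \<in> Ob K. Arr (MCar Y) (p k) (?X k) \<bullet> x = Arr (MCar Y) (p k) (?X k) \<bullet> y"
    then show "x = y" by (intro jm[of x Z y]) (simp_all add: P_def)
  qed
qed

end

section \<open>Restriction of scalars and exactness of base change\<close>

context localisation
begin

text \<open>Restriction of scalars along \<open>F\<close>.\<close>

definition res :: "('o, 'a) amod \<Rightarrow> ('o, 'a) amod" where
  "res N = \<lparr>MCar = MCar N, Act = raw (actT B N \<bullet> (idn (MCar N) \<boxtimes> F))\<rparr>"

lemma res_simps [simp]: "MCar (res N) = MCar N" "actT A (res N) = actT B N \<bullet> (idn (MCar N) \<boxtimes> F)"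
proof -
  show "MCar (res N) = MCar N" by (simp add: res_def)
  show "actT A (res N) = actT B N \<bullet> (idn (MCar N) \<boxtimes> F)"
    unfolding tarrow_eq by (simp, simp add: actT_def res_def)
qed

lemma res_module:
  assumes N: "module_ob C B N"
  shows "module_ob C A (res N)"
  unfolding module_ob_iff[OF A_simps(1)] res_simps
proof (intro conjI)
  let ?b = "actT B N" and ?N = "MCar N" and ?A = "Car A" and ?B = "Car B"
  note [simp] = moduleD(1,2)[OF N B_simps(1)]
  have "(?b \<bullet> (idn ?N \<boxtimes> F)) \<bullet> ((?b \<bullet> (idn ?N \<boxtimes> F)) \<boxtimes> idn ?A)
      = ?b \<bullet> (?b \<boxtimes> idn ?B) \<bullet> ((idn ?N \<boxtimes> F) \<boxtimes> F)"
    by (simp add: ten_comp)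
  also have "\<dots> = ?b \<bullet> (idn ?N \<boxtimes> mulT B) \<bullet> asc ?N ?B ?B \<bullet> ((idn ?N \<boxtimes> F) \<boxtimes> F)"
    using reassoc[OF moduleD(3)[OF N B_simps(1)], of "(idn ?N \<boxtimes> F) \<boxtimes> F"] by simp
  also have "\<dots> = ?b \<bullet> (idn ?N \<boxtimes> (mulT B \<bullet> (F \<boxtimes> F))) \<bullet> asc ?N ?A ?A"
    using asc_nat[of "idn ?N" F F ?N ?B ?B] by (simp add: ten_comp2)
  also have "\<dots> = (?b \<bullet> (idn ?N \<boxtimes> F)) \<bullet> (idn ?N \<boxtimes> mulT A) \<bullet> asc ?N ?A ?A"
    by (simp add: ten_comp2 F_mul)
  finally show "(?b \<bullet> (idn ?N \<boxtimes> F)) \<bullet> ((?b \<bullet> (idn ?N \<boxtimes> F)) \<boxtimes> idn ?A)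
    = (?b \<bullet> (idn ?N \<boxtimes> F)) \<bullet> (idn ?N \<boxtimes> mulT A) \<bullet> asc ?N ?A ?A" .
  show "(?b \<bullet> (idn ?N \<boxtimes> F)) \<bullet> (idn ?N \<boxtimes> uniT A) = run ?N"
    by (simp add: ten_comp F_uni moduleD(4)[OF N B_simps(1)])
qed (use moduleD(1,2)[OF N B_simps(1)] in simp_all)

lemma res_Hom:
  assumes N: "module_ob C B N" "module_ob C B N'" and h: "h \<in> Hom (Modules C B) N N'"
  shows "h \<in> Hom (Modules C A) (res N) (res N')"
proof -
  note m [simp] = moduleD(1,2)[OF N(1) B_simps(1)] moduleD(1,2)[OF N(2) B_simps(1)]
  let ?H = "Arr (MCar N) h (MCar N')"
  have H: "arr ?H" "?H \<bullet> actT B N = actT B N' \<bullet> (?H \<boxtimes> idn (Car B))"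
    using h by (simp_all add: Hom_Modules)
  have "?H \<bullet> actT B N \<bullet> (idn (MCar N) \<boxtimes> F) = actT B N' \<bullet> (idn (MCar N') \<boxtimes> F) \<bullet> (?H \<boxtimes> idn (Car A))"
    using reassoc[OF H(2), of "idn (MCar N) \<boxtimes> F"] H(1) by (simp add: ten_comp)
  then show ?thesis using H(1) by (simp add: Hom_Modules)
qed

lemma jbc_simps [simp]:
  assumes "module_ob C A M"
  shows "arr (jbc M n)" "src (jbc M n) = MCar M" "tgt (jbc M n) = MCar (FOb BC M)"
  using scolD(4)[OF BC_col[OF assms], of n] by simp_all

lemma jbc_Arr: "module_ob C A M \<Longrightarrow> Arr (MCar M) (raw (jbc M n)) (MCar (FOb BC M)) = jbc M n"
  by (simp add: tarrow_eq)

lemma T_on_Arr: "Arr (MCar M) (raw (T_on M)) (MCar M) = T_on M"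
  by (simp add: tarrow_eq)

lemma T_on_Hom: "module_ob C A M \<Longrightarrow> raw (T_on M) \<in> Hom (Modules C A) M M"
  using moduleD(1,2)[of A M] T_on_act[of M]
  by (simp add: Hom_Modules T_on_Arr)

lemma jbc_Hom:
  assumes M: "module_ob C A M"
  shows "raw (jbc M n) \<in> Hom (Modules C A) M (res (FOb BC M))"
proof -
  note m = moduleD(1,2)[OF M A_simps(1)] moduleD(1,2)[OF BC_module[OF M] B_simps(1)]
  have "actT B (FOb BC M) \<bullet> (jbc M n \<boxtimes> \<iota> 0) = jbc M (n + 0) \<bullet> actT A M"
    using BC_Ob(2)[OF M] unfolding colim_data_def by blast
  then show ?thesis
    using m M by (simp add: Hom_Modules jbc_Arr ten_comp \<iota>_0)
qed

text \<open>The commutation with finite limits is a statement about modules, so the colimit of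
  \<open>BC_col\<close>, which is one in \<open>C\<close>, is restated for the base change regarded
  as an A-module.\<close>

lemma BC_colimit:
  assumes M: "module_ob C A M"
  shows "is_colimit nat_chain (Modules C A) (endo_chain (Modules C A) M (raw (T_on M)))
    (res (FOb BC M)) (\<lambda>n. raw (jbc M n))"
proof (rule is_colimit_Modules[OF monoid_A M res_module[OF BC_module[OF M]] T_on_Hom[OF M] jbc_Hom[OF M]])
  show "scol (Arr (MCar M) (raw (T_on M)) (MCar M)) (MCar (res (FOb BC M)))
    (\<lambda>n. Arr (MCar M) (raw (jbc M n)) (MCar (res (FOb BC M))))"
    using BC_col[OF M] by (simp add: T_on_Arr jbc_Arr[OF M])
qed

text \<open>Both functor laws are tested on the jointly epic stage maps \<open>jbc\<close>. In
  \<open>flat\<close> they make the base changed diagram a functor again.\<close>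

lemma BC_functor: "is_functor (Modules C A) (Modules C B) BC"
  unfolding is_functor_def
proof (intro conjI ballI)
  fix M assume "M \<in> Ob (Modules C A)"
  then have M: "module_ob C A M" by simp
  then show "FOb BC M \<in> Ob (Modules C B)" using BC_module by simp
  interpret ModA: category "Modules C A" by (rule category_Modules[OF monoid_A])
  note m [simp] = moduleD(1,2)[OF M A_simps(1)] moduleD(1,2)[OF BC_module[OF M] B_simps(1)]
  have i: "Id C (MCar M) \<in> Hom (Modules C A) M M" using ModA.Id_in_Hom[of M] M by simp
  have "Arr (MCar (FOb BC M)) (FAr BC M M (Id C (MCar M))) (MCar (FOb BC M)) = idn (MCar (FOb BC M))"
  proof (rule scol_unique[OF BC_col[OF M], of _ "MCar (FOb BC M)"])
    show "Arr (MCar (FOb BC M)) (FAr BC M M (Id C (MCar M))) (MCar (FOb BC M)) \<bullet> jbc M n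
        = idn (MCar (FOb BC M)) \<bullet> jbc M n" for n
      using BC_Ar(2)[OF M M i, of n] M by (simp flip: idn_def)
  qed (use BC_Ar(1)[OF M M i] in \<open>simp_all add: Hom_Modules\<close>)
  then show "FAr BC M M (Id (Modules C A) M) = Id (Modules C B) (FOb BC M)"
    by (simp add: idn_def)
next
  fix M N f assume "M \<in> Ob (Modules C A)" "N \<in> Ob (Modules C A)" "f \<in> Hom (Modules C A) M N"
  then show "FAr BC M N f \<in> Hom (Modules C B) (FOb BC M) (FOb BC N)"
    by (intro BC_Ar(1)) simp_all
next
  fix M N P f g
  assume "M \<in> Ob (Modules C A)" "N \<in> Ob (Modules C A)" "P \<in> Ob (Modules C A)"
    and f: "f \<in> Hom (Modules C A) M N" and g: "g \<in> Hom (Modules C A) N P"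
  then have M: "module_ob C A M" and N: "module_ob C A N" and P: "module_ob C A P" by simp_all
  interpret ModA: category "Modules C A" by (rule category_Modules[OF monoid_A])
  note m [simp] = moduleD(1,2)[OF M A_simps(1)] moduleD(1,2)[OF BC_module[OF M] B_simps(1)]
    moduleD(1,2)[OF N A_simps(1)] moduleD(1,2)[OF BC_module[OF N] B_simps(1)]
    moduleD(1,2)[OF P A_simps(1)] moduleD(1,2)[OF BC_module[OF P] B_simps(1)]
  let ?G = "\<lambda>M N f. Arr (MCar (FOb BC M)) (FAr BC M N f) (MCar (FOb BC N))"
  have gf: "g \<cdot> f \<in> Hom (Modules C A) M P"
    using ModA.Comp_in_Hom[of M N P f g] M N P f g by simp
  have a [simp]: "arr (?G M N f)" "arr (?G N P g)" "arr (?G M P (g \<cdot> f))"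
    "arr (Arr (MCar M) f (MCar N))" "arr (Arr (MCar N) g (MCar P))"
    using BC_Ar(1)[OF M N f] BC_Ar(1)[OF N P g] BC_Ar(1)[OF M P gf] f g by (simp_all add: Hom_Modules)
  have "?G M P (g \<cdot> f) = ?G N P g \<bullet> ?G M N f"
  proof (rule scol_unique[OF BC_col[OF M], of _ "MCar (FOb BC P)"])
    fix n
    have "?G M P (g \<cdot> f) \<bullet> jbc M n = jbc P n \<bullet> Arr (MCar N) g (MCar P) \<bullet> Arr (MCar M) f (MCar N)"
      unfolding BC_Ar(2)[OF M P gf] by (simp add: tcomp_def)
    also have "\<dots> = ?G N P g \<bullet> jbc N n \<bullet> Arr (MCar M) f (MCar N)"
      using reassoc[OF BC_Ar(2)[OF N P g, of n], of "Arr (MCar M) f (MCar N)"] N P by simp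
    also have "\<dots> = (?G N P g \<bullet> ?G M N f) \<bullet> jbc M n"
      using M by (simp add: BC_Ar(2)[OF M N f])
    finally show "?G M P (g \<cdot> f) \<bullet> jbc M n = (?G N P g \<bullet> ?G M N f) \<bullet> jbc M n" .
  qed simp_all
  then show "FAr BC M P (g \<cdot>\<^bsub>Modules C A\<^esub> f) = FAr BC N P g \<cdot>\<^bsub>Modules C B\<^esub> FAr BC M N f"
    by (simp add: tcomp_def)
qed

lemma T_on_natural:
  assumes M: "module_ob C A M" "module_ob C A M'" and h: "h \<in> Hom (Modules C A) M M'"
  shows "h \<cdot> raw (T_on M) = raw (T_on M') \<cdot> h"
proof -
  note [simp] = moduleD(1,2)[OF M(1) A_simps(1)] moduleD(1,2)[OF M(2) A_simps(1)]
  have "Arr (MCar M) h (MCar M') \<bullet> T_on M = T_on M' \<bullet> Arr (MCar M) h (MCar M')"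
    using h by (intro T_on_linear[OF M]) (simp_all add: Hom_Modules)
  from arg_cong[OF this, of raw] show ?thesis by (simp add: raw_simps)
qed

lemma BC_natural:
  assumes "module_ob C A M" "module_ob C A M'" "h \<in> Hom (Modules C A) M M'"
  shows "FAr BC M M' h \<cdot> raw (jbc M n) = raw (jbc M' n) \<cdot> h"
  using arg_cong[OF BC_Ar(2)[OF assms, of n], of raw] by (simp add: raw_simps)

text \<open>Commutation yields an isomorphism \<open>\<phi>\<close> of A-modules from the base
  change of \<open>L\<close> to a limit \<open>Y\<close> of the base changes. It remains to match
  its components with the base changed projections and to pass from A-linear to B-linear
  maps.\<close>

lemma flat: "preserves_finite_limits (Modules C A) (Modules C B) BC"
  unfolding preserves_finite_limits_def
proof (intro allI impI, elim conjE)
  fix K :: "(nat, nat) cat" and G L \<pi>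
  assume K: "finite_cat K" and G: "is_functor K (Modules C A) G" and L_lim: "is_limit K (Modules C A) G L \<pi>"
  interpret ModA: category "Modules C A" by (rule category_Modules[OF monoid_A])
  interpret K: category K using K by (simp add: finite_cat_def)
  let ?MA = "Modules C A" and ?MB = "Modules C B"
  have M: "module_ob C A (FOb G k)" if "k \<in> Ob K" for k
    using G that by (simp add: is_functor_def)
  have M': "FOb G k \<in> Ob ?MA" if "k \<in> Ob K" for k
    using M[OF that] by simp
  have GA: "FAr G k l v \<in> Hom ?MA (FOb G k) (FOb G l)" if "k \<in> Ob K" "l \<in> Ob K" "v \<in> Hom K k l" for k l v
    using G that by (simp add: is_functor_def)
  have G_Id: "FAr G k k (Id K k) = Id ?MA (FOb G k)" if "k \<in> Ob K" for k
    using G that by (simp add: is_functor_def)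
  have L: "module_ob C A L" and \<pi>: "\<And>k. k \<in> Ob K \<Longrightarrow> \<pi> k \<in> Hom ?MA L (FOb G k)"
    and G\<pi>: "\<And>k l v. \<lbrakk>k \<in> Ob K; l \<in> Ob K; v \<in> Hom K k l\<rbrakk> \<Longrightarrow> FAr G k l v \<cdot> \<pi> k = \<pi> l"
    using L_lim by (simp_all add: is_limit_def cone_def)
  have L': "L \<in> Ob ?MA" using L by simp
  let ?t = "\<lambda>k. raw (T_on (FOb G k))"
  obtain e :: "nat \<Rightarrow> 'i" where e: "inj e" and J_small: "small_cat (relabel_cat e (\<lambda>_. undefined) nat_chain)"
    by (rule nat_chain_relabel)
  define J :: "('i, 'i) cat" where "J = relabel_cat e (\<lambda>_. undefined) nat_chain"
  define d where "d = inv_into UNIV e"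
  have de: "d (e n) = n" for n using e by (simp add: d_def)
  have u: "inj (\<lambda>_ :: unit. undefined :: 'i)" by (simp add: inj_on_def)
  have J: "small_cat J" "filtered_cat J"
    using J_small filtered_relabel[OF e u filtered_nat_chain] by (simp_all add: J_def)
  have J_Ob: "Ob J = range e" by (simp add: J_def relabel_cat_def nat_chain_def)
  have J_le: "d i \<le> d j" if "x \<in> Hom J i j" for i j x
    using that by (auto simp: J_def relabel_cat_def nat_chain_def d_def split: if_splits)
  define Fp where "Fp = (ModA.chain_prod G ?t d :: ('i \<times> nat, 'i \<times> nat, ('o, 'a) amod, 'a) ftor)"
  define Lf :: "('i, 'i, ('o, 'a) amod, 'a) ftor" where
    "Lf = relabel_ftor e (\<lambda>_. undefined) (endo_chain ?MA L (raw (T_on L)))"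
  define Cf :: "(nat, nat, ('o, 'a) amod, 'a) ftor" where
    "Cf = \<lparr>FOb = (\<lambda>k. res (FOb BC (FOb G k))),
           FAr = (\<lambda>k l v. FAr BC (FOb G k) (FOb G l) (FAr G k l v))\<rparr>"
  define \<kappa> where "\<kappa> k i = raw (jbc (FOb G k) (d i))" for k i
  define q where "q i = raw (jbc L (d i))" for i
  have Fp_FAr: "FAr Fp (i, k) (j, l) (x, v) = epow ?MA (FOb G l) (?t l) (d j - d i) \<cdot> FAr G k l v" for i j k l x v
    by (simp add: Fp_def ModA.chain_prod_def)
  have Fp_FOb: "FOb Fp (i, k) = FOb G k" for i k by (simp add: Fp_def ModA.chain_prod_def)
  have t: "?t k \<in> Hom ?MA (FOb G k) (FOb G k)" if "k \<in> Ob K" for k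
    by (rule T_on_Hom[OF M[OF that]])
  have Fp_Id1: "FAr Fp (i, k) (j, k) (x, Id K k) = epow ?MA (FOb G k) (?t k) (d j - d i)" if "k \<in> Ob K" for i j k x
    using ModA.Comp_Id_right[OF M'[OF that] M'[OF that] ModA.epow_in_Hom[OF M'[OF that] t[OF that]]]
    by (simp add: Fp_FAr G_Id[OF that])
  have Fp_Id2: "FAr Fp (j, k) (j, l) (x, v) = FAr G k l v" if "k \<in> Ob K" "l \<in> Ob K" "v \<in> Hom K k l" for j k l x v
    using ModA.Comp_Id_left[OF M'[OF that(1)] M'[OF that(2)] GA[OF that]]
    by (simp add: Fp_FAr)
  have Fp: "is_functor (prod_cat J K) ?MA Fp"
    unfolding Fp_def
  proof (rule ModA.is_functor_chain_prod[OF G t])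
    fix k l v assume kl: "k \<in> Ob K" "l \<in> Ob K" "v \<in> Hom K k l"
    show "FAr G k l v \<cdot>\<^bsub>?MA\<^esub> ?t k = ?t l \<cdot>\<^bsub>?MA\<^esub> FAr G k l v"
      using T_on_natural[OF M[OF kl(1)] M[OF kl(2)] GA[OF kl]] by simp
  qed (use J_le in simp_all)
  have Lf: "is_functor J ?MA Lf"
    unfolding J_def Lf_def using L' T_on_Hom[OF L]
    by (intro is_functor_relabel[OF e u] ModA.is_functor_endo_chain)
  have BCM: "module_ob C B (FOb BC (FOb G k))" if "k \<in> Ob K" for k
    by (rule BC_module[OF M[OF that]])
  have Cf: "is_functor K ?MA Cf"
    unfolding is_functor_def
  proof (intro conjI ballI)
    show "FOb Cf k \<in> Ob ?MA" if "k \<in> Ob K" for k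
      using res_module[OF BCM[OF that]] by (simp add: Cf_def)
    show "FAr Cf k l v \<in> Hom ?MA (FOb Cf k) (FOb Cf l)" if "k \<in> Ob K" "l \<in> Ob K" "v \<in> Hom K k l" for k l v
      using res_Hom[OF BCM[OF that(1)] BCM[OF that(2)] BC_Ar(1)[OF M[OF that(1)] M[OF that(2)] GA[OF that]]]
      by (simp add: Cf_def)
    show "FAr Cf k k (Id K k) = Id ?MA (FOb Cf k)" if "k \<in> Ob K" for k
      using BC_functor M'[OF that] by (simp add: Cf_def G_Id[OF that] is_functor_def)
    show "FAr Cf k m (w \<cdot>\<^bsub>K\<^esub> v) = FAr Cf l m w \<cdot>\<^bsub>?MA\<^esub> FAr Cf k l v"
      if k: "k \<in> Ob K" "l \<in> Ob K" "m \<in> Ob K" and v: "v \<in> Hom K k l" "w \<in> Hom K l m" for k l m v w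
    proof -
      have "FAr G k m (w \<cdot>\<^bsub>K\<^esub> v) = FAr G l m w \<cdot>\<^bsub>?MA\<^esub> FAr G k l v"
        using G k v unfolding is_functor_def by blast
      moreover have "FAr BC (FOb G k) (FOb G m) (FAr G l m w \<cdot>\<^bsub>?MA\<^esub> FAr G k l v)
        = FAr BC (FOb G l) (FOb G m) (FAr G l m w) \<cdot>\<^bsub>?MB\<^esub> FAr BC (FOb G k) (FOb G l) (FAr G k l v)"
        using BC_functor M'[OF k(1)] M'[OF k(2)] M'[OF k(3)] GA[OF k(1,2) v(1)] GA[OF k(2,3) v(2)]
        unfolding is_functor_def by blast
      ultimately show ?thesis by (simp add: Cf_def)
    qed
  qed
  \<comment> \<open>Commutation applies to any limit \<open>Y\<close>; the one of
    \<open>Modules_limit\<close> is taken because its projections are jointly monic in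
    \<open>C\<close>.\<close>
  obtain Y p where Y: "is_limit K ?MA Cf Y p"
    and jm': "\<forall>Z. \<forall>x \<in> thom Z (MCar Y). \<forall>y \<in> thom Z (MCar Y).
      (\<forall>k \<in> Ob K. Arr (MCar Y) (p k) (MCar (FOb Cf k)) \<bullet> x = Arr (MCar Y) (p k) (MCar (FOb Cf k)) \<bullet> y)
      \<longrightarrow> x = y"
    by (rule Modules_limit[OF monoid_A K Cf])
  have jm: "x = y" if "x \<in> thom Z (MCar Y)" "y \<in> thom Z (MCar Y)"
    "\<And>k. k \<in> Ob K \<Longrightarrow> Arr (MCar Y) (p k) (MCar (FOb Cf k)) \<bullet> x = Arr (MCar Y) (p k) (MCar (FOb Cf k)) \<bullet> y"
    for x y Z
    using jm'[THEN spec, THEN bspec, THEN bspec, THEN mp, OF that(1,2)] that(3) by simp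
  have A_Ob: "A \<in> Ob (Comm C)" using monoid_A by simp
  have "\<exists>\<phi>. iso_arr ?MA (res (FOb BC L)) Y \<phi> \<and>
    (\<forall>j \<in> Ob J. \<forall>k \<in> Ob K. p k \<cdot>\<^bsub>?MA\<^esub> \<phi> \<cdot>\<^bsub>?MA\<^esub> q j = \<kappa> k j \<cdot>\<^bsub>?MA\<^esub> \<pi> k)"
  \<comment> \<open>At each stage of the chain the diagram over \<open>K\<close> is \<open>G\<close>
    itself, so its limit is \<open>L\<close> with projections \<open>\<pi>\<close> independent of
    the stage. For fixed \<open>k\<close> the colimit along the chain is the base change of
    \<open>FOb G k\<close>.\<close>
  proof (rule filtered_colimits_finite_limits[OF A_Ob, unfolded filtered_colimits_commute_with_finite_limits_def,
        THEN spec[of _ J], THEN spec[of _ K], THEN spec[of _ Fp], THEN spec[of _ Lf], THEN spec[of _ "\<lambda>_. \<pi>"],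
        THEN spec[of _ Cf], THEN spec[of _ \<kappa>], THEN spec[of _ "res (FOb BC L)"], THEN spec[of _ q],
        THEN spec[of _ Y], THEN spec[of _ p], THEN mp], intro conjI ballI J K Fp Lf Cf Y)
    fix j assume "j \<in> Ob J"
    have "is_limit K ?MA (slice_left J Fp j) L \<pi> \<longleftrightarrow> is_limit K ?MA G L \<pi>"
      by (rule is_limit_cong) (simp_all add: slice_left_def Fp_FOb Fp_Id2)
    moreover have "FOb Lf j = L" by (simp add: Lf_def relabel_ftor_def endo_chain_def)
    ultimately show "is_limit K ?MA (slice_left J Fp j) (FOb Lf j) \<pi>" using L_lim by simp
  next
    fix i j x k assume k: "k \<in> Ob K"
    have "\<pi> k \<cdot>\<^bsub>?MA\<^esub> epow ?MA L (raw (T_on L)) (d j - d i) = epow ?MA (FOb G k) (?t k) (d j - d i) \<cdot>\<^bsub>?MA\<^esub> \<pi> k"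
      using ModA.epow_natural[OF L' T_on_Hom[OF L] M'[OF k] t[OF k] \<pi>[OF k]] T_on_natural[OF L M[OF k] \<pi>[OF k]]
      by simp
    then show "\<pi> k \<cdot>\<^bsub>?MA\<^esub> FAr Lf i j x = FAr Fp (i, k) (j, k) (x, Id K k) \<cdot>\<^bsub>?MA\<^esub> \<pi> k"
      unfolding Fp_Id1[OF k] by (simp add: Lf_def relabel_ftor_def endo_chain_def d_def)
  next
    fix k assume k: "k \<in> Ob K"
    have "is_colimit J ?MA (relabel_ftor e (\<lambda>_. undefined) (endo_chain ?MA (FOb G k) (?t k)))
        (res (FOb BC (FOb G k))) (\<kappa> k)"
      unfolding J_def is_colimit_relabel[OF e u] using BC_colimit[OF M[OF k]]
      by (simp add: \<kappa>_def o_def de)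
    moreover have "is_colimit J ?MA (slice_right K Fp k) (res (FOb BC (FOb G k))) (\<kappa> k) \<longleftrightarrow>
      is_colimit J ?MA (relabel_ftor e (\<lambda>_. undefined) (endo_chain ?MA (FOb G k) (?t k)))
        (res (FOb BC (FOb G k))) (\<kappa> k)"
      by (rule is_colimit_cong)
        (simp_all add: slice_right_def Fp_FOb Fp_Id1[OF k] relabel_ftor_def endo_chain_def d_def)
    ultimately show "is_colimit J ?MA (slice_right K Fp k) (FOb Cf k) (\<kappa> k)"
      by (simp add: Cf_def)
  next
    fix k l v j assume k: "k \<in> Ob K" "l \<in> Ob K" "v \<in> Hom K k l"
    show "FAr Cf k l v \<cdot>\<^bsub>?MA\<^esub> \<kappa> k j = \<kappa> l j \<cdot>\<^bsub>?MA\<^esub> FAr Fp (j, k) (j, l) (Id J j, v)"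
      unfolding Fp_Id2[OF k] using BC_natural[OF M[OF k(1)] M[OF k(2)] GA[OF k]]
      by (simp add: Cf_def \<kappa>_def)
  next
    show "is_colimit J ?MA Lf (res (FOb BC L)) q"
      unfolding J_def Lf_def is_colimit_relabel[OF e u] using BC_colimit[OF L]
      by (simp add: q_def o_def de)
  qed
  then obtain \<phi> where \<phi>: "iso_arr ?MA (res (FOb BC L)) Y \<phi>"
    and p\<phi>: "\<forall>j \<in> Ob J. \<forall>k \<in> Ob K. p k \<cdot> \<phi> \<cdot> q j = \<kappa> k j \<cdot> \<pi> k"
    by (elim exE conjE) simp
  obtain \<psi> where \<psi>: "\<psi> \<in> Hom ?MA Y (res (FOb BC L))" "\<psi> \<cdot> \<phi> = Id C (MCar (FOb BC L))" "\<phi> \<cdot> \<psi> = Id C (MCar Y)"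
    using \<phi> by (auto simp: iso_arr_def)
  have \<phi>_Hom: "\<phi> \<in> Hom ?MA (res (FOb BC L)) Y" using \<phi> by (simp add: iso_arr_def)
  have Y_mod: "module_ob C A Y" and p_Hom: "\<And>k. k \<in> Ob K \<Longrightarrow> p k \<in> Hom ?MA Y (res (FOb BC (FOb G k)))"
    using Y by (simp_all add: is_limit_def cone_def Cf_def)
  note mL [simp] = moduleD(1,2)[OF L A_simps(1)] moduleD(1,2)[OF BC_module[OF L] B_simps(1)]
    moduleD(1,2)[OF Y_mod A_simps(1)]
  define N where "N = MCar (FOb BC L)"
  have [simp]: "N \<in> Ob C" by (simp add: N_def)
  define \<Phi> \<Psi> where "\<Phi> = Arr N \<phi> (MCar Y)" and "\<Psi> = Arr (MCar Y) \<psi> N"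
  have \<Phi>\<Psi>: "inv_pair \<Phi> \<Psi>"
    using \<psi> Hom_Modules_Hom[OF \<phi>_Hom] Hom_Modules_Hom[OF \<psi>(1)]
    by (simp add: inv_pair_def \<Phi>_def \<Psi>_def arr_Arr tcomp_def idn_def N_def)
  have [simp]: "arr \<Phi>" "src \<Phi> = N" "tgt \<Phi> = MCar Y" "arr \<Psi>" "src \<Psi> = MCar Y" "tgt \<Psi> = N"
    and \<Phi>\<Psi>_id: "\<Phi> \<bullet> \<Psi> = idn (MCar Y)"
    using \<Phi>\<Psi> by (simp_all add: inv_pair_def \<Phi>_def \<Psi>_def)
  define X where "X k = MCar (FOb BC (FOb G k))" for k
  define P where "P k = Arr (MCar Y) (p k) (X k)" for k
  define D where "D k = Arr N (FAr BC L (FOb G k) (\<pi> k)) (X k)" for k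
  have X_Ob: "X k \<in> Ob C" "arr (actT B (FOb BC (FOb G k)))" if "k \<in> Ob K" for k
    using moduleD(1,2)[OF BCM[OF that] B_simps(1)] by (simp_all add: X_def)
  have P: "arr (P k)" "src (P k) = MCar Y" "tgt (P k) = X k" if "k \<in> Ob K" for k
    using Hom_Modules_Hom[OF p_Hom[OF that]] X_Ob[OF that] by (simp_all add: P_def arr_Arr X_def)
  have D_Hom: "FAr BC L (FOb G k) (\<pi> k) \<in> Hom ?MB (FOb BC L) (FOb BC (FOb G k))" if "k \<in> Ob K" for k
    by (rule BC_Ar(1)[OF L M[OF that] \<pi>[OF that]])
  have D: "arr (D k)" "src (D k) = N" "tgt (D k) = X k"
    "D k \<bullet> actT B (FOb BC L) = actT B (FOb BC (FOb G k)) \<bullet> (D k \<boxtimes> idn (Car B))" if "k \<in> Ob K" for k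
    using D_Hom[OF that] X_Ob[OF that] by (simp_all add: D_def N_def X_def Hom_Modules)
  \<comment> \<open>Compared on the stages of the chain for \<open>L\<close>: both sides become the
    stage map of \<open>FOb G k\<close> after \<open>\<pi> k\<close>.\<close>
  have P\<Phi>: "P k \<bullet> \<Phi> = D k" if k: "k \<in> Ob K" for k
  proof (rule scol_unique[OF BC_col[OF L], of _ "X k"])
    fix n
    have "p k \<cdot> (\<phi> \<cdot> raw (jbc L n)) = raw (jbc (FOb G k) n) \<cdot> \<pi> k"
      using p\<phi> k by (simp add: J_Ob q_def \<kappa>_def de)
    also have "\<dots> = FAr BC L (FOb G k) (\<pi> k) \<cdot> raw (jbc L n)"
      by (rule BC_natural[OF L M[OF k] \<pi>[OF k], symmetric])
    finally have "P k \<bullet> \<Phi> \<bullet> jbc L n = D k \<bullet> jbc L n"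
      by (simp add: tarrow_eq raw_simps) (simp add: P_def D_def \<Phi>_def)
    then show "(P k \<bullet> \<Phi>) \<bullet> jbc L n = D k \<bullet> jbc L n"
      using P[OF k] L by (simp add: N_def)
  qed (use P[OF k] D[OF k] in \<open>simp_all add: N_def\<close>)
  \<comment> \<open>Joint monicity of the projections of \<open>Y\<close>, carried along the
    isomorphism \<open>\<Phi>\<close> to the base changed projections \<open>D k\<close>.\<close>
  have jmD: "x = y" if x: "x \<in> thom Z N" and y: "y \<in> thom Z N" and eq: "\<And>k. k \<in> Ob K \<Longrightarrow> D k \<bullet> x = D k \<bullet> y"
    for x y Z
  proof -
    have "\<Phi> \<bullet> x = \<Phi> \<bullet> y"
    proof (rule jm[of _ Z])
      fix k assume k: "k \<in> Ob K"
      have "P k \<bullet> \<Phi> \<bullet> x = P k \<bullet> \<Phi> \<bullet> y"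
        using reassoc[OF P\<Phi>[OF k], of x] reassoc[OF P\<Phi>[OF k], of y] eq[OF k] x y P[OF k] by simp
      then show "Arr (MCar Y) (p k) (MCar (FOb Cf k)) \<bullet> \<Phi> \<bullet> x = Arr (MCar Y) (p k) (MCar (FOb Cf k)) \<bullet> \<Phi> \<bullet> y"
        by (simp add: P_def X_def Cf_def)
    qed (use x y in simp_all)
    then show ?thesis using inv_pair_cancel(1)[OF \<Phi>\<Psi>, of x y] x y by simp
  qed
  show "is_limit K ?MB (ftor_comp BC G) (FOb BC L) (\<lambda>k. FAr BC L (FOb G k) (\<pi> k))"
    unfolding is_limit_def
  proof (intro conjI allI impI)
    have "FAr BC (FOb G k) (FOb G l) (FAr G k l v) \<cdot> FAr BC L (FOb G k) (\<pi> k) = FAr BC L (FOb G l) (\<pi> l)"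
      if k: "k \<in> Ob K" "l \<in> Ob K" "v \<in> Hom K k l" for k l v
    proof -
      have "FAr BC L (FOb G l) (FAr G k l v \<cdot>\<^bsub>?MA\<^esub> \<pi> k)
          = FAr BC (FOb G k) (FOb G l) (FAr G k l v) \<cdot>\<^bsub>?MB\<^esub> FAr BC L (FOb G k) (\<pi> k)"
        using BC_functor L' M'[OF k(1)] M'[OF k(2)] GA[OF k] \<pi>[OF k(1)] unfolding is_functor_def by blast
      then show ?thesis by (simp add: G\<pi>[OF k])
    qed
    then show "cone K ?MB (ftor_comp BC G) (FOb BC L) (\<lambda>k. FAr BC L (FOb G k) (\<pi> k))"
      using BC_module[OF L] D_Hom by (simp add: cone_def ftor_comp_def)
    fix W \<mu> assume W: "cone K ?MB (ftor_comp BC G) W \<mu>"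
    have W_mod: "module_ob C B W" and \<mu>: "\<And>k. k \<in> Ob K \<Longrightarrow> \<mu> k \<in> Hom ?MB W (FOb BC (FOb G k))"
      using W by (simp_all add: cone_def ftor_comp_def)
    note mW [simp] = moduleD(1,2)[OF W_mod B_simps(1)]
    define V where "V k = Arr (MCar W) (\<mu> k) (X k)" for k
    have V: "arr (V k)" "src (V k) = MCar W" "tgt (V k) = X k"
      "V k \<bullet> actT B W = actT B (FOb BC (FOb G k)) \<bullet> (V k \<boxtimes> idn (Car B))" if "k \<in> Ob K" for k
      using \<mu>[OF that] X_Ob[OF that] by (simp_all add: V_def X_def Hom_Modules)
    \<comment> \<open>A cone of B-modules is first factored over \<open>A\<close>, through the limit
      \<open>Y\<close>. That the factorisation is linear over \<open>B\<close> is recovered in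
      \<open>Hl\<close> by joint monicity.\<close>
    have "cone K ?MA Cf (res W) \<mu>"
      using W res_module[OF W_mod] res_Hom[OF W_mod BCM \<mu>] by (simp add: cone_def ftor_comp_def Cf_def)
    then obtain h0 where h0: "h0 \<in> Hom ?MA (res W) Y \<and> (\<forall>k \<in> Ob K. p k \<cdot>\<^bsub>?MA\<^esub> h0 = \<mu> k)"
      using Y unfolding is_limit_def by (elim conjE allE impE ex1E) auto
    define H0 where "H0 = Arr (MCar W) h0 (MCar Y)"
    have [simp]: "arr H0" "src H0 = MCar W" "tgt H0 = MCar Y"
      using Hom_Modules_Hom[of h0 A "res W" Y] h0 by (simp_all add: H0_def arr_Arr)
    have PH0: "P k \<bullet> H0 = V k" if "k \<in> Ob K" for k
      using h0 that by (simp add: P_def H0_def V_def tcomp_def)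
    define H where "H = \<Psi> \<bullet> H0"
    have H [simp]: "arr H" "src H = MCar W" "tgt H = N" by (simp_all add: H_def)
    have DH: "D k \<bullet> H = V k" if k: "k \<in> Ob K" for k
    proof -
      have "D k \<bullet> H = P k \<bullet> \<Phi> \<bullet> \<Psi> \<bullet> H0"
        using P[OF k] by (simp add: P\<Phi>[OF k, symmetric] H_def)
      also have "\<Phi> \<bullet> \<Psi> \<bullet> H0 = H0" using reassoc[OF \<Phi>\<Psi>_id, of H0] by simp
      finally show ?thesis using PH0[OF k] by simp
    qed
    have Hl: "H \<bullet> actT B W = actT B (FOb BC L) \<bullet> (H \<boxtimes> idn (Car B))"
    proof (rule jmD)
      fix k assume k: "k \<in> Ob K"
      note [simp] = D(1-3)[OF k] X_Ob[OF k]
      have [simp]: "MCar (FOb BC (FOb G k)) = X k" "MCar (FOb BC L) = N" by (simp_all add: X_def N_def)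
      have "D k \<bullet> H \<bullet> actT B W = actT B (FOb BC (FOb G k)) \<bullet> (D k \<boxtimes> idn (Car B)) \<bullet> (H \<boxtimes> idn (Car B))"
        using reassoc[OF DH[OF k], of "actT B W"] V[OF k] by (simp add: ten_comp DH[OF k])
      also have "\<dots> = D k \<bullet> actT B (FOb BC L) \<bullet> (H \<boxtimes> idn (Car B))"
        using reassoc[OF D(4)[OF k], of "H \<boxtimes> idn (Car B)"] by simp
      finally show "D k \<bullet> H \<bullet> actT B W = D k \<bullet> actT B (FOb BC L) \<bullet> (H \<boxtimes> idn (Car B))" .
    qed (simp_all, simp_all add: N_def)
    have H_Arr: "Arr (MCar W) (raw H) (MCar (FOb BC L)) = H" by (simp add: tarrow_eq N_def)
    show "\<exists>!h. h \<in> Hom ?MB W (FOb BC L) \<and> (\<forall>k \<in> Ob K. FAr BC L (FOb G k) (\<pi> k) \<cdot>\<^bsub>?MB\<^esub> h = \<mu> k)"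
    proof (intro ex1I[of _ "raw H"] conjI ballI)
      show "raw H \<in> Hom ?MB W (FOb BC L)" by (simp add: Hom_Modules H_Arr Hl)
      show "FAr BC L (FOb G k) (\<pi> k) \<cdot>\<^bsub>?MB\<^esub> raw H = \<mu> k" if "k \<in> Ob K" for k
        using arg_cong[OF DH[OF that], of raw] by (simp add: raw_simps) (simp add: D_def V_def)
      fix r assume r: "r \<in> Hom ?MB W (FOb BC L) \<and> (\<forall>k \<in> Ob K. FAr BC L (FOb G k) (\<pi> k) \<cdot>\<^bsub>?MB\<^esub> r = \<mu> k)"
      have "Arr (MCar W) r N = H"
      proof (rule jmD)
        show "D k \<bullet> Arr (MCar W) r N = D k \<bullet> H" if "k \<in> Ob K" for k
          unfolding DH[OF that] using r that by (simp add: D_def V_def tcomp_def)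
      qed (use r in \<open>simp_all add: Hom_Modules N_def\<close>)
      then show "r = raw H" by auto
    qed
  qed
qed

end

section \<open>Finite presentation\<close>

lemma sym_hom_step: "sym ((hom_step J C X F \<union> (hom_step J C X F)\<inverse>)\<^sup>*)"
  by (intro sym_rtrancl sym_Un_converse)

lemma hom_colimE:
  assumes "c \<in> hom_colim J C X F"
  obtains j g where "j \<in> Ob J" "g \<in> Hom C X (FOb F j)"
    "c = (hom_step J C X F \<union> (hom_step J C X F)\<inverse>)\<^sup>* `` {(j, g)}"
  using assms unfolding hom_colim_def by (elim quotientE) auto

lemma hom_colimI:
  assumes "j \<in> Ob J" "g \<in> Hom C X (FOb F j)"
  shows "(hom_step J C X F \<union> (hom_step J C X F)\<inverse>)\<^sup>* `` {(j, g)} \<in> hom_colim J C X F"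
  using assms unfolding hom_colim_def by (intro quotientI) auto

lemma rtrancl_class_eq:
  assumes "sym (r\<^sup>*)" "(x, y) \<in> r\<^sup>*"
  shows "r\<^sup>* `` {x} = r\<^sup>* `` {y}"
proof -
  have "(y, x) \<in> r\<^sup>*" using assms by (rule symD)
  then show ?thesis using assms(2) by (auto intro: rtrancl_trans)
qed

text \<open>\<open>the_elem\<close> needs a singleton; the hypothesis makes the value constant on
  the class.\<close>

lemma hom_colim_map_class:
  assumes "\<And>i h. ((j, g), (i, h)) \<in> r\<^sup>* \<Longrightarrow> \<iota> i \<cdot>\<^bsub>C\<^esub> h = \<iota> j \<cdot>\<^bsub>C\<^esub> g"
  shows "hom_colim_map C \<iota> (r\<^sup>* `` {(j, g)}) = \<iota> j \<cdot>\<^bsub>C\<^esub> g"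
proof -
  have "(\<lambda>(j, g). \<iota> j \<cdot>\<^bsub>C\<^esub> g) ` (r\<^sup>* `` {(j, g)}) = {\<iota> j \<cdot>\<^bsub>C\<^esub> g}"
  proof (intro equalityI subsetI)
    fix x assume "x \<in> {\<iota> j \<cdot>\<^bsub>C\<^esub> g}"
    then show "x \<in> (\<lambda>(j, g). \<iota> j \<cdot>\<^bsub>C\<^esub> g) ` (r\<^sup>* `` {(j, g)})"
      using imageI[of "(j, g)" "r\<^sup>* `` {(j, g)}" "\<lambda>(j, g). \<iota> j \<cdot>\<^bsub>C\<^esub> g"] by simp
  next
    fix x assume "x \<in> (\<lambda>(j, g). \<iota> j \<cdot>\<^bsub>C\<^esub> g) ` (r\<^sup>* `` {(j, g)})"
    then obtain p where "p \<in> r\<^sup>* `` {(j, g)}" "x = (\<lambda>(j, g). \<iota> j \<cdot>\<^bsub>C\<^esub> g) p" by (elim imageE)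
    then show "x \<in> {\<iota> j \<cdot>\<^bsub>C\<^esub> g}"
      using assms[of "fst p" "snd p"] by (simp add: case_prod_beta)
  qed
  then show ?thesis by (simp add: hom_colim_map_def)
qed

context category
begin

text \<open>After an upper bound of \<open>k\<close> and \<open>k'\<close>, the arrow
  \<open>y\<close> equalises the two paths from \<open>i\<close>, and then \<open>z\<close> those
  from \<open>j\<close>. The second correction preserves the first equality.\<close>

lemma filtered_merge:
  assumes J: "filtered_cat C" and O: "i \<in> Ob C" "j \<in> Ob C" "k \<in> Ob C" "k' \<in> Ob C"
    and a: "a \<in> Hom C i k" "a' \<in> Hom C i k'" and b: "b \<in> Hom C j k" "b' \<in> Hom C j k'"
  obtains l w w' where "l \<in> Ob C" "w \<in> Hom C k l" "w' \<in> Hom C k' l" "w \<cdot> a = w' \<cdot> a'" "w \<cdot> b = w' \<cdot> b'"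
proof -
  have up: "\<exists>k \<in> Ob C. Hom C i k \<noteq> {} \<and> Hom C j k \<noteq> {}" if "i \<in> Ob C" "j \<in> Ob C" for i j
    using J that unfolding filtered_cat_def by blast
  have eq: "\<exists>k \<in> Ob C. \<exists>w \<in> Hom C j k. w \<cdot> u = w \<cdot> v"
    if "i \<in> Ob C" "j \<in> Ob C" "u \<in> Hom C i j" "v \<in> Hom C i j" for i j u v
    using J that unfolding filtered_cat_def by blast
  obtain p x x' where p: "p \<in> Ob C" "x \<in> Hom C k p" "x' \<in> Hom C k' p"
    using up[OF O(3,4)] by blast
  obtain q y where q: "q \<in> Ob C" "y \<in> Hom C p q" "y \<cdot> (x \<cdot> a) = y \<cdot> (x' \<cdot> a')"
    using eq[OF O(1) p(1) Comp_in_Hom[OF O(1,3) p(1) a(1) p(2)] Comp_in_Hom[OF O(1,4) p(1) a(2) p(3)]] by blast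
  have yx: "y \<cdot> x \<in> Hom C k q" "y \<cdot> x' \<in> Hom C k' q"
    using Comp_in_Hom[OF O(3) p(1) q(1) p(2) q(2)] Comp_in_Hom[OF O(4) p(1) q(1) p(3) q(2)] by simp_all
  have yxa: "(y \<cdot> x) \<cdot> a = (y \<cdot> x') \<cdot> a'"
    using q(3) Comp_assoc[OF O(1,3) p(1) q(1) a(1) p(2) q(2)] Comp_assoc[OF O(1,4) p(1) q(1) a(2) p(3) q(2)] by simp
  obtain l z where l: "l \<in> Ob C" "z \<in> Hom C q l" "z \<cdot> ((y \<cdot> x) \<cdot> b) = z \<cdot> ((y \<cdot> x') \<cdot> b')"
    using eq[OF O(2) q(1) Comp_in_Hom[OF O(2,3) q(1) b(1) yx(1)] Comp_in_Hom[OF O(2,4) q(1) b(2) yx(2)]] by blast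
  have w: "z \<cdot> (y \<cdot> x) \<in> Hom C k l" "z \<cdot> (y \<cdot> x') \<in> Hom C k' l"
    using Comp_in_Hom[OF O(3) q(1) l(1) yx(1) l(2)] Comp_in_Hom[OF O(4) q(1) l(1) yx(2) l(2)] by simp_all
  have "(z \<cdot> (y \<cdot> x)) \<cdot> a = (z \<cdot> (y \<cdot> x')) \<cdot> a'"
    using yxa Comp_assoc[OF O(1,3) q(1) l(1) a(1) yx(1) l(2)] Comp_assoc[OF O(1,4) q(1) l(1) a(2) yx(2) l(2)] by simp
  moreover have "(z \<cdot> (y \<cdot> x)) \<cdot> b = (z \<cdot> (y \<cdot> x')) \<cdot> b'"
    using l(3) Comp_assoc[OF O(2,3) q(1) l(1) b(1) yx(1) l(2)] Comp_assoc[OF O(2,4) q(1) l(1) b(2) yx(2) l(2)] by simp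
  ultimately show ?thesis using that[OF l(1) w] by simp
qed

lemma category_under: "X \<in> Ob C \<Longrightarrow> category (under_cat C X)"
proof -
  assume X: "X \<in> Ob C"
  show ?thesis
  proof unfold_locales
    fix Y Z W f g
    assume "Y \<in> Ob (under_cat C X)" "Z \<in> Ob (under_cat C X)" "W \<in> Ob (under_cat C X)"
      "f \<in> Hom (under_cat C X) Y Z" "g \<in> Hom (under_cat C X) Z W"
    then have *: "fst Y \<in> Ob C" "fst Z \<in> Ob C" "fst W \<in> Ob C" "snd Y \<in> Hom C X (fst Y)"
      "f \<in> Hom C (fst Y) (fst Z)" "g \<in> Hom C (fst Z) (fst W)" "f \<cdot> snd Y = snd Z" "g \<cdot> snd Z = snd W"
      by (auto simp: under_cat_def)
    have "(g \<cdot> f) \<cdot> snd Y = snd W"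
      using Comp_assoc[OF X *(1,2,3,4,5,6)] *(7,8) by simp
    then show "g \<cdot>\<^bsub>under_cat C X\<^esub> f \<in> Hom (under_cat C X) Y W"
      using Comp_in_Hom[OF *(1,2,3,5,6)] by (simp add: under_cat_def case_prod_beta)
  next
    fix Y assume "Y \<in> Ob (under_cat C X)"
    then show "Id (under_cat C X) Y \<in> Hom (under_cat C X) Y Y"
      using X Comp_Id_left[of X "fst Y" "snd Y"] by (auto simp: under_cat_def Id_in_Hom)
  next
    fix Y Z f
    assume "Y \<in> Ob (under_cat C X)" "Z \<in> Ob (under_cat C X)" "f \<in> Hom (under_cat C X) Y Z"
    then have *: "fst Y \<in> Ob C" "fst Z \<in> Ob C" "f \<in> Hom C (fst Y) (fst Z)"
      by (auto simp: under_cat_def)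
    show "f \<cdot>\<^bsub>under_cat C X\<^esub> Id (under_cat C X) Y = f" "Id (under_cat C X) Z \<cdot>\<^bsub>under_cat C X\<^esub> f = f"
      using Comp_Id_right[OF *] Comp_Id_left[OF *] by (simp_all add: under_cat_def case_prod_beta)
  next
    fix V W Y Z f g h
    assume "V \<in> Ob (under_cat C X)" "W \<in> Ob (under_cat C X)" "Y \<in> Ob (under_cat C X)" "Z \<in> Ob (under_cat C X)"
      "f \<in> Hom (under_cat C X) V W" "g \<in> Hom (under_cat C X) W Y" "h \<in> Hom (under_cat C X) Y Z"
    then show "(h \<cdot>\<^bsub>under_cat C X\<^esub> g) \<cdot>\<^bsub>under_cat C X\<^esub> f = h \<cdot>\<^bsub>under_cat C X\<^esub> (g \<cdot>\<^bsub>under_cat C X\<^esub> f)"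
      using Comp_assoc[of "fst V" "fst W" "fst Y" "fst Z" f g h] by (auto simp: under_cat_def)
  qed
qed

text \<open>Two elements at different stages are identified at any upper bound, as there is at most
  one arrow to it; this settles injectivity. Surjectivity becomes the mere existence of an arrow to
  some stage. It is applied to \<open>(B, raw F)\<close> under \<open>A\<close>, where uniqueness is
  the epimorphism property.\<close>

lemma hom_preserves_colimit_subsingleton:
  assumes J: "category J" "filtered_cat J" and F: "is_functor J C F" and L: "is_colimit J C F L \<iota>"
    and X: "X \<in> Ob C" and sub: "\<And>Y g h. \<lbrakk>Y \<in> Ob C; g \<in> Hom C X Y; h \<in> Hom C X Y\<rbrakk> \<Longrightarrow> g = h"
    and ex: "\<And>h. h \<in> Hom C X L \<Longrightarrow> \<exists>j \<in> Ob J. \<exists>g. g \<in> Hom C X (FOb F j)"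
  shows "hom_preserves_colimit J C X F L \<iota>"
proof -
  let ?s = "hom_step J C X F \<union> (hom_step J C X F)\<inverse>"
  have L_Ob: "L \<in> Ob C" and \<iota>: "\<And>i. i \<in> Ob J \<Longrightarrow> \<iota> i \<in> Hom C (FOb F i) L"
    using L by (simp_all add: is_colimit_def cocone_def)
  have F_Ob: "FOb F i \<in> Ob C" if "i \<in> Ob J" for i using F that by (simp add: is_functor_def)
  have F_Hom: "FAr F i j u \<in> Hom C (FOb F i) (FOb F j)" if "i \<in> Ob J" "j \<in> Ob J" "u \<in> Hom J i j" for i j u
    using F that by (simp add: is_functor_def)
  have \<iota>g: "\<iota> j \<cdot> g \<in> Hom C X L" if "j \<in> Ob J" "g \<in> Hom C X (FOb F j)" for j g
    by (rule Comp_in_Hom[OF X F_Ob[OF that(1)] L_Ob that(2) \<iota>[OF that(1)]])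
  have val: "hom_colim_map C \<iota> (?s\<^sup>* `` {(j, g)}) = \<iota> j \<cdot> g" if j: "j \<in> Ob J" "g \<in> Hom C X (FOb F j)" for j g
  proof (rule hom_colim_map_class)
    fix i h assume "((j, g), (i, h)) \<in> ?s\<^sup>*"
    from hom_colim_filtered[OF J(1) category_axioms F J(2) X this j]
    have "i \<in> Ob J" "h \<in> Hom C X (FOb F i)" by simp_all
    then show "\<iota> i \<cdot> h = \<iota> j \<cdot> g" using j by (intro sub[OF L_Ob] \<iota>g)
  qed
  have same: "?s\<^sup>* `` {(i, g)} = ?s\<^sup>* `` {(j, h)}"
    if i: "i \<in> Ob J" "g \<in> Hom C X (FOb F i)" and j: "j \<in> Ob J" "h \<in> Hom C X (FOb F j)" for i j g h
  proof -
    obtain k u v where k: "k \<in> Ob J" "u \<in> Hom J i k" "v \<in> Hom J j k"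
      using J(2) i(1) j(1) unfolding filtered_cat_def by blast
    have e: "FAr F i k u \<cdot> g = FAr F j k v \<cdot> h"
      using Comp_in_Hom[OF X F_Ob[OF i(1)] F_Ob[OF k(1)] i(2) F_Hom[OF i(1) k(1,2)]]
        Comp_in_Hom[OF X F_Ob[OF j(1)] F_Ob[OF k(1)] j(2) F_Hom[OF j(1) k(1,3)]]
      by (intro sub[OF F_Ob[OF k(1)]])
    have "((i, g), (k, FAr F i k u \<cdot> g)) \<in> ?s" "((k, FAr F j k v \<cdot> h), (j, h)) \<in> ?s"
      using i j k unfolding hom_step_def by blast+
    then have "((i, g), (j, h)) \<in> ?s\<^sup>*"
      unfolding e by (meson converse_rtrancl_into_rtrancl rtrancl.rtrancl_refl)
    then show ?thesis by (rule rtrancl_class_eq[OF sym_hom_step])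
  qed
  show ?thesis
    unfolding hom_preserves_colimit_def bij_betw_def
  proof
    show "inj_on (hom_colim_map C \<iota>) (hom_colim J C X F)"
    proof (rule inj_onI)
      fix c c' assume c: "c \<in> hom_colim J C X F" and c': "c' \<in> hom_colim J C X F"
      obtain i g where i: "i \<in> Ob J" "g \<in> Hom C X (FOb F i)" "c = ?s\<^sup>* `` {(i, g)}"
        using c by (rule hom_colimE)
      obtain j h where j: "j \<in> Ob J" "h \<in> Hom C X (FOb F j)" "c' = ?s\<^sup>* `` {(j, h)}"
        using c' by (rule hom_colimE)
      show "c = c'" unfolding i(3) j(3) by (rule same[OF i(1,2) j(1,2)])
    qed
    show "hom_colim_map C \<iota> ` hom_colim J C X F = Hom C X L"
    proof (intro equalityI subsetI)
      fix x assume "x \<in> hom_colim_map C \<iota> ` hom_colim J C X F"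
      then obtain c where c: "c \<in> hom_colim J C X F" "x = hom_colim_map C \<iota> c" by (elim imageE)
      obtain j g where j: "j \<in> Ob J" "g \<in> Hom C X (FOb F j)" "c = ?s\<^sup>* `` {(j, g)}"
        using c(1) by (rule hom_colimE)
      show "x \<in> Hom C X L" unfolding c(2) j(3) val[OF j(1,2)] by (rule \<iota>g[OF j(1,2)])
    next
      fix h assume h: "h \<in> Hom C X L"
      obtain j g where j: "j \<in> Ob J" "g \<in> Hom C X (FOb F j)" using ex[OF h] by auto
      have "h = hom_colim_map C \<iota> (?s\<^sup>* `` {(j, g)})"
        unfolding val[OF j] by (rule sub[OF L_Ob h \<iota>g[OF j]])
      then show "h \<in> hom_colim_map C \<iota> ` hom_colim J C X F"
        using hom_colimI[OF j] by (rule image_eqI)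
    qed
  qed
qed

text \<open>The two halves of bijectivity in the form in which (C1) is used: surjectivity represents
  an element at a stage, injectivity realises an equation at a later one.\<close>

lemma hom_preserves_colimitD:
  assumes J: "category J" "filtered_cat J" and F: "is_functor J C F" and L: "is_colimit J C F L \<iota>"
    and X: "X \<in> Ob C" and pres: "hom_preserves_colimit J C X F L \<iota>"
  shows "x \<in> Hom C X L \<Longrightarrow> \<exists>j \<in> Ob J. \<exists>z \<in> Hom C X (FOb F j). \<iota> j \<cdot> z = x"
    and "\<lbrakk>j \<in> Ob J; z \<in> Hom C X (FOb F j); z' \<in> Hom C X (FOb F j); \<iota> j \<cdot> z = \<iota> j \<cdot> z'\<rbrakk>
      \<Longrightarrow> \<exists>k \<in> Ob J. \<exists>u \<in> Hom J j k. FAr F j k u \<cdot> z = FAr F j k u \<cdot> z'"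
proof -
  let ?s = "hom_step J C X F \<union> (hom_step J C X F)\<inverse>"
  interpret J: category J by (rule J(1))
  have L_Ob: "L \<in> Ob C" and \<iota>: "\<And>i. i \<in> Ob J \<Longrightarrow> \<iota> i \<in> Hom C (FOb F i) L"
    and \<iota>F: "\<And>i j u. \<lbrakk>i \<in> Ob J; j \<in> Ob J; u \<in> Hom J i j\<rbrakk> \<Longrightarrow> \<iota> j \<cdot> FAr F i j u = \<iota> i"
    using L by (simp_all add: is_colimit_def cocone_def)
  have F_Ob: "FOb F i \<in> Ob C" if "i \<in> Ob J" for i using F that by (simp add: is_functor_def)
  have F_Hom: "FAr F i j u \<in> Hom C (FOb F i) (FOb F j)" if "i \<in> Ob J" "j \<in> Ob J" "u \<in> Hom J i j" for i j u
    using F that by (simp add: is_functor_def)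
  have val: "hom_colim_map C \<iota> (?s\<^sup>* `` {(j, g)}) = \<iota> j \<cdot> g" if j: "j \<in> Ob J" "g \<in> Hom C X (FOb F j)" for j g
  proof (rule hom_colim_map_class)
    fix i h assume "((j, g), (i, h)) \<in> ?s\<^sup>*"
    from hom_colim_filtered[OF J(1) category_axioms F J(2) X this j]
    obtain k u v where i: "i \<in> Ob J" "h \<in> Hom C X (FOb F i)" and k: "k \<in> Ob J" "u \<in> Hom J j k" "v \<in> Hom J i k"
      "FAr F j k u \<cdot> g = FAr F i k v \<cdot> h" by blast
    have "\<iota> j \<cdot> g = \<iota> k \<cdot> (FAr F j k u \<cdot> g)"
      using Comp_assoc[OF X F_Ob[OF j(1)] F_Ob[OF k(1)] L_Ob j(2) F_Hom[OF j(1) k(1,2)] \<iota>[OF k(1)]]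
        \<iota>F[OF j(1) k(1,2)] by simp
    also have "\<dots> = \<iota> i \<cdot> h"
      using Comp_assoc[OF X F_Ob[OF i(1)] F_Ob[OF k(1)] L_Ob i(2) F_Hom[OF i(1) k(1,3)] \<iota>[OF k(1)]]
        \<iota>F[OF i(1) k(1,3)] k(4) by simp
    finally show "\<iota> i \<cdot> h = \<iota> j \<cdot> g" ..
  qed
  show "\<exists>j \<in> Ob J. \<exists>z \<in> Hom C X (FOb F j). \<iota> j \<cdot> z = x" if x: "x \<in> Hom C X L"
  proof -
    have "x \<in> hom_colim_map C \<iota> ` hom_colim J C X F"
      using pres x unfolding hom_preserves_colimit_def bij_betw_def by simp
    then obtain c where c: "c \<in> hom_colim J C X F" "x = hom_colim_map C \<iota> c" by (elim imageE)
    from c(1) obtain j g where j: "j \<in> Ob J" "g \<in> Hom C X (FOb F j)" "c = ?s\<^sup>* `` {(j, g)}"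
      by (rule hom_colimE)
    then have "\<iota> j \<cdot> g = x" using val c(2) by simp
    then show ?thesis using j by blast
  qed
  show "\<exists>k \<in> Ob J. \<exists>u \<in> Hom J j k. FAr F j k u \<cdot> z = FAr F j k u \<cdot> z'"
    if j: "j \<in> Ob J" and z: "z \<in> Hom C X (FOb F j)" "z' \<in> Hom C X (FOb F j)" "\<iota> j \<cdot> z = \<iota> j \<cdot> z'"
  proof -
    have "hom_colim_map C \<iota> (?s\<^sup>* `` {(j, z)}) = hom_colim_map C \<iota> (?s\<^sup>* `` {(j, z')})"
      using val[OF j z(1)] val[OF j z(2)] z(3) by simp
    moreover have "inj_on (hom_colim_map C \<iota>) (hom_colim J C X F)"
      using pres unfolding hom_preserves_colimit_def bij_betw_def by (rule conjunct1)
    ultimately have "?s\<^sup>* `` {(j, z)} = ?s\<^sup>* `` {(j, z')}"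
      using hom_colimI[OF j z(1)] hom_colimI[OF j z(2)] by (simp add: inj_on_eq_iff)
    then have "((j, z), (j, z')) \<in> ?s\<^sup>*" by blast
    from hom_colim_filtered[OF J(1) category_axioms F J(2) X this j z(1)]
    obtain k u v where k: "k \<in> Ob J" "u \<in> Hom J j k" "v \<in> Hom J j k" "FAr F j k u \<cdot> z = FAr F j k v \<cdot> z'"
      by blast
    \<comment> \<open>The zigzag gives two arrows \<open>u\<close> and \<open>v\<close> from
      \<open>j\<close> to \<open>k\<close>, possibly different. \<open>w\<close> coequalises them,
      so that one arrow serves both elements.\<close>
    obtain l w where l: "l \<in> Ob J" "w \<in> Hom J k l" "w \<cdot>\<^bsub>J\<^esub> u = w \<cdot>\<^bsub>J\<^esub> v"
      using J(2) j k(1-3) unfolding filtered_cat_def by blast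
    have c: "FAr F j l (w \<cdot>\<^bsub>J\<^esub> x) \<cdot> z = FAr F k l w \<cdot> (FAr F j k x \<cdot> z)"
      if "x \<in> Hom J j k" "z \<in> Hom C X (FOb F j)" for x z
      using Comp_assoc[OF X F_Ob[OF j] F_Ob[OF k(1)] F_Ob[OF l(1)] that(2) F_Hom[OF j k(1) that(1)] F_Hom[OF k(1) l(1,2)]]
        F j k(1) l(1,2) that(1) by (simp add: is_functor_def)
    have "FAr F j l (w \<cdot>\<^bsub>J\<^esub> u) \<cdot> z = FAr F j l (w \<cdot>\<^bsub>J\<^esub> u) \<cdot> z'"
      using c[OF k(2) z(1)] c[OF k(3) z(2)] k(4) l(3) by simp
    then show ?thesis using J.Comp_in_Hom[OF j k(1) l(1) k(2) l(2)] l(1) by blast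
  qed
qed

end

context algebraic_context
begin

lemma category_Comm: "category (Comm C)"
proof unfold_locales
  fix A B D f g
  assume "A \<in> Ob (Comm C)" "B \<in> Ob (Comm C)" "D \<in> Ob (Comm C)"
    and f: "f \<in> Hom (Comm C) A B" and g: "g \<in> Hom (Comm C) B D"
  then have A: "comm_monoid_ob C A" and B: "comm_monoid_ob C B" and D: "comm_monoid_ob C D" by simp_all
  note [simp] = monoidD(1-3)[OF A] monoidD(1-3)[OF B] monoidD(1-3)[OF D]
  let ?f = "Arr (Car A) f (Car B)" and ?g = "Arr (Car B) g (Car D)"
  have f': "arr ?f" "?f \<bullet> mulT A = mulT B \<bullet> (?f \<boxtimes> ?f)" "?f \<bullet> uniT A = uniT B"
    and g': "arr ?g" "?g \<bullet> mulT B = mulT D \<bullet> (?g \<boxtimes> ?g)" "?g \<bullet> uniT B = uniT D"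
    using f g by (simp_all add: Hom_Comm)
  have e: "?g \<bullet> ?f = Arr (Car A) (g \<cdot> f) (Car D)" by (simp add: tcomp_def)
  have "(?g \<bullet> ?f) \<bullet> mulT A = mulT D \<bullet> ((?g \<bullet> ?f) \<boxtimes> (?g \<bullet> ?f))"
    using reassoc[OF g'(2), of "?f \<boxtimes> ?f"] f' g'(1) by (simp add: ten_comp)
  moreover have "(?g \<bullet> ?f) \<bullet> uniT A = uniT D"
    using f' g' by simp
  moreover have "arr (?g \<bullet> ?f)" using f' g' by simp
  ultimately show "g \<cdot>\<^bsub>Comm C\<^esub> f \<in> Hom (Comm C) A D"
    unfolding e by (simp add: Hom_Comm)
next
  fix A assume "A \<in> Ob (Comm C)"
  then have A: "comm_monoid_ob C A" by simp
  note [simp] = monoidD(1-3)[OF A]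
  show "Id (Comm C) A \<in> Hom (Comm C) A A"
    by (simp add: Hom_Comm flip: idn_def)
next
  fix A B f assume "A \<in> Ob (Comm C)" "B \<in> Ob (Comm C)" "f \<in> Hom (Comm C) A B"
  then have "Car A \<in> Ob C" "Car B \<in> Ob C" "f \<in> Hom C (Car A) (Car B)"
    using monoidD(1) by (auto simp: Comm_def)
  then show "f \<cdot>\<^bsub>Comm C\<^esub> Id (Comm C) A = f" "Id (Comm C) B \<cdot>\<^bsub>Comm C\<^esub> f = f"
    by (simp_all add: Comp_Id_right[of "Car A" "Car B"] Comp_Id_left[of "Car A" "Car B"])
next
  fix A B D E f g h
  assume "A \<in> Ob (Comm C)" "B \<in> Ob (Comm C)" "D \<in> Ob (Comm C)" "E \<in> Ob (Comm C)"
    "f \<in> Hom (Comm C) A B" "g \<in> Hom (Comm C) B D" "h \<in> Hom (Comm C) D E"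
  then have "Car A \<in> Ob C" "Car B \<in> Ob C" "Car D \<in> Ob C" "Car E \<in> Ob C"
    "f \<in> Hom C (Car A) (Car B)" "g \<in> Hom C (Car B) (Car D)" "h \<in> Hom C (Car D) (Car E)"
    using monoidD(1) by (auto simp: Comm_def)
  then show "(h \<cdot>\<^bsub>Comm C\<^esub> g) \<cdot>\<^bsub>Comm C\<^esub> f = h \<cdot>\<^bsub>Comm C\<^esub> (g \<cdot>\<^bsub>Comm C\<^esub> f)"
    using Comp_assoc[of "Car A" "Car B" "Car D" "Car E" f g h] by simp
qed

end

section \<open>Filtered colimits of commutative monoids\<close>

locale filtered_colimit = algebraic_context C U
  for C :: "('o, 'a, 'm) smcat_scheme" (structure) and U :: "'i itself" +
  fixes J :: "('i, 'i) cat" and E :: "('i, 'i, 'o, 'a) ftor" and Y :: 'o and \<iota> :: "'i \<Rightarrow> 'a"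
  assumes J_small: "small_cat J" and J_filtered: "filtered_cat J" and E: "is_functor J C E"
    and colim: "is_colimit J C E Y \<iota>"
begin

sublocale J: category J
  using J_small by (simp add: small_cat_def)

abbreviation e :: "'i \<Rightarrow> 'i \<Rightarrow> 'i \<Rightarrow> ('o, 'a) tarrow" where
  "e i j u \<equiv> Arr (FOb E i) (FAr E i j u) (FOb E j)"

abbreviation y :: "'i \<Rightarrow> ('o, 'a) tarrow" where
  "y i \<equiv> Arr (FOb E i) (\<iota> i) Y"

lemma Y_Ob [simp]: "Y \<in> Ob C"
  using colim by (simp add: is_colimit_def cocone_def)

lemma E_Ob [simp]: "i \<in> Ob J \<Longrightarrow> FOb E i \<in> Ob C"
  using E by (simp add: is_functor_def)

lemma arr_e [simp]: "\<lbrakk>i \<in> Ob J; j \<in> Ob J; u \<in> Hom J i j\<rbrakk> \<Longrightarrow> arr (e i j u)"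
  using E by (simp add: is_functor_def arr_Arr)

lemma arr_y [simp]: "i \<in> Ob J \<Longrightarrow> arr (y i)"
  using colim by (simp add: is_colimit_def cocone_def arr_Arr)

lemma y_e: "\<lbrakk>i \<in> Ob J; j \<in> Ob J; u \<in> Hom J i j\<rbrakk> \<Longrightarrow> y j \<bullet> e i j u = y i"
  using colim by (simp add: is_colimit_def cocone_def tcomp_def)

lemma e_comp:
  "\<lbrakk>i \<in> Ob J; j \<in> Ob J; k \<in> Ob J; u \<in> Hom J i j; v \<in> Hom J j k\<rbrakk>
    \<Longrightarrow> e j k v \<bullet> e i j u = e i k (v \<cdot>\<^bsub>J\<^esub> u)"
  using E by (simp add: is_functor_def tcomp_def)

lemma e_Id: "i \<in> Ob J \<Longrightarrow> e i i (Id J i) = idn (FOb E i)"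
  using E by (simp add: is_functor_def idn_def)

lemma upper:
  assumes "i \<in> Ob J" "j \<in> Ob J"
  obtains k a b where "k \<in> Ob J" "a \<in> Hom J i k" "b \<in> Hom J j k"
  using J_filtered assms unfolding filtered_cat_def by blast

text \<open>Two stages are compared at an upper bound. This makes the unit of the colimit, and its
  structure map from \<open>A\<close>, independent of the stage at which they are taken.\<close>

lemma y_const:
  assumes a: "\<And>i. i \<in> Ob J \<Longrightarrow> arr (a i) \<and> tgt (a i) = FOb E i"
    and e: "\<And>i j u. \<lbrakk>i \<in> Ob J; j \<in> Ob J; u \<in> Hom J i j\<rbrakk> \<Longrightarrow> e i j u \<bullet> a i = a j"
    and ij: "i \<in> Ob J" "j \<in> Ob J"
  shows "y i \<bullet> a i = y j \<bullet> a j"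
proof -
  obtain k p q where k: "k \<in> Ob J" "p \<in> Hom J i k" "q \<in> Hom J j k" by (rule upper[OF ij])
  show ?thesis
    using reassoc[OF y_e[OF ij(1) k(1,2)], of "a i"] reassoc[OF y_e[OF ij(2) k(1,3)], of "a j"]
      ij k a[OF ij(1)] a[OF ij(2)] e[OF ij(1) k(1,2)] e[OF ij(2) k(1,3)] by simp
qed

lemma Y_col: "qcol (Ob J) (FOb E) (jrel J E) Y y"
  by (rule qcol_is_colimit[OF E colim])

lemma Y_rten: "Z \<in> Ob C \<Longrightarrow> qcol (Ob J) (\<lambda>i. FOb E i \<odot> Z) (rten (jrel J E) Z) (Y \<odot> Z) (\<lambda>i. y i \<boxtimes> idn Z)"
  by (rule qcol_rten[OF J_small E colim])

lemma Y_lten: "Z \<in> Ob C \<Longrightarrow> qcol (Ob J) (\<lambda>i. Z \<odot> FOb E i) (lten (jrel J E) Z) (Z \<odot> Y) (\<lambda>i. idn Z \<boxtimes> y i)"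
  by (rule qcol_lten[OF Y_col _ Y_rten])

text \<open>By filteredness every \<open>y i \<boxtimes> y j\<close> factors through some
  \<open>y k \<boxtimes> y k\<close>, so it is enough to test on the diagonal.\<close>

lemma ten_unique:
  assumes x: "x \<in> thom (Y \<odot> Y) Z" and x': "x' \<in> thom (Y \<odot> Y) Z"
    and eq: "\<And>i. i \<in> Ob J \<Longrightarrow> x \<bullet> (y i \<boxtimes> y i) = x' \<bullet> (y i \<boxtimes> y i)"
  shows "x = x'"
proof (rule qcol_unique[OF Y_rten[OF Y_Ob] x x'])
  note [simp] = x[simplified] x'[simplified]
  fix i assume i [simp]: "i \<in> Ob J"
  show "x \<bullet> (y i \<boxtimes> idn Y) = x' \<bullet> (y i \<boxtimes> idn Y)"
  proof (rule qcol_unique[OF Y_lten[OF E_Ob[OF i]], of _ Z])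
    fix j assume j [simp]: "j \<in> Ob J"
    obtain k a b where k [simp]: "k \<in> Ob J" "a \<in> Hom J i k" "b \<in> Hom J j k"
      by (rule upper[OF i j])
    have *: "(w \<bullet> (y i \<boxtimes> idn Y)) \<bullet> (idn (FOb E i) \<boxtimes> y j) = (w \<bullet> (y k \<boxtimes> y k)) \<bullet> (e i k a \<boxtimes> e j k b)"
      if "arr w" "src w = Y \<odot> Y" for w
      using that by (simp add: ten_comp y_e)
    show "(x \<bullet> (y i \<boxtimes> idn Y)) \<bullet> (idn (FOb E i) \<boxtimes> y j) = (x' \<bullet> (y i \<boxtimes> idn Y)) \<bullet> (idn (FOb E i) \<boxtimes> y j)"
      using *[of x] *[of x'] eq[OF k(1)] by simp
  qed simp_all
qed

lemma Y_ten_ten_unique: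
  assumes P: "P \<in> Ob C" and Q: "Q \<in> Ob C" and x: "x \<in> thom ((Y \<odot> P) \<odot> Q) Z" and x': "x' \<in> thom ((Y \<odot> P) \<odot> Q) Z"
    and eq: "\<And>i. i \<in> Ob J \<Longrightarrow> x \<bullet> ((y i \<boxtimes> idn P) \<boxtimes> idn Q) = x' \<bullet> ((y i \<boxtimes> idn P) \<boxtimes> idn Q)"
  shows "x = x'"
proof (rule qcol_unique[OF qcol_rten[OF J_small tensor_functor[OF J_small E P] tensor_colimit[OF J_small E colim P] Q] x x'])
  fix i assume "i \<in> Ob J"
  then show "x \<bullet> (Arr (FOb (ftor_comp (tensor_right C P) E) i) (\<iota> i \<star> Id C P) (Y \<odot> P) \<boxtimes> idn Q)
    = x' \<bullet> (Arr (FOb (ftor_comp (tensor_right C P) E) i) (\<iota> i \<star> Id C P) (Y \<odot> P) \<boxtimes> idn Q)"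
    using eq[of i] by (simp add: ftor_comp_def tensor_right_def ten_def idn_def)
qed

text \<open>The braiding moves the middle variable to the first place.\<close>

lemma ten_Y_ten_unique:
  assumes P [simp]: "P \<in> Ob C" and Q [simp]: "Q \<in> Ob C"
    and x: "x \<in> thom ((P \<odot> Y) \<odot> Q) Z" and x': "x' \<in> thom ((P \<odot> Y) \<odot> Q) Z"
    and eq: "\<And>i. i \<in> Ob J \<Longrightarrow> x \<bullet> ((idn P \<boxtimes> y i) \<boxtimes> idn Q) = x' \<bullet> ((idn P \<boxtimes> y i) \<boxtimes> idn Q)"
  shows "x = x'"
proof -
  note [simp] = x[simplified] x'[simplified]
  have ip: "inv_pair (brd Y P \<boxtimes> idn Q) (brd P Y \<boxtimes> idn Q)"
    by (rule inv_pair_ten) (simp_all add: inv_pair_def)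
  have "x \<bullet> (brd Y P \<boxtimes> idn Q) = x' \<bullet> (brd Y P \<boxtimes> idn Q)"
  proof (rule Y_ten_ten_unique[OF P Q])
    fix i assume i [simp]: "i \<in> Ob J"
    have *: "(w \<bullet> (brd Y P \<boxtimes> idn Q)) \<bullet> ((y i \<boxtimes> idn P) \<boxtimes> idn Q)
        = (w \<bullet> ((idn P \<boxtimes> y i) \<boxtimes> idn Q)) \<bullet> (brd (FOb E i) P \<boxtimes> idn Q)"
      if "arr w" "src w = (P \<odot> Y) \<odot> Q" for w
      using that by (simp add: ten_comp brd_nat)
    show "(x \<bullet> (brd Y P \<boxtimes> idn Q)) \<bullet> ((y i \<boxtimes> idn P) \<boxtimes> idn Q)
      = (x' \<bullet> (brd Y P \<boxtimes> idn Q)) \<bullet> ((y i \<boxtimes> idn P) \<boxtimes> idn Q)"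
      using *[of x] *[of x'] eq[OF i] by simp
  qed simp_all
  then show ?thesis using inv_pair_cancel(2)[OF ip, of x x'] by simp
qed

text \<open>The variables are treated one at a time, and the three indices are then moved to a
  common upper bound. It serves the associativity of the multiplication on the colimit.\<close>

lemma ten3_unique:
  assumes x: "x \<in> thom ((Y \<odot> Y) \<odot> Y) Z" and x': "x' \<in> thom ((Y \<odot> Y) \<odot> Y) Z"
    and eq: "\<And>i. i \<in> Ob J \<Longrightarrow> x \<bullet> ((y i \<boxtimes> y i) \<boxtimes> y i) = x' \<bullet> ((y i \<boxtimes> y i) \<boxtimes> y i)"
  shows "x = x'"
proof (rule qcol_unique[OF Y_lten[of "Y \<odot> Y"] x x'])
  note [simp] = x[simplified] x'[simplified]
  fix l assume l [simp]: "l \<in> Ob J"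
  show "x \<bullet> (idn (Y \<odot> Y) \<boxtimes> y l) = x' \<bullet> (idn (Y \<odot> Y) \<boxtimes> y l)"
  proof (rule Y_ten_ten_unique[OF Y_Ob E_Ob[OF l], of _ Z])
    fix i assume i [simp]: "i \<in> Ob J"
    show "(x \<bullet> (idn (Y \<odot> Y) \<boxtimes> y l)) \<bullet> ((y i \<boxtimes> idn Y) \<boxtimes> idn (FOb E l))
      = (x' \<bullet> (idn (Y \<odot> Y) \<boxtimes> y l)) \<bullet> ((y i \<boxtimes> idn Y) \<boxtimes> idn (FOb E l))"
    proof (rule ten_Y_ten_unique[OF E_Ob[OF i] E_Ob[OF l], of _ Z])
      fix j assume j [simp]: "j \<in> Ob J"
      obtain p a b where p [simp]: "p \<in> Ob J" "a \<in> Hom J i p" "b \<in> Hom J j p"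
        by (rule upper[OF i j])
      obtain k a' c where k [simp]: "k \<in> Ob J" "a' \<in> Hom J p k" "c \<in> Hom J l k"
        by (rule upper[OF p(1) l])
      have [simp]: "a' \<cdot>\<^bsub>J\<^esub> a \<in> Hom J i k" "a' \<cdot>\<^bsub>J\<^esub> b \<in> Hom J j k"
        using J.Comp_in_Hom[OF i p(1) k(1) p(2) k(2)] J.Comp_in_Hom[OF j p(1) k(1) p(3) k(2)] by simp_all
      have *: "((w \<bullet> (idn (Y \<odot> Y) \<boxtimes> y l)) \<bullet> ((y i \<boxtimes> idn Y) \<boxtimes> idn (FOb E l)))
            \<bullet> ((idn (FOb E i) \<boxtimes> y j) \<boxtimes> idn (FOb E l))
          = (w \<bullet> ((y k \<boxtimes> y k) \<boxtimes> y k)) \<bullet> ((e i k (a' \<cdot>\<^bsub>J\<^esub> a) \<boxtimes> e j k (a' \<cdot>\<^bsub>J\<^esub> b)) \<boxtimes> e l k c)"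
        if "arr w" "src w = (Y \<odot> Y) \<odot> Y" for w
        using that by (simp add: ten_comp y_e)
      show "((x \<bullet> (idn (Y \<odot> Y) \<boxtimes> y l)) \<bullet> ((y i \<boxtimes> idn Y) \<boxtimes> idn (FOb E l)))
            \<bullet> ((idn (FOb E i) \<boxtimes> y j) \<boxtimes> idn (FOb E l))
          = ((x' \<bullet> (idn (Y \<odot> Y) \<boxtimes> y l)) \<bullet> ((y i \<boxtimes> idn Y) \<boxtimes> idn (FOb E l)))
            \<bullet> ((idn (FOb E i) \<boxtimes> y j) \<boxtimes> idn (FOb E l))"
        using *[of x] *[of x'] eq[OF k(1)] by simp
    qed simp_all
  qed simp_all
qed simp_all

text \<open>The diagonal is cofinal in the product of a filtered category with itself. The family
  \<open>c\<close> is extended from the diagonal to all pairs by passing to an upper bound; the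
  resulting \<open>d\<close> is glued in the second variable and then in the first.\<close>

lemma diagonal_factor:
  assumes Z: "Z \<in> Ob C" and c: "\<And>i. i \<in> Ob J \<Longrightarrow> c i \<in> thom (FOb E i \<odot> FOb E i) Z"
    and cc: "\<And>i j u. \<lbrakk>i \<in> Ob J; j \<in> Ob J; u \<in> Hom J i j\<rbrakk> \<Longrightarrow> c j \<bullet> (e i j u \<boxtimes> e i j u) = c i"
  obtains m where "m \<in> thom (Y \<odot> Y) Z" "\<And>i. i \<in> Ob J \<Longrightarrow> m \<bullet> (y i \<boxtimes> y i) = c i"
proof -
  have c_arr: "arr (c i)" "src (c i) = FOb E i \<odot> FOb E i" "tgt (c i) = Z" if "i \<in> Ob J" for i
    using c[OF that] by simp_all
  \<comment> \<open>Two upper bounds of \<open>i\<close> and \<open>j\<close> are merged compatibly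
    with the arrows from both, so the extension to pairs does not depend on the upper bound.\<close>
  have indep: "c k \<bullet> (e i k a \<boxtimes> e j k b) = c k' \<bullet> (e i k' a' \<boxtimes> e j k' b')"
    if O: "i \<in> Ob J" "j \<in> Ob J" "k \<in> Ob J" "k' \<in> Ob J"
      and a: "a \<in> Hom J i k" "a' \<in> Hom J i k'" and b: "b \<in> Hom J j k" "b' \<in> Hom J j k'" for i j k k' a a' b b'
  proof -
    obtain l w w' where l: "l \<in> Ob J" "w \<in> Hom J k l" "w' \<in> Hom J k' l"
      "w \<cdot>\<^bsub>J\<^esub> a = w' \<cdot>\<^bsub>J\<^esub> a'" "w \<cdot>\<^bsub>J\<^esub> b = w' \<cdot>\<^bsub>J\<^esub> b'"
      by (rule J.filtered_merge[OF J_filtered O a b])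
    note [simp] = O a b l(1-3) c_arr[OF O(3)] c_arr[OF O(4)] c_arr[OF l(1)]
    have "c k \<bullet> (e i k a \<boxtimes> e j k b) = c l \<bullet> ((e k l w \<boxtimes> e k l w) \<bullet> (e i k a \<boxtimes> e j k b))"
      using reassoc[OF cc[of k l w], of "e i k a \<boxtimes> e j k b"] by simp
    also have "\<dots> = c l \<bullet> ((e k' l w' \<boxtimes> e k' l w') \<bullet> (e i k' a' \<boxtimes> e j k' b'))"
      by (simp add: ten_comp e_comp l(4,5))
    also have "\<dots> = c k' \<bullet> (e i k' a' \<boxtimes> e j k' b')"
      using reassoc[OF cc[of k' l w'], of "e i k' a' \<boxtimes> e j k' b'"] by simp
    finally show ?thesis .
  qed
  have "\<exists>d. \<forall>k a b. k \<in> Ob J \<longrightarrow> a \<in> Hom J i k \<longrightarrow> b \<in> Hom J j k \<longrightarrow> d = c k \<bullet> (e i k a \<boxtimes> e j k b)"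
    if ij: "i \<in> Ob J" "j \<in> Ob J" for i j
  proof -
    obtain k a b where k: "k \<in> Ob J" "a \<in> Hom J i k" "b \<in> Hom J j k" by (rule upper[OF ij])
    show ?thesis
    proof (intro exI[of _ "c k \<bullet> (e i k a \<boxtimes> e j k b)"] allI impI)
      fix k' a' b' assume "k' \<in> Ob J" "a' \<in> Hom J i k'" "b' \<in> Hom J j k'"
      then show "c k \<bullet> (e i k a \<boxtimes> e j k b) = c k' \<bullet> (e i k' a' \<boxtimes> e j k' b')"
        using ij k by (intro indep)
    qed
  qed
  then have "\<forall>i. \<forall>j. \<exists>d. i \<in> Ob J \<longrightarrow> j \<in> Ob J \<longrightarrow> (\<forall>k a b. k \<in> Ob J \<longrightarrow> a \<in> Hom J i k \<longrightarrow> b \<in> Hom J j k \<longrightarrow>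
      d = c k \<bullet> (e i k a \<boxtimes> e j k b))"
    by auto
  then have "\<forall>i. \<exists>d. \<forall>j. i \<in> Ob J \<longrightarrow> j \<in> Ob J \<longrightarrow> (\<forall>k a b. k \<in> Ob J \<longrightarrow> a \<in> Hom J i k \<longrightarrow> b \<in> Hom J j k \<longrightarrow>
      d j = c k \<bullet> (e i k a \<boxtimes> e j k b))"
    by (intro allI choice) (elim allE)
  from choice[OF this] obtain d where "\<forall>i j. i \<in> Ob J \<longrightarrow> j \<in> Ob J \<longrightarrow> (\<forall>k a b. k \<in> Ob J \<longrightarrow>
      a \<in> Hom J i k \<longrightarrow> b \<in> Hom J j k \<longrightarrow> d i j = c k \<bullet> (e i k a \<boxtimes> e j k b))"
    by (elim exE)
  then have d: "d i j = c k \<bullet> (e i k a \<boxtimes> e j k b)"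
    if "i \<in> Ob J" "j \<in> Ob J" "k \<in> Ob J" "a \<in> Hom J i k" "b \<in> Hom J j k" for i j k a b
    using that by simp
  have d_arr: "arr (d i j)" "src (d i j) = FOb E i \<odot> FOb E j" "tgt (d i j) = Z" if ij: "i \<in> Ob J" "j \<in> Ob J" for i j
  proof -
    obtain k a b where k: "k \<in> Ob J" "a \<in> Hom J i k" "b \<in> Hom J j k" by (rule upper[OF ij])
    then show "arr (d i j)" "src (d i j) = FOb E i \<odot> FOb E j" "tgt (d i j) = Z"
      using ij c_arr[OF k(1)] by (simp_all add: d[OF ij k])
  qed
  have d_e: "d i' j' \<bullet> (e i i' u \<boxtimes> e j j' v) = d i j"
    if O: "i \<in> Ob J" "j \<in> Ob J" "i' \<in> Ob J" "j' \<in> Ob J" and u: "u \<in> Hom J i i'" and v: "v \<in> Hom J j j'"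
    for i j i' j' u v
  proof -
    obtain k a b where k: "k \<in> Ob J" "a \<in> Hom J i' k" "b \<in> Hom J j' k" by (rule upper[OF O(3,4)])
    have "d i' j' \<bullet> (e i i' u \<boxtimes> e j j' v) = c k \<bullet> (e i k (a \<cdot>\<^bsub>J\<^esub> u) \<boxtimes> e j k (b \<cdot>\<^bsub>J\<^esub> v))"
      using O u v k c_arr[OF k(1)] by (simp add: d[OF O(3,4) k] ten_comp e_comp)
    also have "\<dots> = d i j"
      using O u v k by (intro d[symmetric] J.Comp_in_Hom[of _ i'] J.Comp_in_Hom[of _ j'])
    finally show ?thesis .
  qed
  have "\<exists>m. m \<in> thom (FOb E i \<odot> Y) Z \<and> (\<forall>j \<in> Ob J. m \<bullet> (idn (FOb E i) \<boxtimes> y j) = d i j)" if i: "i \<in> Ob J" for i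
  proof (rule qcol_factor[OF Y_lten[OF E_Ob[OF i]] Z, of "d i"])
    fix h assume "h \<in> thom (FOb E i \<odot> Y) Z" "\<And>j. j \<in> Ob J \<Longrightarrow> h \<bullet> (idn (FOb E i) \<boxtimes> y j) = d i j"
    then show "\<exists>m. m \<in> thom (FOb E i \<odot> Y) Z \<and> (\<forall>j \<in> Ob J. m \<bullet> (idn (FOb E i) \<boxtimes> y j) = d i j)"
      by (intro exI[of _ h]) simp
  next
    fix j j' x assume "(j, j', x) \<in> lten (jrel J E) (FOb E i)"
    then obtain v where v: "j \<in> Ob J" "j' \<in> Ob J" "v \<in> Hom J j j'" "x = idn (FOb E i) \<boxtimes> e j j' v"
      by (auto simp: lten_def jrel_def)
    show "d i j' \<bullet> x = d i j"
      using d_e[OF i v(1) i v(2) J.Id_in_Hom[OF i] v(3)] v(4) by (simp add: e_Id[OF i])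
  qed (use d_arr[OF i] in simp_all)
  then have "\<forall>i. \<exists>m. i \<in> Ob J \<longrightarrow> m \<in> thom (FOb E i \<odot> Y) Z \<and> (\<forall>j \<in> Ob J. m \<bullet> (idn (FOb E i) \<boxtimes> y j) = d i j)"
    by auto
  from choice[OF this] obtain m where
    m': "\<forall>i. i \<in> Ob J \<longrightarrow> m i \<in> thom (FOb E i \<odot> Y) Z \<and> (\<forall>j \<in> Ob J. m i \<bullet> (idn (FOb E i) \<boxtimes> y j) = d i j)"
    by (elim exE)
  have m: "arr (m i)" "src (m i) = FOb E i \<odot> Y" "tgt (m i) = Z" if "i \<in> Ob J" for i
    using m' that by simp_all
  have my: "m i \<bullet> (idn (FOb E i) \<boxtimes> y j) = d i j" if "i \<in> Ob J" "j \<in> Ob J" for i j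
    using m' that by simp
  obtain n where n: "n \<in> thom (Y \<odot> Y) Z" "\<And>i. i \<in> Ob J \<Longrightarrow> n \<bullet> (y i \<boxtimes> idn Y) = m i"
  proof (rule qcol_factor[OF Y_rten[OF Y_Ob] Z, of m])
    fix i i' x assume "(i, i', x) \<in> rten (jrel J E) Y"
    then obtain u where u: "i \<in> Ob J" "i' \<in> Ob J" "u \<in> Hom J i i'" "x = e i i' u \<boxtimes> idn Y"
      by (auto simp: rten_def jrel_def)
    note [simp] = u(1-3) m[OF u(1)] m[OF u(2)]
    show "m i' \<bullet> x = m i"
    proof (rule qcol_unique[OF Y_lten[OF E_Ob[OF u(1)]], of _ Z])
      fix j assume j [simp]: "j \<in> Ob J"
      have "(m i' \<bullet> x) \<bullet> (idn (FOb E i) \<boxtimes> y j) = m i' \<bullet> ((idn (FOb E i') \<boxtimes> y j) \<bullet> (e i i' u \<boxtimes> idn (FOb E j)))"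
        by (simp add: u(4) ten_comp)
      also have "\<dots> = d i' j \<bullet> (e i i' u \<boxtimes> e j j (Id J j))"
        using reassoc[OF my[OF u(2) j], of "e i i' u \<boxtimes> idn (FOb E j)"] by (simp add: e_Id)
      finally show "(m i' \<bullet> x) \<bullet> (idn (FOb E i) \<boxtimes> y j) = m i \<bullet> (idn (FOb E i) \<boxtimes> y j)"
        using d_e[OF u(1) j u(2) j u(3) J.Id_in_Hom[OF j]] by (simp add: my)
    qed (simp_all add: u(4))
  qed (use m in simp_all)
  have "n \<bullet> (y i \<boxtimes> y i) = c i" if i [simp]: "i \<in> Ob J" for i
  proof -
    have "n \<bullet> (y i \<boxtimes> y i) = n \<bullet> ((y i \<boxtimes> idn Y) \<bullet> (idn (FOb E i) \<boxtimes> y i))"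
      by (simp add: ten_comp)
    also have "\<dots> = d i i"
      using reassoc[OF n(2)[OF i], of "idn (FOb E i) \<boxtimes> y i"] n(1) by (simp add: my)
    also have "\<dots> = c i"
      using c_arr[OF i] by (simp add: d[OF i i i J.Id_in_Hom[OF i] J.Id_in_Hom[OF i]] e_Id)
    finally show ?thesis .
  qed
  then show ?thesis by (rule that[OF n(1)])
qed

text \<open>The multiplication is glued from the diagonal by \<open>diagonal_factor\<close>, the
  unit is that of any stage, and each axiom is tested on one of the jointly epic families
  above.\<close>

lemma colimit_monoid:
  assumes G: "\<And>i. i \<in> Ob J \<Longrightarrow> comm_monoid_ob C (G i)" and Car_G: "\<And>i. i \<in> Ob J \<Longrightarrow> Car (G i) = FOb E i"
    and e_mul: "\<And>i j u. \<lbrakk>i \<in> Ob J; j \<in> Ob J; u \<in> Hom J i j\<rbrakk>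
      \<Longrightarrow> e i j u \<bullet> mulT (G i) = mulT (G j) \<bullet> (e i j u \<boxtimes> e i j u)"
    and e_uni: "\<And>i j u. \<lbrakk>i \<in> Ob J; j \<in> Ob J; u \<in> Hom J i j\<rbrakk> \<Longrightarrow> e i j u \<bullet> uniT (G i) = uniT (G j)"
  obtains Z where "comm_monoid_ob C Z" "Car Z = Y"
    "\<And>i. i \<in> Ob J \<Longrightarrow> y i \<bullet> mulT (G i) = mulT Z \<bullet> (y i \<boxtimes> y i)"
    "\<And>i. i \<in> Ob J \<Longrightarrow> y i \<bullet> uniT (G i) = uniT Z"
proof -
  have mul_arr: "arr (mulT (G i))" "src (mulT (G i)) = FOb E i \<odot> FOb E i" "tgt (mulT (G i)) = FOb E i" if "i \<in> Ob J" for i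
    using monoidD(2)[OF G[OF that]] by (simp_all add: Car_G[OF that])
  have uni_arr: "arr (uniT (G i))" "src (uniT (G i)) = Unit C" "tgt (uniT (G i)) = FOb E i" if "i \<in> Ob J" for i
    using monoidD(3)[OF G[OF that]] by (simp_all add: Car_G[OF that])
  have c1: "y i \<bullet> mulT (G i) \<in> thom (FOb E i \<odot> FOb E i) Y" if "i \<in> Ob J" for i
    using that mul_arr[OF that] by (simp add: Car_G[OF that])
  have c2: "(y j \<bullet> mulT (G j)) \<bullet> (e i j u \<boxtimes> e i j u) = y i \<bullet> mulT (G i)"
    if ij: "i \<in> Ob J" "j \<in> Ob J" "u \<in> Hom J i j" for i j u
  proof -
    note [simp] = ij mul_arr[OF ij(1)] mul_arr[OF ij(2)] Car_G[OF ij(1)] Car_G[OF ij(2)]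
    show ?thesis
      using reassoc[OF y_e[OF ij], of "mulT (G i)"] by (simp add: e_mul[OF ij])
  qed
  obtain m where m0: "m \<in> thom (Y \<odot> Y) Y"
    and my: "\<And>i. i \<in> Ob J \<Longrightarrow> m \<bullet> (y i \<boxtimes> y i) = y i \<bullet> mulT (G i)"
    by (rule diagonal_factor[OF Y_Ob c1 c2]) (simp_all only: that)
  have m [simp]: "arr m" "src m = Y \<odot> Y" "tgt m = Y" using m0 by simp_all
  obtain i0 where i0: "i0 \<in> Ob J" using J_filtered unfolding filtered_cat_def by blast
  define n where "n = y i0 \<bullet> uniT (G i0)"
  have n [simp]: "arr n" "src n = Unit C" "tgt n = Y" using i0 uni_arr[OF i0] by (simp_all add: n_def)
  have yn: "y i \<bullet> uniT (G i) = n" if "i \<in> Ob J" for i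
    unfolding n_def by (rule y_const[OF _ e_uni that i0]) (simp_all add: uni_arr Car_G)
  define Z where "Z = \<lparr>Car = Y, Mul = raw m, Uni = raw n\<rparr>"
  have Z_simps [simp]: "Car Z = Y" "mulT Z = m" "uniT Z = n"
    using m n by (simp_all add: Z_def mulT_def uniT_def tarrow_eq)
  have "comm_monoid_ob C Z"
    unfolding comm_monoid_ob_iff Z_simps
  proof (intro conjI)
    show "m \<bullet> (m \<boxtimes> idn Y) = m \<bullet> (idn Y \<boxtimes> m) \<bullet> asc Y Y Y"
    proof (rule ten3_unique[of _ Y])
      fix i assume i: "i \<in> Ob J"
      note [simp] = i mul_arr[OF i] Car_G[OF i]
      let ?X = "FOb E i" and ?m = "mulT (G i)"
      have "(m \<bullet> (m \<boxtimes> idn Y)) \<bullet> ((y i \<boxtimes> y i) \<boxtimes> y i) = m \<bullet> ((y i \<boxtimes> y i) \<bullet> (?m \<boxtimes> idn ?X))"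
        by (simp add: ten_comp my)
      also have "\<dots> = y i \<bullet> ?m \<bullet> (?m \<boxtimes> idn ?X)"
        using reassoc[OF my[OF i], of "?m \<boxtimes> idn ?X"] by simp
      also have "\<dots> = y i \<bullet> ?m \<bullet> (idn ?X \<boxtimes> ?m) \<bullet> asc ?X ?X ?X"
        by (simp add: monoidD(4)[OF G[OF i], unfolded Car_G[OF i]])
      also have "\<dots> = m \<bullet> ((y i \<boxtimes> y i) \<bullet> ((idn ?X \<boxtimes> ?m) \<bullet> asc ?X ?X ?X))"
        using reassoc[OF my[OF i], of "(idn ?X \<boxtimes> ?m) \<bullet> asc ?X ?X ?X"] by simp
      also have "\<dots> = m \<bullet> ((idn Y \<boxtimes> m) \<bullet> ((y i \<boxtimes> (y i \<boxtimes> y i)) \<bullet> asc ?X ?X ?X))"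
        by (simp add: ten_comp2 my)
      also have "\<dots> = (m \<bullet> (idn Y \<boxtimes> m) \<bullet> asc Y Y Y) \<bullet> ((y i \<boxtimes> y i) \<boxtimes> y i)"
        using asc_nat[of "y i" "y i" "y i" Y Y Y] by simp
      finally show "(m \<bullet> (m \<boxtimes> idn Y)) \<bullet> ((y i \<boxtimes> y i) \<boxtimes> y i)
        = (m \<bullet> (idn Y \<boxtimes> m) \<bullet> asc Y Y Y) \<bullet> ((y i \<boxtimes> y i) \<boxtimes> y i)" .
    qed simp_all
    show "m \<bullet> (n \<boxtimes> idn Y) = lun Y"
    proof (rule qcol_unique[OF Y_lten[OF Unit_in_Ob], of _ Y])
      fix i assume i: "i \<in> Ob J"
      note [simp] = i mul_arr[OF i] uni_arr[OF i] Car_G[OF i]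
      have "(m \<bullet> (n \<boxtimes> idn Y)) \<bullet> (idn (Unit C) \<boxtimes> y i) = m \<bullet> ((y i \<boxtimes> y i) \<bullet> (uniT (G i) \<boxtimes> idn (FOb E i)))"
        by (simp add: ten_comp yn)
      also have "\<dots> = y i \<bullet> lun (FOb E i)"
        using reassoc[OF my[OF i], of "uniT (G i) \<boxtimes> idn (FOb E i)"] by (simp add: monoidD(5)[OF G[OF i], unfolded Car_G[OF i]])
      finally show "(m \<bullet> (n \<boxtimes> idn Y)) \<bullet> (idn (Unit C) \<boxtimes> y i) = lun Y \<bullet> (idn (Unit C) \<boxtimes> y i)"
        by (simp add: lun_nat)
    qed simp_all
    show "m \<bullet> (idn Y \<boxtimes> n) = run Y"
    proof (rule qcol_unique[OF Y_rten[OF Unit_in_Ob], of _ Y])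
      fix i assume i: "i \<in> Ob J"
      note [simp] = i mul_arr[OF i] uni_arr[OF i] Car_G[OF i]
      have "(m \<bullet> (idn Y \<boxtimes> n)) \<bullet> (y i \<boxtimes> idn (Unit C)) = m \<bullet> ((y i \<boxtimes> y i) \<bullet> (idn (FOb E i) \<boxtimes> uniT (G i)))"
        by (simp add: ten_comp yn)
      also have "\<dots> = y i \<bullet> run (FOb E i)"
        using reassoc[OF my[OF i], of "idn (FOb E i) \<boxtimes> uniT (G i)"] by (simp add: monoidD(6)[OF G[OF i], unfolded Car_G[OF i]])
      finally show "(m \<bullet> (idn Y \<boxtimes> n)) \<bullet> (y i \<boxtimes> idn (Unit C)) = run Y \<bullet> (y i \<boxtimes> idn (Unit C))"
        by (simp add: run_nat)
    qed simp_all
    show "m \<bullet> brd Y Y = m"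
    proof (rule ten_unique[of _ Y])
      fix i assume i: "i \<in> Ob J"
      note [simp] = i mul_arr[OF i] Car_G[OF i]
      show "(m \<bullet> brd Y Y) \<bullet> (y i \<boxtimes> y i) = m \<bullet> (y i \<boxtimes> y i)"
        using reassoc[OF my[OF i], of "brd (FOb E i) (FOb E i)"] monoidD(7)[OF G[OF i], unfolded Car_G[OF i]] by (simp add: brd_nat my)
    qed simp_all
  qed simp_all
  then show ?thesis
    by (rule that) (simp_all add: my yn)
qed

end

context symmetric_monoidal_category
begin

text \<open>In elements, h(x z) = h(x) h(z).\<close>

lemma emul_monoid_hom:
  assumes X: "comm_monoid_ob C X" and Z: "comm_monoid_ob C Z"
    and h: "h \<in> thom (Car X) (Car Z)" "h \<bullet> mulT X = mulT Z \<bullet> (h \<boxtimes> h)" and z: "z \<in> thom (Unit C) (Car X)"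
  shows "h \<bullet> emul X (self_module X) z = emul Z (self_module Z) (h \<bullet> z) \<bullet> h"
proof -
  note [simp] = monoidD(1-3)[OF X] monoidD(1-3)[OF Z] h(1)[simplified] z[simplified]
  have "h \<bullet> emul X (self_module X) z = mulT Z \<bullet> ((h \<boxtimes> h) \<bullet> ((idn (Car X) \<boxtimes> z) \<bullet> iarr (run (Car X))))"
    using reassoc[OF h(2), of "(idn (Car X) \<boxtimes> z) \<bullet> iarr (run (Car X))"] by (simp add: emul_def)
  also have "\<dots> = mulT Z \<bullet> ((idn (Car Z) \<boxtimes> (h \<bullet> z)) \<bullet> ((h \<boxtimes> idn (Unit C)) \<bullet> iarr (run (Car X))))"
    by (simp add: ten_comp2)
  finally show ?thesis by (simp add: iarr_run_nat emul_def)
qed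

end

section \<open>The localisation as an epimorphism of finite presentation\<close>

context localisation
begin

lemma F_Hom: "raw F \<in> Hom (Comm C) A B"
  by (simp add: Hom_Comm F_Arr F_mul F_uni)

lemma epi_arr_F: "epi_arr (Comm C) A B (raw F)"
  unfolding epi_arr_def
proof (intro conjI ballI impI F_Hom)
  fix Z g h assume "Z \<in> Ob (Comm C)" and g: "g \<in> Hom (Comm C) B Z" and h: "h \<in> Hom (Comm C) B Z"
    and eq: "g \<cdot>\<^bsub>Comm C\<^esub> raw F = h \<cdot>\<^bsub>Comm C\<^esub> raw F"
  then have Z: "comm_monoid_ob C Z" by simp
  note [simp] = monoidD(1)[OF Z]
  have "Arr (Car B) g (Car Z) \<bullet> F = Arr (Car B) h (Car Z) \<bullet> F"
    using eq by (simp add: tcomp_def)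
  then have "Arr (Car B) g (Car Z) = Arr (Car B) h (Car Z)"
    by (rule epi[OF Z, rotated -1]) (use g h in \<open>simp_all add: Hom_Comm\<close>)
  then show "g = h" by simp
qed

text \<open>The hypothesis on \<open>z\<close> is an equation between global elements, the form in
  which (C1) yields it at a stage. Linearity over \<open>l\<close> (\<open>linear_eq_emul\<close>)
  upgrades it to the equation between arrows out of \<open>A\<close> that \<open>extension\<close>
  requires.\<close>

lemma extension_of_inverse:
  assumes Z: "comm_monoid_ob C Z"
    and l: "l \<in> thom (Car A) (Car Z)" "l \<bullet> mulT A = mulT Z \<bullet> (l \<boxtimes> l)" "l \<bullet> uniT A = uniT Z"
    and z: "z \<in> thom (Unit C) (Car Z)" "emul Z (self_module Z) z \<bullet> l \<bullet> T \<bullet> uniT A = uniT Z"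
  obtains G where "G \<in> thom (Car B) (Car Z)" "G \<bullet> mulT B = mulT Z \<bullet> (G \<boxtimes> G)"
    "G \<bullet> uniT B = uniT Z" "G \<bullet> F = l"
proof -
  note [simp] = monoidD(1-3)[OF Z] l(1)[simplified] z(1)[simplified]
  let ?e = "emul Z (self_module Z) z"
  have [simp]: "arr ?e" using arr_emul[OF Z module_self[OF Z] z(1)] .
  note el = emul_self_linear(2)[OF Z z(1)]
  have lin: "(?e \<bullet> l \<bullet> T) \<bullet> mulT A = mulT Z \<bullet> ((?e \<bullet> l \<bullet> T) \<boxtimes> l)"
  proof -
    have "(?e \<bullet> l \<bullet> T) \<bullet> mulT A = ?e \<bullet> (l \<bullet> mulT A) \<bullet> (T \<boxtimes> idn (Car A))"
      by (simp add: T_linear)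
    also have "\<dots> = ?e \<bullet> mulT Z \<bullet> ((l \<bullet> T) \<boxtimes> l)"
      unfolding l(2) by (simp add: ten_comp)
    also have "\<dots> = mulT Z \<bullet> ((?e \<bullet> l \<bullet> T) \<boxtimes> l)"
      using reassoc[OF el, of "(l \<bullet> T) \<boxtimes> l"] by (simp add: ten_comp)
    finally show ?thesis .
  qed
  have "?e \<bullet> l \<bullet> T = emul Z (self_module Z) ((?e \<bullet> l \<bullet> T) \<bullet> uniT A) \<bullet> l"
    by (rule linear_eq_emul[OF monoid_A Z l(1) _ lin]) simp
  also have "(?e \<bullet> l \<bullet> T) \<bullet> uniT A = l \<bullet> uniT A"
    using z(2) l(3) by simp
  also have "emul Z (self_module Z) (l \<bullet> uniT A) \<bullet> l = l"
    by (rule linear_eq_emul[OF monoid_A Z l(1) l(1,2), symmetric])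
  finally have elT: "?e \<bullet> l \<bullet> T = l" .
  show ?thesis
    by (rule extension[OF Z l _ el elT]) (simp, rule that)
qed

text \<open>Uniqueness of arrows out of \<open>B\<close> under \<open>A\<close> leaves only the
  existence of one to some stage. The colimit \<open>L\<close> is given among monoids under
  \<open>A\<close>, whereas (C1) concerns the colimit \<open>Y\<close> of the underlying objects in
  \<open>C\<close>; most of the proof compares the two.\<close>

lemma finitely_presented: "finitely_presented_mor U C A B (raw F)"
  unfolding finitely_presented_mor_def hom_preserves_filtered_colimits_def
proof (intro allI impI, elim conjE)
  fix J :: "('i, 'i) cat" and \<F> L \<iota>L
  let ?D = "under_cat (Comm C) A"
  assume J: "small_cat J" "filtered_cat J" and \<F>: "is_functor J ?D \<F>" and L: "is_colimit J ?D \<F> L \<iota>L"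
  interpret D: category ?D
    using category.category_under[OF category_Comm] monoid_A by simp
  interpret J: category J using J by (simp add: small_cat_def)
  let ?B = "(B, raw F)"
  have B_Ob: "?B \<in> Ob ?D" using F_Hom monoid_B by (simp add: under_cat_def)
  show "hom_preserves_colimit J ?D ?B \<F> L \<iota>L"
  proof (rule D.hom_preserves_colimit_subsingleton[OF J.category_axioms J(2) \<F> L B_Ob])
    fix W g h assume "W \<in> Ob ?D" "g \<in> Hom ?D ?B W" "h \<in> Hom ?D ?B W"
    then have "fst W \<in> Ob (Comm C)" "g \<in> Hom (Comm C) B (fst W)" "h \<in> Hom (Comm C) B (fst W)"
      "g \<cdot>\<^bsub>Comm C\<^esub> raw F = h \<cdot>\<^bsub>Comm C\<^esub> raw F"
      by (auto simp: under_cat_def)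
    then show "g = h" using epi_arr_F unfolding epi_arr_def by blast
  next
    fix h assume h: "h \<in> Hom ?D ?B L"
    define G where "G i = fst (FOb \<F> i)" for i
    define l where "l i = Arr (Car A) (snd (FOb \<F> i)) (Car (G i))" for i
    define E where "E = \<lparr>FOb = (\<lambda>i. Car (G i)), FAr = FAr \<F>\<rparr>"
    have \<F>_Ob: "FOb \<F> i \<in> Ob ?D" if "i \<in> Ob J" for i
      using \<F> that by (simp add: is_functor_def)
    have G: "comm_monoid_ob C (G i)" and l_Hom: "snd (FOb \<F> i) \<in> Hom (Comm C) A (G i)" if "i \<in> Ob J" for i
      using \<F>_Ob[OF that] by (auto simp: under_cat_def G_def)
    have e_Hom: "FAr \<F> i j u \<in> Hom (Comm C) (G i) (G j)" "FAr \<F> i j u \<cdot> snd (FOb \<F> i) = snd (FOb \<F> j)"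
      if "i \<in> Ob J" "j \<in> Ob J" "u \<in> Hom J i j" for i j u
    proof -
      have "FAr \<F> i j u \<in> Hom ?D (FOb \<F> i) (FOb \<F> j)"
        using \<F> that by (simp add: is_functor_def)
      then show "FAr \<F> i j u \<in> Hom (Comm C) (G i) (G j)" "FAr \<F> i j u \<cdot> snd (FOb \<F> i) = snd (FOb \<F> j)"
        by (simp_all add: under_cat_def G_def case_prod_beta)
    qed
    have E: "is_functor J C E"
      using \<F> monoidD(1)[OF G] e_Hom(1)
      by (simp add: is_functor_def E_def under_cat_def case_prod_beta G_def Comm_def)
    obtain Y \<kappa> where Y: "is_colimit J C E Y \<kappa>"
      using small_colimits J(1) E unfolding has_small_colimits_def by blast
    interpret fc: filtered_colimit C U J E Y \<kappa>
      by unfold_locales (rule J E Y)+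
    have Car_G: "FOb E i = Car (G i)" for i by (simp add: E_def)
    have FAr_E: "FAr E = FAr \<F>" by (simp add: E_def)
    have e: "fc.e i j u \<bullet> mulT (G i) = mulT (G j) \<bullet> (fc.e i j u \<boxtimes> fc.e i j u)"
      "fc.e i j u \<bullet> uniT (G i) = uniT (G j)" "fc.e i j u \<bullet> l i = l j"
      if "i \<in> Ob J" "j \<in> Ob J" "u \<in> Hom J i j" for i j u
    proof -
      note m = monoidD(1)[OF G[OF that(1)]] monoidD(1)[OF G[OF that(2)]]
      show "fc.e i j u \<bullet> mulT (G i) = mulT (G j) \<bullet> (fc.e i j u \<boxtimes> fc.e i j u)"
        "fc.e i j u \<bullet> uniT (G i) = uniT (G j)"
        using e_Hom(1)[OF that] by (simp_all add: Hom_Comm[OF m] Car_G FAr_E)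
      show "fc.e i j u \<bullet> l i = l j"
        using e_Hom(2)[OF that] by (simp add: l_def tcomp_def Car_G FAr_E)
    qed
    have l: "arr (l i)" "src (l i) = Car A" "tgt (l i) = Car (G i)"
      "l i \<bullet> mulT A = mulT (G i) \<bullet> (l i \<boxtimes> l i)" "l i \<bullet> uniT A = uniT (G i)" if "i \<in> Ob J" for i
      using l_Hom[OF that] monoidD(1)[OF G[OF that]] by (simp_all add: l_def Hom_Comm)
    obtain YM where YM: "comm_monoid_ob C YM" "Car YM = Y"
      and y_mul: "\<And>i. i \<in> Ob J \<Longrightarrow> fc.y i \<bullet> mulT (G i) = mulT YM \<bullet> (fc.y i \<boxtimes> fc.y i)"
      and y_uni: "\<And>i. i \<in> Ob J \<Longrightarrow> fc.y i \<bullet> uniT (G i) = uniT YM"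
      by (rule fc.colimit_monoid[of G]) (rule G, assumption, rule Car_G[symmetric], rule e(1), assumption+, rule e(2), assumption+, rule that, assumption, assumption, simp, simp)
    note [simp] = monoidD(1-3)[OF YM(1), unfolded YM(2)] YM(2)
    note e0 = e and e = e[unfolded Car_G FAr_E] and y_mul = y_mul[unfolded Car_G] and y_uni = y_uni[unfolded Car_G]
    note [simp] = Car_G
    have y: "arr (Arr (Car (G i)) (\<kappa> i) Y)" if "i \<in> Ob J" for i
      using fc.arr_y[OF that] by simp
    define LM where "LM = fst L"
    define ll where "ll = Arr (Car A) (snd L) (Car LM)"
    define x where "x i = Arr (Car (G i)) (\<iota>L i) (Car LM)" for i
    have D_Comp: "Comp ?D = Comp C" by (simp add: under_cat_def)
    have L_Ob: "L \<in> Ob ?D" and \<iota>L: "\<And>i. i \<in> Ob J \<Longrightarrow> \<iota>L i \<in> Hom ?D (FOb \<F> i) L"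
      and \<iota>L_e: "\<And>i j u. \<lbrakk>i \<in> Ob J; j \<in> Ob J; u \<in> Hom J i j\<rbrakk> \<Longrightarrow> \<iota>L j \<cdot> FAr \<F> i j u = \<iota>L i"
      using L by (simp_all add: is_colimit_def cocone_def D_Comp)
    have L_univ: "\<exists>!h. h \<in> Hom ?D L M \<and> (\<forall>i \<in> Ob J. h \<cdot> \<iota>L i = \<mu> i)" if "cocone J ?D \<F> M \<mu>" for M \<mu>
      using L[unfolded is_colimit_def, THEN conjunct2, THEN spec[of _ M], THEN spec[of _ \<mu>], THEN mp, OF that]
      by (simp add: D_Comp)
    have LM: "comm_monoid_ob C LM" and ll_Hom: "snd L \<in> Hom (Comm C) A LM"
      using L_Ob by (auto simp: under_cat_def LM_def)
    note [simp] = monoidD(1-3)[OF LM]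
    have ll: "arr ll" "src ll = Car A" "tgt ll = Car LM" "ll \<bullet> uniT A = uniT LM"
      using ll_Hom by (simp_all add: ll_def Hom_Comm)
    have x: "arr (x i)" "src (x i) = Car (G i)" "tgt (x i) = Car LM"
      "x i \<bullet> mulT (G i) = mulT LM \<bullet> (x i \<boxtimes> x i)" "x i \<bullet> uniT (G i) = uniT LM" "x i \<bullet> l i = ll" if "i \<in> Ob J" for i
    proof -
      have "\<iota>L i \<in> Hom (Comm C) (G i) LM" "\<iota>L i \<cdot> snd (FOb \<F> i) = snd L"
        using \<iota>L[OF that] by (simp_all add: under_cat_def G_def LM_def case_prod_beta)
      then show "arr (x i)" "src (x i) = Car (G i)" "tgt (x i) = Car LM"
        "x i \<bullet> mulT (G i) = mulT LM \<bullet> (x i \<boxtimes> x i)" "x i \<bullet> uniT (G i) = uniT LM" "x i \<bullet> l i = ll"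
        using monoidD(1)[OF G[OF that]] by (simp_all add: x_def Hom_Comm) (simp add: l_def ll_def tcomp_def)
    qed
    define H where "H = Arr (Car B) h (Car LM)"
    have H: "arr H" "src H = Car B" "tgt H = Car LM" "H \<bullet> mulT B = mulT LM \<bullet> (H \<boxtimes> H)" "H \<bullet> F = ll"
    proof -
      have "h \<in> Hom (Comm C) B LM" "h \<cdot> raw F = snd L"
        using h by (simp_all add: under_cat_def LM_def case_prod_beta)
      then show "arr H" "src H = Car B" "tgt H = Car LM" "H \<bullet> mulT B = mulT LM \<bullet> (H \<boxtimes> H)" "H \<bullet> F = ll"
        by (simp_all add: H_def Hom_Comm) (simp add: tcomp_def ll_def)
    qed
    obtain i0 where i0: "i0 \<in> Ob J" using J(2) unfolding filtered_cat_def by blast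
    define l' where "l' = fc.y i0 \<bullet> l i0"
    have yl: "fc.y i \<bullet> l i = l'" if "i \<in> Ob J" for i
      unfolding l'_def by (rule fc.y_const[OF _ e0(3) that i0]) (simp_all add: l)
    note yl = yl[unfolded Car_G]
    have l': "arr l'" "src l' = Car A" "tgt l' = Y" using l[OF i0] y[OF i0] by (simp_all add: l'_def)
    have l'_mul: "l' \<bullet> mulT A = mulT YM \<bullet> (l' \<boxtimes> l')"
      using reassoc[OF y_mul[OF i0], of "l i0 \<boxtimes> l i0"] l[OF i0] y[OF i0] monoidD(2)[OF G[OF i0]]
      by (simp add: l'_def ten_comp)
    have l'_uni: "l' \<bullet> uniT A = uniT YM"
      using l[OF i0] y[OF i0] y_uni[OF i0] by (simp add: l'_def)
    have l'_Arr: "Arr (Car A) (raw l') Y = l'" using l' by (simp add: tarrow_eq)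
    have YM_Ob: "(YM, raw l') \<in> Ob ?D"
      using YM l' l'_mul l'_uni by (simp add: under_cat_def Hom_Comm l'_Arr)
    have \<kappa>_Hom: "\<kappa> i \<in> Hom ?D (FOb \<F> i) (YM, raw l')" if i: "i \<in> Ob J" for i
    proof -
      have "\<kappa> i \<in> Hom (Comm C) (G i) YM"
        using y[OF i] y_mul[OF i] y_uni[OF i] monoidD(1)[OF G[OF i]] by (simp add: Hom_Comm YM(2))
      moreover have "\<kappa> i \<cdot> snd (FOb \<F> i) = raw l'"
        using arg_cong[OF yl[OF i], of raw] by (simp add: raw_simps) (simp add: l_def)
      ultimately show ?thesis by (simp add: under_cat_def G_def case_prod_beta)
    qed
    \<comment> \<open>The monoid structure on \<open>Y\<close> makes it a cocone under
      \<open>A\<close>, which gives \<open>HL\<close> from \<open>L\<close> to \<open>Y\<close>. The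
      arrow \<open>K\<close> in the other direction comes from the universal property of
      \<open>Y\<close> in \<open>C\<close>.\<close>
    have "cocone J ?D \<F> (YM, raw l') \<kappa>"
      using YM_Ob \<kappa>_Hom Y by (simp add: cocone_def is_colimit_def D_Comp FAr_E)
    from L_univ[OF this] obtain hL where hL: "hL \<in> Hom ?D L (YM, raw l') \<and> (\<forall>i \<in> Ob J. hL \<cdot> \<iota>L i = \<kappa> i)"
      by (elim ex1E)
    define HL where "HL = Arr (Car LM) hL Y"
    have HL: "arr HL" "src HL = Car LM" "tgt HL = Y" "HL \<bullet> uniT LM = uniT YM"
    proof -
      have "hL \<in> Hom (Comm C) LM YM"
        using hL by (simp add: under_cat_def LM_def case_prod_beta)
      then show "arr HL" "src HL = Car LM" "tgt HL = Y" "HL \<bullet> uniT LM = uniT YM"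
        by (simp_all add: Hom_Comm YM(2) HL_def)
    qed
    have HLx: "HL \<bullet> x i = fc.y i" if "i \<in> Ob J" for i
      using hL that by (simp add: HL_def x_def tcomp_def)
    note HLx = HLx[unfolded Car_G]
    obtain K where K: "arr K" "src K = Y" "tgt K = Car LM" and Ky: "\<And>i. i \<in> Ob J \<Longrightarrow> K \<bullet> fc.y i = x i"
    proof (rule qcol_factor[OF fc.Y_col, of "Car LM" x])
      fix i j r assume "(i, j, r) \<in> jrel J E"
      then obtain u where u: "i \<in> Ob J" "j \<in> Ob J" "u \<in> Hom J i j" "r = fc.e i j u" by (auto simp: jrel_def)
      show "x j \<bullet> r = x i"
        using \<iota>L_e[OF u(1-3)] by (simp add: u(4) x_def tcomp_def FAr_E)
    next
      fix k assume "k \<in> thom Y (Car LM)" "\<And>i. i \<in> Ob J \<Longrightarrow> k \<bullet> fc.y i = x i"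
      then show thesis by (intro that[of k]) simp_all
    qed (use x in \<open>simp_all add: Car_G\<close>)
    note Ky = Ky[unfolded Car_G]
    have K_mul: "K \<bullet> mulT YM = mulT LM \<bullet> (K \<boxtimes> K)"
    proof (rule fc.ten_unique[of _ "Car LM"])
      fix i assume i: "i \<in> Ob J"
      note [simp] = x(1-3)[OF i] y[OF i] K monoidD(2)[OF G[OF i]]
      have "(K \<bullet> mulT YM) \<bullet> (fc.y i \<boxtimes> fc.y i) = K \<bullet> fc.y i \<bullet> mulT (G i)"
        by (simp add: y_mul[OF i])
      also have "\<dots> = x i \<bullet> mulT (G i)" using reassoc[OF Ky[OF i], of "mulT (G i)"] by simp
      finally show "(K \<bullet> mulT YM) \<bullet> (fc.y i \<boxtimes> fc.y i) = (mulT LM \<bullet> (K \<boxtimes> K)) \<bullet> (fc.y i \<boxtimes> fc.y i)"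
        by (simp add: ten_comp Ky[OF i] x(4)[OF i])
    qed (use K in simp_all)
    have K_uni: "K \<bullet> uniT YM = uniT LM"
      using reassoc[OF Ky[OF i0], of "uniT (G i0)"] y_uni[OF i0] x[OF i0] y[OF i0] K monoidD(3)[OF G[OF i0]]
      by simp
    have Kl: "K \<bullet> l' = ll"
      using reassoc[OF Ky[OF i0], of "l i0"] x[OF i0] y[OF i0] K l[OF i0]
      by (simp add: l'_def)
    have K_Arr: "Arr Y (raw K) (Car LM) = K" using K by (simp add: tarrow_eq)
    have "raw K \<in> Hom (Comm C) YM LM"
      using K K_mul K_uni by (simp add: Hom_Comm YM(2) K_Arr)
    moreover have "raw K \<cdot> raw l' = snd L"
      using arg_cong[OF Kl, of raw] by (simp add: raw_simps) (simp add: ll_def)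
    ultimately have K_Hom: "raw K \<in> Hom ?D (YM, raw l') L"
      by (simp add: under_cat_def LM_def case_prod_beta)
    \<comment> \<open>A global element of \<open>L\<close> can thus be pushed to \<open>Y\<close>,
      represented there at a stage, and recovered in \<open>L\<close>.\<close>
    have KHL: "K \<bullet> HL = idn (Car LM)"
    proof -
      obtain s where s: "\<forall>h. h \<in> Hom ?D L L \<and> (\<forall>i \<in> Ob J. h \<cdot> \<iota>L i = \<iota>L i) \<longrightarrow> h = s"
        using L_univ[OF L[unfolded is_colimit_def, THEN conjunct1]] by (elim ex1E)
      have D_comp: "Comp ?D = Comp C" "Id ?D L = Id C (Car LM)" by (simp_all add: under_cat_def LM_def case_prod_beta)
      have "(raw K \<cdot> hL) \<cdot> \<iota>L i = \<iota>L i" if i: "i \<in> Ob J" for i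
      proof -
        have "(K \<bullet> HL) \<bullet> x i = x i"
          using HLx[OF i] Ky[OF i] K HL x(1-3)[OF i] by simp
        from arg_cong[OF this, of raw] show ?thesis by (simp add: raw_simps) (simp add: HL_def x_def)
      qed
      moreover have "raw K \<cdot> hL \<in> Hom ?D L L"
        using D.Comp_in_Hom[OF L_Ob YM_Ob L_Ob _ K_Hom, of hL] hL by (simp add: D_comp)
      ultimately have "raw K \<cdot> hL = s" using s by simp
      moreover have "Id C (Car LM) \<cdot> \<iota>L i = \<iota>L i" if i: "i \<in> Ob J" for i
        using D.Comp_Id_left[OF \<F>_Ob[OF i] L_Ob \<iota>L[OF i]] by (simp add: D_comp)
      then have "Id C (Car LM) = s"
        using s D.Id_in_Hom[OF L_Ob] by (simp add: D_comp)
      ultimately show ?thesis using K HL by (simp add: tarrow_eq raw_simps) (simp add: HL_def)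
    qed
    \<comment> \<open>The image in \<open>L\<close> of the unit at stage 1 of the chain, that is,
      the inverse of t in \<open>L\<close>.\<close>
    define X where "X = H \<bullet> \<iota> 1 \<bullet> uniT A"
    have X: "X \<in> thom (Unit C) (Car LM)" using H by (simp add: X_def)
    have pres: "hom_preserves_colimit J C (Unit C) E Y \<kappa>"
      using C1_filtered J E Y unfolding hom_preserves_filtered_colimits_def by blast
    note presD = hom_preserves_colimitD[OF J.category_axioms J(2) E Y Unit_in_Ob pres]
    have "raw (HL \<bullet> X) \<in> Hom C (Unit C) Y"
      using arr_def[of "HL \<bullet> X"] X HL by simp
    from presD(1)[OF this] obtain j z where j: "j \<in> Ob J" "z \<in> Hom C (Unit C) (FOb E j)" "\<kappa> j \<cdot> z = raw (HL \<bullet> X)"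
      by blast
    define z' where "z' = Arr (Unit C) z (Car (G j))"
    have z': "z' \<in> thom (Unit C) (Car (G j))"
      using j monoidD(1)[OF G[OF j(1)]] by (simp add: z'_def arr_Arr)
    have yz: "fc.y j \<bullet> z' = HL \<bullet> X"
      using j(3) X HL by (simp add: tarrow_eq raw_simps) (simp add: z'_def)
    note yz = yz[unfolded Car_G]
    have xz: "x j \<bullet> z' = X"
    proof -
      have "x j \<bullet> z' = K \<bullet> fc.y j \<bullet> z'"
        using reassoc[OF Ky[OF j(1)], of z'] z' y[OF j(1)] K by simp
      also have "\<dots> = X" using reassoc[OF KHL, of X] X HL K by (simp add: yz)
      finally show ?thesis .
    qed
    note Gj [simp] = monoidD(1-3)[OF G[OF j(1)]] and lj [simp] = l(1-3)[OF j(1)] and xj [simp] = x(1-3)[OF j(1)]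
      and yj [simp] = y[OF j(1)]
    let ?R = "emul (G j) (self_module (G j)) z'"
    have [simp]: "arr ?R" by (rule arr_emul[OF G[OF j(1)] module_self[OF G[OF j(1)]] z'])
    have [simp]: "arr (emul LM (self_module LM) X)" by (rule arr_emul[OF LM module_self[OF LM] X])
    \<comment> \<open>The product of \<open>z'\<close> with the image of t at stage
      \<open>j\<close>. It need not be 1 there, but it becomes 1 in \<open>L\<close>
      (\<open>xw\<close>), hence in \<open>Y\<close>, and so by (C1) at a later stage
      \<open>k\<close>.\<close>
    define w where "w = ?R \<bullet> l j \<bullet> T \<bullet> uniT A"
    have w [simp]: "arr w" "src w = Unit C" "tgt w = Car (G j)" by (simp_all add: w_def)
    have xw: "x j \<bullet> w = uniT LM"
    proof -
      have e1: "x j \<bullet> ?R = emul LM (self_module LM) X \<bullet> x j"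
        using emul_monoid_hom[OF G[OF j(1)] LM _ x(4)[OF j(1)] z'] xz by simp
      have e2: "H \<bullet> inv_T = emul LM (self_module LM) X \<bullet> H"
        unfolding inv_T_def X_def using H by (intro emul_monoid_hom[OF monoid_B LM _ H(4)]) simp_all
      have "x j \<bullet> w = emul LM (self_module LM) X \<bullet> x j \<bullet> l j \<bullet> T \<bullet> uniT A"
        using reassoc[OF e1, of "l j \<bullet> T \<bullet> uniT A"] by (simp add: w_def)
      also have "x j \<bullet> l j \<bullet> T \<bullet> uniT A = H \<bullet> F \<bullet> T \<bullet> uniT A"
        using reassoc[OF x(6)[OF j(1)], of "T \<bullet> uniT A"] reassoc[OF H(5), of "T \<bullet> uniT A"] H(1-3) by simp
      also have "emul LM (self_module LM) X \<bullet> H \<bullet> F \<bullet> T \<bullet> uniT A = H \<bullet> (inv_T \<bullet> F \<bullet> T) \<bullet> uniT A"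
        using reassoc[OF e2, of "F \<bullet> T \<bullet> uniT A"] H(1-3) by simp
      also have "\<dots> = uniT LM"
        using reassoc[OF H(5), of "uniT A"] H(1-3) ll(4) unfolding inv_T_F by simp
      finally show ?thesis .
    qed
    have "fc.y j \<bullet> w = fc.y j \<bullet> uniT (G j)"
    proof -
      have "fc.y j \<bullet> w = HL \<bullet> x j \<bullet> w"
        using reassoc[OF HLx[OF j(1)], of w] HL by simp
      then show ?thesis using xw HL(4) y_uni[OF j(1)] by simp
    qed
    from arg_cong[OF this, of raw] have "\<kappa> j \<cdot> raw w = \<kappa> j \<cdot> raw (uniT (G j))" by (simp add: raw_simps)
    moreover have "raw w \<in> Hom C (Unit C) (FOb E j)" "raw (uniT (G j)) \<in> Hom C (Unit C) (FOb E j)"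
      using arr_def[of w] arr_def[of "uniT (G j)"] by simp_all
    ultimately obtain k u where k: "k \<in> Ob J" "u \<in> Hom J j k"
      and ku: "FAr E j k u \<cdot> raw w = FAr E j k u \<cdot> raw (uniT (G j))"
      using presD(2)[OF j(1)] by blast
    let ?e = "Arr (Car (G j)) (FAr \<F> j k u) (Car (G k))"
    have [simp]: "arr ?e" using fc.arr_e[OF j(1) k] by (simp add: FAr_E)
    have ew: "?e \<bullet> w = uniT (G k)"
      using ku e(2)[OF j(1) k] by (simp add: tcomp_def FAr_E)
    have ez: "?e \<bullet> z' \<in> thom (Unit C) (Car (G k))" using z' by simp
    note [simp] = monoidD(1-3)[OF G[OF k(1)]]
    \<comment> \<open>At stage \<open>k\<close> the image of \<open>z'\<close> is an inverse of t,
      which is what \<open>extension_of_inverse\<close> asks for.\<close>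
    have "emul (G k) (self_module (G k)) (?e \<bullet> z') \<bullet> l k \<bullet> T \<bullet> uniT A = uniT (G k)"
    proof -
      have [simp]: "arr (emul (G k) (self_module (G k)) (?e \<bullet> z'))"
        by (rule arr_emul[OF G[OF k(1)] module_self[OF G[OF k(1)]] ez])
      have e1: "?e \<bullet> ?R = emul (G k) (self_module (G k)) (?e \<bullet> z') \<bullet> ?e"
        by (rule emul_monoid_hom[OF G[OF j(1)] G[OF k(1)] _ e(1)[OF j(1) k] z']) simp
      have "emul (G k) (self_module (G k)) (?e \<bullet> z') \<bullet> l k \<bullet> T \<bullet> uniT A
          = emul (G k) (self_module (G k)) (?e \<bullet> z') \<bullet> ?e \<bullet> l j \<bullet> T \<bullet> uniT A"
        using reassoc[OF e(3)[OF j(1) k], of "T \<bullet> uniT A"] by simp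
      also have "\<dots> = ?e \<bullet> w"
        using reassoc[OF e1, of "l j \<bullet> T \<bullet> uniT A"] by (simp add: w_def)
      finally show ?thesis by (simp add: ew)
    qed
    from extension_of_inverse[OF G[OF k(1)] _ l(4,5)[OF k(1)] ez this] obtain Q where
      Q: "Q \<in> thom (Car B) (Car (G k))" "Q \<bullet> mulT B = mulT (G k) \<bullet> (Q \<boxtimes> Q)" "Q \<bullet> uniT B = uniT (G k)" "Q \<bullet> F = l k"
      using l(1-3)[OF k(1)] by auto
    have Q_Arr: "Arr (Car B) (raw Q) (Car (G k)) = Q" using Q(1) by (simp add: tarrow_eq)
    have "raw Q \<in> Hom (Comm C) B (G k)" using Q by (simp add: Hom_Comm Q_Arr)
    moreover have "raw Q \<cdot> raw F = snd (FOb \<F> k)"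
      using arg_cong[OF Q(4), of raw] by (simp add: raw_simps) (simp add: l_def)
    ultimately have "raw Q \<in> Hom ?D ?B (FOb \<F> k)"
      by (simp add: under_cat_def G_def case_prod_beta)
    then show "\<exists>j \<in> Ob J. \<exists>g. g \<in> Hom ?D ?B (FOb \<F> j)"
      using k(1) by (intro bexI[of _ k] exI[of _ "raw Q"])
  qed
qed

end

theorem proposition2p5:
  fixes C :: "('o, 'a) smcat" and U :: "'i itself"
    and A A\<^sub>t :: "('o, 'a) cmon" and t I\<^sub>t :: 'a
  assumes "algebraic_context C U"
    and "A \<in> Ob (Comm C)"
    and "t \<in> carrier (endo_ring C A)"
    and "is_localisation C A t A\<^sub>t I\<^sub>t"
  shows "zariski_open_immersion U C (Spec A\<^sub>t) (Spec A) I\<^sub>t"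
proof -
  interpret algebraic_context C U by fact
  have A: "comm_monoid_ob C A" using assms(2) by simp
  have B: "comm_monoid_ob C A\<^sub>t" and I: "I\<^sub>t \<in> Hom (Comm C) A A\<^sub>t"
    using assms(4) by (simp_all add: is_localisation_def)
  obtain \<iota> where c: "is_colimit nat_chain (Modules C A) (mult_chain C A t) (monoid_as_module C A\<^sub>t I\<^sub>t) \<iota>"
    and \<iota>0: "\<iota> 0 = I\<^sub>t"
    using assms(4) unfolding is_localisation_def by blast
  note [simp] = monoidD(1-3)[OF A] monoidD(1-3)[OF B]
  let ?T = "Arr (Car A) t (Car A)" and ?F = "Arr (Car A) I\<^sub>t (Car A\<^sub>t)"
  let ?i = "\<lambda>n. Arr (Car A) (\<iota> n) (Car A\<^sub>t)"
  have t: "t \<in> Hom (Modules C A) (self_module A) (self_module A)"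
    using assms(3) by (simp add: endo_ring_def)
  have T: "arr ?T" "?T \<bullet> mulT A = mulT A \<bullet> (?T \<boxtimes> idn (Car A))"
    using t by (simp_all add: Hom_Modules)
  have F: "arr ?F" "?F \<bullet> mulT A = mulT A\<^sub>t \<bullet> (?F \<boxtimes> ?F)" "?F \<bullet> uniT A = uniT A\<^sub>t"
    using I by (simp_all add: Hom_Comm)
  have "t [^]\<^bsub>endo_ring C A\<^esub> n = epow (Modules C A) (self_module A) t n" for n :: nat
    by (induction n) (simp_all add: nat_pow_def endo_ring_def)
  then have chain: "mult_chain C A t = endo_chain (Modules C A) (self_module A) t"
    by (simp add: mult_chain_def endo_chain_def)
  have M [simp]: "MCar (monoid_as_module C A\<^sub>t I\<^sub>t) = Car A\<^sub>t"
    "actT A (monoid_as_module C A\<^sub>t I\<^sub>t) = mulT A\<^sub>t \<bullet> (idn (Car A\<^sub>t) \<boxtimes> ?F)"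
    by (simp_all add: monoid_as_module_def actT_def mulT_def tcomp_def ten_def idn_def)
  have "\<iota> n \<in> Hom (Modules C A) (self_module A) (monoid_as_module C A\<^sub>t I\<^sub>t)" for n
    using c by (simp add: is_colimit_def cocone_def nat_chain_def mult_chain_def)
  then have i: "arr (?i n)" "?i n \<bullet> mulT A = mulT A\<^sub>t \<bullet> (?i n \<boxtimes> ?F)" for n
    using F(1) by (simp_all add: Hom_Modules ten_comp)
  \<comment> \<open>The given colimit is one of modules, while the locale asks for one in
    \<open>C\<close>.\<close>
  have "scol ?T (Car A\<^sub>t) ?i"
    using scol_Modules[OF A module_self[OF A] t c[unfolded chain]] by simp
  then interpret localisation C U A A\<^sub>t ?T ?F ?i
    using A B T F i \<iota>0 by unfold_locales simp_all
  have "I\<^sub>t \<in> Hom (Aff C) (Spec A\<^sub>t) (Spec A)"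
    using I by (simp add: Aff_def op_cat_def Spec_def)
  then show ?thesis
    unfolding zariski_open_immersion_def
    using flat epi_arr_F finitely_presented by (auto simp: flat_mor_def Spec_def)
qed

end
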